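(* Let $(M,B)$ be a based $\mathbf U$-module whose weights are bounded above. Assume the involution $\psi_\imath:=\Upsilon\circ\psi$ of $M$ preserves the $\mathcal A^\pi$-submodule ${}_{\mathcal A}M$. Then: (1) The $\mathbf U^\imath$-module $M$ admits a unique $\pi$-basis (called the $\imath$-canonical basis) $B^\imath:=\{b^\imath\mid b\in B\}$, which is $\psi_\imath$-invariant and of the form $$b^\imath=b+\sum_{b'\in B,\ b'<b}t_{b;b'}\,b',\qquad t_{b;b'}\in q^{-1}\mathbb Z^\pi[q^{-1}],$$ where $b'<b$ refers to the partial order of weights $\lambda\le\lambda'\iff\lambda'-\lambda\in\mathbb N[I]$. (2) $B^\imath$ forms an $\mathcal A^\pi$-basis for the $\mathcal A^\pi$-lattice ${}_{\mathcal A}M$ (generated by $B$), and forms a $\mathbb Z^\pi[q^{-1}]$-basis for the $\mathbb Z^\pi[q^{-1}]$-lattice $\mathcal M$ (generated by $B$). (3) $(M,B^\imath)$ is a based $\mathbf U^\imath$-module, where $B^\imath$ is called the $\imath$-canonical basis of $M$.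
   Context: Quantum covering group. $\mathbb N=\{0,1,\dots\}$; $R^\pi=R[\pi]/(\pi^2-1)$ for a ring $R$; $\mathcal A=\mathbb Z[q,q^{-1}]$. A $\pi$-basis of a free $R^\pi$-module is a set $S$ for which there is an $R^\pi$-basis $B$ with $S=B\cup\pi B$. On $\mathbb Q(q)^\pi$ the bar involution is $\overline q=\pi q^{-1}$, $\overline\pi=\pi$; semilinear refers to it. A super Cartan datum is a finite set $I=I_{\bar0}\sqcup I_{\bar1}$, $I_{\bar1}\ne\emptyset$, with a symmetric bilinear form $\cdot:\mathbb Z[I]^2\to\mathbb Z$ such that $d_i=\frac{i\cdot i}2\in\mathbb Z_{>0}$; $a_{ij}=\frac{2\,i\cdot j}{i\cdot i}\in-\mathbb N$ for $i\ne j$; $a_{ij}\in2\mathbb Z$ if $i\in I_{\bar1}$; $d_i\equiv p(i)$ mod 2, where $p(i)=0,1$ for $i\in I_{\bar0},I_{\bar1}$, extended additively. A root datum: finitely generated free abelian groups $Y,X$ with a perfect pairing $\langle\cdot,\cdot\rangle$ and embeddings $I\subset X$ ($i\mapsto i'$), $I\subset Y$ with linearly independent images and $\langle i,j'\rangle=a_{ij}$. Put $q_i=q^{d_i}$, $\pi_i=\pi^{p(i)}$, $[n]_i=\frac{(\pi_iq_i)^n-q_i^{-n}}{\pi_iq_i-q_i^{-1}}$, with the usual factorials and binomials. $\mathbf U$ is the $\mathbb Q(q)^\pi$-superalgebra with generators $E_i,F_i$ (parity $p(i)$), $K_\mu,J_\mu$ ($\mu\in Y$, even) and relations: $K_0=1$,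 $K_\mu K_{\mu'}=K_{\mu+\mu'}$, $J_{2\mu}=1$, $J_\mu J_{\mu'}=J_{\mu+\mu'}$, $J_\mu K_{\mu'}=K_{\mu'}J_\mu$, $K_\mu E_i=q^{\langle\mu,i'\rangle}E_iK_\mu$, $J_\mu E_i=\pi^{\langle\mu,i'\rangle}E_iJ_\mu$, $K_\mu F_i=q^{-\langle\mu,i'\rangle}F_iK_\mu$, $J_\mu F_i=\pi^{-\langle\mu,i'\rangle}F_iJ_\mu$, $E_iF_j-\pi^{p(i)p(j)}F_jE_i=\delta_{ij}\frac{\widetilde J_i\widetilde K_i-\widetilde K_i^{-1}}{\pi_iq_i-q_i^{-1}}$ with $\widetilde K_i=K_{d_ii}$, $\widetilde J_i=J_{d_ii}$, and for $i\ne j$, $\sum_{n=0}^{1-a_{ij}}(-1)^n\pi_i^{np(j)+\binom n2}\left[{1-a_{ij}\atop n}\right]_ix_i^nx_jx_i^{1-a_{ij}-n}=0$ for $x=E,F$. $\mathbf U^+,\mathbf U^-,\mathbf U^0$ are generated by the $E_i$, the $F_i$, the $K_\mu,J_\mu$; $\mathbf U^+_\mu$ is the span of monomials in the $E_i$ of weight $\mu\in\mathbb N[I]$; $\mathrm{ht}(\sum\nu_ii)=\sum\nu_i$. $\psi$ is the semilinear $\mathbb Q$-algebra involution of $\mathbf U$ fixing $E_i,F_i,J_\mu$ with $\psi(K_\mu)=J_\mu K_{-\mu}$. $\widehat{\mathbf U}$ is the completion of $\mathbf U$ with respect to the submodules $\mathbf U^-\mathbf U^0(\sum_{\mathrm{ht}(\mu)\ge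 N}\mathbf U^+_\mu)$. The modified form $\dot{\mathbf U}=\bigoplus_{\lambda\in X}\mathbf U1_\lambda$ has orthogonal idempotents $1_\lambda$ with $K_\mu1_\lambda=q^{\langle\mu,\lambda\rangle}1_\lambda$, $J_\mu1_\lambda=\pi^{\langle\mu,\lambda\rangle}1_\lambda$, $E_i1_\lambda=1_{\lambda+i'}E_i$, $F_i1_\lambda=1_{\lambda-i'}F_i$; ${}_{\mathcal A}\dot{\mathbf U}$ is its $\mathcal A^\pi$-subalgebra generated by all $E_i^{(n)}1_\lambda,F_i^{(n)}1_\lambda$, $x^{(n)}=x^n/[n]_i^!$. Based $\mathbf U$-module: a weight $\mathbf U$-module $M=\bigoplus_{\lambda\in X}M_\lambda$ ($K_\mu,J_\mu$ act on $M_\lambda$ by $q^{\langle\mu,\lambda\rangle},\pi^{\langle\mu,\lambda\rangle}$) with a $\mathbb Q(q)^\pi$-basis $B$ such that $B\cap M_\lambda$ is a basis of $M_\lambda$; the $\mathcal A^\pi$-span ${}_{\mathcal A}M$ of $B$ is ${}_{\mathcal A}\dot{\mathbf U}$-stable; the semilinear involution $\psi$ of $M$ fixing $B$ satisfies $\psi(um)=\psi(u)\psi(m)$; with $\mathbf A=\mathbb Q[[q^{-1}]]^\pi\cap\mathbb Q(q)^\pi$ and $L(M)$ the $\mathbf A$-span of $B$, the image of $B$ is a $\mathbb Q^\pi$-basis of $L(M)/q^{-1}L(M)$. Weights are bounded above if there are finitely many $\lambda_j\in X$ such that every weight is $\le$ some $\lambda_j$. $\imath$quantum covering group. $\tau$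 is an involution (possibly trivial) of $I$ with $\tau i\cdot\tau j=i\cdot j$, extended compatibly to $X,Y$ preserving the pairing; $Y^\imath=\{\mu\in Y:\tau\mu=-\mu\}$, $X_\imath=X/\{\lambda+\tau\lambda:\lambda\in X\}$, $\lambda\mapsto\overline\lambda$ the quotient map. Parameters $\varsigma_i\in(\mathbb Q(q)^\pi)^\times$ satisfy: $\overline{\varsigma_iq_i}=\varsigma_iq_i$ if $\tau i=i$ and $a_{ij}\ne0$ for some $j\in I\setminus\{i\}$; $\overline{\varsigma_i}=\varsigma_i=\varsigma_{\tau i}$ if $\tau i\ne i$, $a_{i,\tau i}=0$; $\varsigma_{\tau i}=\pi_iq_i^{-a_{i,\tau i}}\overline{\varsigma_i}$ if $\tau i\ne i$, $a_{i,\tau i}\ne0$. $\mathbf U^\imath\subset\mathbf U$ is the subalgebra generated by $B_i=F_i+\varsigma_iE_{\tau i}\widetilde K_i^{-1}$, $\widetilde J_i$ ($i\in I$), $K_\mu$ ($\mu\in Y^\imath$). $\psi_\imath$ is its semilinear $\mathbb Q$-algebra automorphism with $\psi_\imath(B_i)=B_i$, $\psi_\imath(\widetilde J_i)=\widetilde J_i$, $\psi_\imath(K_\mu)=J_\mu K_\mu^{-1}$. The quasi-$K$-matrix is the unique $\Upsilon=\sum_{\mu\in\mathbb N[I]}\Upsilon_\mu\in\widehat{\mathbf U}$ with $\Upsilon_\mu\in\mathbf U^+_\mu$, $\Upsilon_0=1$, $\psi_\imath(u)\Upsilon=\Upsilon\psi(u)$ for all $u\in\mathbf U^\imath$; it acts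 on weight modules with weights bounded above. The modified form $\dot{\mathbf U}^\imath=\bigoplus_{\zeta\in X_\imath}\mathbf U^\imath\mathbf 1_\zeta$ has orthogonal idempotents $\mathbf 1_\zeta$ with $K_\mu\mathbf 1_\zeta=q^{\langle\mu,\zeta\rangle}\mathbf 1_\zeta$ ($\mu\in Y^\imath$), $B_i\mathbf 1_\zeta=\mathbf 1_{\zeta-\overline{i'}}B_i$; $\psi_\imath$ extends to it fixing the $\mathbf 1_\zeta$. It acts on $\dot{\mathbf U}$ by $(x\mathbf 1_\zeta)m=xm$ for $m\in1_\lambda\dot{\mathbf U}$ with $\overline\lambda=\zeta$, and $0$ if $\overline\lambda\ne\zeta$. ${}_{\mathcal A}\dot{\mathbf U}^\imath=\{u\in\dot{\mathbf U}^\imath:u\cdot m\in{}_{\mathcal A}\dot{\mathbf U}\ \forall m\in{}_{\mathcal A}\dot{\mathbf U}\}$. Based $\mathbf U^\imath$-module: a weight $\mathbf U^\imath$-module $M=\bigoplus_{\zeta\in X_\imath}M_\zeta$ ($K_\mu m=q^{\langle\mu,\zeta\rangle}m$ for $m\in M_\zeta$, $\mu\in Y^\imath$) with a $\mathbb Q(q)^\pi$-basis $\mathbf B^\imath$ such that (1) $\mathbf B^\imath\cap M_\zeta$ is a basis of $M_\zeta$; (2) the $\mathcal A^\pi$-submodule generated by $\mathbf B^\imath$ is ${}_{\mathcal A}\dot{\mathbf U}^\imath$-stable; (3) the semilinear involution $\psi_\imath$ of $M$ fixing $\mathbf B^\imath$ satisfies $\psi_\imath(um)=\psi_\imath(u)\psi_\imath(m)$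 for $u\in\dot{\mathbf U}^\imath$; (4) with $L(M)$ the $\mathbf A$-span of $\mathbf B^\imath$, the image of $\mathbf B^\imath$ is a $\mathbb Q^\pi$-basis of $L(M)/q^{-1}L(M)$.
   Formalization: In (1) the sum runs over b' whose weight is strictly larger than that of b (the printed b'<b reversed), since Υ raises weights; as printed it fails, e.g. for F^(2)v in V(2) in rank one with ς=q^{-1}. *)

theory Defs
  imports
    "HOL-Algebra.Algebraic_Closure_Type"
    "HOL-Algebra.Module"
    "HOL-Algebra.QuotRing"
    "HOL-Algebra.Generated_Rings"
    "HOL-Library.Poly_Mapping"
    "HOL-Library.FuncSet"
    "HOL-Computational_Algebra.Computational_Algebra"
begin

section \<open>The ring \<open>R[\<pi>]/(\<pi>\<^sup>2 - 1)\<close>\<close>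

text \<open>\<open>Piext a b\<close> is \<open>a + b \<pi>\<close>.\<close>

datatype 'a piext = Piext (pi0: 'a) (pi1: 'a)

instantiation piext :: (comm_ring_1) comm_ring_1
begin

definition "0 = Piext 0 0"
definition "1 = Piext 1 0"
definition "x + y = Piext (pi0 x + pi0 y) (pi1 x + pi1 y)"
definition "x - y = Piext (pi0 x - pi0 y) (pi1 x - pi1 y)"
definition "- x = Piext (- pi0 x) (- pi1 x)"
definition "x * y = Piext (pi0 x * pi0 y + pi1 x * pi1 y) (pi0 x * pi1 y + pi1 x * pi0 y)"

instance
  by standard
    (auto simp: zero_piext_def one_piext_def plus_piext_def minus_piext_def
      uminus_piext_def times_piext_def algebra_simps piext.expand)

end

text \<open>
  \<open>R\<^sup>\<pi>\<close> is not a field, but \<open>a + b \<pi>\<close> is a unit exactly if \<open>a\<^sup>2 \<noteq> b\<^sup>2\<close>, and then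
  \<open>inverse\<close> is its inverse; division is only used below with units as denominators.
\<close>

instantiation piext :: (field) inverse
begin

definition "inverse x =
  Piext (pi0 x / (pi0 x ^ 2 - pi1 x ^ 2)) (- pi1 x / (pi0 x ^ 2 - pi1 x ^ 2))"
definition "divide x y = x * inverse (y :: 'a piext)"

instance ..

end

lemma piext_unit_iff: "(x :: 'a::field piext) dvd 1 \<longleftrightarrow> x * inverse x = 1"
proof
  assume "x dvd 1"
  then obtain y where y: "1 = x * y" by (auto simp: dvd_def)
  have 1: "pi0 x * pi0 y + pi1 x * pi1 y = 1" "pi0 x * pi1 y + pi1 x * pi0 y = 0"
    using y by (auto simp: one_piext_def times_piext_def)
  have "(pi0 x + pi1 x) * (pi0 y + pi1 y)
          = (pi0 x * pi0 y + pi1 x * pi1 y) + (pi0 x * pi1 y + pi1 x * pi0 y)"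
    "(pi0 x - pi1 x) * (pi0 y - pi1 y)
          = (pi0 x * pi0 y + pi1 x * pi1 y) - (pi0 x * pi1 y + pi1 x * pi0 y)"
    by (simp_all add: algebra_simps)
  then have "pi0 x + pi1 x \<noteq> 0" "pi0 x - pi1 x \<noteq> 0" using 1 by auto
  then have "pi0 x ^ 2 - pi1 x ^ 2 \<noteq> 0"
    by (metis mult_eq_0_iff square_diff_square_factored power2_eq_square)
  then show "x * inverse x = 1"
    by (simp add: one_piext_def times_piext_def inverse_piext_def power2_eq_square
        diff_divide_distrib [symmetric])
next
  assume "x * inverse x = 1"
  then show "x dvd 1" by (metis dvd_triv_left)
qed

text \<open>The subset \<open>S\<^sup>\<pi> \<subseteq> R\<^sup>\<pi>\<close> for \<open>S \<subseteq> R\<close>.\<close>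

definition pi_closure :: "'a set \<Rightarrow> 'a piext set" where
  "pi_closure S = {x. pi0 x \<in> S \<and> pi1 x \<in> S}"


section \<open>The scalars \<open>\<rat>(q)\<^sup>\<pi>\<close> and their subrings\<close>

type_synonym ratq = "rat poly fract"
type_synonym scal = "ratq piext"

definition qvar :: ratq where "qvar = Fract [:0, 1:] 1"

definition qq :: scal where "qq = Piext qvar 0"
definition ppi :: scal where "ppi = Piext 0 1"

text \<open>The value of a rational function at a scalar at which its denominators become units.\<close>

definition poly_at :: "scal \<Rightarrow> rat poly \<Rightarrow> scal" where
  "poly_at x p = poly (map_poly (\<lambda>c. Piext (Fract [:c:] 1) 0) p) x"

definition ratq_at :: "scal \<Rightarrow> ratq \<Rightarrow> scal" where
  "ratq_at x f = (SOME y. \<exists>a b. b \<noteq> 0 \<and> f = Fract a b \<and> y = poly_at x a / poly_at x b)"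

text \<open>The bar involution: \<open>q \<mapsto> \<pi> q\<^sup>-\<^sup>1\<close>, \<open>\<pi> \<mapsto> \<pi>\<close>.\<close>

definition qbar :: "scal \<Rightarrow> scal" where
  "qbar x = ratq_at (ppi / qq) (pi0 x) + ppi * ratq_at (ppi / qq) (pi1 x)"

text \<open>Integral Laurent polynomials in \<open>q\<close> all of whose exponents lie in \<open>T\<close>.\<close>

definition laurent_Z :: "int set \<Rightarrow> ratq set" where
  "laurent_Z T = {(\<Sum>n\<in>S. of_int (c n) * qvar powi n) | S c. finite S \<and> S \<subseteq> T}"

definition A_pi :: "scal set" where
  "A_pi = pi_closure (laurent_Z UNIV)"

definition Z_pi_qinv :: "scal set" where
  "Z_pi_qinv = pi_closure (laurent_Z {..0})"

definition qinv_Z_pi_qinv :: "scal set" where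
  "qinv_Z_pi_qinv = pi_closure (laurent_Z {..<0})"

text \<open>\<open>\<rat>[[q\<^sup>-\<^sup>1]] \<inter> \<rat>(q)\<close>, where \<open>\<rat>(q)\<close> is embedded into \<open>\<rat>((q\<^sup>-\<^sup>1))\<close>, the Laurent series
  variable being \<open>q\<^sup>-\<^sup>1\<close>.\<close>

definition at_infinity :: "rat poly \<Rightarrow> rat fls" where
  "at_infinity p = poly (map_poly fls_const p) fls_X_inv"

definition regular_at_infinity :: "ratq set" where
  "regular_at_infinity =
     {Fract a b | a b. b \<noteq> 0 \<and> at_infinity a / at_infinity b \<in> range fps_to_fls}"

definition A_inf :: "scal set" where
  "A_inf = pi_closure regular_at_infinity"

definition Q_pi :: "scal set" where
  "Q_pi = pi_closure (range (\<lambda>c. Fract [:c:] 1))"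


section \<open>Left modules, spans and gradings\<close>

text \<open>The axioms of \<^locale>\<open>Module.module\<close>, over a ring that need not be commutative. Of the record
  for the module, only the fields \<open>carrier\<close>, \<open>add\<close>, \<open>zero\<close> and \<open>smult\<close> are relevant.\<close>

locale left_module = R?: ring R + M?: abelian_group M
  for R :: "('a, 'r) ring_scheme" (structure) and M :: "('a, 'm, 'z) module_scheme" (structure) +
  assumes smult_closed:
      "\<lbrakk>a \<in> carrier R; x \<in> carrier M\<rbrakk> \<Longrightarrow> a \<odot>\<^bsub>M\<^esub> x \<in> carrier M"
    and smult_l_distr:
      "\<lbrakk>a \<in> carrier R; b \<in> carrier R; x \<in> carrier M\<rbrakk> \<Longrightarrow>
        (a \<oplus> b) \<odot>\<^bsub>M\<^esub> x = a \<odot>\<^bsub>M\<^esub> x \<oplus>\<^bsub>M\<^esub> b \<odot>\<^bsub>M\<^esub> x"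
    and smult_r_distr:
      "\<lbrakk>a \<in> carrier R; x \<in> carrier M; y \<in> carrier M\<rbrakk> \<Longrightarrow>
        a \<odot>\<^bsub>M\<^esub> (x \<oplus>\<^bsub>M\<^esub> y) = a \<odot>\<^bsub>M\<^esub> x \<oplus>\<^bsub>M\<^esub> a \<odot>\<^bsub>M\<^esub> y"
    and smult_assoc:
      "\<lbrakk>a \<in> carrier R; b \<in> carrier R; x \<in> carrier M\<rbrakk> \<Longrightarrow>
        (a \<otimes> b) \<odot>\<^bsub>M\<^esub> x = a \<odot>\<^bsub>M\<^esub> (b \<odot>\<^bsub>M\<^esub> x)"
    and smult_one:
      "x \<in> carrier M \<Longrightarrow> \<one> \<odot>\<^bsub>M\<^esub> x = x"

definition regular_module :: "('a, 'z) ring_scheme \<Rightarrow> ('a, 'a) module" where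
  "regular_module R = \<lparr>carrier = carrier R, monoid.mult = monoid.mult R, one = one R,
     zero = zero R, add = add R, module.smult = monoid.mult R\<rparr>"

definition left_ideal_gen :: "('a, 'z) ring_scheme \<Rightarrow> 'a set \<Rightarrow> 'a set" where
  "left_ideal_gen R S =
     {(\<Oplus>\<^bsub>R\<^esub>s\<in>t. c s \<otimes>\<^bsub>R\<^esub> s) | t c. finite t \<and> t \<subseteq> S \<and> c \<in> t \<rightarrow> carrier R}"

text \<open>\<open>f\<close> is the family of components of \<open>m\<close> with respect to subgroups \<open>G k\<close>, \<open>k \<in> K\<close>.\<close>

definition decomposes :: "('m, 'z) ring_scheme \<Rightarrow> 'k set \<Rightarrow> ('k \<Rightarrow> 'm set) \<Rightarrow> 'm \<Rightarrow> ('k \<Rightarrow> 'm) \<Rightarrow> bool"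
  where "decomposes M K G m f \<longleftrightarrow>
     (\<forall>k\<in>K. f k \<in> G k) \<and> (\<forall>k. k \<notin> K \<longrightarrow> f k = \<zero>\<^bsub>M\<^esub>) \<and> finite {k. f k \<noteq> \<zero>\<^bsub>M\<^esub>} \<and>
     m = (\<Oplus>\<^bsub>M\<^esub>k\<in>{k. f k \<noteq> \<zero>\<^bsub>M\<^esub>}. f k)"

definition direct_sum :: "('m, 'z) ring_scheme \<Rightarrow> 'k set \<Rightarrow> ('k \<Rightarrow> 'm set) \<Rightarrow> bool" where
  "direct_sum M K G \<longleftrightarrow>
     (\<forall>k\<in>K. subgroup (G k) (add_monoid M)) \<and> (\<forall>m\<in>carrier M. \<exists>!f. decomposes M K G m f)"

definition component :: "('m, 'z) ring_scheme \<Rightarrow> 'k set \<Rightarrow> ('k \<Rightarrow> 'm set) \<Rightarrow> 'k \<Rightarrow> 'm \<Rightarrow> 'm" where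
  "component M K G k m = (THE f. decomposes M K G m f) k"


section \<open>Super root data\<close>

definition int_mult :: "int \<Rightarrow> 'a::ab_group_add \<Rightarrow> 'a" where
  "int_mult k x = (if 0 \<le> k then (\<Sum>_<nat k. x) else - (\<Sum>_<nat (- k). x))"

text \<open>
  \<open>I\<close> is a finite type \<open>'i\<close>, \<open>X\<close> and \<open>Y\<close> are abelian groups given as types. The form on
  \<open>\<int>[I]\<close> is given by its values on \<open>I\<close>, elements of \<open>\<nat>[I]\<close> are functions \<open>'i \<Rightarrow> nat\<close>.
  \<open>xroot i\<close> is \<open>i' \<in> X\<close> and \<open>yroot i\<close> is \<open>i \<in> Y\<close>.
\<close>

record ('i, 'x, 'y) root_datum =
  inner :: "'i \<Rightarrow> 'i \<Rightarrow> int"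
  odd_nodes :: "'i set"
  pairing :: "'y \<Rightarrow> 'x \<Rightarrow> int"
  xroot :: "'i \<Rightarrow> 'x"
  yroot :: "'i \<Rightarrow> 'y"

definition par :: "('i, 'x, 'y, 'z) root_datum_scheme \<Rightarrow> 'i \<Rightarrow> nat" where
  "par D i = (if i \<in> odd_nodes D then 1 else 0)"

definition dd :: "('i, 'x, 'y, 'z) root_datum_scheme \<Rightarrow> 'i \<Rightarrow> nat" where
  "dd D i = nat (inner D i i div 2)"

definition cartan :: "('i, 'x, 'y, 'z) root_datum_scheme \<Rightarrow> 'i \<Rightarrow> 'i \<Rightarrow> int" where
  "cartan D i j = 2 * inner D i j div inner D i i"

definition super_cartan_datum :: "('i::finite, 'x, 'y, 'z) root_datum_scheme \<Rightarrow> bool" where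
  "super_cartan_datum D \<longleftrightarrow>
     odd_nodes D \<noteq> {} \<and>
     (\<forall>i j. inner D i j = inner D j i) \<and>
     (\<forall>i. even (inner D i i) \<and> inner D i i > 0) \<and>
     (\<forall>i j. i \<noteq> j \<longrightarrow> inner D i i dvd 2 * inner D i j \<and> cartan D i j \<le> 0) \<and>
     (\<forall>i\<in>odd_nodes D. \<forall>j. even (cartan D i j)) \<and>
     (\<forall>i. dd D i mod 2 = par D i)"

definition fg_free_abelian :: "'a::ab_group_add itself \<Rightarrow> bool" where
  "fg_free_abelian _ \<longleftrightarrow>
     (\<exists>S::'a set. finite S \<and> \<not> Modules.module.dependent int_mult S \<and>
        Modules.module.span int_mult S = UNIV)"

definition int_linear_independent :: "('i::finite \<Rightarrow> 'a::ab_group_add) \<Rightarrow> bool" where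
  "int_linear_independent v \<longleftrightarrow> (\<forall>c. (\<Sum>i\<in>UNIV. int_mult (c i) (v i)) = 0 \<longrightarrow> (\<forall>i. c i = 0))"

definition perfect_pairing :: "('y::ab_group_add \<Rightarrow> 'x::ab_group_add \<Rightarrow> int) \<Rightarrow> bool" where
  "perfect_pairing p \<longleftrightarrow>
     (\<forall>\<mu>. additive (p \<mu>)) \<and> (\<forall>\<xi>. additive (\<lambda>\<mu>. p \<mu> \<xi>)) \<and>
     (\<forall>f. additive f \<longrightarrow> (\<exists>!\<mu>. f = p \<mu>)) \<and>
     (\<forall>f. additive f \<longrightarrow> (\<exists>!\<xi>. f = (\<lambda>\<mu>. p \<mu> \<xi>)))"

definition super_root_datum ::
  "('i::finite, 'x::ab_group_add, 'y::ab_group_add, 'z) root_datum_scheme \<Rightarrow> bool" where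
  "super_root_datum D \<longleftrightarrow>
     super_cartan_datum D \<and> fg_free_abelian TYPE('x) \<and> fg_free_abelian TYPE('y) \<and>
     perfect_pairing (pairing D) \<and>
     int_linear_independent (xroot D) \<and> int_linear_independent (yroot D) \<and>
     (\<forall>i j. pairing D (yroot D i) (xroot D j) = cartan D i j)"

definition root_of ::
  "('i::finite, 'x::ab_group_add, 'y, 'z) root_datum_scheme \<Rightarrow> ('i \<Rightarrow> nat) \<Rightarrow> 'x" where
  "root_of D \<nu> = (\<Sum>i\<in>UNIV. int_mult (int (\<nu> i)) (xroot D i))"

definition ht :: "('i::finite \<Rightarrow> nat) \<Rightarrow> nat" where
  "ht \<nu> = (\<Sum>i\<in>UNIV. \<nu> i)"

definition wle ::
  "('i::finite, 'x::ab_group_add, 'y, 'z) root_datum_scheme \<Rightarrow> 'x \<Rightarrow> 'x \<Rightarrow> bool" where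
  "wle D \<xi> \<xi>' \<longleftrightarrow> (\<exists>\<nu>. \<xi>' - \<xi> = root_of D \<nu>)"

definition q_i :: "('i, 'x, 'y, 'z) root_datum_scheme \<Rightarrow> 'i \<Rightarrow> scal" where
  "q_i D i = qq ^ dd D i"

definition pi_i :: "('i, 'x, 'y, 'z) root_datum_scheme \<Rightarrow> 'i \<Rightarrow> scal" where
  "pi_i D i = ppi ^ par D i"

definition qint :: "('i, 'x, 'y, 'z) root_datum_scheme \<Rightarrow> 'i \<Rightarrow> nat \<Rightarrow> scal" where
  "qint D i n = ((pi_i D i * q_i D i) ^ n - inverse (q_i D i) ^ n)
                / (pi_i D i * q_i D i - inverse (q_i D i))"

definition qfact :: "('i, 'x, 'y, 'z) root_datum_scheme \<Rightarrow> 'i \<Rightarrow> nat \<Rightarrow> scal" where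
  "qfact D i n = (\<Prod>k=1..n. qint D i k)"

definition qbinom :: "('i, 'x, 'y, 'z) root_datum_scheme \<Rightarrow> 'i \<Rightarrow> nat \<Rightarrow> nat \<Rightarrow> scal" where
  "qbinom D i n k = qfact D i n / (qfact D i k * qfact D i (n - k))"


section \<open>The quantum covering group\<close>

datatype ('i, 'y) gen = GenE 'i | GenF 'i | GenK 'y | GenJ 'y

datatype 'g free_monoid = Word "'g list"

instantiation free_monoid :: (type) monoid_add
begin

definition "0 = Word []"
definition "v + w = (case v of Word xs \<Rightarrow> case w of Word ys \<Rightarrow> Word (xs @ ys))"

instance
  by standard (auto simp: zero_free_monoid_def plus_free_monoid_def split: free_monoid.splits)

end

text \<open>The free \<open>\<rat>(q)\<^sup>\<pi>\<close>-algebra on the generators, as the monoid algebra of the free monoid.\<close>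

type_synonym ('i, 'y) free_alg = "('i, 'y) gen free_monoid \<Rightarrow>\<^sub>0 scal"

definition fa_gen :: "('i, 'y) gen \<Rightarrow> ('i, 'y) free_alg" where
  "fa_gen g = Poly_Mapping.single (Word [g]) 1"

definition fa_const :: "scal \<Rightarrow> ('i, 'y) free_alg" where
  "fa_const c = Poly_Mapping.single 0 c"

text \<open>The left hand side of the Serre relation for \<open>x = E\<close> or \<open>x = F\<close>.\<close>

definition serre ::
  "('i, 'x, 'y, 'z) root_datum_scheme \<Rightarrow> ('i \<Rightarrow> ('i, 'y) gen) \<Rightarrow> 'i \<Rightarrow> 'i \<Rightarrow> ('i, 'y) free_alg" where
  "serre D x i j =
     (let N = nat (1 - cartan D i j) in
      \<Sum>n\<le>N. fa_const ((- 1) ^ n * pi_i D i ^ (n * par D j + (n choose 2)) * qbinom D i N n)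
            * fa_gen (x i) ^ n * fa_gen (x j) * fa_gen (x i) ^ (N - n))"

text \<open>Each relation \<open>l = r\<close> is recorded as \<open>l - r\<close>.\<close>

definition U_rels ::
  "('i, 'x, 'y::ab_group_add, 'z) root_datum_scheme \<Rightarrow> ('i, 'y) free_alg set" where
  "U_rels D = (let E = \<lambda>i. fa_gen (GenE i); F = \<lambda>i. fa_gen (GenF i);
                   K = \<lambda>\<mu>. fa_gen (GenK \<mu>); J = \<lambda>\<mu>. fa_gen (GenJ \<mu>) in
     {K 0 - 1} \<union>
     {K (\<mu> + \<nu>) - K \<mu> * K \<nu> | \<mu> \<nu>. True} \<union>
     {J (\<mu> + \<mu>) - 1 | \<mu>. True} \<union>
     {J (\<mu> + \<nu>) - J \<mu> * J \<nu> | \<mu> \<nu>. True} \<union>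
     {J \<mu> * K \<nu> - K \<nu> * J \<mu> | \<mu> \<nu>. True} \<union>
     {K \<mu> * E i - fa_const (qq powi pairing D \<mu> (xroot D i)) * E i * K \<mu> | \<mu> i. True} \<union>
     {J \<mu> * E i - fa_const (ppi powi pairing D \<mu> (xroot D i)) * E i * J \<mu> | \<mu> i. True} \<union>
     {K \<mu> * F i - fa_const (qq powi (- pairing D \<mu> (xroot D i))) * F i * K \<mu> | \<mu> i. True} \<union>
     {J \<mu> * F i - fa_const (ppi powi (- pairing D \<mu> (xroot D i))) * F i * J \<mu> | \<mu> i. True} \<union>
     {E i * F j - fa_const (ppi ^ (par D i * par D j)) * F j * E i
        - (if i = j
           then fa_const (1 / (pi_i D i * q_i D i - inverse (q_i D i)))
                * (J (int_mult (int (dd D i)) (yroot D i)) * K (int_mult (int (dd D i)) (yroot D i))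
                   - K (- int_mult (int (dd D i)) (yroot D i)))
           else 0) | i j. True} \<union>
     {serre D GenE i j | i j. i \<noteq> j} \<union>
     {serre D GenF i j | i j. i \<noteq> j})"

type_synonym ('i, 'y) Uelt = "('i, 'y) free_alg set"

definition U_ideal ::
  "('i, 'x, 'y::ab_group_add, 'z) root_datum_scheme \<Rightarrow> ('i, 'y) free_alg set" where
  "U_ideal D = Idl\<^bsub>ring_of_type_algebra\<^esub> (U_rels D)"

definition U ::
  "('i, 'x, 'y::ab_group_add, 'z) root_datum_scheme \<Rightarrow> ('i, 'y) Uelt ring" where
  "U D = ring_of_type_algebra Quot U_ideal D"

definition U_class ::
  "('i, 'x, 'y::ab_group_add, 'z) root_datum_scheme \<Rightarrow> ('i, 'y) free_alg \<Rightarrow> ('i, 'y) Uelt" where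
  "U_class D x = U_ideal D +>\<^bsub>ring_of_type_algebra\<^esub> x"

abbreviation "UE D i \<equiv> U_class D (fa_gen (GenE i))"
abbreviation "UF D i \<equiv> U_class D (fa_gen (GenF i))"
abbreviation "UK D \<mu> \<equiv> U_class D (fa_gen (GenK \<mu>))"
abbreviation "UJ D \<mu> \<equiv> U_class D (fa_gen (GenJ \<mu>))"
abbreviation "Uscal D c \<equiv> U_class D (fa_const c)"

definition Jtilde ::
  "('i, 'x, 'y::ab_group_add, 'z) root_datum_scheme \<Rightarrow> 'i \<Rightarrow> ('i, 'y) Uelt" where
  "Jtilde D i = UJ D (int_mult (int (dd D i)) (yroot D i))"

text \<open>The inverse of \<open>K\<^bsub>d\<^sub>i i\<^esub>\<close>.\<close>

definition Ktilde_inv ::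
  "('i, 'x, 'y::ab_group_add, 'z) root_datum_scheme \<Rightarrow> 'i \<Rightarrow> ('i, 'y) Uelt" where
  "Ktilde_inv D i = UK D (- int_mult (int (dd D i)) (yroot D i))"

definition U_minus ::
  "('i, 'x, 'y::ab_group_add, 'z) root_datum_scheme \<Rightarrow> ('i, 'y) Uelt set" where
  "U_minus D = generate_ring (U D) (range (Uscal D) \<union> range (UF D))"

definition U_zero ::
  "('i, 'x, 'y::ab_group_add, 'z) root_datum_scheme \<Rightarrow> ('i, 'y) Uelt set" where
  "U_zero D = generate_ring (U D) (range (Uscal D) \<union> range (UK D) \<union> range (UJ D))"


subsection \<open>Linear algebra over \<open>\<rat>(q)\<^sup>\<pi>\<close> and its subrings in \<open>\<^bold>U\<close>-modules\<close>

definition scale ::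
  "('i, 'x, 'y::ab_group_add, 'z) root_datum_scheme \<Rightarrow> (('i, 'y) Uelt, 'm) module \<Rightarrow> scal \<Rightarrow> 'm \<Rightarrow> 'm"
  where "scale D M c m = Uscal D c \<odot>\<^bsub>M\<^esub> m"

definition lspan ::
  "('i, 'x, 'y::ab_group_add, 'z) root_datum_scheme \<Rightarrow> (('i, 'y) Uelt, 'm) module \<Rightarrow>
    scal set \<Rightarrow> 'm set \<Rightarrow> 'm set" where
  "lspan D M R S =
     {(\<Oplus>\<^bsub>M\<^esub>s\<in>t. scale D M (c s) s) | t c. finite t \<and> t \<subseteq> S \<and> c \<in> t \<rightarrow> R}"

text \<open>The images in \<open>N / P\<close> of the elements of \<open>B \<subseteq> N\<close> form an \<open>R\<close>-basis (and are distinct).\<close>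

definition is_basis_mod ::
  "('i, 'x, 'y::ab_group_add, 'z) root_datum_scheme \<Rightarrow> (('i, 'y) Uelt, 'm) module \<Rightarrow>
    scal set \<Rightarrow> 'm set \<Rightarrow> 'm set \<Rightarrow> 'm set \<Rightarrow> bool" where
  "is_basis_mod D M R N P B \<longleftrightarrow>
     B \<subseteq> N \<and> lspan D M R B \<subseteq> N \<and>
     (\<forall>x\<in>N. \<exists>y\<in>lspan D M R B. x \<ominus>\<^bsub>M\<^esub> y \<in> P) \<and>
     (\<forall>t c. finite t \<and> t \<subseteq> B \<and> c \<in> t \<rightarrow> R \<and> (\<Oplus>\<^bsub>M\<^esub>s\<in>t. scale D M (c s) s) \<in> P
        \<longrightarrow> (\<forall>s\<in>t. c s = 0))"

definition is_basis ::
  "('i, 'x, 'y::ab_group_add, 'z) root_datum_scheme \<Rightarrow> (('i, 'y) Uelt, 'm) module \<Rightarrow>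
    scal set \<Rightarrow> 'm set \<Rightarrow> 'm set \<Rightarrow> bool" where
  "is_basis D M R N B \<longleftrightarrow> is_basis_mod D M R N {\<zero>\<^bsub>M\<^esub>} B"

definition is_pi_basis ::
  "('i, 'x, 'y::ab_group_add, 'z) root_datum_scheme \<Rightarrow> (('i, 'y) Uelt, 'm) module \<Rightarrow> 'm set \<Rightarrow> bool"
  where "is_pi_basis D M S \<longleftrightarrow>
     (\<exists>B. is_basis D M UNIV (carrier M) B \<and> S = B \<union> scale D M ppi ` B)"

text \<open>The image of \<open>B\<close> is a \<open>\<rat>\<^sup>\<pi>\<close>-basis of \<open>L / q\<^sup>-\<^sup>1 L\<close>, where \<open>L\<close> is the \<open>\<^bold>A\<close>-span of \<open>B\<close>.\<close>

definition basis_at_infinity ::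
  "('i, 'x, 'y::ab_group_add, 'z) root_datum_scheme \<Rightarrow> (('i, 'y) Uelt, 'm) module \<Rightarrow> 'm set \<Rightarrow> bool"
  where "basis_at_infinity D M B \<longleftrightarrow>
     (let L = lspan D M A_inf B in is_basis_mod D M Q_pi L (scale D M (inverse qq) ` L) B)"

definition semilinear ::
  "('i, 'x, 'y::ab_group_add, 'z) root_datum_scheme \<Rightarrow> (('i, 'y) Uelt, 'm) module \<Rightarrow> ('m \<Rightarrow> 'm) \<Rightarrow> bool"
  where "semilinear D M f \<longleftrightarrow>
     f \<in> carrier M \<rightarrow> carrier M \<and>
     (\<forall>x\<in>carrier M. \<forall>y\<in>carrier M. f (x \<oplus>\<^bsub>M\<^esub> y) = f x \<oplus>\<^bsub>M\<^esub> f y) \<and>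
     (\<forall>c. \<forall>x\<in>carrier M. f (scale D M c x) = scale D M (qbar c) (f x))"

text \<open>The semilinear involution of \<open>M\<close> that fixes the elements of the basis \<open>B\<close>.\<close>

definition basis_involution ::
  "('i, 'x, 'y::ab_group_add, 'z) root_datum_scheme \<Rightarrow> (('i, 'y) Uelt, 'm) module \<Rightarrow> 'm set \<Rightarrow> 'm \<Rightarrow> 'm"
  where "basis_involution D M B =
     (THE f. f \<in> extensional (carrier M) \<and> semilinear D M f \<and> (\<forall>b\<in>B. f b = b))"


subsection \<open>Involution, positive part and completion\<close>

definition is_psi ::
  "('i, 'x, 'y::ab_group_add, 'z) root_datum_scheme \<Rightarrow> (('i, 'y) Uelt \<Rightarrow> ('i, 'y) Uelt) \<Rightarrow> bool" where
  "is_psi D \<psi> \<longleftrightarrow>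
     \<psi> \<in> ring_hom (U D) (U D) \<and> semilinear D (regular_module (U D)) \<psi> \<and>
     (\<forall>x\<in>carrier (U D). \<psi> (\<psi> x) = x) \<and>
     (\<forall>i. \<psi> (UE D i) = UE D i) \<and> (\<forall>i. \<psi> (UF D i) = UF D i) \<and>
     (\<forall>\<mu>. \<psi> (UJ D \<mu>) = UJ D \<mu>) \<and>
     (\<forall>\<mu>. \<psi> (UK D \<mu>) = UJ D \<mu> \<otimes>\<^bsub>U D\<^esub> UK D (- \<mu>))"

definition E_monomial ::
  "('i, 'x, 'y::ab_group_add, 'z) root_datum_scheme \<Rightarrow> 'i list \<Rightarrow> ('i, 'y) Uelt" where
  "E_monomial D is = foldr (\<lambda>i x. UE D i \<otimes>\<^bsub>U D\<^esub> x) is \<one>\<^bsub>U D\<^esub>"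

definition U_plus_wt ::
  "('i, 'x, 'y::ab_group_add, 'z) root_datum_scheme \<Rightarrow> ('i \<Rightarrow> nat) \<Rightarrow> ('i, 'y) Uelt set" where
  "U_plus_wt D \<nu> =
     lspan D (regular_module (U D)) UNIV {E_monomial D is | is. \<forall>i. count_list is i = \<nu> i}"

text \<open>\<open>\<^bold>U\<^sup>- \<^bold>U\<^sup>0 (\<Sum>\<^bsub>ht \<mu> \<ge> N\<^esub> \<^bold>U\<^sup>+\<^sub>\<mu>)\<close>\<close>

definition hat_nbhd ::
  "('i::finite, 'x, 'y::ab_group_add, 'z) root_datum_scheme \<Rightarrow> nat \<Rightarrow> ('i, 'y) Uelt set" where
  "hat_nbhd D N = lspan D (regular_module (U D)) UNIV
     {x \<otimes>\<^bsub>U D\<^esub> y \<otimes>\<^bsub>U D\<^esub> z | x y z \<nu>. x \<in> U_minus D \<and> y \<in> U_zero D \<and> z \<in> U_plus_wt D \<nu> \<and> N \<le> ht \<nu>}"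

text \<open>
  Elements of the completion are represented by Cauchy sequences in \<open>\<^bold>U\<close>, multiplied termwise;
  two Cauchy sequences represent the same element if their difference tends to \<open>0\<close>.
\<close>

definition hat_eq ::
  "('i::finite, 'x, 'y::ab_group_add, 'z) root_datum_scheme \<Rightarrow>
    (nat \<Rightarrow> ('i, 'y) Uelt) \<Rightarrow> (nat \<Rightarrow> ('i, 'y) Uelt) \<Rightarrow> bool" where
  "hat_eq D s t \<longleftrightarrow> (\<forall>N. \<exists>n0. \<forall>n\<ge>n0. s n \<ominus>\<^bsub>U D\<^esub> t n \<in> hat_nbhd D N)"

text \<open>The sequence representing \<open>\<Sum>\<^sub>\<mu> \<Upsilon>\<^sub>\<mu>\<close>.\<close>

definition hat_sum ::
  "('i::finite, 'x, 'y::ab_group_add, 'z) root_datum_scheme \<Rightarrow>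
    (('i \<Rightarrow> nat) \<Rightarrow> ('i, 'y) Uelt) \<Rightarrow> nat \<Rightarrow> ('i, 'y) Uelt" where
  "hat_sum D \<Upsilon> n = (\<Oplus>\<^bsub>U D\<^esub>\<nu>\<in>{\<nu>. ht \<nu> < n}. \<Upsilon> \<nu>)"


subsection \<open>Weight modules and the modified form\<close>

definition wt_space ::
  "('i, 'x, 'y::ab_group_add, 'z) root_datum_scheme \<Rightarrow> (('i, 'y) Uelt, 'm) module \<Rightarrow> 'x \<Rightarrow> 'm set" where
  "wt_space D M \<xi> = {m \<in> carrier M. \<forall>\<mu>.
     UK D \<mu> \<odot>\<^bsub>M\<^esub> m = scale D M (qq powi pairing D \<mu> \<xi>) m \<and>
     UJ D \<mu> \<odot>\<^bsub>M\<^esub> m = scale D M (ppi powi pairing D \<mu> \<xi>) m}"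

text \<open>Since the pairing is perfect, the summand \<open>M\<^sub>\<lambda>\<close> of a weight module is the whole
  simultaneous eigenspace.\<close>

definition weight_module ::
  "('i, 'x, 'y::ab_group_add, 'z) root_datum_scheme \<Rightarrow> (('i, 'y) Uelt, 'm) module \<Rightarrow> bool" where
  "weight_module D M \<longleftrightarrow> left_module (U D) M \<and> direct_sum M UNIV (wt_space D M)"

text \<open>\<open>\<^bold>U 1\<^sub>\<lambda>\<close> is the quotient of \<open>\<^bold>U\<close> by the left ideal generated by all
  \<open>K\<^sub>\<mu> - q\<^bsup>\<langle>\<mu>,\<lambda>\<rangle>\<^esup>\<close> and \<open>J\<^sub>\<mu> - \<pi>\<^bsup>\<langle>\<mu>,\<lambda>\<rangle>\<^esup>\<close>.\<close>

definition dot_ideal ::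
  "('i, 'x, 'y::ab_group_add, 'z) root_datum_scheme \<Rightarrow> 'x \<Rightarrow> ('i, 'y) Uelt set" where
  "dot_ideal D \<xi> = left_ideal_gen (U D)
     ({UK D \<mu> \<ominus>\<^bsub>U D\<^esub> Uscal D (qq powi pairing D \<mu> \<xi>) | \<mu>. True} \<union>
      {UJ D \<mu> \<ominus>\<^bsub>U D\<^esub> Uscal D (ppi powi pairing D \<mu> \<xi>) | \<mu>. True})"

text \<open>\<open>\<Oplus>\<^sub>\<lambda> \<^bold>U 1\<^sub>\<lambda>\<close> as a left \<open>\<^bold>U\<close>-module; its multiplication is \<open>Udot_mult\<close> below.\<close>

definition Udot ::
  "('i, 'x, 'y::ab_group_add, 'z) root_datum_scheme \<Rightarrow>
    (('i, 'y) Uelt, 'x \<Rightarrow> ('i, 'y) Uelt set) module" where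
  "Udot D = \<lparr>
     carrier = {f. (\<forall>\<xi>. f \<xi> \<in> a_rcosets\<^bsub>U D\<^esub> (dot_ideal D \<xi>)) \<and> finite {\<xi>. f \<xi> \<noteq> dot_ideal D \<xi>}},
     monoid.mult = undefined,
     one = undefined,
     zero = dot_ideal D,
     add = (\<lambda>f g \<xi>. f \<xi> <+>\<^bsub>U D\<^esub> g \<xi>),
     module.smult = (\<lambda>u f \<xi>. \<Union>x\<in>f \<xi>. dot_ideal D \<xi> +>\<^bsub>U D\<^esub> (u \<otimes>\<^bsub>U D\<^esub> x))\<rparr>"

definition dot_idem ::
  "('i, 'x, 'y::ab_group_add, 'z) root_datum_scheme \<Rightarrow> 'x \<Rightarrow> 'x \<Rightarrow> ('i, 'y) Uelt set" where
  "dot_idem D \<xi> = (\<lambda>\<kappa>. dot_ideal D \<kappa> +>\<^bsub>U D\<^esub> (if \<kappa> = \<xi> then \<one>\<^bsub>U D\<^esub> else \<zero>\<^bsub>U D\<^esub>))"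

text \<open>The action on a weight module: \<open>u 1\<^sub>\<lambda>\<close> acts as \<open>u\<close> on the component of weight \<open>\<lambda>\<close>.\<close>

definition dot_act ::
  "('i, 'x, 'y::ab_group_add, 'z) root_datum_scheme \<Rightarrow> (('i, 'y) Uelt, 'm) module \<Rightarrow>
    ('x \<Rightarrow> ('i, 'y) Uelt set) \<Rightarrow> 'm \<Rightarrow> 'm" where
  "dot_act D M f m = (\<Oplus>\<^bsub>M\<^esub>\<xi>\<in>{\<xi>. f \<xi> \<noteq> dot_ideal D \<xi>}.
     (SOME u. u \<in> f \<xi>) \<odot>\<^bsub>M\<^esub> component M UNIV (wt_space D M) \<xi> m)"

text \<open>\<open>(u 1\<^sub>\<lambda>) (v 1\<^sub>\<kappa>) = u (1\<^sub>\<lambda> v 1\<^sub>\<kappa>)\<close>, where \<open>1\<^sub>\<lambda>\<close> projects onto left weight \<open>\<lambda>\<close>; this encodes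
  \<open>E\<^sub>i 1\<^sub>\<lambda> = 1\<^bsub>\<lambda>+i'\<^esub> E\<^sub>i\<close> and \<open>F\<^sub>i 1\<^sub>\<lambda> = 1\<^bsub>\<lambda>-i'\<^esub> F\<^sub>i\<close>.\<close>

definition Udot_mult ::
  "('i, 'x, 'y::ab_group_add, 'z) root_datum_scheme \<Rightarrow> ('x \<Rightarrow> ('i, 'y) Uelt set) \<Rightarrow>
    ('x \<Rightarrow> ('i, 'y) Uelt set) \<Rightarrow> 'x \<Rightarrow> ('i, 'y) Uelt set" where
  "Udot_mult D = dot_act D (Udot D)"

inductive_set A_Udot ::
  "('i, 'x, 'y::ab_group_add, 'z) root_datum_scheme \<Rightarrow> ('x \<Rightarrow> ('i, 'y) Uelt set) set"
  for D where
    divE: "scale D (Udot D) (1 / qfact D i n) ((UE D i [^]\<^bsub>U D\<^esub> n) \<odot>\<^bsub>Udot D\<^esub> dot_idem D \<xi>) \<in> A_Udot D"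
  | divF: "scale D (Udot D) (1 / qfact D i n) ((UF D i [^]\<^bsub>U D\<^esub> n) \<odot>\<^bsub>Udot D\<^esub> dot_idem D \<xi>) \<in> A_Udot D"
  | add: "f \<in> A_Udot D \<Longrightarrow> g \<in> A_Udot D \<Longrightarrow> f \<oplus>\<^bsub>Udot D\<^esub> g \<in> A_Udot D"
  | scal: "c \<in> A_pi \<Longrightarrow> f \<in> A_Udot D \<Longrightarrow> scale D (Udot D) c f \<in> A_Udot D"
  | mult: "f \<in> A_Udot D \<Longrightarrow> g \<in> A_Udot D \<Longrightarrow> Udot_mult D f g \<in> A_Udot D"

definition based_module ::
  "('i, 'x, 'y::ab_group_add, 'z) root_datum_scheme \<Rightarrow> (('i, 'y) Uelt \<Rightarrow> ('i, 'y) Uelt) \<Rightarrow>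
    (('i, 'y) Uelt, 'm) module \<Rightarrow> 'm set \<Rightarrow> bool" where
  "based_module D \<psi> M B \<longleftrightarrow>
     weight_module D M \<and>
     is_basis D M UNIV (carrier M) B \<and>
     (\<forall>\<xi>. is_basis D M UNIV (wt_space D M \<xi>) (B \<inter> wt_space D M \<xi>)) \<and>
     (\<forall>u\<in>A_Udot D. \<forall>m\<in>lspan D M A_pi B. dot_act D M u m \<in> lspan D M A_pi B) \<and>
     (\<forall>u\<in>carrier (U D). \<forall>m\<in>carrier M.
        basis_involution D M B (u \<odot>\<^bsub>M\<^esub> m) = \<psi> u \<odot>\<^bsub>M\<^esub> basis_involution D M B m) \<and>
     basis_at_infinity D M B"

definition weights_bounded_above ::
  "('i::finite, 'x::ab_group_add, 'y::ab_group_add, 'z) root_datum_scheme \<Rightarrow>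
    (('i, 'y) Uelt, 'm) module \<Rightarrow> bool" where
  "weights_bounded_above D M \<longleftrightarrow>
     (\<exists>S. finite S \<and> (\<forall>\<xi>. wt_space D M \<xi> \<noteq> {\<zero>\<^bsub>M\<^esub>} \<longrightarrow> (\<exists>\<kappa>\<in>S. wle D \<xi> \<kappa>)))"


section \<open>The \<open>\<imath>\<close>quantum covering group\<close>

record ('i, 'x, 'y) iroot_datum = "('i, 'x, 'y) root_datum" +
  tau :: "'i \<Rightarrow> 'i"
  tauX :: "'x \<Rightarrow> 'x"
  tauY :: "'y \<Rightarrow> 'y"
  vs :: "'i \<Rightarrow> scal"

definition iparameters :: "('i, 'x, 'y, 'z) iroot_datum_scheme \<Rightarrow> bool" where
  "iparameters D \<longleftrightarrow>
     (\<forall>i. vs D i dvd 1) \<and>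
     (\<forall>i. tau D i = i \<and> (\<exists>j. j \<noteq> i \<and> cartan D i j \<noteq> 0)
        \<longrightarrow> qbar (vs D i * q_i D i) = vs D i * q_i D i) \<and>
     (\<forall>i. tau D i \<noteq> i \<and> cartan D i (tau D i) = 0
        \<longrightarrow> qbar (vs D i) = vs D i \<and> vs D i = vs D (tau D i)) \<and>
     (\<forall>i. tau D i \<noteq> i \<and> cartan D i (tau D i) \<noteq> 0
        \<longrightarrow> vs D (tau D i) = pi_i D i * q_i D i powi (- cartan D i (tau D i)) * qbar (vs D i))"

definition iquantum_datum ::
  "('i::finite, 'x::ab_group_add, 'y::ab_group_add, 'z) iroot_datum_scheme \<Rightarrow> bool" where
  "iquantum_datum D \<longleftrightarrow>
     super_root_datum D \<and>
     (\<forall>i. tau D (tau D i) = i) \<and>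
     (\<forall>i j. inner D (tau D i) (tau D j) = inner D i j) \<and>
     additive (tauX D) \<and> additive (tauY D) \<and>
     (\<forall>\<xi>. tauX D (tauX D \<xi>) = \<xi>) \<and> (\<forall>\<mu>. tauY D (tauY D \<mu>) = \<mu>) \<and>
     (\<forall>i. tauX D (xroot D i) = xroot D (tau D i)) \<and>
     (\<forall>i. tauY D (yroot D i) = yroot D (tau D i)) \<and>
     (\<forall>\<mu> \<xi>. pairing D (tauY D \<mu>) (tauX D \<xi>) = pairing D \<mu> \<xi>) \<and>
     iparameters D"

definition Yi :: "('i, 'x, 'y::ab_group_add, 'z) iroot_datum_scheme \<Rightarrow> 'y set" where
  "Yi D = {\<mu>. tauY D \<mu> = - \<mu>}"

text \<open>Elements of \<open>X\<^sub>\<imath>\<close> are cosets of \<open>{\<lambda> + \<tau> \<lambda>}\<close>.\<close>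

definition xcoset ::
  "('i, 'x::ab_group_add, 'y, 'z) iroot_datum_scheme \<Rightarrow> 'x \<Rightarrow> 'x set" where
  "xcoset D \<xi> = {\<xi> + (\<kappa> + tauX D \<kappa>) | \<kappa>. True}"

definition Xi :: "('i, 'x::ab_group_add, 'y, 'z) iroot_datum_scheme \<Rightarrow> 'x set set" where
  "Xi D = range (xcoset D)"

text \<open>\<open>\<langle>\<mu>, \<zeta>\<rangle>\<close>, which for \<open>\<mu> \<in> Y\<^sup>\<imath>\<close> does not depend on the representative of \<open>\<zeta>\<close>.\<close>

definition ipairing ::
  "('i, 'x::ab_group_add, 'y, 'z) iroot_datum_scheme \<Rightarrow> 'y \<Rightarrow> 'x set \<Rightarrow> int" where
  "ipairing D \<mu> \<zeta> = pairing D \<mu> (SOME \<xi>. \<xi> \<in> \<zeta>)"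

definition UB ::
  "('i, 'x, 'y::ab_group_add, 'z) iroot_datum_scheme \<Rightarrow> 'i \<Rightarrow> ('i, 'y) Uelt" where
  "UB D i = UF D i \<oplus>\<^bsub>U D\<^esub> Uscal D (vs D i) \<otimes>\<^bsub>U D\<^esub> UE D (tau D i) \<otimes>\<^bsub>U D\<^esub> Ktilde_inv D i"

definition Ui ::
  "('i, 'x, 'y::ab_group_add, 'z) iroot_datum_scheme \<Rightarrow> ('i, 'y) Uelt ring" where
  "Ui D = (U D) \<lparr>carrier := generate_ring (U D)
     (range (Uscal D) \<union> range (UB D) \<union> range (Jtilde D) \<union> UK D ` Yi D)\<rparr>"

definition is_psi_i ::
  "('i, 'x, 'y::ab_group_add, 'z) iroot_datum_scheme \<Rightarrow> (('i, 'y) Uelt \<Rightarrow> ('i, 'y) Uelt) \<Rightarrow> bool" where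
  "is_psi_i D \<psi>i \<longleftrightarrow>
     \<psi>i \<in> ring_hom (Ui D) (Ui D) \<and> bij_betw \<psi>i (carrier (Ui D)) (carrier (Ui D)) \<and>
     semilinear D (regular_module (Ui D)) \<psi>i \<and>
     (\<forall>i. \<psi>i (UB D i) = UB D i) \<and> (\<forall>i. \<psi>i (Jtilde D i) = Jtilde D i) \<and>
     (\<forall>\<mu>\<in>Yi D. \<psi>i (UK D \<mu>) = UJ D \<mu> \<otimes>\<^bsub>U D\<^esub> UK D (- \<mu>))"


subsection \<open>The quasi-\<open>K\<close>-matrix\<close>

definition intertwiner ::
  "('i::finite, 'x, 'y::ab_group_add, 'z) iroot_datum_scheme \<Rightarrow>
    (('i, 'y) Uelt \<Rightarrow> ('i, 'y) Uelt) \<Rightarrow> (('i, 'y) Uelt \<Rightarrow> ('i, 'y) Uelt) \<Rightarrow>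
    (('i \<Rightarrow> nat) \<Rightarrow> ('i, 'y) Uelt) \<Rightarrow> bool" where
  "intertwiner D \<psi> \<psi>i \<Upsilon> \<longleftrightarrow>
     (\<forall>\<nu>. \<Upsilon> \<nu> \<in> U_plus_wt D \<nu>) \<and> \<Upsilon> (\<lambda>_. 0) = \<one>\<^bsub>U D\<^esub> \<and>
     (\<forall>u\<in>carrier (Ui D).
        hat_eq D (\<lambda>n. \<psi>i u \<otimes>\<^bsub>U D\<^esub> hat_sum D \<Upsilon> n) (\<lambda>n. hat_sum D \<Upsilon> n \<otimes>\<^bsub>U D\<^esub> \<psi> u))"

text \<open>The quasi-\<open>K\<close>-matrix is by definition the unique such element of the completion.\<close>

definition is_quasi_K ::
  "('i::finite, 'x, 'y::ab_group_add, 'z) iroot_datum_scheme \<Rightarrow>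
    (('i, 'y) Uelt \<Rightarrow> ('i, 'y) Uelt) \<Rightarrow> (('i, 'y) Uelt \<Rightarrow> ('i, 'y) Uelt) \<Rightarrow>
    (('i \<Rightarrow> nat) \<Rightarrow> ('i, 'y) Uelt) \<Rightarrow> bool" where
  "is_quasi_K D \<psi> \<psi>i \<Upsilon> \<longleftrightarrow>
     intertwiner D \<psi> \<psi>i \<Upsilon> \<and>
     (\<forall>\<Upsilon>'. intertwiner D \<psi> \<psi>i \<Upsilon>' \<longrightarrow> hat_eq D (hat_sum D \<Upsilon>') (hat_sum D \<Upsilon>))"

text \<open>On a module whose weights are bounded above, only finitely many terms are nonzero.\<close>

definition quasi_K_act ::
  "(('i \<Rightarrow> nat) \<Rightarrow> ('i, 'y) Uelt) \<Rightarrow> (('i, 'y) Uelt, 'm) module \<Rightarrow> 'm \<Rightarrow> 'm" where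
  "quasi_K_act \<Upsilon> M m = (\<Oplus>\<^bsub>M\<^esub>\<nu>\<in>{\<nu>. \<Upsilon> \<nu> \<odot>\<^bsub>M\<^esub> m \<noteq> \<zero>\<^bsub>M\<^esub>}. \<Upsilon> \<nu> \<odot>\<^bsub>M\<^esub> m)"

definition psi_iM ::
  "('i, 'x, 'y::ab_group_add, 'z) root_datum_scheme \<Rightarrow> (('i \<Rightarrow> nat) \<Rightarrow> ('i, 'y) Uelt) \<Rightarrow>
    (('i, 'y) Uelt, 'm) module \<Rightarrow> 'm set \<Rightarrow> 'm \<Rightarrow> 'm" where
  "psi_iM D \<Upsilon> M B m = quasi_K_act \<Upsilon> M (basis_involution D M B m)"


subsection \<open>The modified form and based modules\<close>

text \<open>
  \<open>\<^bold>U\<^sup>\<imath> 1\<^sub>\<zeta>\<close> is a quotient of \<open>\<^bold>U\<^sup>\<imath>\<close> by a left ideal. The relations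
  \<open>J\<^sub>\<mu> 1\<^sub>\<zeta> = \<pi>\<^bsup>\<langle>\<mu>,\<zeta>\<rangle>\<^esup> 1\<^sub>\<zeta>\<close> (\<open>\<mu> \<in> Y\<^sup>\<imath>\<close>) are forced by the extension of \<open>\<psi>\<^sub>\<imath>\<close>:
  apply it to \<open>K\<^sub>\<mu> 1\<^sub>\<zeta> = q\<^bsup>\<langle>\<mu>,\<zeta>\<rangle>\<^esup> 1\<^sub>\<zeta>\<close>. That \<open>J\<^sub>\<mu> \<in> \<^bold>U\<^sup>\<imath>\<close> is automatic when \<open>\<psi>\<^sub>\<imath>\<close> exists.
\<close>

definition idot_ideal ::
  "('i, 'x::ab_group_add, 'y::ab_group_add, 'z) iroot_datum_scheme \<Rightarrow> 'x set \<Rightarrow> ('i, 'y) Uelt set" where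
  "idot_ideal D \<zeta> = left_ideal_gen (Ui D)
     ({UK D \<mu> \<ominus>\<^bsub>U D\<^esub> Uscal D (qq powi ipairing D \<mu> \<zeta>) | \<mu>. \<mu> \<in> Yi D} \<union>
      {UJ D \<mu> \<ominus>\<^bsub>U D\<^esub> Uscal D (ppi powi ipairing D \<mu> \<zeta>) | \<mu>. \<mu> \<in> Yi D \<and> UJ D \<mu> \<in> carrier (Ui D)})"

text \<open>The underlying set of \<open>\<Oplus>\<^sub>\<zeta> \<^bold>U\<^sup>\<imath> 1\<^sub>\<zeta>\<close>.\<close>

definition Uidot ::
  "('i, 'x::ab_group_add, 'y::ab_group_add, 'z) iroot_datum_scheme \<Rightarrow>
    ('x set \<Rightarrow> ('i, 'y) Uelt set) set" where
  "Uidot D = {g \<in> extensional (Xi D).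
     (\<forall>\<zeta>\<in>Xi D. g \<zeta> \<in> a_rcosets\<^bsub>Ui D\<^esub> (idot_ideal D \<zeta>)) \<and>
     finite {\<zeta>\<in>Xi D. g \<zeta> \<noteq> idot_ideal D \<zeta>}}"

definition Uidot_psi ::
  "('i, 'x::ab_group_add, 'y::ab_group_add, 'z) iroot_datum_scheme \<Rightarrow>
    (('i, 'y) Uelt \<Rightarrow> ('i, 'y) Uelt) \<Rightarrow>
    ('x set \<Rightarrow> ('i, 'y) Uelt set) \<Rightarrow> 'x set \<Rightarrow> ('i, 'y) Uelt set" where
  "Uidot_psi D \<psi>i g =
     (\<lambda>\<zeta>\<in>Xi D. idot_ideal D \<zeta> +>\<^bsub>Ui D\<^esub> \<psi>i (SOME x. x \<in> g \<zeta>))"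

text \<open>The action on a module with \<open>X\<^sub>\<imath>\<close>-grading \<open>G\<close>: \<open>x 1\<^sub>\<zeta>\<close> acts as \<open>x\<close> on the component
  in \<open>G \<zeta>\<close>.\<close>

definition idot_act ::
  "('i, 'x::ab_group_add, 'y::ab_group_add, 'z) iroot_datum_scheme \<Rightarrow>
    (('i, 'y) Uelt, 'm) module \<Rightarrow> ('x set \<Rightarrow> 'm set) \<Rightarrow>
    ('x set \<Rightarrow> ('i, 'y) Uelt set) \<Rightarrow> 'm \<Rightarrow> 'm" where
  "idot_act D M G g m = (\<Oplus>\<^bsub>M\<^esub>\<zeta>\<in>{\<zeta>\<in>Xi D. g \<zeta> \<noteq> idot_ideal D \<zeta>}.
     (SOME x. x \<in> g \<zeta>) \<odot>\<^bsub>M\<^esub> component M (Xi D) G \<zeta> m)"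

text \<open>The \<open>X\<^sub>\<imath>\<close>-grading \<open>M\<^sub>\<zeta> = \<Oplus>\<^bsub>\<lambda>\<in>\<zeta>\<^esub> M\<^sub>\<lambda>\<close> of a weight \<open>\<^bold>U\<close>-module.\<close>

definition iwt_space ::
  "('i, 'x::ab_group_add, 'y::ab_group_add, 'z) root_datum_scheme \<Rightarrow>
    (('i, 'y) Uelt, 'm) module \<Rightarrow> 'x set \<Rightarrow> 'm set" where
  "iwt_space D M \<zeta> =
     {(\<Oplus>\<^bsub>M\<^esub>\<xi>\<in>t. f \<xi>) | t f. finite t \<and> t \<subseteq> \<zeta> \<and> (\<forall>\<xi>\<in>t. f \<xi> \<in> wt_space D M \<xi>)}"

definition A_Uidot ::
  "('i, 'x::ab_group_add, 'y::ab_group_add, 'z) iroot_datum_scheme \<Rightarrow>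
    ('x set \<Rightarrow> ('i, 'y) Uelt set) set" where
  "A_Uidot D = {g \<in> Uidot D. \<forall>m\<in>A_Udot D.
     idot_act D (Udot D) (iwt_space D (Udot D)) g m
       \<in> A_Udot D}"

text \<open>The conditions on \<open>J\<^sub>\<mu>\<close>, \<open>B\<^sub>i\<close> and the last one are what makes \<open>x 1\<^sub>\<zeta>\<close>, acting as \<open>x\<close> on
  \<open>G \<zeta>\<close>, compatible with the relations of the modified form.\<close>

definition weight_imodule ::
  "('i, 'x::ab_group_add, 'y::ab_group_add, 'z) iroot_datum_scheme \<Rightarrow>
    (('i, 'y) Uelt, 'm) module \<Rightarrow> ('x set \<Rightarrow> 'm set) \<Rightarrow> bool" where
  "weight_imodule D M G \<longleftrightarrow>
     left_module (Ui D) M \<and> direct_sum M (Xi D) G \<and>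
     (\<forall>\<zeta>\<in>Xi D. \<forall>m\<in>G \<zeta>.
        (\<forall>\<mu>\<in>Yi D. UK D \<mu> \<odot>\<^bsub>M\<^esub> m = scale D M (qq powi ipairing D \<mu> \<zeta>) m) \<and>
        (\<forall>\<mu>\<in>Yi D. UJ D \<mu> \<in> carrier (Ui D)
           \<longrightarrow> UJ D \<mu> \<odot>\<^bsub>M\<^esub> m = scale D M (ppi powi ipairing D \<mu> \<zeta>) m) \<and>
        (\<forall>i. UB D i \<odot>\<^bsub>M\<^esub> m \<in> G ((\<lambda>\<xi>. \<xi> - xroot D i) ` \<zeta>) \<and> Jtilde D i \<odot>\<^bsub>M\<^esub> m \<in> G \<zeta>))"

definition based_imodule ::
  "('i, 'x::ab_group_add, 'y::ab_group_add, 'z) iroot_datum_scheme \<Rightarrow>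
    (('i, 'y) Uelt \<Rightarrow> ('i, 'y) Uelt) \<Rightarrow>
    (('i, 'y) Uelt, 'm) module \<Rightarrow> ('x set \<Rightarrow> 'm set) \<Rightarrow> 'm set \<Rightarrow> bool" where
  "based_imodule D \<psi>i M G B \<longleftrightarrow>
     weight_imodule D M G \<and>
     is_basis D M UNIV (carrier M) B \<and>
     (\<forall>\<zeta>\<in>Xi D. is_basis D M UNIV (G \<zeta>) (B \<inter> G \<zeta>)) \<and>
     (\<forall>g\<in>A_Uidot D. \<forall>m\<in>lspan D M A_pi B. idot_act D M G g m \<in> lspan D M A_pi B) \<and>
     (\<forall>g\<in>Uidot D. \<forall>m\<in>carrier M.
        basis_involution D M B (idot_act D M G g m)
          = idot_act D M G (Uidot_psi D \<psi>i g) (basis_involution D M B m)) \<and>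
     basis_at_infinity D M B"


subsection \<open>The \<open>\<imath>\<close>canonical basis\<close>

definition wt_above ::
  "('i::finite, 'x::ab_group_add, 'y::ab_group_add, 'z) root_datum_scheme \<Rightarrow>
    (('i, 'y) Uelt, 'm) module \<Rightarrow> 'm \<Rightarrow> 'm \<Rightarrow> bool" where
  "wt_above D M b b' \<longleftrightarrow>
     (\<exists>\<xi> \<xi>'. b \<in> wt_space D M \<xi> \<and> b' \<in> wt_space D M \<xi>' \<and> wle D \<xi> \<xi>' \<and> \<xi> \<noteq> \<xi>')"

text \<open>
  \<open>f b = b + \<Sum>\<^bsub>b'\<^esub> t\<^bsub>b;b'\<^esub> b'\<close> with the sum over those \<open>b'\<close> that precede \<open>b\<close>. As \<open>\<Upsilon>\<close> lies in the
  completion of \<open>\<^bold>U\<^sup>+\<close> and hence raises weights, \<open>b'\<close> precedes \<open>b\<close> means that the weight of \<open>b'\<close>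
  is strictly larger than that of \<open>b\<close> with respect to \<open>\<lambda> \<le> \<lambda>' \<longleftrightarrow> \<lambda>' - \<lambda> \<in> \<nat>[I]\<close>.
  (In rank one, \<open>F\<^sup>(\<^sup>2\<^sup>) v + q\<^sup>-\<^sup>1 v\<close> is invariant if \<open>v\<close> has highest weight \<open>2\<close> and
  \<open>\<varsigma> = q\<^sup>-\<^sup>1\<close>.)
\<close>

definition icanonical ::
  "('i::finite, 'x::ab_group_add, 'y::ab_group_add, 'z) root_datum_scheme \<Rightarrow> ('m \<Rightarrow> 'm) \<Rightarrow>
    (('i, 'y) Uelt, 'm) module \<Rightarrow> 'm set \<Rightarrow> ('m \<Rightarrow> 'm) \<Rightarrow> bool" where
  "icanonical D \<psi>M M B f \<longleftrightarrow> f \<in> extensional B \<and>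
     (\<forall>b\<in>B. \<psi>M (f b) = f b \<and>
        (\<exists>x\<in>lspan D M qinv_Z_pi_qinv {b'\<in>B. wt_above D M b b'}. f b = b \<oplus>\<^bsub>M\<^esub> x))"

end

theory Submission
  imports Defs
begin

text \<open>
  Write \<open>\<theta>\<close> for the action of \<open>\<Upsilon>\<close> on \<open>M\<close> and \<open>\<Psi> = \<theta> \<circ> \<psi>\<close>. Weights being bounded above, \<open>\<theta>\<close> is unipotent with
  respect to the weight order. Truncating \<open>\<Upsilon>\<close> to the weights in \<open>{\<lambda> + \<tau> \<lambda>}\<close> preserves the
  intertwining property, and so does passing to \<open>\<Upsilon> \<psi>(\<Upsilon>) \<Upsilon>\<close>; by uniqueness of the quasi-\<open>K\<close>-matrix both
  act on \<open>M\<close> as \<open>\<theta>\<close>. Hence \<open>\<theta> \<psi> \<theta> \<psi> \<theta> = \<theta>\<close>, so that \<open>\<Psi>\<close> is an involution, and \<open>\<Psi>\<close> preserves the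
  \<open>X\<^sub>\<imath>\<close>-grading. As \<open>\<Psi>\<close> is semilinear, unitriangular and preserves the \<open>\<A>\<^sup>\<pi>\<close>-lattice, the
  Kazhdan--Lusztig argument yields a unique \<open>\<Psi>\<close>-invariant basis that is unitriangular over
  \<open>q\<^sup>-\<^sup>1 \<int>\<^sup>\<pi>[q\<^sup>-\<^sup>1]\<close>. The linear map \<open>b \<mapsto> b\<^sup>\<imath>\<close> is bijective on \<open>M\<close>, on the lattices and on the
  graded pieces, and transports the basis properties of \<open>B\<close>. Compatibility with the modified form
  needs \<open>\<psi>\<^sub>\<imath>(J\<^sub>\<mu>) = J\<^sub>\<mu>\<close>, which holds since every \<open>J\<^sub>\<mu>\<close> in \<open>\<^bold>U\<^sup>\<imath>\<close> is a product of the \<open>J\<close>'s of the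
  simple coroots.
\<close>


section \<open>The scalars\<close>

text \<open>Elements of \<open>U\<close> are handled through representatives in the free algebra,
  and the arguments rest on spanning statements about words. Smallness in the completion means lying
  in the span of sorted words with many letters \<open>E\<close>; bounded weights make such words
  kill a given vector, so that an identity in the completion becomes an identity on \<open>M\<close>
  at a large enough truncation. The uniqueness of the quasi-K-matrix speaks only of intertwiners
  from \<open>\<psi>\<close> to \<open>\<psi>i\<close>. Conjugation by \<open>\<psi>\<close>
  reverses the direction, so the product of \<open>\<Upsilon>\<close> and
  \<open>\<psi>(\<Upsilon>)\<close> merely commutes with the \<open>B_i\<close> and is out of its
  reach; a further factor \<open>\<Upsilon>\<close> restores the direction, and surjectivity of
  \<open>\<theta>\<close> cancels that factor again. Truncation to
  \<open>T = {\<lambda> + \<tau> \<lambda>}\<close> is possible because the two summands of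
  \<open>B_i\<close>, of weights \<open>- i'\<close> and \<open>(\<tau> i)'\<close>, lie in one
  class modulo \<open>T\<close>. The scalars have zero divisors, so cancelling a scalar requires a
  unit; units are detected by setting \<open>\<pi>\<close> to \<open>1\<close> and to
  \<open>-1\<close>.\<close>

lemma piext_sel [simp]:
  "pi0 (x + y) = pi0 x + pi0 y" "pi1 (x + y) = pi1 x + pi1 y"
  "pi0 (x - y) = pi0 x - pi0 y" "pi1 (x - y) = pi1 x - pi1 y"
  "pi0 (- x) = - pi0 x" "pi1 (- x) = - pi1 x"
  "pi0 (x * y) = pi0 x * pi0 y + pi1 x * pi1 y"
  "pi1 (x * y) = pi0 x * pi1 y + pi1 x * pi0 y"
  "pi0 (0 :: 'a::comm_ring_1 piext) = 0" "pi1 (0 :: 'a piext) = 0"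
  "pi0 (1 :: 'a piext) = 1" "pi1 (1 :: 'a piext) = 0"
  by (simp_all add: plus_piext_def minus_piext_def uminus_piext_def times_piext_def
      zero_piext_def one_piext_def)

lemma piext_eqI: "pi0 x = pi0 y \<Longrightarrow> pi1 x = pi1 y \<Longrightarrow> x = y"
  by (rule piext.expand) simp

text \<open>\<open>pi0 x + pi1 x\<close> and \<open>pi0 x - pi1 x\<close> are the values at
  \<open>\<pi> = 1\<close> and \<open>\<pi> = -1\<close>; their product is the norm by which
  \<open>inverse\<close> divides.\<close>

lemma piext_dvd_1_iff: "(x :: 'a::field piext) dvd 1 \<longleftrightarrow> pi0 x + pi1 x \<noteq> 0 \<and> pi0 x - pi1 x \<noteq> 0"
proof
  assume "x dvd 1"
  then obtain y where y: "1 = x * y" by (auto simp: dvd_def)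
  have "(pi0 x + pi1 x) * (pi0 y + pi1 y) = pi0 (x * y) + pi1 (x * y)"
    "(pi0 x - pi1 x) * (pi0 y - pi1 y) = pi0 (x * y) - pi1 (x * y)"
    by (simp_all add: algebra_simps)
  then show "pi0 x + pi1 x \<noteq> 0 \<and> pi0 x - pi1 x \<noteq> 0" by (auto simp: y [symmetric])
next
  assume *: "pi0 x + pi1 x \<noteq> 0 \<and> pi0 x - pi1 x \<noteq> 0"
  then have "pi0 x ^ 2 - pi1 x ^ 2 \<noteq> 0"
    by (metis mult_eq_0_iff square_diff_square_factored power2_eq_square)
  then have "x * inverse x = 1"
    by (simp add: one_piext_def times_piext_def inverse_piext_def power2_eq_square
        diff_divide_distrib [symmetric])
  then show "x dvd 1" by (metis dvd_triv_left)
qed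

lemma piext_mult_inverse: "x dvd 1 \<Longrightarrow> (x :: 'a::field piext) * inverse x = 1"
  by (simp add: piext_unit_iff)

lemma unit_eq_inverse: "x * y = 1 \<Longrightarrow> (y :: 'a::field piext) = inverse x"
proof -
  assume xy: "x * y = 1"
  then have "x * inverse x = 1" by (intro piext_mult_inverse) (simp flip: xy)
  then have "y = y * (x * inverse x)" by simp
  also have "\<dots> = (x * y) * inverse x" by (simp only: mult_ac)
  finally show ?thesis by (simp add: xy)
qed

lemma divide_piext_eq_iff:
  "(y :: 'a::field piext) dvd 1 \<Longrightarrow> x / y = z \<longleftrightarrow> x = z * y"
proof -
  assume "y dvd 1"
  then have y: "y * inverse y = 1" by (rule piext_mult_inverse)
  have "x = z * y" if "x * inverse y = z"
    unfolding that [symmetric] using y by (simp add: mult.assoc mult.commute [of "inverse y"])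
  moreover have "z * y * inverse y = z" using y by (simp add: mult.assoc)
  ultimately show ?thesis unfolding divide_piext_def by blast
qed

lemma ppi_square [simp]: "ppi * ppi = 1"
  by (rule piext_eqI) (simp_all add: ppi_def)

lemma ppi_square_left [simp]: "ppi * (ppi * x) = x"
  by (simp add: mult.assoc [symmetric])

lemma inverse_ppi [simp]: "inverse ppi = ppi"
  using unit_eq_inverse [OF ppi_square] by simp

lemma ppi_dvd_1: "ppi dvd 1"
  by (metis dvd_triv_left ppi_square)

lemma qvar_nonzero [simp]: "qvar \<noteq> 0"
  by (simp add: qvar_def Zero_fract_def eq_fract)

lemma inverse_Piext [simp]: "inverse (Piext a 0) = Piext (inverse (a :: 'a::field)) 0"
  by (cases "a = 0") (simp_all add: inverse_piext_def power2_eq_square field_simps)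

lemma qq_dvd_1: "qq dvd 1"
  by (simp add: piext_dvd_1_iff qq_def)

lemma qq_inverse [simp]: "qq * inverse qq = 1" "inverse qq * qq = 1"
  using piext_mult_inverse [OF qq_dvd_1] by (simp_all add: mult.commute)

lemma Piext_mult: "Piext a 0 * Piext b 0 = Piext (a * b) (0 :: 'a::comm_ring_1)"
  by (rule piext_eqI) simp_all

lemma Piext_add: "Piext a 0 + Piext b 0 = Piext (a + b) (0 :: 'a::comm_ring_1)"
  by (rule piext_eqI) simp_all

lemma Piext_power: "Piext a 0 ^ n = Piext (a ^ n) (0 :: 'a::comm_ring_1)"
  by (induction n) (simp_all add: Piext_mult one_piext_def)

lemma qq_powi: "qq powi n = Piext (qvar powi n) 0"
  by (simp add: power_int_def qq_def Piext_power)

lemma qq_powi_add: "qq powi (m + n) = qq powi m * qq powi n"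
  by (simp add: qq_powi Piext_mult power_int_add)

lemma qq_powi_minus: "qq powi m * qq powi (- m) = 1"
  by (simp flip: qq_powi_add)

lemma ppi_powi_parity: "ppi powi n = (if even n then 1 else ppi)"
proof -
  have "ppi ^ k = (if even k then 1 else ppi)" for k :: nat
    by (induction k) auto
  then show ?thesis by (simp add: power_int_def even_nat_iff)
qed

lemma ppi_powi_add: "ppi powi (m + n) = ppi powi m * ppi powi n"
  by (simp add: ppi_powi_parity)

subsection \<open>The bar involution\<close>

definition const_ratq :: "rat \<Rightarrow> ratq" where "const_ratq c = Fract [:c:] 1"

lemma const_ratq_to_fract: "const_ratq c = to_fract [:c:]"
  by (simp add: const_ratq_def to_fract_def)

lemma const_ratq_simps [simp]:
  "const_ratq 0 = 0" "const_ratq 1 = 1"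
  "const_ratq (a + b) = const_ratq a + const_ratq b"
  "const_ratq (a * b) = const_ratq a * const_ratq b"
  by (simp_all add: const_ratq_to_fract one_pCons [symmetric] flip: to_fract_add to_fract_mult)

lemma poly_at_0 [simp]: "poly_at x 0 = 0"
  by (simp add: poly_at_def)

lemma poly_at_pCons [simp]: "poly_at x (pCons c p) = Piext (const_ratq c) 0 + x * poly_at x p"
proof -
  have "Piext (Fract [:0:] 1) 0 = (0 :: scal)"
    using const_ratq_simps(1) by (simp add: const_ratq_def zero_piext_def)
  then show ?thesis by (simp add: poly_at_def const_ratq_def map_poly_pCons)
qed

lemma poly_at_add: "poly_at x (p + r) = poly_at x p + poly_at x r"
  by (induction p r rule: poly_induct2) (simp_all add: algebra_simps Piext_add [symmetric])

lemma poly_at_smult: "poly_at x (smult c p) = Piext (const_ratq c) 0 * poly_at x p"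
  by (induction p) (simp_all add: algebra_simps Piext_mult [symmetric])

lemma poly_at_mult: "poly_at x (p * r) = poly_at x p * poly_at x r"
  by (induction p) (simp_all add: poly_at_add poly_at_smult algebra_simps zero_piext_def [symmetric])

lemma poly_at_1 [simp]: "poly_at x 1 = 1"
  by (simp add: one_pCons one_piext_def [symmetric])

text \<open>\<open>ratq_at\<close> chooses some representing fraction. The choice is harmless once
  every nonzero denominator becomes a unit, because the cross-multiplied equation between two
  representations then determines the quotient.\<close>

lemma ratq_at_Fract:
  assumes "\<And>b. b \<noteq> 0 \<Longrightarrow> poly_at x b dvd 1" and "b \<noteq> 0"
  shows "ratq_at x (Fract a b) = poly_at x a / poly_at x b"
  unfolding ratq_at_def
proof (rule some_equality)
  show "\<exists>a' b'. b' \<noteq> 0 \<and> Fract a b = Fract a' b' \<and> poly_at x a / poly_at x b = poly_at x a' / poly_at x b'"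
    using \<open>b \<noteq> 0\<close> by blast
next
  fix y assume "\<exists>a' b'. b' \<noteq> 0 \<and> Fract a b = Fract a' b' \<and> y = poly_at x a' / poly_at x b'"
  then obtain a' b' where *: "b' \<noteq> 0" "Fract a b = Fract a' b'" "y = poly_at x a' / poly_at x b'"
    by blast
  then have "a * b' = a' * b" using \<open>b \<noteq> 0\<close> by (simp add: eq_fract)
  then have "poly_at x a * poly_at x b' = poly_at x a' * poly_at x b"
    by (simp flip: poly_at_mult)
  then have "(poly_at x a * poly_at x b') * inverse (poly_at x b)
      = (poly_at x a' * poly_at x b) * inverse (poly_at x b)"
    by (rule arg_cong)
  then have "poly_at x a * inverse (poly_at x b) * poly_at x b'
      = poly_at x a' * (poly_at x b * inverse (poly_at x b))"
    by (simp only: mult_ac)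
  then have "poly_at x a / poly_at x b * poly_at x b' = poly_at x a'"
    using \<open>b \<noteq> 0\<close> assms(1) [of b] by (simp add: divide_piext_def piext_mult_inverse)
  then show "y = poly_at x a / poly_at x b"
    using *(1) assms(1) [of b'] unfolding *(3) by (simp add: divide_piext_eq_iff)
qed

text \<open>Setting \<open>\<pi>\<close> to a square root \<open>s\<close> of \<open>1\<close> is a
  ring homomorphism to the rational functions, so it commutes with evaluating polynomials.\<close>

lemma poly_at_specialize:
  assumes "s * s = (1 :: ratq)"
  shows "pi0 (poly_at x p) + s * pi1 (poly_at x p) =
    (\<Sum>i\<le>degree p. const_ratq (coeff p i) * (pi0 x + s * pi1 x) ^ i)" (is "?e (poly_at x p) = _")
proof -
  \<comment> \<open>Multiplicativity is where \<open>s * s = 1\<close> enters.\<close>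
  have mult: "?e (u * v) = ?e u * ?e v" for u v :: scal
  proof -
    have "s * (s * z) = z" for z using assms by (simp flip: mult.assoc)
    then show ?thesis by (simp add: algebra_simps)
  qed
  have "?e (poly_at x p) = (\<Sum>i\<le>n. const_ratq (coeff p i) * ?e x ^ i)" if "degree p \<le> n" for n
    using that
  proof (induction p arbitrary: n)
    case (pCons c p)
    have "?e (poly_at x (pCons c p)) = const_ratq c + ?e x * ?e (poly_at x p)"
      unfolding poly_at_pCons mult [symmetric] by (simp add: algebra_simps)
    also have "\<dots> = (\<Sum>i\<le>n. const_ratq (coeff (pCons c p) i) * ?e x ^ i)"
    proof (cases n)
      case 0
      then have "p = 0" using pCons.prems by (auto split: if_splits)
      then show ?thesis using 0 by simp
    next
      case (Suc m)
      then have "degree p \<le> m" using pCons.prems by (auto split: if_splits)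
      from pCons.IH [OF this] show ?thesis
        unfolding Suc sum.atMost_Suc_shift by (simp add: sum_distrib_left algebra_simps)
    qed
    finally show ?case .
  qed simp
  then show ?thesis by blast
qed

lemma to_fract_monom: "to_fract (monom c n) = const_ratq c * qvar ^ n"
proof (induction n)
  case (Suc n)
  have "to_fract (monom c (Suc n)) = to_fract [:0, 1:] * to_fract (monom c n)"
    unfolding to_fract_mult [symmetric] monom_Suc by simp
  also have "to_fract [:0, 1:] = qvar" by (simp add: qvar_def to_fract_def)
  finally show ?case using Suc by (simp add: mult_ac)
qed (simp add: const_ratq_to_fract monom_0)

text \<open>A unit is recognized at \<open>\<pi> = 1\<close> and \<open>\<pi> = -1\<close>. There
  \<open>ppi / qq\<close> becomes \<open>s / q\<close> with \<open>s = 1\<close> or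
  \<open>s = -1\<close>, and a nonzero polynomial does not vanish at such a value. This is what
  makes the bar involution well defined on fractions.\<close>

lemma poly_at_bar_unit:
  assumes "p \<noteq> 0"
  shows "poly_at (ppi / qq) p dvd 1"
proof -
  have x: "ppi / qq = Piext 0 (inverse qvar)"
    by (rule piext_eqI) (simp_all add: divide_piext_def ppi_def qq_def)
  have "pi0 (poly_at (ppi / qq) p) + to_fract [:s:] * pi1 (poly_at (ppi / qq) p) \<noteq> 0"
    if s: "s * s = 1" for s :: rat
  proof -
    have ss: "to_fract [:s:] * to_fract [:s:] = 1"
      using s by (simp add: one_pCons [symmetric] flip: to_fract_mult)
    have pw: "to_fract [:s ^ i:] = to_fract [:s:] ^ i" for i
      unfolding const_ratq_to_fract [symmetric] by (induction i) simp_all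
    \<comment> \<open>\<open>r\<close> is \<open>q ^ degree p\<close> times the value at
      \<open>s / q\<close>, hence a polynomial: the coefficients of \<open>p\<close> in reversed
      order. Its constant coefficient is the leading coefficient of \<open>p\<close> times a power
      of \<open>s\<close>.\<close>
    define r where "r = (\<Sum>i\<le>degree p. monom (coeff p i * s ^ i) (degree p - i))"
    have "coeff r 0 = (\<Sum>i\<le>degree p. if i = degree p then coeff p i * s ^ i else 0)"
      unfolding r_def coeff_sum by (rule sum.cong) (auto simp: coeff_monom)
    also have "\<dots> = coeff p (degree p) * s ^ degree p" by simp
    also have "\<dots> \<noteq> 0" using assms s by auto
    finally have "r \<noteq> 0" by auto
    have "qvar ^ degree p * (pi0 (poly_at (ppi / qq) p) + to_fract [:s:] * pi1 (poly_at (ppi / qq) p))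
        = (\<Sum>i\<le>degree p. qvar ^ degree p * (const_ratq (coeff p i) * (to_fract [:s:] * inverse qvar) ^ i))"
      unfolding poly_at_specialize [OF ss] x by (simp add: sum_distrib_left)
    also have "\<dots> = to_fract r"
      unfolding r_def to_fract_sum
    proof (rule sum.cong)
      fix i assume "i \<in> {..degree p}"
      then have "qvar ^ degree p = qvar ^ (degree p - i) * qvar ^ i"
        by (simp flip: power_add)
      then show "qvar ^ degree p * (const_ratq (coeff p i) * (to_fract [:s:] * inverse qvar) ^ i) =
          to_fract (monom (coeff p i * s ^ i) (degree p - i))"
        by (simp add: to_fract_monom pw const_ratq_to_fract [of "s ^ i"] power_mult_distrib field_simps)
    qed simp
    finally show ?thesis using \<open>r \<noteq> 0\<close> by auto
  qed
  from this [of 1] this [of "-1"] have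
    "pi0 (poly_at (ppi / qq) p) + to_fract [:1:] * pi1 (poly_at (ppi / qq) p) \<noteq> 0"
    "pi0 (poly_at (ppi / qq) p) + to_fract [:- 1:] * pi1 (poly_at (ppi / qq) p) \<noteq> 0"
    by simp_all
  moreover have "to_fract [:1::rat:] = 1" "to_fract [:- 1::rat:] = - 1"
    using to_fract_1 [where 'a = "rat poly"] to_fract_uminus [of "1 :: rat poly"]
    by (simp_all add: one_pCons)
  ultimately show ?thesis by (simp add: piext_dvd_1_iff)
qed

lemma bar_coeff_Fract:
  "b \<noteq> 0 \<Longrightarrow> ratq_at (ppi / qq) (Fract a b) = poly_at (ppi / qq) a / poly_at (ppi / qq) b"
  by (rule ratq_at_Fract [OF poly_at_bar_unit])

lemma divide_piext_mult:
  assumes "(y :: 'a::field piext) dvd 1" "z dvd 1"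
  shows "a / y * (c / z) = (a * c) / (y * z)"
proof -
  have "inverse (y * z) = inverse y * inverse z"
  proof (rule unit_eq_inverse [symmetric])
    have "y * z * (inverse y * inverse z) = (y * inverse y) * (z * inverse z)"
      by (simp only: mult_ac)
    then show "y * z * (inverse y * inverse z) = 1" using assms by (simp add: piext_mult_inverse)
  qed
  then show ?thesis unfolding divide_piext_def by (simp only: mult_ac)
qed

lemma divide_piext_add:
  assumes "(y :: 'a::field piext) dvd 1" "z dvd 1"
  shows "a / y + c / z = (a * z + c * y) / (y * z)"
proof -
  have "a / y = a / y * (z / z)" "c / z = c / z * (y / y)"
    using assms by (simp_all add: divide_piext_def piext_mult_inverse)
  then have "a / y = (a * z) / (y * z)" "c / z = (c * y) / (y * z)"
    using assms by (simp_all add: divide_piext_mult mult.commute)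
  then show ?thesis by (simp add: divide_piext_def distrib_right)
qed

lemma bar_coeff_add:
  "ratq_at (ppi / qq) (f + g) = ratq_at (ppi / qq) f + ratq_at (ppi / qq) g"
proof -
  obtain a b c d where *: "f = Fract a b" "b \<noteq> 0" "g = Fract c d" "d \<noteq> 0"
    by (metis Fract_cases)
  then show ?thesis
    by (simp add: bar_coeff_Fract poly_at_add poly_at_mult divide_piext_add poly_at_bar_unit)
qed

lemma bar_coeff_mult:
  "ratq_at (ppi / qq) (f * g) = ratq_at (ppi / qq) f * ratq_at (ppi / qq) g"
proof -
  obtain a b c d where *: "f = Fract a b" "b \<noteq> 0" "g = Fract c d" "d \<noteq> 0"
    by (metis Fract_cases)
  then show ?thesis
    by (simp add: bar_coeff_Fract poly_at_mult divide_piext_mult poly_at_bar_unit)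
qed

lemma bar_coeff_to_fract: "ratq_at (ppi / qq) (to_fract p) = poly_at (ppi / qq) p"
  unfolding to_fract_def by (simp add: bar_coeff_Fract divide_piext_eq_iff)

lemma qbar_add: "qbar (x + y) = qbar x + qbar y"
  by (simp add: qbar_def bar_coeff_add algebra_simps)

lemma qbar_mult: "qbar (x * y) = qbar x * qbar y"
  by (simp add: qbar_def bar_coeff_add bar_coeff_mult algebra_simps)

lemma qbar_const: "qbar (Piext (const_ratq c) 0) = Piext (const_ratq c) 0"
  using bar_coeff_to_fract [of "[:c:]"] bar_coeff_to_fract [of 0]
  by (simp add: qbar_def const_ratq_to_fract)

lemma qbar_0 [simp]: "qbar 0 = 0"
  using qbar_const [of 0] by (simp add: zero_piext_def)

lemma qbar_1 [simp]: "qbar 1 = 1"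
  using qbar_const [of 1] by (simp add: one_piext_def)

lemma qbar_ppi [simp]: "qbar ppi = ppi"
  using bar_coeff_to_fract [of 0] bar_coeff_to_fract [of 1] by (simp add: qbar_def ppi_def)

lemma qvar_to_fract: "qvar = to_fract [:0, 1:]"
  by (simp add: qvar_def to_fract_def)

lemma qbar_qq: "qbar qq = ppi / qq"
proof -
  have "ratq_at (ppi / qq) qvar = ppi / qq" "ratq_at (ppi / qq) 0 = 0"
    using bar_coeff_to_fract [of "[:0, 1:]"] bar_coeff_to_fract [of 0]
    by (simp_all add: qvar_to_fract zero_piext_def [symmetric] one_piext_def [symmetric])
  moreover have "pi0 qq = qvar" "pi1 qq = 0" by (simp_all add: qq_def)
  ultimately show ?thesis by (simp add: qbar_def)
qed

lemma qbar_uminus: "qbar (- x) = - qbar x"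
  using qbar_add [of x "- x"] by (simp add: eq_neg_iff_add_eq_0 add.commute)

lemma qbar_diff: "qbar (x - y) = qbar x - qbar y"
  using qbar_add [of x "- y"] by (simp add: qbar_uminus)

lemma qbar_inverse: "x dvd 1 \<Longrightarrow> qbar (inverse x) = inverse (qbar x)"
  by (rule unit_eq_inverse) (simp add: piext_mult_inverse flip: qbar_mult)

text \<open>\<open>ppi / qq\<close> is the conjugate of \<open>qq\<close>, so this is the involution
  property on the generator.\<close>

lemma qbar_ppi_qq: "qbar (ppi / qq) = qq"
proof -
  have "qbar (ppi / qq) * qbar qq = ppi"
    unfolding qbar_mult [symmetric] divide_piext_def by (simp add: mult.assoc)
  then have "qbar (ppi / qq) * (ppi * inverse qq) * ppi * qq = ppi * ppi * qq"
    by (simp add: qbar_qq divide_piext_def)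
  moreover have "qbar (ppi / qq) * (ppi * inverse qq) * ppi * qq =
     qbar (ppi / qq) * (inverse qq * qq) * (ppi * ppi)" by (simp only: mult_ac)
  ultimately show ?thesis by simp
qed

lemma poly_at_qq: "poly_at qq p = Piext (to_fract p) 0"
proof (induction p)
  case (pCons c p)
  have "to_fract (pCons c p) = to_fract [:c:] + to_fract [:0, 1:] * to_fract p"
    by (simp flip: to_fract_mult to_fract_add)
  then show ?case
    using pCons by (simp add: qq_def Piext_mult Piext_add const_ratq_to_fract qvar_def to_fract_def)
qed (simp add: zero_piext_def)

lemma qbar_poly_at: "qbar (poly_at x p) = poly_at (qbar x) p"
  by (induction p) (simp_all add: qbar_add qbar_mult qbar_const)

lemma qbar_divide: "y dvd 1 \<Longrightarrow> qbar (x / y) = qbar x / qbar y"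
  by (simp add: divide_piext_def qbar_mult qbar_inverse)

lemma piext_decompose: "x = Piext (pi0 x) 0 + ppi * Piext (pi1 x) 0"
  by (rule piext_eqI) (simp_all add: ppi_def)

text \<open>Conjugating a value at \<open>ppi / qq\<close> gives the value at the conjugate of
  \<open>ppi / qq\<close>, which is \<open>qq\<close>; evaluation at \<open>qq\<close> in turn
  returns the rational function itself.\<close>

lemma qbar_qbar [simp]: "qbar (qbar x) = x"
proof -
  have 1: "qbar (ratq_at (ppi / qq) f) = Piext f 0" for f
  proof (cases f)
    case (Fract a b)
    have "qbar (ratq_at (ppi / qq) f) = Piext (to_fract a) 0 / Piext (to_fract b) 0"
      unfolding Fract(1) bar_coeff_Fract [OF Fract(2)] qbar_divide [OF poly_at_bar_unit [OF Fract(2)]]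
        qbar_poly_at qbar_ppi_qq poly_at_qq by (rule refl)
    also have "\<dots> = Piext f 0"
      using Fract by (simp add: divide_piext_def Piext_mult Fract_conv_to_fract divide_inverse)
    finally show ?thesis .
  qed
  have "qbar (qbar x) = Piext (pi0 x) 0 + ppi * Piext (pi1 x) 0"
    unfolding qbar_def [of x] by (simp only: qbar_add qbar_mult qbar_ppi 1)
  then show ?thesis by (simp flip: piext_decompose)
qed


subsection \<open>Integral Laurent polynomials\<close>

lemma laurent_Z_induct [consumes 1, case_names zero add]:
  assumes "x \<in> laurent_Z T" "P 0"
    "\<And>x k n. P x \<Longrightarrow> n \<in> T \<Longrightarrow> P (x + of_int k * qvar powi n)"
  shows "P x"
proof -
  obtain S c where "finite S" "S \<subseteq> T" and x: "x = (\<Sum>n\<in>S. of_int (c n) * qvar powi n)"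
    using assms(1) unfolding laurent_Z_def by blast
  then show ?thesis unfolding x
  proof (induction S rule: finite_induct)
    case (insert m S)
    then have "P ((\<Sum>n\<in>S. of_int (c n) * qvar powi n) + of_int (c m) * qvar powi m)"
      by (intro assms(3)) auto
    with insert show ?case by (simp add: add.commute)
  qed (simp add: assms)
qed

lemma laurent_Z_0: "0 \<in> laurent_Z T"
  unfolding laurent_Z_def by (rule CollectI, rule exI [of _ "{}"]) auto

lemma laurent_Z_monom: "n \<in> T \<Longrightarrow> of_int k * qvar powi n \<in> laurent_Z T"
  unfolding laurent_Z_def by (rule CollectI, rule exI [of _ "{n}"], rule exI [of _ "\<lambda>_. k"]) auto

lemma laurent_Z_add:
  assumes "x \<in> laurent_Z T" "y \<in> laurent_Z T" shows "x + y \<in> laurent_Z T"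
proof -
  obtain S c S' c' where *: "finite S" "S \<subseteq> T" "x = (\<Sum>n\<in>S. of_int (c n) * qvar powi n)"
    "finite S'" "S' \<subseteq> T" "y = (\<Sum>n\<in>S'. of_int (c' n) * qvar powi n)"
    using assms unfolding laurent_Z_def by blast
  let ?c = "\<lambda>n. (if n \<in> S then c n else 0) + (if n \<in> S' then c' n else 0)"
  have "x = (\<Sum>n\<in>S \<union> S'. of_int (if n \<in> S then c n else 0) * qvar powi n)"
    "y = (\<Sum>n\<in>S \<union> S'. of_int (if n \<in> S' then c' n else 0) * qvar powi n)"
    unfolding * using *(1,4) by (auto intro!: sum.mono_neutral_cong_left)
  then have "x + y = (\<Sum>n\<in>S \<union> S'. of_int (?c n) * qvar powi n)"
    by (simp add: sum.distrib algebra_simps)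
  then show ?thesis using * unfolding laurent_Z_def
    by (intro CollectI exI [of _ "S \<union> S'"] exI [of _ ?c]) auto
qed

lemma laurent_Z_uminus: "x \<in> laurent_Z T \<Longrightarrow> - x \<in> laurent_Z T"
proof (induction rule: laurent_Z_induct)
  case (add x k n)
  then have "- x + of_int (- k) * qvar powi n \<in> laurent_Z T"
    by (intro laurent_Z_add laurent_Z_monom)
  then show ?case by simp
qed (simp add: laurent_Z_0)

lemma laurent_Z_mult:
  assumes "x \<in> laurent_Z T" "y \<in> laurent_Z T'" "\<And>m n. m \<in> T \<Longrightarrow> n \<in> T' \<Longrightarrow> m + n \<in> T''"
  shows "x * y \<in> laurent_Z T''"
  using assms(1)
proof (induction rule: laurent_Z_induct)
  case (add x k m)
  from assms(2) have "of_int k * qvar powi m * y \<in> laurent_Z T''"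
  proof (induction rule: laurent_Z_induct)
    case (add z l n)
    have "of_int k * qvar powi m * z + of_int (k * l) * qvar powi (m + n) \<in> laurent_Z T''"
      using add \<open>m \<in> T\<close> assms(3) by (intro laurent_Z_add laurent_Z_monom)
    then show ?case by (simp add: algebra_simps power_int_add)
  qed (simp add: laurent_Z_0)
  with add show ?case by (simp add: algebra_simps laurent_Z_add)
qed (simp add: laurent_Z_0)

lemma laurent_Z_mono: "T \<subseteq> T' \<Longrightarrow> laurent_Z T \<subseteq> laurent_Z T'"
  unfolding laurent_Z_def by blast

lemma qvar_powi_independent:
  assumes "finite S" "(\<Sum>n\<in>S. of_int (c n) * qvar powi n) = 0" "m \<in> S"
  shows "c m = 0"
proof -
  \<comment> \<open>Multiplication by \<open>q ^ N\<close> clears all negative exponents and turns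
    the relation into one between polynomials, where coefficients can be compared.\<close>
  define N where "N = nat (Max (insert 0 ((\<lambda>n. - n) ` S)))"
  have N: "n + int N \<ge> 0" if "n \<in> S" for n
  proof -
    have "- n \<le> Max (insert 0 ((\<lambda>n. - n) ` S))"
      using that assms(1) by (intro Max_ge) auto
    then show ?thesis unfolding N_def by linarith
  qed
  define r where "r = (\<Sum>n\<in>S. monom (rat_of_int (c n)) (nat (n + int N)))"
  have ofint: "const_ratq (of_int k) = of_int k" for k
  proof (induction k rule: int_induct [of _ 0])
    case (step2 i)
    have "const_ratq (rat_of_int (i - 1)) + const_ratq 1 = const_ratq (rat_of_int i)"
      by (simp only: const_ratq_simps(3) [symmetric]) simp
    then show ?case using step2 by (simp add: algebra_simps)
  qed simp_all
  have "to_fract r = (\<Sum>n\<in>S. of_int (c n) * qvar powi n) * qvar ^ N"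
    unfolding r_def to_fract_sum sum_distrib_right
  proof (rule sum.cong)
    fix n assume "n \<in> S"
    then have "qvar ^ nat (n + int N) = qvar powi n * qvar ^ N"
      using N [OF \<open>n \<in> S\<close>] by (simp add: power_int_add flip: power_int_of_nat)
    then show "to_fract (monom (rat_of_int (c n)) (nat (n + int N))) = of_int (c n) * qvar powi n * qvar ^ N"
      by (simp add: to_fract_monom ofint)
  qed simp
  then have "r = 0" using assms(2) by simp
  then have "0 = coeff r (nat (m + int N))" by simp
  also have "\<dots> = (\<Sum>n\<in>S. if n = m then rat_of_int (c n) else 0)"
    unfolding r_def coeff_sum
  proof (rule sum.cong)
    fix n assume "n \<in> S"
    then show "coeff (monom (rat_of_int (c n)) (nat (n + int N))) (nat (m + int N)) =
        (if n = m then rat_of_int (c n) else 0)"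
      using N [of n] N [OF \<open>m \<in> S\<close>] by (auto simp: coeff_monom nat_eq_iff)
  qed simp
  also have "\<dots> = rat_of_int (c m)" using assms(1,3) by simp
  finally show ?thesis by simp
qed

text \<open>Takes the place of comparing coefficients: later splittings of Laurent polynomials are
  separated by their ranges of exponents alone. The two representations combine to a single relation
  on the disjoint union of the supports.\<close>

lemma laurent_Z_disjoint:
  assumes "x \<in> laurent_Z T" "x \<in> laurent_Z T'" "T \<inter> T' = {}"
  shows "x = 0"
proof -
  obtain S c S' c' where *: "finite S" "S \<subseteq> T" "x = (\<Sum>n\<in>S. of_int (c n) * qvar powi n)"
    "finite S'" "S' \<subseteq> T'" "x = (\<Sum>n\<in>S'. of_int (c' n) * qvar powi n)"
    using assms unfolding laurent_Z_def by blast
  let ?c = "\<lambda>n. if n \<in> S then c n else - c' n"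
  have "(\<Sum>n\<in>S \<union> S'. of_int (?c n) * qvar powi n) =
      (\<Sum>n\<in>S. of_int (?c n) * qvar powi n) + (\<Sum>n\<in>S'. of_int (?c n) * qvar powi n)"
    using * assms(3) by (intro sum.union_disjoint) auto
  also have "(\<Sum>n\<in>S. of_int (?c n) * qvar powi n) = x"
    unfolding *(3) by (rule sum.cong) auto
  also have "(\<Sum>n\<in>S'. of_int (?c n) * qvar powi n) = (\<Sum>n\<in>S'. - (of_int (c' n) * qvar powi n))"
    using * assms(3) by (intro sum.cong) auto
  also have "\<dots> = - x" unfolding *(6) by (simp add: sum_negf)
  finally have "c n = 0" if "n \<in> S" for n
    using qvar_powi_independent [of "S \<union> S'" ?c n] that * by auto
  then show ?thesis unfolding *(3) by simp
qed

lemma qvar_powi_inj: "qvar powi m = qvar powi n \<Longrightarrow> m = n"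
proof (rule ccontr)
  assume "qvar powi m = qvar powi n" "m \<noteq> n"
  moreover have "of_int 1 * qvar powi m \<in> laurent_Z {m}" "of_int 1 * qvar powi n \<in> laurent_Z {n}"
    by (rule laurent_Z_monom; simp)+
  ultimately have "qvar powi m = 0" using laurent_Z_disjoint [of "qvar powi m" "{m}" "{n}"] by auto
  then show False by simp
qed

text \<open>For separating weights it is not enough that two eigenvalues differ, as there are zero
  divisors; their difference must be a unit. It is one here because it is a nonzero rational
  function without \<open>\<pi>\<close> part.\<close>

lemma qq_powi_diff_unit: "m \<noteq> n \<Longrightarrow> qq powi m - qq powi n dvd 1"
  using qvar_powi_inj [of m n] by (auto simp: piext_dvd_1_iff qq_powi)

lemma pi_closure_laurent:
  "0 \<in> pi_closure (laurent_Z T)"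
  "x \<in> pi_closure (laurent_Z T) \<Longrightarrow> y \<in> pi_closure (laurent_Z T) \<Longrightarrow> x + y \<in> pi_closure (laurent_Z T)"
  "x \<in> pi_closure (laurent_Z T) \<Longrightarrow> - x \<in> pi_closure (laurent_Z T)"
  by (auto simp: pi_closure_def laurent_Z_0 laurent_Z_add laurent_Z_uminus)

lemma pi_closure_laurent_mult:
  assumes "x \<in> pi_closure (laurent_Z T)" "y \<in> pi_closure (laurent_Z T')"
    "\<And>m n. m \<in> T \<Longrightarrow> n \<in> T' \<Longrightarrow> m + n \<in> T''"
  shows "x * y \<in> pi_closure (laurent_Z T'')"
  using assms by (auto simp: pi_closure_def intro!: laurent_Z_add laurent_Z_mult)

lemma pi_closure_laurent_disjoint:
  assumes "x \<in> pi_closure (laurent_Z T)" "x \<in> pi_closure (laurent_Z T')" "T \<inter> T' = {}"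
  shows "x = 0"
  using assms by (auto simp: pi_closure_def intro!: piext_eqI intro: laurent_Z_disjoint)

lemma qbar_qq_powi: "qbar (qq powi n) = ppi powi n * qq powi (- n)"
proof -
  have 1: "qbar (qq ^ k) = ppi ^ k * inverse qq ^ k" for k
    by (induction k) (simp_all add: qbar_mult qbar_qq divide_piext_def)
  have "qbar (inverse qq) = ppi * qq"
    unfolding qbar_inverse [OF qq_dvd_1] qbar_qq divide_piext_def
    by (rule unit_eq_inverse [symmetric]) (simp add: mult.assoc, simp add: mult.left_commute)
  then have 2: "qbar (inverse qq ^ k) = ppi ^ k * qq ^ k" for k
    by (induction k) (simp_all add: qbar_mult)
  show ?thesis by (simp add: power_int_def 1 2)
qed

lemma qbar_of_int [simp]: "qbar (of_int k) = of_int k"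
  by (induction k rule: int_induct [of _ 0]) (simp_all add: qbar_add qbar_diff)

lemma of_int_Piext: "of_int k = Piext (of_int k :: 'a::comm_ring_1) 0"
  by (induction k rule: int_induct [of _ 0]; rule piext_eqI) simp_all

lemma pi_closure_ppi: "x \<in> pi_closure S \<Longrightarrow> ppi * x \<in> pi_closure S"
  by (simp add: pi_closure_def ppi_def)

lemma qbar_laurent_Piext:
  assumes "f \<in> laurent_Z T"
  shows "qbar (Piext f 0) \<in> pi_closure (laurent_Z (uminus ` T))"
  using assms
proof (induction rule: laurent_Z_induct)
  case zero
  then show ?case by (simp add: zero_piext_def [symmetric] pi_closure_laurent)
next
  case (add f k n)
  have "Piext (f + of_int k * qvar powi n) 0 = Piext f 0 + of_int k * qq powi n"
    by (simp add: qq_powi of_int_Piext Piext_mult Piext_add)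
  moreover have "of_int k * qvar powi (- n) \<in> laurent_Z (uminus ` T)"
    using add by (intro laurent_Z_monom) simp
  then have "of_int k * qq powi (- n) \<in> pi_closure (laurent_Z (uminus ` T))"
    by (simp add: qq_powi of_int_Piext Piext_mult pi_closure_def laurent_Z_0)
  then have "of_int k * (ppi powi n * qq powi (- n)) \<in> pi_closure (laurent_Z (uminus ` T))"
    using pi_closure_ppi unfolding ppi_powi_parity by (simp add: mult.left_commute)
  ultimately show ?case using add
    by (simp add: qbar_add qbar_mult qbar_qq_powi pi_closure_laurent)
qed

text \<open>The factors \<open>\<pi> ^ n\<close> produced by conjugation at most exchange the two
  components, so integrality is kept while the exponents change sign.\<close>

lemma qbar_laurent:
  assumes "x \<in> pi_closure (laurent_Z T)"
  shows "qbar x \<in> pi_closure (laurent_Z (uminus ` T))"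
proof -
  have "qbar x = qbar (Piext (pi0 x) 0) + ppi * qbar (Piext (pi1 x) 0)"
    by (subst (1) piext_decompose [of x]) (simp only: qbar_add qbar_mult qbar_ppi)
  moreover have "pi0 x \<in> laurent_Z T" "pi1 x \<in> laurent_Z T"
    using assms by (simp_all add: pi_closure_def)
  ultimately show ?thesis
    by (simp only: pi_closure_laurent qbar_laurent_Piext pi_closure_ppi)
qed

lemma laurent_Z_split:
  assumes "x \<in> laurent_Z UNIV"
  obtains a b c where "x = a + b + c" "a \<in> laurent_Z {..<0}" "b \<in> laurent_Z {0}" "c \<in> laurent_Z {0<..}"
proof -
  from assms have "\<exists>a b c. x = a + b + c \<and> a \<in> laurent_Z {..<0} \<and> b \<in> laurent_Z {0} \<and> c \<in> laurent_Z {0<..}"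
  proof (induction rule: laurent_Z_induct)
    case zero
    then show ?case using laurent_Z_0 by (intro exI [of _ 0]) auto
  next
    case (add x k n)
    then obtain a b c where *: "x = a + b + c" "a \<in> laurent_Z {..<0}" "b \<in> laurent_Z {0}"
      "c \<in> laurent_Z {0<..}" by blast
    let ?m = "of_int k * qvar powi n"
    consider "n < 0" | "n = 0" | "0 < n" by linarith
    then show ?case
    proof cases
      case 1
      then show ?thesis
        using * by (intro exI [of _ "a + ?m"] exI [of _ b] exI [of _ c])
          (auto intro!: laurent_Z_add laurent_Z_monom)
    next
      case 2
      then show ?thesis
        using * laurent_Z_monom [of n "{0}" k] by (intro exI [of _ a] exI [of _ "b + ?m"] exI [of _ c])
          (auto intro!: laurent_Z_add)
    next
      case 3
      then show ?thesis
        using * by (intro exI [of _ a] exI [of _ b] exI [of _ "c + ?m"])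
          (auto intro!: laurent_Z_add laurent_Z_monom)
    qed
  qed
  then show ?thesis using that by blast
qed

lemma A_pi_split:
  assumes "x \<in> A_pi"
  obtains a b c where "x = a + b + c" "a \<in> qinv_Z_pi_qinv" "b \<in> pi_closure (laurent_Z {0})"
    "c \<in> pi_closure (laurent_Z {0<..})"
proof -
  have "pi0 x \<in> laurent_Z UNIV" "pi1 x \<in> laurent_Z UNIV"
    using assms by (auto simp: A_pi_def pi_closure_def)
  then obtain a b c a' b' c' where "pi0 x = a + b + c" "pi1 x = a' + b' + c'"
    "a \<in> laurent_Z {..<0}" "b \<in> laurent_Z {0}" "c \<in> laurent_Z {0<..}"
    "a' \<in> laurent_Z {..<0}" "b' \<in> laurent_Z {0}" "c' \<in> laurent_Z {0<..}"
    by (metis laurent_Z_split)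
  then show ?thesis
    by (intro that [of "Piext a a'" "Piext b b'" "Piext c c'"])
      (auto simp: pi_closure_def qinv_Z_pi_qinv_def intro: piext_eqI)
qed

lemma uminus_image_Iio_0: "uminus ` {..<0::int} = {0<..}" "uminus ` {0<..} = {..<0::int}"
  by (auto intro: rev_image_eqI [of "- x" for x])

text \<open>Conjugation turns negative exponents into positive ones, and the two ranges are
  disjoint. This is the scalar case of the uniqueness of the canonical basis.\<close>

lemma bar_invariant_qinv:
  assumes "c \<in> qinv_Z_pi_qinv" "qbar c = c"
  shows "c = 0"
proof (rule pi_closure_laurent_disjoint)
  show "c \<in> pi_closure (laurent_Z {..<0})" using assms by (simp add: qinv_Z_pi_qinv_def)
  then show "c \<in> pi_closure (laurent_Z {0<..})"
    using qbar_laurent [of c "{..<0}"] assms(2) by (simp add: uminus_image_Iio_0)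
qed auto

text \<open>The scalar case of existence. Split \<open>h = a + b + c\<close> into its parts with
  negative, zero and positive exponents. Anti-invariance gives \<open>qbar a = - c\<close> and
  \<open>qbar b = - b\<close>, while conjugation fixes integers and \<open>\<pi>\<close>, hence
  \<open>b\<close>; so \<open>b = 0\<close> and \<open>t = a\<close> is a solution.\<close>

lemma bar_antiinvariant_split:
  assumes "h \<in> A_pi" "qbar h = - h"
  shows "\<exists>t\<in>qinv_Z_pi_qinv. t - qbar t = h"
proof -
  obtain a b c where h: "h = a + b + c" and a: "a \<in> qinv_Z_pi_qinv"
    and b: "b \<in> pi_closure (laurent_Z {0})" and c: "c \<in> pi_closure (laurent_Z {0<..})"
    using A_pi_split [OF assms(1)] .
  let ?P = "\<lambda>T. pi_closure (laurent_Z T)"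
  have mono: "x \<in> ?P T \<Longrightarrow> T \<subseteq> T' \<Longrightarrow> x \<in> ?P T'" for x T T'
    using laurent_Z_mono [of T T'] by (auto simp: pi_closure_def)
  have bars: "qbar a \<in> ?P {0<..}" "qbar b \<in> ?P {0}" "qbar c \<in> ?P {..<0}"
    using qbar_laurent [of a "{..<0}"] qbar_laurent [of b "{0}"] qbar_laurent [of c "{0<..}"] a b c
    by (simp_all add: qinv_Z_pi_qinv_def uminus_image_Iio_0)
  have "qbar h + h = 0" using assms(2) by simp
  then have "qbar a + qbar b + qbar c + (a + b + c) = 0" unfolding h qbar_add .
  then have eq: "(qbar a + c) + (qbar b + b) + (qbar c + a) = 0" by (simp only: add_ac)
  have pc: "qbar a + c \<in> ?P {0<..}" "qbar b + b \<in> ?P {0}" "qbar c + a \<in> ?P {..<0}"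
    using bars a b c by (simp_all add: qinv_Z_pi_qinv_def pi_closure_laurent)
  from eq have "qbar a + c = - ((qbar b + b) + (qbar c + a))"
    unfolding eq_neg_iff_add_eq_0 by (simp only: add.assoc)
  moreover have "- ((qbar b + b) + (qbar c + a)) \<in> ?P {..0}"
    by (intro pi_closure_laurent mono [OF pc(2)] mono [OF pc(3)]) auto
  ultimately have 1: "qbar a + c = 0"
    using pc(1) by (intro pi_closure_laurent_disjoint [of "qbar a + c" "{0<..}" "{..0}"]) auto
  with eq have "qbar b + b = - (qbar c + a)" unfolding eq_neg_iff_add_eq_0 by simp
  then have "qbar b + b = 0"
    using pc(2) pi_closure_laurent(3) [OF pc(3)]
    by (intro pi_closure_laurent_disjoint [of "qbar b + b" "{0}" "{..<0}"]) auto
  moreover have "qbar b = b"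
  proof -
    have 0: "qbar (Piext f 0) = Piext f 0" if "f \<in> laurent_Z {0}" for f
      using that
    proof (induction rule: laurent_Z_induct)
      case (add f k n)
      then have "Piext (f + of_int k * qvar powi n) 0 = Piext f 0 + of_int k"
        by (simp add: of_int_Piext Piext_add)
      then show ?case using add by (simp add: qbar_add)
    qed (simp add: zero_piext_def [symmetric])
    have "pi0 b \<in> laurent_Z {0}" "pi1 b \<in> laurent_Z {0}"
      using b by (simp_all add: pi_closure_def)
    then have "qbar (Piext (pi0 b) 0 + ppi * Piext (pi1 b) 0) = Piext (pi0 b) 0 + ppi * Piext (pi1 b) 0"
      by (simp only: qbar_add qbar_mult qbar_ppi 0)
    then show ?thesis by (simp flip: piext_decompose)
  qed
  ultimately have "b + b = 0" by simp
  then have "pi0 b + pi0 b = 0" "pi1 b + pi1 b = 0"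
    unfolding piext_sel(1,2) [symmetric] by simp_all
  then have "b = 0" by (intro piext_eqI) simp_all
  with 1 h a show ?thesis by (intro bexI [of _ a]) (auto simp: add_eq_0_iff)
qed

lemma subring_A_pi:
  "0 \<in> A_pi" "1 \<in> A_pi" "x \<in> A_pi \<Longrightarrow> y \<in> A_pi \<Longrightarrow> x + y \<in> A_pi"
  "x \<in> A_pi \<Longrightarrow> - x \<in> A_pi" "x \<in> A_pi \<Longrightarrow> y \<in> A_pi \<Longrightarrow> x * y \<in> A_pi"
  using laurent_Z_monom [of 0 UNIV 1] laurent_Z_0
  by (auto simp: A_pi_def intro: pi_closure_laurent pi_closure_laurent_mult)
    (simp add: pi_closure_def)

lemma subring_Z_pi_qinv:
  "0 \<in> Z_pi_qinv" "1 \<in> Z_pi_qinv" "x \<in> Z_pi_qinv \<Longrightarrow> y \<in> Z_pi_qinv \<Longrightarrow> x + y \<in> Z_pi_qinv"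
  "x \<in> Z_pi_qinv \<Longrightarrow> - x \<in> Z_pi_qinv" "x \<in> Z_pi_qinv \<Longrightarrow> y \<in> Z_pi_qinv \<Longrightarrow> x * y \<in> Z_pi_qinv"
  using laurent_Z_monom [of 0 "{..0}" 1] laurent_Z_0
  by (auto simp: Z_pi_qinv_def intro: pi_closure_laurent pi_closure_laurent_mult)
    (simp add: pi_closure_def)

lemma qinv_Z_pi_qinv_simps:
  "0 \<in> qinv_Z_pi_qinv"
  "x \<in> qinv_Z_pi_qinv \<Longrightarrow> y \<in> qinv_Z_pi_qinv \<Longrightarrow> x + y \<in> qinv_Z_pi_qinv"
  "x \<in> qinv_Z_pi_qinv \<Longrightarrow> - x \<in> qinv_Z_pi_qinv"
  by (simp_all add: qinv_Z_pi_qinv_def pi_closure_laurent)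

lemma qinv_Z_pi_qinv_subset: "qinv_Z_pi_qinv \<subseteq> Z_pi_qinv" "Z_pi_qinv \<subseteq> A_pi"
proof -
  have "{..<0::int} \<subseteq> {..0}" by auto
  from laurent_Z_mono [OF this] laurent_Z_mono [OF subset_UNIV, of "{..0}"]
  show "qinv_Z_pi_qinv \<subseteq> Z_pi_qinv" "Z_pi_qinv \<subseteq> A_pi"
    unfolding qinv_Z_pi_qinv_def Z_pi_qinv_def A_pi_def by (auto simp: pi_closure_def)
qed

section \<open>The quantum covering group as a quotient of the free algebra\<close>

lemma ring_of_type_algebra_sel [simp]:
  "carrier ring_of_type_algebra = (UNIV :: 'a::ring_1 set)"
  "x \<otimes>\<^bsub>ring_of_type_algebra\<^esub> y = x * (y :: 'a)"
  "x \<oplus>\<^bsub>ring_of_type_algebra\<^esub> y = x + y"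
  "\<one>\<^bsub>ring_of_type_algebra\<^esub> = (1 :: 'a)" "\<zero>\<^bsub>ring_of_type_algebra\<^esub> = (0 :: 'a)"
  by (simp_all add: ring_of_type_algebra_def)

lemma ring_ring_of_type_algebra: "ring (ring_of_type_algebra :: 'a::ring_1 ring)"
proof -
  have "\<exists>y. y + x = 0" for x :: 'a by (rule exI [of _ "- x"]) simp
  then show ?thesis
    by (intro ringI abelian_groupI monoidI) (auto simp: algebra_simps)
qed

lemma ring_of_type_algebra_a_inv [simp]:
  "\<ominus>\<^bsub>ring_of_type_algebra\<^esub> x = - (x :: 'a::ring_1)"
proof -
  interpret ring "ring_of_type_algebra :: 'a ring" by (rule ring_ring_of_type_algebra)
  show ?thesis by (rule minus_equality) auto
qed

lemma ideal_U_ideal: "ideal (U_ideal D) ring_of_type_algebra"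
  unfolding U_ideal_def by (rule ring.genideal_ideal [OF ring_ring_of_type_algebra]) simp

lemma U_ideal_rels: "U_rels D \<subseteq> U_ideal D"
  unfolding U_ideal_def by (rule ring.genideal_self [OF ring_ring_of_type_algebra]) simp

lemma U_ideal_closed:
  "0 \<in> U_ideal D" "x \<in> U_ideal D \<Longrightarrow> y \<in> U_ideal D \<Longrightarrow> x + y \<in> U_ideal D"
  "x \<in> U_ideal D \<Longrightarrow> - x \<in> U_ideal D"
  "x \<in> U_ideal D \<Longrightarrow> a * x \<in> U_ideal D" "x \<in> U_ideal D \<Longrightarrow> x * a \<in> U_ideal D"
proof -
  interpret ideal "U_ideal D" ring_of_type_algebra by (rule ideal_U_ideal)
  show "0 \<in> U_ideal D" "x \<in> U_ideal D \<Longrightarrow> y \<in> U_ideal D \<Longrightarrow> x + y \<in> U_ideal D"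
    "x \<in> U_ideal D \<Longrightarrow> - x \<in> U_ideal D"
    "x \<in> U_ideal D \<Longrightarrow> a * x \<in> U_ideal D" "x \<in> U_ideal D \<Longrightarrow> x * a \<in> U_ideal D"
    using additive_subgroup.zero_closed [OF is_additive_subgroup]
      additive_subgroup.a_closed [OF is_additive_subgroup, of x y]
      I_l_closed [of x "- 1"] I_l_closed [of x a] I_r_closed [of x a]
    by simp_all
qed

lemma U_ideal_least:
  fixes D :: "('i, 'x, 'y::ab_group_add, 'z) root_datum_scheme"
  assumes "U_rels D \<subseteq> J" "0 \<in> J" "\<And>x y. x \<in> J \<Longrightarrow> y \<in> J \<Longrightarrow> x + y \<in> J"
    "\<And>x. x \<in> J \<Longrightarrow> - x \<in> J"
    "\<And>a x. x \<in> J \<Longrightarrow> a * x \<in> J" "\<And>a x. x \<in> J \<Longrightarrow> x * a \<in> J"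
  shows "U_ideal D \<subseteq> J"
proof -
  interpret R: ring "ring_of_type_algebra :: ('i, 'y) free_alg ring"
    by (rule ring_ring_of_type_algebra)
  have "ideal J ring_of_type_algebra"
  proof (rule idealI [OF R.ring_axioms])
    show "subgroup J (add_monoid ring_of_type_algebra)"
    proof (rule R.add.subgroupI)
      show "J \<noteq> {}" using assms(2) by blast
      show "\<ominus>\<^bsub>ring_of_type_algebra\<^esub> x \<in> J" if "x \<in> J" for x
        using assms(4) [OF that] by simp
    qed (use assms(3) in auto)
  qed (use assms in auto)
  then show ?thesis
    unfolding U_ideal_def by (intro R.genideal_minimal assms)
qed

lemma ring_U: "ring (U D)"
  unfolding U_def by (rule ideal.quotient_is_ring [OF ideal_U_ideal])

lemma U_class_hom: "ring_hom_ring ring_of_type_algebra (U D) (U_class D)"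
proof -
  have "U_class D = (+>\<^bsub>ring_of_type_algebra\<^esub>) (U_ideal D)" by (rule ext) (simp add: U_class_def)
  then show ?thesis unfolding U_def by (simp add: ideal.rcos_ring_hom_ring [OF ideal_U_ideal])
qed

lemma U_class_simps:
  "U_class D x \<in> carrier (U D)"
  "U_class D (x + y) = U_class D x \<oplus>\<^bsub>U D\<^esub> U_class D y"
  "U_class D (x * y) = U_class D x \<otimes>\<^bsub>U D\<^esub> U_class D y"
  "U_class D 0 = \<zero>\<^bsub>U D\<^esub>" "U_class D 1 = \<one>\<^bsub>U D\<^esub>"
  "U_class D (- x) = \<ominus>\<^bsub>U D\<^esub> U_class D x"
  "U_class D (x - y) = U_class D x \<ominus>\<^bsub>U D\<^esub> U_class D y"
proof -
  interpret ring_hom_ring ring_of_type_algebra "U D" "U_class D" by (rule U_class_hom)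
  show "U_class D x \<in> carrier (U D)" "U_class D (x + y) = U_class D x \<oplus>\<^bsub>U D\<^esub> U_class D y"
    "U_class D (x * y) = U_class D x \<otimes>\<^bsub>U D\<^esub> U_class D y"
    "U_class D 0 = \<zero>\<^bsub>U D\<^esub>" "U_class D 1 = \<one>\<^bsub>U D\<^esub>"
    "U_class D (- x) = \<ominus>\<^bsub>U D\<^esub> U_class D x"
    using hom_closed [of x] hom_add [of x y] hom_mult [of x y] hom_zero hom_one hom_a_inv [of x] by simp_all
  show "U_class D (x - y) = U_class D x \<ominus>\<^bsub>U D\<^esub> U_class D y"
    using hom_add [of x "- y"] hom_a_inv [of y] unfolding a_minus_def by simp
qed

lemma carrier_U: "carrier (U D) = range (U_class D)"
  unfolding U_def FactRing_def A_RCOSETS_def RCOSETS_def U_class_def a_r_coset_def by auto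

lemma U_class_eq_iff: "U_class D x = U_class D y \<longleftrightarrow> x - y \<in> U_ideal D"
proof -
  interpret ideal "U_ideal D" ring_of_type_algebra by (rule ideal_U_ideal)
  have "x \<in> U_ideal D +>\<^bsub>ring_of_type_algebra\<^esub> y \<longleftrightarrow> x - y \<in> U_ideal D"
    using a_rcos_module_minus [OF ring_ring_of_type_algebra, of y x]
    by (simp add: a_minus_def)
  moreover have "x \<in> U_ideal D +>\<^bsub>ring_of_type_algebra\<^esub> x" by (rule a_rcos_self) simp
  ultimately show ?thesis
    unfolding U_class_def using a_repr_independence' [of x y] by auto
qed

lemma U_class_sum:
  "finite A \<Longrightarrow> U_class D (sum f A) = (\<Oplus>\<^bsub>U D\<^esub>a\<in>A. U_class D (f a))"
proof (induction A rule: finite_induct)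
  interpret ring "U D" by (rule ring_U)
  case empty
  show ?case by (simp add: U_class_simps)
next
  interpret ring "U D" by (rule ring_U)
  case (insert a A)
  then show ?case by (simp add: U_class_simps)
qed

lemma U_class_mult_cong:
  "U_class D a = U_class D a' \<Longrightarrow> U_class D b = U_class D b' \<Longrightarrow> U_class D (a * b) = U_class D (a' * b')"
  by (simp add: U_class_simps)


subsection \<open>Spans of words\<close>

definition mon :: "('i, 'y) gen list \<Rightarrow> ('i, 'y) free_alg" where
  "mon gs = Poly_Mapping.single (Word gs) 1"

lemma mon_append: "mon (xs @ ys) = mon xs * mon ys"
  by (simp add: mon_def mult_single plus_free_monoid_def)

lemma mon_Nil [simp]: "mon [] = 1"
  by (simp add: mon_def zero_free_monoid_def [symmetric])

lemma mon_Cons: "mon (g # gs) = fa_gen g * mon gs"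
  using mon_append [of "[g]" gs] by (simp add: mon_def fa_gen_def)

lemma fa_const_simps:
  "fa_const 0 = 0" "fa_const 1 = 1" "fa_const (a + b) = fa_const a + fa_const b"
  "fa_const (a * b) = fa_const a * fa_const b" "fa_const (- a) = - fa_const a"
  by (simp_all add: fa_const_def single_add mult_single single_uminus)

lemma poly_mapping_expand: "p = (\<Sum>w\<in>Poly_Mapping.keys p. Poly_Mapping.single w (Poly_Mapping.lookup p w))"
proof (rule poly_mapping_eqI)
  fix v
  have "(\<Sum>w\<in>Poly_Mapping.keys p. Poly_Mapping.lookup (Poly_Mapping.single w (Poly_Mapping.lookup p w)) v) =
    (\<Sum>w\<in>Poly_Mapping.keys p. if w = v then Poly_Mapping.lookup p v else 0)"
    by (rule sum.cong) (auto simp: lookup_single)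
  then show "Poly_Mapping.lookup p v =
      Poly_Mapping.lookup (\<Sum>w\<in>Poly_Mapping.keys p. Poly_Mapping.single w (Poly_Mapping.lookup p w)) v"
    by (simp add: lookup_sum in_keys_iff)
qed

lemma single_Word: "Poly_Mapping.single (Word gs) c = fa_const c * mon gs"
  by (simp add: fa_const_def mon_def mult_single)

lemma fa_const_commute: "fa_const c * p = p * fa_const c"
proof -
  have 1: "fa_const c * Poly_Mapping.single w d = Poly_Mapping.single w d * fa_const c" for w d
    by (simp add: fa_const_def mult_single mult.commute)
  have "fa_const c * (\<Sum>w\<in>Poly_Mapping.keys p. Poly_Mapping.single w (Poly_Mapping.lookup p w)) =
      (\<Sum>w\<in>Poly_Mapping.keys p. Poly_Mapping.single w (Poly_Mapping.lookup p w)) * fa_const c"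
    unfolding sum_distrib_left sum_distrib_right by (intro sum.cong refl 1)
  then show ?thesis by (simp flip: poly_mapping_expand)
qed

lemma fa_const_left_commute: "p * (fa_const c * r) = fa_const c * (p * r)"
  by (simp only: mult.assoc [symmetric] fa_const_commute [of c p])

text \<open>The linear span of the words in \<open>L\<close>, encoded by the support so that closure
  properties reduce to statements about \<open>keys\<close>.\<close>

definition wsupp :: "('i, 'y) gen list set \<Rightarrow> ('i, 'y) free_alg set" where
  "wsupp L = {p. Poly_Mapping.keys p \<subseteq> Word ` L}"

lemma wsupp_expand:
  assumes "p \<in> wsupp L"
  obtains A c where "finite A" "A \<subseteq> L" "p = (\<Sum>gs\<in>A. fa_const (c gs) * mon gs)"
proof -
  define A where "A = {gs. Word gs \<in> Poly_Mapping.keys p}"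
  have inj: "inj_on Word A" by (auto simp: inj_on_def)
  have "w \<in> Word ` A" if "w \<in> Poly_Mapping.keys p" for w
    using that by (cases w) (auto simp: A_def)
  then have A: "Poly_Mapping.keys p = Word ` A" by (auto simp: A_def)
  have "finite A" using finite_keys [of p] unfolding A by (rule finite_imageD) (rule inj)
  moreover have "A \<subseteq> L" using assms unfolding A_def wsupp_def by auto
  moreover have "p = (\<Sum>gs\<in>A. fa_const (Poly_Mapping.lookup p (Word gs)) * mon gs)"
    using poly_mapping_expand [of p] unfolding A sum.reindex [OF inj] comp_def single_Word .
  ultimately show ?thesis by (rule that)
qed

lemma wsupp_simps [intro]:
  "0 \<in> wsupp L" "p \<in> wsupp L \<Longrightarrow> r \<in> wsupp L \<Longrightarrow> p + r \<in> wsupp L"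
  "p \<in> wsupp L \<Longrightarrow> - p \<in> wsupp L" "p \<in> wsupp L \<Longrightarrow> fa_const c * p \<in> wsupp L"
  "gs \<in> L \<Longrightarrow> mon gs \<in> wsupp L"
proof -
  show "0 \<in> wsupp L" by (simp add: wsupp_def)
  show "p \<in> wsupp L \<Longrightarrow> r \<in> wsupp L \<Longrightarrow> p + r \<in> wsupp L"
    unfolding wsupp_def using keys_add [of p r] by blast
  show "p \<in> wsupp L \<Longrightarrow> - p \<in> wsupp L"
    by (auto simp: wsupp_def in_keys_iff)
  have "Poly_Mapping.keys (fa_const c * p) \<subseteq> Poly_Mapping.keys p"
  proof
    fix v assume "v \<in> Poly_Mapping.keys (fa_const c * p)"
    then obtain a b where "v = a + b" "a \<in> Poly_Mapping.keys (fa_const c)" "b \<in> Poly_Mapping.keys p"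
      using keys_mult by blast
    then show "v \<in> Poly_Mapping.keys p" by (cases "c = 0") (auto simp: fa_const_def)
  qed
  then show "p \<in> wsupp L \<Longrightarrow> fa_const c * p \<in> wsupp L" unfolding wsupp_def by blast
  show "gs \<in> L \<Longrightarrow> mon gs \<in> wsupp L" by (auto simp: wsupp_def mon_def)
qed

lemma wsupp_diff: "p \<in> wsupp L \<Longrightarrow> r \<in> wsupp L \<Longrightarrow> p - r \<in> wsupp L"
  using wsupp_simps(2) [of p L "- r"] wsupp_simps(3) [of r L] by simp

lemma wsupp_sum: "(\<And>a. a \<in> A \<Longrightarrow> f a \<in> wsupp L) \<Longrightarrow> sum f A \<in> wsupp L"
  by (induction A rule: infinite_finite_induct) auto

lemma wsupp_mono: "L \<subseteq> L' \<Longrightarrow> wsupp L \<subseteq> wsupp L'"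
  unfolding wsupp_def by blast

lemma wsupp_gen: "[g] \<in> L \<Longrightarrow> fa_gen g \<in> wsupp L"
  by (auto simp: wsupp_def fa_gen_def)

lemma wsupp_const: "[] \<in> L \<Longrightarrow> fa_const c \<in> wsupp L"
  using wsupp_simps(4) [OF wsupp_simps(5), of "[]" L c] by simp

lemma wsupp_mult:
  assumes "p \<in> wsupp L" "r \<in> wsupp L'" "\<And>xs ys. xs \<in> L \<Longrightarrow> ys \<in> L' \<Longrightarrow> xs @ ys \<in> L''"
  shows "p * r \<in> wsupp L''"
proof -
  have "v + w \<in> Word ` L''" if "v \<in> Poly_Mapping.keys p" "w \<in> Poly_Mapping.keys r" for v w
  proof -
    obtain xs ys where "v = Word xs" "xs \<in> L" "w = Word ys" "ys \<in> L'"
      using assms(1,2) \<open>v \<in> _\<close> \<open>w \<in> _\<close> unfolding wsupp_def by blast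
    then show ?thesis using assms(3) by (auto simp: plus_free_monoid_def)
  qed
  then show ?thesis using keys_mult [of p r] unfolding wsupp_def by blast
qed

lemma wsupp_UNIV: "p \<in> wsupp UNIV"
proof -
  have "w \<in> range Word" for w by (cases w) auto
  then show ?thesis by (auto simp: wsupp_def)
qed

text \<open>The preimage in the free algebra of the span of the classes of words in
  \<open>L\<close>. Membership may be tested on any representative (\<open>mspan_cong\<close>),
  which permits rewriting by the defining relations without leaving the free algebra.\<close>

definition mspan ::
  "('i, 'x, 'y::ab_group_add, 'z) root_datum_scheme \<Rightarrow> ('i, 'y) gen list set \<Rightarrow> ('i, 'y) free_alg set" where
  "mspan D L = {p. U_class D p \<in> U_class D ` wsupp L}"

lemma mspan_iff: "p \<in> mspan D L \<longleftrightarrow> (\<exists>p'\<in>wsupp L. U_class D p = U_class D p')"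
  by (auto simp: mspan_def)

lemma mspan_cong: "U_class D p = U_class D p' \<Longrightarrow> p \<in> mspan D L \<longleftrightarrow> p' \<in> mspan D L"
  by (simp add: mspan_def)

lemma wsupp_mspan: "p \<in> wsupp L \<Longrightarrow> p \<in> mspan D L"
  by (auto simp: mspan_def)

lemma mspan_simps:
  "0 \<in> mspan D L" "p \<in> mspan D L \<Longrightarrow> r \<in> mspan D L \<Longrightarrow> p + r \<in> mspan D L"
  "p \<in> mspan D L \<Longrightarrow> - p \<in> mspan D L" "p \<in> mspan D L \<Longrightarrow> fa_const c * p \<in> mspan D L"
  "gs \<in> L \<Longrightarrow> mon gs \<in> mspan D L"
proof -
  show "p \<in> mspan D L \<Longrightarrow> r \<in> mspan D L \<Longrightarrow> p + r \<in> mspan D L"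
    unfolding mspan_iff by (metis U_class_simps(2) wsupp_simps(2))
  show "p \<in> mspan D L \<Longrightarrow> - p \<in> mspan D L"
    unfolding mspan_iff by (metis U_class_simps(6) wsupp_simps(3))
  show "p \<in> mspan D L \<Longrightarrow> fa_const c * p \<in> mspan D L"
    unfolding mspan_iff by (metis U_class_simps(3) wsupp_simps(4))
qed (auto intro: wsupp_mspan)

lemma mspan_sum: "(\<And>a. a \<in> A \<Longrightarrow> f a \<in> mspan D L) \<Longrightarrow> sum f A \<in> mspan D L"
  by (induction A rule: infinite_finite_induct) (auto intro: mspan_simps)

lemma mspan_mono: "L \<subseteq> L' \<Longrightarrow> mspan D L \<subseteq> mspan D L'"
  unfolding mspan_def using wsupp_mono by blast

lemma mspan_mult_left:
  assumes "p \<in> mspan D L" "\<And>gs. gs \<in> L \<Longrightarrow> a * mon gs \<in> mspan D L'"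
  shows "a * p \<in> mspan D L'"
proof -
  obtain p' where p': "p' \<in> wsupp L" "U_class D p = U_class D p'"
    using assms(1) unfolding mspan_iff by blast
  obtain A c where "finite A" "A \<subseteq> L" "p' = (\<Sum>gs\<in>A. fa_const (c gs) * mon gs)"
    using wsupp_expand [OF p'(1)] .
  then have "a * p' \<in> mspan D L'"
    using assms(2) by (auto simp: sum_distrib_left fa_const_left_commute intro!: mspan_sum mspan_simps)
  moreover have "U_class D (a * p) = U_class D (a * p')" using p' by (simp add: U_class_simps)
  ultimately show ?thesis using mspan_cong by blast
qed

lemma mspan_mult_right:
  assumes "p \<in> mspan D L" "\<And>gs. gs \<in> L \<Longrightarrow> mon gs * a \<in> mspan D L'"
  shows "p * a \<in> mspan D L'"
proof -
  obtain p' where p': "p' \<in> wsupp L" "U_class D p = U_class D p'"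
    using assms(1) unfolding mspan_iff by blast
  obtain A c where "finite A" "A \<subseteq> L" "p' = (\<Sum>gs\<in>A. fa_const (c gs) * mon gs)"
    using wsupp_expand [OF p'(1)] .
  then have "p' * a \<in> mspan D L'"
    using assms(2) by (auto simp: sum_distrib_right mult.assoc intro!: mspan_sum mspan_simps)
  moreover have "U_class D (p * a) = U_class D (p' * a)" using p' by (simp add: U_class_simps)
  ultimately show ?thesis using mspan_cong by blast
qed


subsection \<open>Commutation relations\<close>

definition torus_words :: "('i, 'y) gen list set" where
  "torus_words = lists (range GenK \<union> range GenJ)"

definition nil_words :: "('i, 'y) gen list set" where
  "nil_words = lists (range GenE \<union> range GenF)"

definition F_words :: "('i, 'y) gen list set" where "F_words = lists (range GenF)"
definition E_words :: "('i, 'y) gen list set" where "E_words = lists (range GenE)"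

lemma E_words_map: "E_words = range (map GenE)"
  by (auto simp: E_words_def lists_image)

lemma U_rel_eq: "x - y \<in> U_rels D \<Longrightarrow> U_class D x = U_class D y"
  using U_ideal_rels by (auto simp: U_class_eq_iff)

lemma U_rel_KJ:
  "U_class D (fa_gen (GenK \<mu>) * fa_gen (GenE i)) =
     U_class D (fa_const (qq powi pairing D \<mu> (xroot D i)) * (fa_gen (GenE i) * fa_gen (GenK \<mu>)))"
  "U_class D (fa_gen (GenJ \<mu>) * fa_gen (GenE i)) =
     U_class D (fa_const (ppi powi pairing D \<mu> (xroot D i)) * (fa_gen (GenE i) * fa_gen (GenJ \<mu>)))"
  "U_class D (fa_gen (GenK \<mu>) * fa_gen (GenF i)) =
     U_class D (fa_const (qq powi - pairing D \<mu> (xroot D i)) * (fa_gen (GenF i) * fa_gen (GenK \<mu>)))"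
  "U_class D (fa_gen (GenJ \<mu>) * fa_gen (GenF i)) =
     U_class D (fa_const (ppi powi - pairing D \<mu> (xroot D i)) * (fa_gen (GenF i) * fa_gen (GenJ \<mu>)))"
  unfolding mult.assoc [symmetric]
  by (rule U_rel_eq, unfold U_rels_def Let_def, blast)+

lemma U_rel_torus:
  "U_class D (fa_gen (GenK 0)) = U_class D 1"
  "U_class D (fa_gen (GenK (\<mu> + \<nu>))) = U_class D (fa_gen (GenK \<mu>) * fa_gen (GenK \<nu>))"
  "U_class D (fa_gen (GenJ (\<mu> + \<mu>))) = U_class D 1"
  "U_class D (fa_gen (GenJ (\<mu> + \<nu>))) = U_class D (fa_gen (GenJ \<mu>) * fa_gen (GenJ \<nu>))"
  "U_class D (fa_gen (GenJ \<mu>) * fa_gen (GenK \<nu>)) = U_class D (fa_gen (GenK \<nu>) * fa_gen (GenJ \<mu>))"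
proof -
  show "U_class D (fa_gen (GenK 0)) = U_class D 1"
    by (rule U_rel_eq) (unfold U_rels_def Let_def, fast)
  show "U_class D (fa_gen (GenK (\<mu> + \<nu>))) = U_class D (fa_gen (GenK \<mu>) * fa_gen (GenK \<nu>))"
    by (rule U_rel_eq) (unfold U_rels_def Let_def, fast)
  show "U_class D (fa_gen (GenJ (\<mu> + \<mu>))) = U_class D 1"
    by (rule U_rel_eq) (unfold U_rels_def Let_def, fast)
  show "U_class D (fa_gen (GenJ (\<mu> + \<nu>))) = U_class D (fa_gen (GenJ \<mu>) * fa_gen (GenJ \<nu>))"
    by (rule U_rel_eq) (unfold U_rels_def Let_def, fast)
  show "U_class D (fa_gen (GenJ \<mu>) * fa_gen (GenK \<nu>)) = U_class D (fa_gen (GenK \<nu>) * fa_gen (GenJ \<mu>))"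
    by (rule U_rel_eq) (unfold U_rels_def Let_def, fast)
qed

text \<open>The form of the relation used for sorting words: exchanging an \<open>E\<close> and an
  \<open>F\<close> costs a scalar and adds a torus element, by which both letters are
  consumed.\<close>

lemma U_rel_EF:
  fixes D :: "('i, 'x, 'y::ab_group_add, 'z) root_datum_scheme"
  obtains c z where "z \<in> wsupp torus_words" "U_class D (fa_gen (GenE i) * fa_gen (GenF j)) =
     U_class D (fa_const c * (fa_gen (GenF j) * fa_gen (GenE i)) + z)"
proof -
  define z :: "('i, 'y) free_alg" where "z = (if i = j
           then fa_const (1 / (pi_i D i * q_i D i - inverse (q_i D i)))
                * (fa_gen (GenJ (int_mult (int (dd D i)) (yroot D i))) * fa_gen (GenK (int_mult (int (dd D i)) (yroot D i)))
                   - fa_gen (GenK (- int_mult (int (dd D i)) (yroot D i))))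
           else 0)"
  have "fa_gen (GenE i) * fa_gen (GenF j) - (fa_const (ppi ^ (par D i * par D j)) * (fa_gen (GenF j) * fa_gen (GenE i)) + z)
      \<in> U_rels D"
    unfolding z_def U_rels_def Let_def mult.assoc [symmetric] diff_diff_eq [symmetric] by blast
  moreover have "z \<in> wsupp torus_words"
    unfolding z_def
    by (auto intro!: wsupp_diff wsupp_gen wsupp_simps wsupp_mult [of _ torus_words _ torus_words]
        simp: torus_words_def)
  ultimately show ?thesis by (intro that [OF _ U_rel_eq])
qed

lemma torus_nil_commute1:
  assumes "g \<in> range GenK \<union> range GenJ" "h \<in> range GenE \<union> range GenF"
  shows "\<exists>c. U_class D (fa_gen g * fa_gen h) = U_class D (fa_const c * (fa_gen h * fa_gen g))"
    "\<exists>c. U_class D (fa_gen h * fa_gen g) = U_class D (fa_const c * (fa_gen g * fa_gen h))"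
proof -
  \<comment> \<open>The scalar is a power of \<open>q\<close> or \<open>\<pi>\<close>, hence a unit;
    inverting it gives the exchange in the opposite direction.\<close>
  have 1: "\<exists>c. c dvd 1 \<and> U_class D (fa_gen g * fa_gen h) = U_class D (fa_const c * (fa_gen h * fa_gen g))"
  proof -
    have u: "qq powi n dvd 1" "ppi powi n dvd 1" for n
      by (metis dvd_triv_left qq_powi_minus) (simp add: ppi_powi_parity ppi_dvd_1)
    show ?thesis using assms
      by (elim UnE rangeE; hypsubst) (rule exI, rule conjI [rotated], rule U_rel_KJ, rule u)+
  qed
  then show "\<exists>c. U_class D (fa_gen g * fa_gen h) = U_class D (fa_const c * (fa_gen h * fa_gen g))" by blast
  from 1 obtain c where c: "c dvd 1" "U_class D (fa_gen g * fa_gen h) = U_class D (fa_const c * (fa_gen h * fa_gen g))"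
    by blast
  have "U_class D (fa_const (inverse c) * (fa_gen g * fa_gen h)) =
      U_class D (fa_const (inverse c) * (fa_const c * (fa_gen h * fa_gen g)))"
    using c(2) by (simp only: U_class_simps)
  also have "fa_const (inverse c) * (fa_const c * (fa_gen h * fa_gen g)) = fa_gen h * fa_gen g"
    using piext_mult_inverse [OF c(1)]
    by (simp add: mult.commute fa_const_simps flip: mult.assoc fa_const_simps(4))
  finally show "\<exists>c. U_class D (fa_gen h * fa_gen g) = U_class D (fa_const c * (fa_gen g * fa_gen h))" by metis
qed

lemma commute_words:
  assumes "\<And>g h. g \<in> set gs \<Longrightarrow> h \<in> set hs \<Longrightarrow>
    \<exists>c. U_class D (fa_gen g * fa_gen h) = U_class D (fa_const c * (fa_gen h * fa_gen g))"
  shows "\<exists>c. U_class D (mon gs * mon hs) = U_class D (fa_const c * (mon hs * mon gs))"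
proof -
  have 1: "\<exists>c. U_class D (fa_gen g * mon hs) = U_class D (fa_const c * (mon hs * fa_gen g))"
    if "\<And>h. h \<in> set hs \<Longrightarrow>
      \<exists>c. U_class D (fa_gen g * fa_gen h) = U_class D (fa_const c * (fa_gen h * fa_gen g))" for g hs
    using that
  proof (induction hs)
    case Nil
    show ?case by (rule exI [of _ 1]) (simp add: fa_const_simps)
  next
    case (Cons h hs)
    then obtain c where c: "U_class D (fa_gen g * mon hs) = U_class D (fa_const c * (mon hs * fa_gen g))"
      by auto
    obtain d where d: "U_class D (fa_gen g * fa_gen h) = U_class D (fa_const d * (fa_gen h * fa_gen g))"
      using Cons.prems [of h] by auto
    have "U_class D (fa_gen g * mon (h # hs)) = U_class D ((fa_gen g * fa_gen h) * mon hs)"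
      by (simp add: mon_Cons mult.assoc)
    also have "\<dots> = U_class D (fa_const d * (fa_gen h * fa_gen g) * mon hs)"
      using d by (simp only: U_class_simps)
    also have "\<dots> = U_class D (fa_const d * fa_gen h * (fa_gen g * mon hs))" by (simp add: mult.assoc)
    also have "\<dots> = U_class D (fa_const d * fa_gen h * (fa_const c * (mon hs * fa_gen g)))"
      using c by (simp only: U_class_simps)
    also have "fa_const d * fa_gen h * (fa_const c * (mon hs * fa_gen g)) =
        fa_const (d * c) * (mon (h # hs) * fa_gen g)"
      by (simp add: mon_Cons mult.assoc fa_const_left_commute [of "fa_gen h"] fa_const_simps)
    finally show ?case by blast
  qed
  show ?thesis using assms
  proof (induction gs)
    case Nil
    show ?case by (rule exI [of _ 1]) (simp add: fa_const_simps)
  next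
    case (Cons g gs)
    then obtain c where c: "U_class D (mon gs * mon hs) = U_class D (fa_const c * (mon hs * mon gs))"
      by auto
    obtain d where d: "U_class D (fa_gen g * mon hs) = U_class D (fa_const d * (mon hs * fa_gen g))"
      using 1 [of hs g] Cons.prems by auto
    have "U_class D (mon (g # gs) * mon hs) = U_class D (fa_gen g * (mon gs * mon hs))"
      by (simp add: mon_Cons mult.assoc)
    also have "\<dots> = U_class D (fa_gen g * (fa_const c * (mon hs * mon gs)))"
      using c by (simp only: U_class_simps)
    also have "fa_gen g * (fa_const c * (mon hs * mon gs)) = fa_const c * ((fa_gen g * mon hs) * mon gs)"
      by (simp add: fa_const_left_commute mult.assoc)
    also have "U_class D \<dots> = U_class D (fa_const c * (fa_const d * (mon hs * fa_gen g) * mon gs))"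
      using d by (simp only: U_class_simps)
    also have "fa_const c * (fa_const d * (mon hs * fa_gen g) * mon gs) = fa_const (c * d) * (mon hs * mon (g # gs))"
      by (simp add: mon_Cons mult.assoc fa_const_simps)
    finally show ?case by blast
  qed
qed

lemma torus_nil_commute:
  assumes "zs \<in> torus_words" "hs \<in> nil_words"
  shows "\<exists>c. U_class D (mon zs * mon hs) = U_class D (fa_const c * (mon hs * mon zs))"
    "\<exists>c. U_class D (mon hs * mon zs) = U_class D (fa_const c * (mon zs * mon hs))"
proof -
  have "g \<in> range GenK \<union> range GenJ" "h \<in> range GenE \<union> range GenF" if "g \<in> set zs" "h \<in> set hs" for g h
    using assms that unfolding torus_words_def nil_words_def in_lists_conv_set by blast+
  note * = torus_nil_commute1 [OF this]
  show "\<exists>c. U_class D (mon zs * mon hs) = U_class D (fa_const c * (mon hs * mon zs))"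
    by (rule commute_words) (rule *(1))
  show "\<exists>c. U_class D (mon hs * mon zs) = U_class D (fa_const c * (mon zs * mon hs))"
    by (rule commute_words) (rule *(2))
qed


subsection \<open>The neighbourhoods of zero in the completion\<close>

text \<open>Words sorted as in the triangular decomposition, with at least \<open>N\<close> letters
  \<open>E\<close> at the end. Their classes span the neighbourhood \<open>hat_nbhd D N\<close>
  (\<open>hat_nbhd_words\<close>).\<close>

definition tri_words :: "nat \<Rightarrow> ('i, 'y) gen list set" where
  "tri_words N = {fs @ zs @ es | fs zs es. fs \<in> F_words \<and> zs \<in> torus_words \<and> es \<in> E_words \<and> N \<le> length es}"

lemma tri_words_mono: "N \<le> N' \<Longrightarrow> tri_words N' \<subseteq> tri_words N"
  unfolding tri_words_def by auto (metis le_trans)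

lemma F_words_nil: "fs \<in> F_words \<Longrightarrow> fs \<in> nil_words"
  by (auto simp: F_words_def nil_words_def)

lemma E_words_nil: "fs \<in> E_words \<Longrightarrow> fs \<in> nil_words"
  by (auto simp: E_words_def nil_words_def)

lemma mspan_commute:
  assumes "U_class D (mon xs * mon ys) = U_class D (fa_const c * (mon ys * mon xs))"
    "us @ ys @ xs @ ws \<in> L"
  shows "mon us * (mon xs * mon ys) * mon ws \<in> mspan D L"
proof -
  have "U_class D (mon us * (mon xs * mon ys) * mon ws) = U_class D (mon us * (fa_const c * (mon ys * mon xs)) * mon ws)"
    using assms(1) by (simp only: U_class_simps)
  also have "mon us * (fa_const c * (mon ys * mon xs)) * mon ws = fa_const c * mon (us @ ys @ xs @ ws)"
    by (simp add: mon_append fa_const_left_commute mult.assoc)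
  finally show ?thesis using assms(2) mspan_cong mspan_simps(4,5) by blast
qed

text \<open>The letter \<open>E\<close> travels to the right through the \<open>F\<close>'s. It
  either arrives at the end or is consumed by one of them, and the torus element left behind then
  commutes to the end up to a scalar.\<close>

lemma E_F_word:
  fixes D :: "('i, 'x, 'y::ab_group_add, 'z) root_datum_scheme"
  assumes "fs \<in> F_words"
  shows "fa_gen (GenE i) * mon fs \<in> mspan D ({fs @ [GenE i] | fs. fs \<in> F_words} \<union>
    {fs @ zs | fs zs. fs \<in> F_words \<and> zs \<in> torus_words})" (is "_ \<in> mspan D ?L")
  using assms
proof (induction fs)
  case Nil
  have "[GenE i] \<in> ?L" by (auto simp: F_words_def)
  then have "mon [GenE i] \<in> mspan D ?L" by (rule mspan_simps)
  then show ?case by (simp add: mon_Cons)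
next
  case (Cons f fs)
  then obtain j where f: "f = GenF j" and fs: "fs \<in> F_words" by (auto simp: F_words_def)
  obtain c z where z: "z \<in> wsupp torus_words" and ef: "U_class D (fa_gen (GenE i) * fa_gen (GenF j)) =
     U_class D (fa_const c * (fa_gen (GenF j) * fa_gen (GenE i)) + z)"
    by (rule U_rel_EF)
  have "U_class D (fa_gen (GenE i) * mon (f # fs)) = U_class D ((fa_gen (GenE i) * fa_gen (GenF j)) * mon fs)"
    by (simp add: f mon_Cons mult.assoc)
  also have "\<dots> = U_class D ((fa_const c * (fa_gen (GenF j) * fa_gen (GenE i)) + z) * mon fs)"
    using ef by (simp only: U_class_simps)
  also have "(fa_const c * (fa_gen (GenF j) * fa_gen (GenE i)) + z) * mon fs =
      fa_const c * (fa_gen (GenF j) * (fa_gen (GenE i) * mon fs)) + z * mon fs"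
    by (simp add: algebra_simps)
  finally have eq: "U_class D (fa_gen (GenE i) * mon (f # fs)) =
    U_class D (fa_const c * (fa_gen (GenF j) * (fa_gen (GenE i) * mon fs)) + z * mon fs)" .
  have "fa_gen (GenF j) * (fa_gen (GenE i) * mon fs) \<in> mspan D ?L"
  proof (rule mspan_mult_left [OF Cons.IH [OF fs]])
    fix gs assume "gs \<in> ?L"
    moreover have "GenF j # hs \<in> F_words" if "hs \<in> F_words" for hs
      using that by (auto simp: F_words_def)
    ultimately have "GenF j # gs \<in> ?L" by (auto simp flip: append_Cons) blast+
    then show "fa_gen (GenF j) * mon gs \<in> mspan D ?L" unfolding mon_Cons [symmetric] by (rule mspan_simps)
  qed
  moreover have "z * mon fs \<in> mspan D ?L"
  proof (rule mspan_mult_right [OF wsupp_mspan [OF z]])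
    fix zs :: "('i, 'y) gen list" assume zs: "zs \<in> torus_words"
    obtain c where "U_class D (mon zs * mon fs) = U_class D (fa_const c * (mon fs * mon zs))"
      using torus_nil_commute(1) [where D = D, OF zs F_words_nil [OF fs]] ..
    then show "mon zs * mon fs \<in> mspan D ?L"
      using mspan_commute [of D zs fs c "[]" "[]" ?L] zs fs by auto
  qed
  ultimately show ?case unfolding mspan_cong [OF eq] by (intro mspan_simps)
qed

text \<open>The letter \<open>F\<close> travels to the left through the \<open>E\<close>'s. If it is
  consumed, exactly one \<open>E\<close> disappears with it; this is the reason for
  \<open>Suc (length es)\<close> in the second set.\<close>

lemma E_word_F:
  fixes D :: "('i, 'x, 'y::ab_group_add, 'z) root_datum_scheme"
  assumes "es \<in> E_words" "N \<le> length es"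
  shows "mon es * fa_gen (GenF i) \<in> mspan D ({GenF i # es | es. es \<in> E_words \<and> N \<le> length es} \<union>
    {zs @ es | zs es. zs \<in> torus_words \<and> es \<in> E_words \<and> N \<le> Suc (length es)})"
  using assms
proof (induction es arbitrary: N)
  case Nil
  have "mon [GenF i] \<in> mspan D ({GenF i # es | es. es \<in> E_words \<and> N \<le> length es} \<union>
    {zs @ es | zs es. zs \<in> torus_words \<and> es \<in> E_words \<and> N \<le> Suc (length es)})"
    using Nil by (intro mspan_simps) auto
  then show ?case by (simp add: mon_Cons)
next
  case (Cons e es)
  let ?L = "\<lambda>N. {GenF i # es | es. es \<in> E_words \<and> N \<le> length es} \<union>
    {zs @ es | zs es. zs \<in> torus_words \<and> es \<in> E_words \<and> N \<le> Suc (length es)}"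
  from Cons obtain j where e: "e = GenE j" and es: "es \<in> E_words" by (auto simp: E_words_def)
  have Cons_E: "GenE j # hs \<in> E_words" if "hs \<in> E_words" for hs
    using that by (auto simp: E_words_def)
  obtain c z where z: "z \<in> wsupp torus_words" and ef: "U_class D (fa_gen (GenE j) * fa_gen (GenF i)) =
     U_class D (fa_const c * (fa_gen (GenF i) * fa_gen (GenE j)) + z)"
    by (rule U_rel_EF)
  have 1: "fa_gen (GenE j) * (mon es * fa_gen (GenF i)) \<in> mspan D (?L N)"
  \<comment> \<open>The bound is lowered to \<open>N - 1\<close> for the remaining word because the
    letter \<open>GenE j\<close> multiplied from the left supplies one more \<open>E\<close>, or is
    itself the one that is lost.\<close>
  proof (rule mspan_mult_left [OF Cons.IH [OF es, of "N - 1"]])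
    show "N - 1 \<le> length es" using Cons.prems by simp
    fix gs :: "('i, 'y) gen list" assume "gs \<in> ?L (N - 1)"
    then consider hs where "gs = GenF i # hs" "hs \<in> E_words" "N - 1 \<le> length hs"
      | zs hs where "gs = zs @ hs" "zs \<in> torus_words" "hs \<in> E_words" "N - 1 \<le> Suc (length hs)" by blast
    then show "fa_gen (GenE j) * mon gs \<in> mspan D (?L N)"
    proof cases
      case 1
      have "U_class D (fa_gen (GenE j) * mon gs) = U_class D ((fa_gen (GenE j) * fa_gen (GenF i)) * mon hs)"
        by (simp add: 1 mon_Cons mult.assoc)
      also have "\<dots> = U_class D ((fa_const c * (fa_gen (GenF i) * fa_gen (GenE j)) + z) * mon hs)"
        using ef by (simp only: U_class_simps)
      also have "(fa_const c * (fa_gen (GenF i) * fa_gen (GenE j)) + z) * mon hs =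
          fa_const c * mon (GenF i # GenE j # hs) + z * mon hs"
        by (simp add: mon_Cons algebra_simps)
      finally have eq: "U_class D (fa_gen (GenE j) * mon gs) =
          U_class D (fa_const c * mon (GenF i # GenE j # hs) + z * mon hs)" .
      have "GenF i # GenE j # hs \<in> ?L N" using 1 Cons_E [of hs] by auto
      moreover have "z * mon hs \<in> mspan D (?L N)"
      proof (rule mspan_mult_right [OF wsupp_mspan [OF z]])
        fix zs :: "('i, 'y) gen list" assume "zs \<in> torus_words"
        then have "zs @ hs \<in> ?L N"
          using 1 by (intro UnI2 CollectI exI [of _ zs] exI [of _ hs]) auto
        then show "mon zs * mon hs \<in> mspan D (?L N)" unfolding mon_append [symmetric] by (rule mspan_simps)
      qed
      ultimately show ?thesis unfolding mspan_cong [OF eq] by (intro mspan_simps)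
    next
      case 2
      have n: "[GenE j] \<in> nil_words" by (auto simp: nil_words_def)
      obtain c where "U_class D (mon [GenE j] * mon zs) = U_class D (fa_const c * (mon zs * mon [GenE j]))"
        using torus_nil_commute(2) [where D = D, OF 2(2) n] ..
      moreover have "zs @ [GenE j] @ hs \<in> ?L N" using 2 Cons_E [of hs] by force
      ultimately have "mon [GenE j] * mon zs * mon hs \<in> mspan D (?L N)"
        using mspan_commute [of D "[GenE j]" zs c "[]" hs "?L N"] by simp
      then show ?thesis using 2 by (simp add: mon_Cons mon_append mult.assoc)
    qed
  qed
  then show ?case by (simp add: e mon_Cons mult.assoc)
qed

text \<open>A letter coming from the left is absorbed by the \<open>F\<close> part or the torus
  part, or it is an \<open>E\<close> that joins the final \<open>E\<close> part; the
  \<open>E\<close>'s already present are never touched. Hence the neighbourhoods are left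
  ideals.\<close>

lemma tri_left_gen:
  fixes D :: "('i, 'x, 'y::ab_group_add, 'z) root_datum_scheme"
  assumes "p \<in> mspan D (tri_words N)"
  shows "fa_gen g * p \<in> mspan D (tri_words N)"
proof (rule mspan_mult_left [OF assms])
  fix gs :: "('i, 'y) gen list" assume "gs \<in> tri_words N"
  then obtain fs zs es where gs: "gs = fs @ zs @ es" and fs: "fs \<in> F_words" and zs: "zs \<in> torus_words"
    and es: "es \<in> E_words" "N \<le> length es" unfolding tri_words_def by blast
  show "fa_gen g * mon gs \<in> mspan D (tri_words N)"
  proof (cases g)
    case (GenF i)
    then have "g # fs \<in> F_words" using fs by (simp add: F_words_def)
    then have "(g # fs) @ zs @ es \<in> tri_words N" using zs es unfolding tri_words_def by blast
    then show ?thesis unfolding mon_Cons [symmetric] gs by (intro mspan_simps) simp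
  next
    case (GenE i)
    have "fa_gen g * mon fs * mon (zs @ es) \<in> mspan D (tri_words N)"
    proof (rule mspan_mult_right)
      show "fa_gen g * mon fs \<in> mspan D ({fs @ [GenE i] | fs. fs \<in> F_words} \<union>
          {fs @ zs | fs zs. fs \<in> F_words \<and> zs \<in> torus_words})" (is "_ \<in> mspan D ?L")
        unfolding GenE by (rule E_F_word [OF fs])
      fix hs assume "hs \<in> ?L"
      then consider fs' where "hs = fs' @ [GenE i]" "fs' \<in> F_words"
        | fs' zs' where "hs = fs' @ zs'" "fs' \<in> F_words" "zs' \<in> torus_words" by blast
      then show "mon hs * mon (zs @ es) \<in> mspan D (tri_words N)"
      proof cases
        case 1
        have n: "[GenE i] \<in> nil_words" by (auto simp: nil_words_def)
        obtain c where "U_class D (mon [GenE i] * mon zs) = U_class D (fa_const c * (mon zs * mon [GenE i]))"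
          using torus_nil_commute(2) [where D = D, OF zs n] ..
        moreover have "[GenE i] @ es \<in> E_words" "N \<le> length ([GenE i] @ es)"
          using es by (auto simp: E_words_def)
        then have "fs' @ zs @ [GenE i] @ es \<in> tri_words N" using 1 zs unfolding tri_words_def by blast
        ultimately have "mon fs' * (mon [GenE i] * mon zs) * mon es \<in> mspan D (tri_words N)"
          by (rule mspan_commute)
        then show ?thesis using 1 by (simp add: mon_append mult.assoc)
      next
        case 2
        then have "zs' @ zs \<in> torus_words" using zs by (simp add: torus_words_def)
        then have "fs' @ (zs' @ zs) @ es \<in> tri_words N" using 2 es unfolding tri_words_def by blast
        then show ?thesis unfolding 2(1) mon_append [symmetric] by (intro mspan_simps) simp
      qed
    qed
    then show ?thesis by (simp add: gs mon_append mult.assoc)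
  next
    case (GenK \<mu>)
    then have g: "[g] \<in> torus_words" by (simp add: torus_words_def)
    obtain c where "U_class D (mon [g] * mon fs) = U_class D (fa_const c * (mon fs * mon [g]))"
      using torus_nil_commute(1) [where D = D, OF g F_words_nil [OF fs]] ..
    moreover have "[g] @ zs \<in> torus_words" using g zs by (simp add: torus_words_def)
    then have "fs @ ([g] @ zs) @ es \<in> tri_words N" using fs es unfolding tri_words_def by blast
    then have "[] @ fs @ [g] @ zs @ es \<in> tri_words N" by simp
    ultimately have "mon [] * (mon [g] * mon fs) * mon (zs @ es) \<in> mspan D (tri_words N)"
      by (rule mspan_commute)
    then show ?thesis by (simp add: gs mon_append mon_Cons mult.assoc)
  next
    case (GenJ \<mu>)
    then have g: "[g] \<in> torus_words" by (simp add: torus_words_def)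
    obtain c where "U_class D (mon [g] * mon fs) = U_class D (fa_const c * (mon fs * mon [g]))"
      using torus_nil_commute(1) [where D = D, OF g F_words_nil [OF fs]] ..
    moreover have "[g] @ zs \<in> torus_words" using g zs by (simp add: torus_words_def)
    then have "fs @ ([g] @ zs) @ es \<in> tri_words N" using fs es unfolding tri_words_def by blast
    then have "[] @ fs @ [g] @ zs @ es \<in> tri_words N" by simp
    ultimately have "mon [] * (mon [g] * mon fs) * mon (zs @ es) \<in> mspan D (tri_words N)"
      by (rule mspan_commute)
    then show ?thesis by (simp add: gs mon_append mon_Cons mult.assoc)
  qed
qed

lemma tri_left:
  assumes "p \<in> mspan D (tri_words N)"
  shows "a * p \<in> mspan D (tri_words N)"
proof -
  have 1: "mon gs * p \<in> mspan D (tri_words N)" for gs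
    by (induction gs) (use assms tri_left_gen in \<open>auto simp: mon_Cons mult.assoc\<close>)
  obtain A c where "finite A" "a = (\<Sum>gs\<in>A. fa_const (c gs) * mon gs)"
    by (rule wsupp_expand [OF wsupp_UNIV [of a]])
  then show ?thesis
    using 1 by (auto simp: sum_distrib_right mult.assoc intro!: mspan_sum mspan_simps)
qed

text \<open>Words in the \<open>E\<close>'s only lengthen the last part, whatever the factor is.
  This uniformity permits multiplication from the right by truncations of a series, which vary along
  the sequence.\<close>

lemma tri_right_E:
  fixes D :: "('i, 'x, 'y::ab_group_add, 'z) root_datum_scheme"
  assumes "p \<in> mspan D (tri_words N)" "a \<in> wsupp E_words"
  shows "p * a \<in> mspan D (tri_words N)"
proof -
  obtain A c where A: "finite A" "A \<subseteq> E_words" "a = (\<Sum>gs\<in>A. fa_const (c gs) * mon gs)"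
    using wsupp_expand [OF assms(2)] .
  have "p * mon gs \<in> mspan D (tri_words N)" if "gs \<in> E_words" for gs
  proof (rule mspan_mult_right [OF assms(1)])
    fix hs :: "('i, 'y) gen list" assume "hs \<in> tri_words N"
    then obtain fs zs es where hs: "hs = fs @ zs @ es" and fs: "fs \<in> F_words" and zs: "zs \<in> torus_words"
      and es: "es \<in> E_words" "N \<le> length es" unfolding tri_words_def by blast
    have "es @ gs \<in> E_words" "N \<le> length (es @ gs)" using es that by (auto simp: E_words_def)
    then have "fs @ zs @ (es @ gs) \<in> tri_words N" using fs zs unfolding tri_words_def by blast
    then show "mon hs * mon gs \<in> mspan D (tri_words N)" unfolding hs mon_append [symmetric]
      by (intro mspan_simps) simp
  qed
  then show ?thesis unfolding A(3)
    using A by (auto simp: sum_distrib_left fa_const_left_commute intro!: mspan_sum mspan_simps)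
qed

text \<open>Of all letters only an \<open>F\<close> can shorten the \<open>E\<close> part, and it
  consumes at most one \<open>E\<close>; this is the step from \<open>Suc N\<close> to
  \<open>N\<close>.\<close>

lemma tri_right_gen:
  fixes D :: "('i, 'x, 'y::ab_group_add, 'z) root_datum_scheme"
  assumes "p \<in> mspan D (tri_words (Suc N))"
  shows "p * fa_gen g \<in> mspan D (tri_words N)"
proof (rule mspan_mult_right [OF assms])
  fix gs :: "('i, 'y) gen list" assume "gs \<in> tri_words (Suc N)"
  then obtain fs zs es where gs: "gs = fs @ zs @ es" and fs: "fs \<in> F_words" and zs: "zs \<in> torus_words"
    and es: "es \<in> E_words" "Suc N \<le> length es" unfolding tri_words_def by blast
  have torus: "mon gs * fa_gen g \<in> mspan D (tri_words N)" if g: "[g] \<in> torus_words"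
  proof -
    obtain c where "U_class D (mon es * mon [g]) = U_class D (fa_const c * (mon [g] * mon es))"
      using torus_nil_commute(2) [where D = D, OF g E_words_nil [OF es(1)]] ..
    moreover have "zs @ [g] \<in> torus_words" using g zs by (simp add: torus_words_def)
    then have "fs @ (zs @ [g]) @ es \<in> tri_words N" using fs es unfolding tri_words_def
      using Suc_leD by blast
    then have "(fs @ zs) @ [g] @ es @ [] \<in> tri_words N" by simp
    ultimately have "mon (fs @ zs) * (mon es * mon [g]) * mon [] \<in> mspan D (tri_words N)"
      by (rule mspan_commute)
    then show ?thesis by (simp add: gs mon_append mon_Cons mult.assoc)
  qed
  show "mon gs * fa_gen g \<in> mspan D (tri_words N)"
  proof (cases g)
    case (GenE i)
    have "mon gs * fa_gen g \<in> mspan D (tri_words (Suc N))"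
    proof (rule tri_right_E)
      show "mon gs \<in> mspan D (tri_words (Suc N))"
        using gs fs zs es by (intro mspan_simps) (auto simp: tri_words_def)
      show "fa_gen g \<in> wsupp E_words" by (rule wsupp_gen) (simp add: GenE E_words_def)
    qed
    then show ?thesis using mspan_mono [OF tri_words_mono [of N "Suc N"]] by auto
  next
    case (GenF i)
    have "mon (fs @ zs) * (mon es * fa_gen g) \<in> mspan D (tri_words N)"
    proof (rule mspan_mult_left)
      show "mon es * fa_gen g \<in> mspan D ({GenF i # es | es. es \<in> E_words \<and> Suc N \<le> length es} \<union>
        {zs @ es | zs es. zs \<in> torus_words \<and> es \<in> E_words \<and> Suc N \<le> Suc (length es)})" (is "_ \<in> mspan D ?L")
        unfolding GenF by (rule E_word_F [OF es])
      fix hs assume "hs \<in> ?L"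
      then consider es' where "hs = GenF i # es'" "es' \<in> E_words" "Suc N \<le> length es'"
        | zs' es' where "hs = zs' @ es'" "zs' \<in> torus_words" "es' \<in> E_words" "Suc N \<le> Suc (length es')" by blast
      then show "mon (fs @ zs) * mon hs \<in> mspan D (tri_words N)"
      proof cases
        case 1
        have F: "[GenF i] \<in> F_words" by (simp add: F_words_def)
        obtain c where "U_class D (mon zs * mon [GenF i]) = U_class D (fa_const c * (mon [GenF i] * mon zs))"
          using torus_nil_commute(1) [where D = D, OF zs F_words_nil [OF F]] ..
        moreover have "fs @ [GenF i] \<in> F_words" using fs by (simp add: F_words_def)
        then have "(fs @ [GenF i]) @ zs @ es' \<in> tri_words N" using 1 zs unfolding tri_words_def
          using Suc_leD by blast
        then have "fs @ [GenF i] @ zs @ es' \<in> tri_words N" by simp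
        ultimately have "mon fs * (mon zs * mon [GenF i]) * mon es' \<in> mspan D (tri_words N)"
          by (rule mspan_commute)
        then show ?thesis using 1 by (simp add: mon_append mon_Cons mult.assoc)
      next
        case 2
        then have "zs @ zs' \<in> torus_words" using zs by (simp add: torus_words_def)
        then have "fs @ (zs @ zs') @ es' \<in> tri_words N" using 2 fs unfolding tri_words_def by blast
        then show ?thesis unfolding 2(1) mon_append [symmetric] by (intro mspan_simps) simp
      qed
    qed
    then show ?thesis by (simp add: gs mon_append mult.assoc)
  next
    case (GenK \<mu>)
    then show ?thesis by (intro torus) (simp add: torus_words_def)
  next
    case (GenJ \<mu>)
    then show ?thesis by (intro torus) (simp add: torus_words_def)
  qed
qed

text \<open>Continuity of multiplication from the right by a fixed element. Each letter costs at
  most one \<open>E\<close>, so the total length of the words occurring in \<open>a\<close> serves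
  as \<open>k\<close>.\<close>

lemma tri_right: "\<exists>k. \<forall>N. \<forall>p\<in>mspan D (tri_words (N + k)). p * a \<in> mspan D (tri_words N)"
proof -
  have 1: "p * mon gs \<in> mspan D (tri_words N)" if "p \<in> mspan D (tri_words (N + length gs))" for p N gs
    using that
  proof (induction gs arbitrary: p N)
    case (Cons g gs)
    then have "p * fa_gen g * mon gs \<in> mspan D (tri_words N)"
      by (intro Cons.IH tri_right_gen) simp
    then show ?case by (simp add: mon_Cons mult.assoc)
  qed simp
  obtain A c where A: "finite A" "a = (\<Sum>gs\<in>A. fa_const (c gs) * mon gs)"
    by (rule wsupp_expand [OF wsupp_UNIV [of a]])
  have "p * a \<in> mspan D (tri_words N)" if p: "p \<in> mspan D (tri_words (N + (\<Sum>gs\<in>A. length gs)))" for p N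
  proof -
    have "p * mon gs \<in> mspan D (tri_words N)" if "gs \<in> A" for gs
    proof (rule 1)
      have "length gs \<le> (\<Sum>gs\<in>A. length gs)" using A(1) that by (intro member_le_sum) auto
      then show "p \<in> mspan D (tri_words (N + length gs))"
        using p mspan_mono [OF tri_words_mono] by (meson add_left_mono subsetD)
    qed
    then show ?thesis unfolding A(2)
      by (auto simp: sum_distrib_left fa_const_left_commute intro!: mspan_sum mspan_simps)
  qed
  then show ?thesis by blast
qed

section \<open>Modules over the quantum covering group\<close>

lemma fa_const_diff: "fa_const (a - b) = fa_const a - fa_const b"
  by (simp add: fa_const_def single_diff)

locale U_module =
  fixes D :: "('i, 'x, 'y::ab_group_add, 'z) root_datum_scheme"
    and M :: "(('i, 'y) Uelt, 'm) module" (structure)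
  assumes left_module_axioms: "left_module (U D) M"
begin

sublocale M: abelian_group M
  using left_module_axioms unfolding left_module_def by blast

abbreviation act :: "('i, 'y) free_alg \<Rightarrow> 'm \<Rightarrow> 'm" where
  "act p m \<equiv> U_class D p \<odot> m"

lemma act_closed [simp]: "m \<in> carrier M \<Longrightarrow> act p m \<in> carrier M"
  using left_module.smult_closed [OF left_module_axioms] U_class_simps(1) by blast

lemma act_add: "m \<in> carrier M \<Longrightarrow> act (p + r) m = act p m \<oplus> act r m"
  by (simp add: U_class_simps left_module.smult_l_distr [OF left_module_axioms])

lemma act_add_right: "m \<in> carrier M \<Longrightarrow> n \<in> carrier M \<Longrightarrow> act p (m \<oplus> n) = act p m \<oplus> act p n"
  by (simp add: U_class_simps left_module.smult_r_distr [OF left_module_axioms])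

lemma act_mult: "m \<in> carrier M \<Longrightarrow> act (p * r) m = act p (act r m)"
  by (simp add: U_class_simps left_module.smult_assoc [OF left_module_axioms])

lemma act_1 [simp]: "m \<in> carrier M \<Longrightarrow> act 1 m = m"
  by (simp add: U_class_simps left_module.smult_one [OF left_module_axioms])

lemma act_0 [simp]: "m \<in> carrier M \<Longrightarrow> act 0 m = \<zero>"
  using act_add [of m 0 0] by simp

lemma act_zero [simp]: "act p \<zero> = \<zero>"
  using act_add_right [of \<zero> \<zero> p] by simp

lemma act_uminus: "m \<in> carrier M \<Longrightarrow> act (- p) m = \<ominus> act p m"
  using act_add [of m "- p" p] M.minus_equality [of "act (- p) m" "act p m"] by simp

lemma act_diff: "m \<in> carrier M \<Longrightarrow> act (p - r) m = act p m \<ominus> act r m"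
  using act_add [of m p "- r"] by (simp add: act_uminus a_minus_def)

lemma act_uminus_right: "m \<in> carrier M \<Longrightarrow> act p (\<ominus> m) = \<ominus> act p m"
  using act_add_right [of "\<ominus> m" m p] M.minus_equality [of "act p (\<ominus> m)" "act p m"] by (simp add: M.l_neg)

lemma act_diff_right: "m \<in> carrier M \<Longrightarrow> n \<in> carrier M \<Longrightarrow> act p (m \<ominus> n) = act p m \<ominus> act p n"
  by (simp add: a_minus_def act_add_right act_uminus_right)

lemma act_sum: "finite A \<Longrightarrow> m \<in> carrier M \<Longrightarrow> act (sum f A) m = (\<Oplus>a\<in>A. act (f a) m)"
  by (induction A rule: finite_induct) (simp_all add: act_add)

lemma act_finsum: "f \<in> A \<rightarrow> carrier M \<Longrightarrow> act p (\<Oplus>a\<in>A. f a) = (\<Oplus>a\<in>A. act p (f a))"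
proof (induction A rule: infinite_finite_induct)
  case (insert a A)
  then have "f \<in> A \<rightarrow> carrier M" "f a \<in> carrier M" "(\<lambda>a. act p (f a)) \<in> A \<rightarrow> carrier M"
    by (auto simp: Pi_iff)
  then show ?case using insert by (simp add: act_add_right)
qed simp_all

lemma scale_closed [simp]: "m \<in> carrier M \<Longrightarrow> scale D M c m \<in> carrier M"
  by (simp add: scale_def)

lemma scale_simps:
  "m \<in> carrier M \<Longrightarrow> scale D M (a + b) m = scale D M a m \<oplus> scale D M b m"
  "m \<in> carrier M \<Longrightarrow> n \<in> carrier M \<Longrightarrow> scale D M a (m \<oplus> n) = scale D M a m \<oplus> scale D M a n"
  "m \<in> carrier M \<Longrightarrow> scale D M (a * b) m = scale D M a (scale D M b m)"
  "m \<in> carrier M \<Longrightarrow> scale D M 1 m = m" "m \<in> carrier M \<Longrightarrow> scale D M 0 m = \<zero>"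
  "m \<in> carrier M \<Longrightarrow> scale D M (- a) m = \<ominus> scale D M a m"
  "m \<in> carrier M \<Longrightarrow> scale D M a (\<ominus> m) = \<ominus> scale D M a m"
  "m \<in> carrier M \<Longrightarrow> scale D M (a - b) m = scale D M a m \<ominus> scale D M b m"
  "m \<in> carrier M \<Longrightarrow> n \<in> carrier M \<Longrightarrow> scale D M a (m \<ominus> n) = scale D M a m \<ominus> scale D M a n"
  by (simp_all add: scale_def fa_const_simps fa_const_diff act_add act_add_right act_mult
      act_uminus act_uminus_right act_diff act_diff_right)

lemma scale_zero [simp]: "scale D M a \<zero> = \<zero>"
  by (simp add: scale_def)

lemma scale_act: "m \<in> carrier M \<Longrightarrow> scale D M c (act p m) = act p (scale D M c m)"
  by (simp add: scale_def fa_const_commute flip: act_mult)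

lemma act_const: "act (fa_const c) m = scale D M c m"
  by (simp add: scale_def)

lemma scale_finsum:
  "f \<in> A \<rightarrow> carrier M \<Longrightarrow> scale D M c (\<Oplus>a\<in>A. f a) = (\<Oplus>a\<in>A. scale D M c (f a))"
  by (simp add: scale_def act_finsum)

lemma scale_cancel:
  assumes "c dvd 1" "m \<in> carrier M" "scale D M c m = \<zero>" shows "m = \<zero>"
proof -
  have "scale D M (inverse c * c) m = \<zero>" using assms(2,3) by (simp add: scale_simps)
  then show ?thesis using assms piext_mult_inverse [OF assms(1)] by (simp add: mult.commute scale_simps)
qed


subsection \<open>Spans\<close>

lemma lspanI:
  "finite t \<Longrightarrow> t \<subseteq> S \<Longrightarrow> c \<in> t \<rightarrow> R \<Longrightarrow> (\<Oplus>s\<in>t. scale D M (c s) s) \<in> lspan D M R S"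
  unfolding lspan_def by blast

lemma lspanE:
  assumes "x \<in> lspan D M R S"
  obtains t c where "finite t" "t \<subseteq> S" "c \<in> t \<rightarrow> R" "x = (\<Oplus>s\<in>t. scale D M (c s) s)"
  using assms unfolding lspan_def by blast

lemma lspan_least:
  assumes "x \<in> lspan D M R S" "S \<subseteq> carrier M" "\<zero> \<in> T"
    "\<And>c s x. c \<in> R \<Longrightarrow> s \<in> S \<Longrightarrow> x \<in> T \<Longrightarrow> x \<in> carrier M \<Longrightarrow> scale D M c s \<oplus> x \<in> T"
  shows "x \<in> T"
proof -
  obtain t c where t: "finite t" "t \<subseteq> S" "c \<in> t \<rightarrow> R" "x = (\<Oplus>s\<in>t. scale D M (c s) s)"
    using assms(1) by (rule lspanE)
  from t(1-3) have "(\<Oplus>s\<in>t. scale D M (c s) s) \<in> T \<inter> carrier M"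
  proof (induction t rule: finite_induct)
    case (insert s t)
    then have *: "(\<lambda>s. scale D M (c s) s) \<in> t \<rightarrow> carrier M" "s \<in> carrier M" "c s \<in> R" "s \<in> S"
      "(\<Oplus>s\<in>t. scale D M (c s) s) \<in> T \<inter> carrier M"
      using assms(2) by auto
    then show ?case using insert(1,2) assms(4) by simp
  qed (simp add: assms)
  then show ?thesis by (simp add: t(4))
qed

lemma lspan_closed: "S \<subseteq> carrier M \<Longrightarrow> x \<in> lspan D M R S \<Longrightarrow> x \<in> carrier M"
  by (erule lspan_least) auto

lemma lspan_0: "\<zero> \<in> lspan D M R S"
  using lspanI [of "{}" S "\<lambda>_. 0" R] by simp

lemma lspan_base: "S \<subseteq> carrier M \<Longrightarrow> 1 \<in> R \<Longrightarrow> s \<in> S \<Longrightarrow> s \<in> lspan D M R S"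
  using lspanI [of "{s}" S "\<lambda>_. 1" R] by (auto simp: scale_simps)

lemma lspan_mono: "R \<subseteq> R' \<Longrightarrow> S \<subseteq> S' \<Longrightarrow> lspan D M R S \<subseteq> lspan D M R' S'"
proof
  fix x assume RS: "R \<subseteq> R'" "S \<subseteq> S'" and "x \<in> lspan D M R S"
  from this(3) obtain t c where t: "finite t" "t \<subseteq> S" "c \<in> t \<rightarrow> R" "x = (\<Oplus>s\<in>t. scale D M (c s) s)"
    by (rule lspanE)
  show "x \<in> lspan D M R' S'" unfolding t(4) using t(1-3) RS by (intro lspanI) auto
qed

lemma lspan_extend:
  assumes "finite t'" "t \<subseteq> t'" "t' \<subseteq> carrier M"
  shows "(\<Oplus>s\<in>t. scale D M (c s) s) = (\<Oplus>s\<in>t'. scale D M (if s \<in> t then c s else 0) s)"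
proof -
  have "(\<Oplus>s\<in>t'. scale D M (if s \<in> t then c s else 0) s) = (\<Oplus>s\<in>t. scale D M (if s \<in> t then c s else 0) s)"
    using assms by (intro M.add.finprod_mono_neutral_cong_right) (auto simp: scale_simps)
  also have "\<dots> = (\<Oplus>s\<in>t. scale D M (c s) s)"
    using assms by (intro M.finsum_cong') auto
  finally show ?thesis by simp
qed

lemma lspan_add:
  assumes "S \<subseteq> carrier M" "0 \<in> R" "\<And>a b. a \<in> R \<Longrightarrow> b \<in> R \<Longrightarrow> a + b \<in> R"
    "x \<in> lspan D M R S" "y \<in> lspan D M R S"
  shows "x \<oplus> y \<in> lspan D M R S"
proof -
  obtain t c where t: "finite t" "t \<subseteq> S" "c \<in> t \<rightarrow> R" "x = (\<Oplus>s\<in>t. scale D M (c s) s)"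
    using assms(4) by (rule lspanE)
  obtain t' c' where t': "finite t'" "t' \<subseteq> S" "c' \<in> t' \<rightarrow> R" "y = (\<Oplus>s\<in>t'. scale D M (c' s) s)"
    using assms(5) by (rule lspanE)
  let ?c = "\<lambda>s. if s \<in> t then c s else 0" and ?c' = "\<lambda>s. if s \<in> t' then c' s else 0"
  have sub: "t \<union> t' \<subseteq> carrier M" using t t' assms(1) by auto
  have "x \<oplus> y = (\<Oplus>s\<in>t \<union> t'. scale D M (?c s) s) \<oplus> (\<Oplus>s\<in>t \<union> t'. scale D M (?c' s) s)"
    unfolding t(4) t'(4) using lspan_extend [of "t \<union> t'" t c] lspan_extend [of "t \<union> t'" t' c'] t t' sub by simp
  also have "\<dots> = (\<Oplus>s\<in>t \<union> t'. scale D M (?c s) s \<oplus> scale D M (?c' s) s)"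
    using sub by (subst M.finsum_addf) auto
  also have "\<dots> = (\<Oplus>s\<in>t \<union> t'. scale D M (?c s + ?c' s) s)"
    using sub by (intro M.finsum_cong') (auto simp: scale_simps)
  also have "\<dots> \<in> lspan D M R S"
    using t t' assms(2,3) by (intro lspanI) (auto simp: Pi_iff)
  finally show ?thesis .
qed

lemma lspan_scale:
  assumes "S \<subseteq> carrier M" "\<And>a. a \<in> R \<Longrightarrow> c * a \<in> R" "x \<in> lspan D M R S"
  shows "scale D M c x \<in> lspan D M R S"
proof -
  obtain t d where t: "finite t" "t \<subseteq> S" "d \<in> t \<rightarrow> R" "x = (\<Oplus>s\<in>t. scale D M (d s) s)"
    using assms(3) by (rule lspanE)
  have "scale D M c x = (\<Oplus>s\<in>t. scale D M c (scale D M (d s) s))"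
    unfolding t(4) using t assms(1) by (intro scale_finsum) auto
  also have "\<dots> = (\<Oplus>s\<in>t. scale D M (c * d s) s)"
    using t assms(1) by (intro M.finsum_cong') (auto simp: scale_simps)
  also have "\<dots> \<in> lspan D M R S" using t assms(2) by (intro lspanI) auto
  finally show ?thesis .
qed

lemma lspan_subset:
  assumes "x \<in> lspan D M UNIV S" "S \<subseteq> lspan D M UNIV S'" "S' \<subseteq> carrier M"
  shows "x \<in> lspan D M UNIV S'"
  using assms(1)
proof (rule lspan_least)
  show "S \<subseteq> carrier M" using assms lspan_closed by blast
  show "scale D M c s \<oplus> x \<in> lspan D M UNIV S'" if "s \<in> S" "x \<in> lspan D M UNIV S'" for c s x
    using that assms by (intro lspan_add lspan_scale) auto
qed (rule lspan_0)

end


subsection \<open>The regular module\<close>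

lemma regular_module_sel [simp]:
  "carrier (regular_module R) = carrier R" "(\<oplus>\<^bsub>regular_module R\<^esub>) = (\<oplus>\<^bsub>R\<^esub>)"
  "\<zero>\<^bsub>regular_module R\<^esub> = \<zero>\<^bsub>R\<^esub>" "(\<odot>\<^bsub>regular_module R\<^esub>) = (\<otimes>\<^bsub>R\<^esub>)"
  by (simp_all add: regular_module_def)

lemma abelian_group_regular_module: "abelian_group R \<Longrightarrow> abelian_group (regular_module R)"
proof -
  assume "abelian_group R"
  then interpret abelian_group R .
  show ?thesis
    by (rule abelian_groupI) (auto simp: a_ac intro: l_neg a_inv_closed)
qed

lemma left_module_regular_module: "ring R \<Longrightarrow> left_module R (regular_module R)"
proof -
  assume "ring R"
  then interpret ring R .
  show ?thesis
    by (intro left_module.intro left_module_axioms.intro \<open>ring R\<close> abelian_group_regular_module abelian_group_axioms)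
      (simp_all add: l_distr r_distr m_assoc)
qed

lemma U_module_regular: "U_module D (regular_module (U D))"
  by (simp add: U_module_def left_module_regular_module ring_U)

lemma scale_regular: "scale D (regular_module (U D)) c (U_class D p) = U_class D (fa_const c * p)"
  by (simp add: scale_def U_class_simps)

lemma lspan_words: "lspan D (regular_module (U D)) UNIV (U_class D ` mon ` L) = U_class D ` wsupp L"
proof -
  interpret U_module D "regular_module (U D)" by (rule U_module_regular)
  have sub: "U_class D ` mon ` L \<subseteq> carrier (regular_module (U D))"
    by (auto simp: U_class_simps)
  show ?thesis
  proof (intro subset_antisym subsetI)
    fix x assume "x \<in> lspan D (regular_module (U D)) UNIV (U_class D ` mon ` L)"
    then show "x \<in> U_class D ` wsupp L"
    proof (rule lspan_least [OF _ sub])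
      show "\<zero>\<^bsub>regular_module (U D)\<^esub> \<in> U_class D ` wsupp L"
        by (auto simp flip: U_class_simps)
      fix c s x assume "s \<in> U_class D ` mon ` L" "x \<in> U_class D ` wsupp L"
      then obtain gs p where *: "s = U_class D (mon gs)" "gs \<in> L" "x = U_class D p" "p \<in> wsupp L" by blast
      then have "scale D (regular_module (U D)) c s \<oplus>\<^bsub>regular_module (U D)\<^esub> x
          = U_class D (fa_const c * mon gs + p)"
        by (simp add: scale_regular U_class_simps)
      then show "scale D (regular_module (U D)) c s \<oplus>\<^bsub>regular_module (U D)\<^esub> x \<in> U_class D ` wsupp L"
        using * by (auto intro!: wsupp_simps)
    qed
  next
    fix x assume "x \<in> U_class D ` wsupp L"
    then obtain p where p: "x = U_class D p" "p \<in> wsupp L" by blast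
    obtain A c where A: "finite A" "A \<subseteq> L" "p = (\<Sum>gs\<in>A. fa_const (c gs) * mon gs)"
      using p(2) by (rule wsupp_expand)
    have "U_class D (\<Sum>gs\<in>A. fa_const (c gs) * mon gs)
        \<in> lspan D (regular_module (U D)) UNIV (U_class D ` mon ` L)"
      using A(1,2)
    proof (induction A rule: finite_induct)
      case empty
      show ?case using lspan_0 by (simp add: U_class_simps)
    next
      case (insert gs A)
      then have "U_class D (mon gs) \<in> lspan D (regular_module (U D)) UNIV (U_class D ` mon ` L)"
        by (intro lspan_base sub) auto
      then have "scale D (regular_module (U D)) (c gs) (U_class D (mon gs)) \<oplus>\<^bsub>regular_module (U D)\<^esub>
          U_class D (\<Sum>gs\<in>A. fa_const (c gs) * mon gs)
          \<in> lspan D (regular_module (U D)) UNIV (U_class D ` mon ` L)"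
        using insert by (intro lspan_add lspan_scale sub) auto
      then show ?case using insert by (simp add: scale_regular U_class_simps)
    qed
    then show "x \<in> lspan D (regular_module (U D)) UNIV (U_class D ` mon ` L)" by (simp add: p A)
  qed
qed

lemma generate_ring_words:
  "generate_ring (U D) (range (Uscal D) \<union> U_class D ` fa_gen ` G) = U_class D ` wsupp (lists G)"
  (is "?A = ?B")
proof (intro subset_antisym subsetI)
  interpret ring "U D" by (rule ring_U)
  fix x assume "x \<in> ?A"
  then show "x \<in> ?B"
  proof (induction rule: generate_ring.induct)
    case one
    have "mon [] \<in> wsupp (lists G)" by (rule wsupp_simps) simp
    then show ?case by (auto simp flip: U_class_simps)
  next
    case (incl h)
    then show ?case by (auto intro!: imageI wsupp_const wsupp_gen)
  next
    case (a_inv h)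
    then show ?case by (auto intro!: imageI wsupp_simps simp flip: U_class_simps)
  next
    case (eng_add h1 h2)
    then show ?case by (auto intro!: imageI wsupp_simps simp flip: U_class_simps)
  next
    case (eng_mult h1 h2)
    then obtain p1 p2 where p: "h1 = U_class D p1" "p1 \<in> wsupp (lists G)" "h2 = U_class D p2" "p2 \<in> wsupp (lists G)"
      by blast
    have "p1 * p2 \<in> wsupp (lists G)" by (rule wsupp_mult [OF p(2,4)]) simp
    then show ?case unfolding p U_class_simps(3) [symmetric] by (rule imageI)
  qed
next
  interpret ring "U D" by (rule ring_U)
  fix x assume "x \<in> ?B"
  then obtain p where p: "x = U_class D p" "p \<in> wsupp (lists G)" by blast
  obtain A c where A: "finite A" "A \<subseteq> lists G" "p = (\<Sum>gs\<in>A. fa_const (c gs) * mon gs)"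
    using p(2) by (rule wsupp_expand)
  have word: "U_class D (mon gs) \<in> ?A" if "gs \<in> lists G" for gs
    using that
  proof (induction gs)
    case Nil
    show ?case using generate_ring.one by (simp add: U_class_simps)
  next
    case (Cons g gs)
    then show ?case unfolding mon_Cons U_class_simps(3)
      by (intro generate_ring.eng_mult [OF generate_ring.incl]) auto
  qed
  have "U_class D (\<Sum>gs\<in>A. fa_const (c gs) * mon gs) \<in> ?A"
    using A(1,2)
  proof (induction A rule: finite_induct)
    case empty
    show ?case using zero_in_generate by (simp add: U_class_simps)
  next
    case (insert gs A)
    then have "Uscal D (c gs) \<otimes>\<^bsub>U D\<^esub> U_class D (mon gs) \<oplus>\<^bsub>U D\<^esub>
        U_class D (\<Sum>gs\<in>A. fa_const (c gs) * mon gs) \<in> ?A"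
      by (intro generate_ring.eng_add [OF generate_ring.eng_mult [OF generate_ring.incl word]]) auto
    then show ?case using insert by (simp add: U_class_simps)
  qed
  then show "x \<in> ?A" by (simp add: p A)
qed

lemma U_minus_words: "U_minus D = U_class D ` wsupp F_words"
  unfolding U_minus_def F_words_def generate_ring_words [symmetric] by (simp add: image_image)

lemma U_zero_words: "U_zero D = U_class D ` wsupp torus_words"
  unfolding U_zero_def torus_words_def generate_ring_words [symmetric]
  by (simp add: image_image image_Un Un_assoc)

definition E_words_wt :: "('i \<Rightarrow> nat) \<Rightarrow> ('i, 'y) gen list set" where
  "E_words_wt \<nu> = {map GenE is | is. \<forall>i. count_list is i = \<nu> i}"

lemma E_monomial_mon: "E_monomial D is = U_class D (mon (map GenE is))"
  by (induction "is") (simp_all add: E_monomial_def mon_Cons U_class_simps)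

lemma U_plus_wt_words: "U_plus_wt D \<nu> = U_class D ` wsupp (E_words_wt \<nu>)"
proof -
  have "{E_monomial D is | is. \<forall>i. count_list is i = \<nu> i} = U_class D ` mon ` E_words_wt \<nu>"
    unfolding E_words_wt_def E_monomial_mon by auto
  then show ?thesis unfolding U_plus_wt_def by (simp add: lspan_words)
qed

lemma ht_count_list: "ht (count_list is) = length is"
proof (induction "is")
  case (Cons i "is")
  have "count_list (i # is) = (\<lambda>j. (if j = i then 1 else 0) + count_list is j)" by auto
  then show ?case using Cons by (simp add: ht_def sum.distrib)
qed (simp add: ht_def)

lemma E_words_wt_length: "gs \<in> E_words_wt \<nu> \<Longrightarrow> length gs = ht \<nu>"
proof -
  assume "gs \<in> E_words_wt \<nu>"
  then obtain js where js: "gs = map GenE js" "\<forall>i. count_list js i = \<nu> i" by (auto simp: E_words_wt_def)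
  then have "\<nu> = count_list js" by auto
  then show ?thesis using js ht_count_list [of js] by simp
qed

lemma E_words_wt_subset: "E_words_wt \<nu> \<subseteq> E_words"
  by (auto simp: E_words_wt_def E_words_map)

text \<open>The subalgebras and the weight pieces are all spans of classes of words, so products of
  their elements are spanned by concatenations; the height of the weight of an \<open>E\<close> word
  is its length.\<close>

lemma hat_nbhd_words:
  fixes D :: "('i::finite, 'x, 'y::ab_group_add, 'z) root_datum_scheme"
  shows "hat_nbhd D N = U_class D ` wsupp (tri_words N)"
proof -
  interpret U_module D "regular_module (U D)" by (rule U_module_regular)
  let ?S = "{x \<otimes>\<^bsub>U D\<^esub> y \<otimes>\<^bsub>U D\<^esub> z | x y z \<nu>. x \<in> U_minus D \<and> y \<in> U_zero D \<and> z \<in> U_plus_wt D \<nu> \<and> N \<le> ht \<nu>}"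
  have S: "?S \<subseteq> U_class D ` wsupp (tri_words N)"
  proof
    fix s assume "s \<in> ?S"
    then obtain x y z \<nu> where *: "s = U_class D (x * y * z)" "x \<in> wsupp F_words" "y \<in> wsupp torus_words"
      "z \<in> wsupp (E_words_wt \<nu>)" "N \<le> ht \<nu>"
      unfolding U_minus_words U_zero_words U_plus_wt_words by (auto simp: U_class_simps)
    have "x * y \<in> wsupp {fs @ zs | fs zs. fs \<in> F_words \<and> zs \<in> torus_words}"
      using * by (intro wsupp_mult [of x F_words y torus_words]) auto
    then have "x * y * z \<in> wsupp (tri_words N)"
    proof (rule wsupp_mult)
      show "z \<in> wsupp (E_words_wt \<nu>)" by fact
      fix xs ys :: "('i, 'y) gen list" assume "xs \<in> {fs @ zs | fs zs. fs \<in> F_words \<and> zs \<in> torus_words}" "ys \<in> E_words_wt \<nu>"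
      moreover have "ys \<in> E_words" "N \<le> length ys"
        using E_words_wt_length [of ys \<nu>] E_words_wt_subset [of \<nu>] calculation *(5) by auto
      ultimately show "xs @ ys \<in> tri_words N"
        unfolding tri_words_def by (auto 4 4)
    qed
    then show "s \<in> U_class D ` wsupp (tri_words N)" using *(1) by blast
  qed
  have S2: "U_class D ` mon ` tri_words N \<subseteq> ?S"
  proof clarify
    fix gs :: "('i, 'y) gen list" assume "gs \<in> tri_words N"
    then obtain fs zs es where gs: "gs = fs @ zs @ es" and "fs \<in> F_words" "zs \<in> torus_words"
      and es: "es \<in> E_words" "N \<le> length es" unfolding tri_words_def by blast
    obtain js where js: "es = map GenE js" using es by (auto simp: E_words_map)
    have "es \<in> E_words_wt (count_list js)" by (auto simp: E_words_wt_def js)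
    moreover have "N \<le> ht (count_list js)" using es js by (simp add: ht_count_list)
    moreover have "U_class D (mon gs) = U_class D (mon fs) \<otimes>\<^bsub>U D\<^esub> U_class D (mon zs) \<otimes>\<^bsub>U D\<^esub> U_class D (mon es)"
      by (simp add: gs mon_append mult.assoc flip: U_class_simps)
    ultimately show "\<exists>x y z \<nu>. U_class D (mon gs) = x \<otimes>\<^bsub>U D\<^esub> y \<otimes>\<^bsub>U D\<^esub> z \<and>
        x \<in> U_minus D \<and> y \<in> U_zero D \<and> z \<in> U_plus_wt D \<nu> \<and> N \<le> ht \<nu>"
      unfolding U_minus_words U_zero_words U_plus_wt_words
      using \<open>fs \<in> F_words\<close> \<open>zs \<in> torus_words\<close> wsupp_simps(5) by (intro exI conjI) (assumption | rule imageI)+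
  qed
  have carr: "U_class D ` T \<subseteq> carrier (regular_module (U D))" for T by (auto simp: U_class_simps)
  have Scarr: "?S \<subseteq> carrier (regular_module (U D))" using S carr by blast
  have "lspan D (regular_module (U D)) UNIV ?S \<subseteq> lspan D (regular_module (U D)) UNIV (U_class D ` mon ` tri_words N)"
    using lspan_subset [of _ ?S "U_class D ` mon ` tri_words N"] S carr [of "mon ` tri_words N"]
    unfolding lspan_words by blast
  moreover have "lspan D (regular_module (U D)) UNIV (U_class D ` mon ` tri_words N)
      \<subseteq> lspan D (regular_module (U D)) UNIV ?S"
    by (intro lspan_mono S2) simp
  ultimately show ?thesis unfolding hat_nbhd_def lspan_words by blast
qed

lemma hat_nbhd_iff: "U_class D p \<in> hat_nbhd D N \<longleftrightarrow> p \<in> mspan D (tri_words N)"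
  by (simp add: hat_nbhd_words mspan_def)


subsection \<open>Weights of words\<close>

fun gen_wt :: "('i, 'x::ab_group_add, 'y, 'z) root_datum_scheme \<Rightarrow> ('i, 'y) gen \<Rightarrow> 'x" where
  "gen_wt D (GenE i) = xroot D i"
| "gen_wt D (GenF i) = - xroot D i"
| "gen_wt D (GenK \<mu>) = 0"
| "gen_wt D (GenJ \<mu>) = 0"

definition word_wt ::
  "('i, 'x::ab_group_add, 'y, 'z) root_datum_scheme \<Rightarrow> ('i, 'y) gen list \<Rightarrow> 'x" where
  "word_wt D gs = sum_list (map (gen_wt D) gs)"

lemma word_wt_simps [simp]:
  "word_wt D [] = 0" "word_wt D (g # gs) = gen_wt D g + word_wt D gs"
  "word_wt D (xs @ ys) = word_wt D xs + word_wt D ys"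
  by (simp_all add: word_wt_def)

lemma int_mult_Suc: "int_mult (int (Suc n)) x = x + int_mult (int n) x"
  by (simp add: int_mult_def nat_add_distrib add.commute)

lemma int_mult_0 [simp]: "int_mult 0 x = 0"
  by (simp add: int_mult_def)

lemma root_of_count_list:
  fixes D :: "('i::finite, 'x::ab_group_add, 'y, 'z) root_datum_scheme"
  shows "root_of D (count_list is) = sum_list (map (xroot D) is)"
proof (induction "is")
  case (Cons i "is")
  have "int_mult (int (count_list (i # is) j)) (xroot D j) =
      (if j = i then xroot D i else 0) + int_mult (int (count_list is j)) (xroot D j)" for j
    by (simp add: int_mult_Suc [simplified])
  then show ?case using Cons by (simp add: root_of_def sum.distrib)
qed (simp add: root_of_def)

lemma word_wt_E_words_wt: "gs \<in> E_words_wt \<nu> \<Longrightarrow> word_wt D gs = root_of D \<nu>"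
proof -
  assume "gs \<in> E_words_wt \<nu>"
  then obtain js where js: "gs = map GenE js" "\<forall>i. count_list js i = \<nu> i" by (auto simp: E_words_wt_def)
  then have "\<nu> = count_list js" by auto
  moreover have "word_wt D (map GenE js) = sum_list (map (xroot D) js)"
    by (simp add: word_wt_def comp_def)
  ultimately show ?thesis using js by (simp add: root_of_count_list)
qed

text \<open>The projection to the words whose weight lies in \<open>S\<close>. It lives on the free
  algebra and descends to \<open>U\<close> because the relations are homogeneous
  (\<open>wproj_U_ideal\<close>).\<close>

definition wproj ::
  "('i, 'x::ab_group_add, 'y, 'z) root_datum_scheme \<Rightarrow> 'x set \<Rightarrow> ('i, 'y) free_alg \<Rightarrow> ('i, 'y) free_alg" where
  "wproj D S p = (\<Sum>w\<in>{w \<in> Poly_Mapping.keys p. w \<in> Word ` {gs. word_wt D gs \<in> S}}.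
     Poly_Mapping.single w (Poly_Mapping.lookup p w))"

lemma lookup_wproj:
  "Poly_Mapping.lookup (wproj D S p) w = (if w \<in> Word ` {gs. word_wt D gs \<in> S} then Poly_Mapping.lookup p w else 0)"
proof -
  let ?K = "{w \<in> Poly_Mapping.keys p. w \<in> Word ` {gs. word_wt D gs \<in> S}}"
  have "Poly_Mapping.lookup (wproj D S p) w = (\<Sum>v\<in>?K. if v = w then Poly_Mapping.lookup p w else 0)"
    unfolding wproj_def lookup_sum by (rule sum.cong) (auto simp: lookup_single)
  also have "\<dots> = (if w \<in> ?K then Poly_Mapping.lookup p w else 0)" by simp
  also have "\<dots> = (if w \<in> Word ` {gs. word_wt D gs \<in> S} then Poly_Mapping.lookup p w else 0)"
    by (auto simp: in_keys_iff)
  finally show ?thesis .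
qed

lemma wproj_add: "wproj D S (p + r) = wproj D S p + wproj D S r"
  by (rule poly_mapping_eqI) (simp add: lookup_wproj lookup_add)

lemma wproj_uminus: "wproj D S (- p) = - wproj D S p"
  by (rule poly_mapping_eqI) (simp add: lookup_wproj)

lemma wproj_diff: "wproj D S (p - r) = wproj D S p - wproj D S r"
  by (rule poly_mapping_eqI) (simp add: lookup_wproj lookup_minus)

lemma wproj_0 [simp]: "wproj D S 0 = 0"
  by (rule poly_mapping_eqI) (simp add: lookup_wproj)

lemma wproj_sum: "wproj D S (sum f A) = (\<Sum>a\<in>A. wproj D S (f a))"
  by (induction A rule: infinite_finite_induct) (simp_all add: wproj_add)

lemma wproj_word:
  "wproj D S (fa_const c * mon gs) = (if word_wt D gs \<in> S then fa_const c * mon gs else 0)"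
  unfolding single_Word [symmetric]
  by (rule poly_mapping_eqI) (auto simp: lookup_wproj lookup_single when_def)

lemma wproj_wsupp: "p \<in> wsupp L \<Longrightarrow> wproj D S p \<in> wsupp L"
  by (auto simp: wsupp_def in_keys_iff lookup_wproj split: if_splits)

lemma wproj_inside:
  assumes "p \<in> wsupp L" "\<And>gs. gs \<in> L \<Longrightarrow> word_wt D gs \<in> S" shows "wproj D S p = p"
proof -
  obtain A c where A: "finite A" "A \<subseteq> L" "p = (\<Sum>gs\<in>A. fa_const (c gs) * mon gs)"
    using assms(1) by (rule wsupp_expand)
  then show ?thesis using assms(2) by (auto simp: wproj_sum wproj_word intro!: sum.cong)
qed

lemma wproj_outside:
  assumes "p \<in> wsupp L" "\<And>gs. gs \<in> L \<Longrightarrow> word_wt D gs \<notin> S" shows "wproj D S p = 0"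
proof -
  obtain A c where A: "finite A" "A \<subseteq> L" "p = (\<Sum>gs\<in>A. fa_const (c gs) * mon gs)"
    using assms(1) by (rule wsupp_expand)
  then show ?thesis using assms(2) by (auto simp: wproj_sum wproj_word intro!: sum.neutral)
qed

text \<open>The factor \<open>a\<close> may be inhomogeneous, provided all its words translate
  \<open>S'\<close> to \<open>S\<close>. This is applied to representatives of \<open>B_i\<close>,
  which are homogeneous only modulo \<open>T\<close>.\<close>

lemma wproj_mult_left:
  assumes "a \<in> wsupp L" "\<And>gs \<xi>. gs \<in> L \<Longrightarrow> word_wt D gs + \<xi> \<in> S \<longleftrightarrow> \<xi> \<in> S'"
  shows "wproj D S (a * p) = a * wproj D S' p"
proof -
  obtain A c where A: "finite A" "A \<subseteq> L" "a = (\<Sum>gs\<in>A. fa_const (c gs) * mon gs)"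
    using assms(1) by (rule wsupp_expand)
  obtain B d where B: "finite B" "p = (\<Sum>hs\<in>B. fa_const (d hs) * mon hs)"
    by (rule wsupp_expand [OF wsupp_UNIV [of p]])
  have "wproj D S (fa_const (c gs) * mon gs * (fa_const (d hs) * mon hs)) =
      fa_const (c gs) * mon gs * wproj D S' (fa_const (d hs) * mon hs)" if "gs \<in> A" for gs hs
  proof -
    have "fa_const (c gs) * mon gs * (fa_const (d hs) * mon hs) = fa_const (c gs * d hs) * mon (gs @ hs)"
      by (simp add: fa_const_simps mon_append mult.assoc fa_const_left_commute [of "mon gs"])
    then show ?thesis using assms(2) [of gs "word_wt D hs"] that A(2) by (auto simp: wproj_word)
  qed
  then show ?thesis unfolding A(3) B(2) wproj_sum sum_distrib_left sum_distrib_right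
    by (intro sum.cong refl)
qed

lemma wproj_mult_right:
  assumes "a \<in> wsupp L" "\<And>gs \<xi>. gs \<in> L \<Longrightarrow> \<xi> + word_wt D gs \<in> S \<longleftrightarrow> \<xi> \<in> S'"
  shows "wproj D S (p * a) = wproj D S' p * a"
proof -
  obtain A c where A: "finite A" "A \<subseteq> L" "a = (\<Sum>gs\<in>A. fa_const (c gs) * mon gs)"
    using assms(1) by (rule wsupp_expand)
  obtain B d where B: "finite B" "p = (\<Sum>hs\<in>B. fa_const (d hs) * mon hs)"
    by (rule wsupp_expand [OF wsupp_UNIV [of p]])
  have "wproj D S (fa_const (d hs) * mon hs * (fa_const (c gs) * mon gs)) =
      wproj D S' (fa_const (d hs) * mon hs) * (fa_const (c gs) * mon gs)" if "gs \<in> A" for gs hs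
  proof -
    have "fa_const (d hs) * mon hs * (fa_const (c gs) * mon gs) = fa_const (d hs * c gs) * mon (hs @ gs)"
      by (simp add: fa_const_simps mon_append mult.assoc fa_const_left_commute [of "mon hs"])
    then show ?thesis using assms(2) [of gs "word_wt D hs"] that A(2) by (auto simp: wproj_word)
  qed
  then show ?thesis unfolding A(3) B(2) wproj_sum sum_distrib_left sum_distrib_right
    by (intro sum.cong refl)
qed

definition homog :: "('i, 'x::ab_group_add, 'y, 'z) root_datum_scheme \<Rightarrow> 'x \<Rightarrow> ('i, 'y) free_alg set" where
  "homog D \<xi> = wsupp {gs. word_wt D gs = \<xi>}"

lemma homog_simps:
  "fa_gen g \<in> homog D (gen_wt D g)" "fa_const c \<in> homog D 0" "1 \<in> homog D 0" "0 \<in> homog D \<xi>"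
  "p \<in> homog D \<xi> \<Longrightarrow> r \<in> homog D \<xi> \<Longrightarrow> p + r \<in> homog D \<xi>"
  "p \<in> homog D \<xi> \<Longrightarrow> r \<in> homog D \<xi> \<Longrightarrow> p - r \<in> homog D \<xi>"
  unfolding homog_def
  using wsupp_gen [of g "{gs. word_wt D gs = gen_wt D g}"] wsupp_const [of "{gs. word_wt D gs = 0}" c]
    wsupp_const [of "{gs. word_wt D gs = 0}" 1]
  by (auto intro: wsupp_diff simp: fa_const_simps)

lemma homog_mult: "p \<in> homog D \<xi> \<Longrightarrow> r \<in> homog D \<xi>' \<Longrightarrow> p * r \<in> homog D (\<xi> + \<xi>')"
  unfolding homog_def by (erule wsupp_mult) auto

lemma homog_mult': "p \<in> homog D \<xi> \<Longrightarrow> r \<in> homog D \<xi>' \<Longrightarrow> \<xi>'' = \<xi> + \<xi>' \<Longrightarrow> p * r \<in> homog D \<xi>''"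
  using homog_mult by blast

lemma homog_power: "p \<in> homog D \<xi> \<Longrightarrow> p ^ n \<in> homog D (\<Sum>_<n. \<xi>)"
  by (induction n) (auto intro: homog_simps homog_mult' simp: add.commute)

lemma homog_serre:
  fixes D :: "('i, 'x::ab_group_add, 'y, 'z) root_datum_scheme"
  shows "serre D x i j \<in> homog D ((\<Sum>_<nat (1 - cartan D i j). gen_wt D (x i)) + gen_wt D (x j))"
proof -
  let ?N = "nat (1 - cartan D i j)"
  have sum_split: "(\<Sum>_<k + l. a) = (\<Sum>_<k. a) + (\<Sum>_<l. a)" for k l :: nat and a :: 'x
    by (induction l) (simp_all add: add.assoc)
  have "fa_const c * fa_gen (x i) ^ n * fa_gen (x j) * fa_gen (x i) ^ (?N - n)
      \<in> homog D ((\<Sum>_<?N. gen_wt D (x i)) + gen_wt D (x j))" if "n \<le> ?N" for c n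
  proof (rule homog_mult' [OF homog_mult [OF homog_mult [OF homog_simps(2) homog_power [OF homog_simps(1)]]
        homog_simps(1)] homog_power [OF homog_simps(1)]])
    show "(\<Sum>_<?N. gen_wt D (x i)) + gen_wt D (x j) =
        0 + (\<Sum>_<n. gen_wt D (x i)) + gen_wt D (x j) + (\<Sum>_<?N - n. gen_wt D (x i))"
      using sum_split [where k = n and l = "?N - n" and a = "gen_wt D (x i)"] that by (simp add: algebra_simps)
  qed
  then show ?thesis
    unfolding serre_def Let_def homog_def by (intro wsupp_sum) auto
qed

lemma homog_U_rels:
  assumes "r \<in> U_rels D" shows "\<exists>\<xi>. r \<in> homog D \<xi>"
proof -
  have gens: "fa_gen (GenK \<mu>) \<in> homog D 0" "fa_gen (GenJ \<mu>) \<in> homog D 0"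
    "fa_gen (GenE i) \<in> homog D (xroot D i)" "fa_gen (GenF i) \<in> homog D (- xroot D i)" for \<mu> i
    using homog_simps(1) [of "GenK \<mu>" D] homog_simps(1) [of "GenJ \<mu>" D] homog_simps(1) [of "GenE i" D]
      homog_simps(1) [of "GenF i" D] by simp_all
  have m2: "p * r \<in> homog D (\<xi> + \<xi>')" if "p \<in> homog D \<xi>" "r \<in> homog D \<xi>'" for p r \<xi> \<xi>'
    using that by (rule homog_mult)
  have m3: "c * p * r \<in> homog D (\<xi> + \<xi>')" if "c \<in> homog D 0" "p \<in> homog D \<xi>" "r \<in> homog D \<xi>'" for c p r \<xi> \<xi>'
    using homog_mult [OF homog_mult [OF that(1,2)] that(3)] by simp
  have ef: "fa_gen (GenE i) * fa_gen (GenF j) - fa_const c * fa_gen (GenF j) * fa_gen (GenE i) - (if i = j then z else 0)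
      \<in> homog D (xroot D i - xroot D j)" if "z \<in> homog D 0" for i j c z
  proof (intro homog_simps(6))
    show "fa_gen (GenE i) * fa_gen (GenF j) \<in> homog D (xroot D i - xroot D j)"
      using m2 [OF gens(3) gens(4), of i j] by simp
    show "fa_const c * fa_gen (GenF j) * fa_gen (GenE i) \<in> homog D (xroot D i - xroot D j)"
      using m3 [OF homog_simps(2) gens(4) gens(3), of c j i] by simp
    show "(if i = j then z else 0) \<in> homog D (xroot D i - xroot D j)"
      using that homog_simps(4) by auto
  qed
  have z: "fa_const c * (fa_gen (GenJ \<mu>) * fa_gen (GenK \<nu>) - fa_gen (GenK \<kappa>)) \<in> homog D 0" for c \<mu> \<nu> \<kappa>
    using m2 [OF homog_simps(2) homog_simps(6) [OF m2 [OF gens(2) gens(1)]]] gens(1)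
    by (metis add_0)
  have KK: "fa_gen (GenK a) * fa_gen (GenK b) \<in> homog D 0" "fa_gen (GenJ a) * fa_gen (GenJ b) \<in> homog D 0"
    "fa_gen (GenJ a) * fa_gen (GenK b) \<in> homog D 0" "fa_gen (GenK a) * fa_gen (GenJ b) \<in> homog D 0" for a b
    using m2 [OF gens(1) gens(1), of a b] m2 [OF gens(2) gens(2), of a b] m2 [OF gens(2) gens(1), of a b]
      m2 [OF gens(1) gens(2), of a b] by simp_all
  have KX: "fa_gen (GenK a) * fa_gen (GenE i) - fa_const c * fa_gen (GenE i) * fa_gen (GenK a) \<in> homog D (xroot D i)"
    "fa_gen (GenJ a) * fa_gen (GenE i) - fa_const c * fa_gen (GenE i) * fa_gen (GenJ a) \<in> homog D (xroot D i)"
    "fa_gen (GenK a) * fa_gen (GenF i) - fa_const c * fa_gen (GenF i) * fa_gen (GenK a) \<in> homog D (- xroot D i)"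
    "fa_gen (GenJ a) * fa_gen (GenF i) - fa_const c * fa_gen (GenF i) * fa_gen (GenJ a) \<in> homog D (- xroot D i)" for a c i
    using m2 [OF gens(1) gens(3), of a i] m2 [OF gens(2) gens(3), of a i] m2 [OF gens(1) gens(4), of a i]
      m2 [OF gens(2) gens(4), of a i] m3 [OF homog_simps(2) gens(3) gens(1), of c i a]
      m3 [OF homog_simps(2) gens(3) gens(2), of c i a] m3 [OF homog_simps(2) gens(4) gens(1), of c i a]
      m3 [OF homog_simps(2) gens(4) gens(2), of c i a]
    by (auto intro: homog_simps(6))
  let ?H = "{r. \<exists>\<xi>. r \<in> homog D \<xi>}"
  have H: "r \<in> ?H" if "r \<in> homog D \<xi>" for r \<xi> using that by blast
  have "U_rels D \<subseteq> ?H" unfolding U_rels_def Let_def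
  proof (intro Un_least)
    show "{fa_gen (GenK 0) - 1} \<subseteq> ?H"
      by (intro subsetI, elim singletonE, simp only:, rule H, rule homog_simps(6) [OF gens(1) homog_simps(3)])
    show "{fa_gen (GenK (\<mu> + \<nu>)) - fa_gen (GenK \<mu>) * fa_gen (GenK \<nu>) | \<mu> \<nu>. True} \<subseteq> ?H"
      by (intro subsetI, elim CollectE exE conjE, simp only:, rule H, rule homog_simps(6) [OF gens(1) KK(1)])
    show "{fa_gen (GenJ (\<mu> + \<mu>)) - 1 | \<mu>. True} \<subseteq> ?H"
      by (intro subsetI, elim CollectE exE conjE, simp only:, rule H, rule homog_simps(6) [OF gens(2) homog_simps(3)])
    show "{fa_gen (GenJ (\<mu> + \<nu>)) - fa_gen (GenJ \<mu>) * fa_gen (GenJ \<nu>) | \<mu> \<nu>. True} \<subseteq> ?H"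
      by (intro subsetI, elim CollectE exE conjE, simp only:, rule H, rule homog_simps(6) [OF gens(2) KK(2)])
    show "{fa_gen (GenJ \<mu>) * fa_gen (GenK \<nu>) - fa_gen (GenK \<nu>) * fa_gen (GenJ \<mu>) | \<mu> \<nu>. True} \<subseteq> ?H"
      by (intro subsetI, elim CollectE exE conjE, simp only:, rule H, rule homog_simps(6) [OF KK(3,4)])
    show "{fa_gen (GenK \<mu>) * fa_gen (GenE i) -
        fa_const (qq powi pairing D \<mu> (xroot D i)) * fa_gen (GenE i) * fa_gen (GenK \<mu>) | \<mu> i. True} \<subseteq> ?H"
      by (intro subsetI, elim CollectE exE conjE, simp only:, rule H, rule KX)
    show "{fa_gen (GenJ \<mu>) * fa_gen (GenE i) -
        fa_const (ppi powi pairing D \<mu> (xroot D i)) * fa_gen (GenE i) * fa_gen (GenJ \<mu>) | \<mu> i. True} \<subseteq> ?H"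
      by (intro subsetI, elim CollectE exE conjE, simp only:, rule H, rule KX)
    show "{fa_gen (GenK \<mu>) * fa_gen (GenF i) -
        fa_const (qq powi (- pairing D \<mu> (xroot D i))) * fa_gen (GenF i) * fa_gen (GenK \<mu>) | \<mu> i. True} \<subseteq> ?H"
      by (intro subsetI, elim CollectE exE conjE, simp only:, rule H, rule KX)
    show "{fa_gen (GenJ \<mu>) * fa_gen (GenF i) -
        fa_const (ppi powi (- pairing D \<mu> (xroot D i))) * fa_gen (GenF i) * fa_gen (GenJ \<mu>) | \<mu> i. True} \<subseteq> ?H"
      by (intro subsetI, elim CollectE exE conjE, simp only:, rule H, rule KX)
    show "{fa_gen (GenE i) * fa_gen (GenF j) - fa_const (ppi ^ (par D i * par D j)) * fa_gen (GenF j) * fa_gen (GenE i)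
        - (if i = j
           then fa_const (1 / (pi_i D i * q_i D i - inverse (q_i D i)))
                * (fa_gen (GenJ (int_mult (int (dd D i)) (yroot D i))) * fa_gen (GenK (int_mult (int (dd D i)) (yroot D i)))
                   - fa_gen (GenK (- int_mult (int (dd D i)) (yroot D i))))
           else 0) | i j. True} \<subseteq> ?H"
    proof (intro subsetI, elim CollectE exE conjE, goal_cases)
      case (1 r i j)
      show ?case unfolding 1(1) by (rule H, rule ef, rule z)
    qed
    show "{serre D GenE i j | i j. i \<noteq> j} \<subseteq> ?H" "{serre D GenF i j | i j. i \<noteq> j} \<subseteq> ?H"
      by (intro subsetI, elim CollectE exE conjE, simp only:, rule H, rule homog_serre)+
  qed
  then show ?thesis using assms by blast
qed

lemma U_ideal_sum: "(\<And>a. a \<in> A \<Longrightarrow> f a \<in> U_ideal D) \<Longrightarrow> sum f A \<in> U_ideal D"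
  by (induction A rule: infinite_finite_induct) (auto intro: U_ideal_closed)

text \<open>Multiplication by a word merely translates the set \<open>S\<close>. So the elements all
  of whose projections, for every \<open>S\<close> at once, lie in the ideal form a two-sided ideal,
  and it contains the homogeneous relations.\<close>

lemma wproj_U_ideal: "p \<in> U_ideal D \<Longrightarrow> wproj D S p \<in> U_ideal D"
proof -
  let ?J = "{p. \<forall>S. wproj D S p \<in> U_ideal D}"
  have left: "a * p \<in> ?J" if "p \<in> ?J" for a p
  proof clarify
    fix S
    obtain A c where A: "finite A" "a = (\<Sum>gs\<in>A. fa_const (c gs) * mon gs)"
      by (rule wsupp_expand [OF wsupp_UNIV [of a]])
    have "wproj D S (fa_const (c gs) * mon gs * p) = fa_const (c gs) * mon gs * wproj D {\<xi>. word_wt D gs + \<xi> \<in> S} p" for gs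
      by (rule wproj_mult_left [of _ "{gs}"]) auto
    then show "wproj D S (a * p) \<in> U_ideal D"
      using that unfolding A(2) sum_distrib_right wproj_sum
      by (intro U_ideal_sum) (simp add: U_ideal_closed)
  qed
  have right: "p * a \<in> ?J" if "p \<in> ?J" for a p
  proof clarify
    fix S
    obtain A c where A: "finite A" "a = (\<Sum>gs\<in>A. fa_const (c gs) * mon gs)"
      by (rule wsupp_expand [OF wsupp_UNIV [of a]])
    have "wproj D S (p * (fa_const (c gs) * mon gs)) = wproj D {\<xi>. \<xi> + word_wt D gs \<in> S} p * (fa_const (c gs) * mon gs)" for gs
      by (rule wproj_mult_right [of _ "{gs}"]) auto
    then show "wproj D S (p * a) \<in> U_ideal D"
      using that unfolding A(2) sum_distrib_left wproj_sum
      by (intro U_ideal_sum) (simp add: U_ideal_closed)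
  qed
  have "U_ideal D \<subseteq> ?J"
  proof (rule U_ideal_least)
    show "U_rels D \<subseteq> ?J"
    proof clarify
      fix r S assume r: "r \<in> U_rels D"
      then obtain \<xi> where "r \<in> wsupp {gs. word_wt D gs = \<xi>}"
        using homog_U_rels unfolding homog_def by blast
      then have "wproj D S r = r \<or> wproj D S r = 0"
        using wproj_inside [of r _ D S] wproj_outside [of r _ D S] by (cases "\<xi> \<in> S") auto
      then show "wproj D S r \<in> U_ideal D"
        using subsetD [OF U_ideal_rels r] U_ideal_closed(1) by (elim disjE) simp_all
    qed
  qed (use left right in \<open>auto simp: wproj_add wproj_uminus intro: U_ideal_closed\<close>)
  then show "p \<in> U_ideal D \<Longrightarrow> wproj D S p \<in> U_ideal D" by blast
qed

lemma wproj_mspan: "p \<in> mspan D L \<Longrightarrow> wproj D S p \<in> mspan D L"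
proof -
  assume "p \<in> mspan D L"
  then obtain p' where p': "p' \<in> wsupp L" "p - p' \<in> U_ideal D"
    unfolding mspan_iff U_class_eq_iff by blast
  then have "wproj D S p' \<in> wsupp L" "wproj D S p - wproj D S p' \<in> U_ideal D"
    using wproj_wsupp [OF p'(1)] wproj_U_ideal [OF p'(2)] by (simp_all add: wproj_diff)
  then show ?thesis unfolding mspan_iff U_class_eq_iff by blast
qed

section \<open>Intertwiners in the completion\<close>

definition heq ::
  "('i, 'x, 'y::ab_group_add, 'z) root_datum_scheme \<Rightarrow>
    (nat \<Rightarrow> ('i, 'y) free_alg) \<Rightarrow> (nat \<Rightarrow> ('i, 'y) free_alg) \<Rightarrow> bool" where
  "heq D s t \<longleftrightarrow> (\<forall>N. \<exists>n0. \<forall>n\<ge>n0. s n - t n \<in> mspan D (tri_words N))"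

lemma hat_eq_iff_heq: "hat_eq D (\<lambda>n. U_class D (s n)) (\<lambda>n. U_class D (t n)) \<longleftrightarrow> heq D s t"
  unfolding hat_eq_def heq_def U_class_simps(7) [symmetric] hat_nbhd_iff ..

lemma heqD:
  assumes "heq D s t" obtains n0 where "\<And>n. n0 \<le> n \<Longrightarrow> s n - t n \<in> mspan D (tri_words N)"
  using assms unfolding heq_def by blast

lemma heq_refl_class: "(\<And>n. U_class D (s n) = U_class D (t n)) \<Longrightarrow> heq D s t"
proof -
  assume "\<And>n. U_class D (s n) = U_class D (t n)"
  then have "U_class D (s n - t n) = U_class D 0" for n
    using ring.ring_simprules(19) [OF ring_U] by (simp add: U_class_eq_iff)
  then have "s n - t n \<in> mspan D L" for n L using mspan_cong mspan_simps(1) by blast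
  then show ?thesis unfolding heq_def by blast
qed

lemma heq_sym: "heq D s t \<Longrightarrow> heq D t s"
proof -
  assume *: "heq D s t"
  show ?thesis unfolding heq_def
  proof
    fix N
    obtain n0 where "\<And>n. n0 \<le> n \<Longrightarrow> s n - t n \<in> mspan D (tri_words N)" using * by (rule heqD [where N = N]) blast
    then have "\<forall>n\<ge>n0. - (s n - t n) \<in> mspan D (tri_words N)" by (blast intro: mspan_simps)
    then show "\<exists>n0. \<forall>n\<ge>n0. t n - s n \<in> mspan D (tri_words N)" by auto
  qed
qed

lemma heq_add: "heq D s t \<Longrightarrow> heq D s' t' \<Longrightarrow> heq D (\<lambda>n. s n + s' n) (\<lambda>n. t n + t' n)"
proof -
  assume *: "heq D s t" "heq D s' t'"
  show ?thesis unfolding heq_def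
  proof
    fix N
    obtain n0 where 1: "\<And>n. n0 \<le> n \<Longrightarrow> s n - t n \<in> mspan D (tri_words N)" using *(1) by (rule heqD [where N = N]) blast
    obtain n1 where 2: "\<And>n. n1 \<le> n \<Longrightarrow> s' n - t' n \<in> mspan D (tri_words N)" using *(2) by (rule heqD [where N = N]) blast
    have "s n + s' n - (t n + t' n) \<in> mspan D (tri_words N)" if "max n0 n1 \<le> n" for n
      using mspan_simps(2) [OF 1 2, of n n] that by (simp add: algebra_simps)
    then show "\<exists>n0. \<forall>n\<ge>n0. s n + s' n - (t n + t' n) \<in> mspan D (tri_words N)" by blast
  qed
qed

lemma heq_uminus: "heq D s t \<Longrightarrow> heq D (\<lambda>n. - s n) (\<lambda>n. - t n)"
  using heq_sym [of D s t] unfolding heq_def by simp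

lemma heq_trans: "heq D s t \<Longrightarrow> heq D t u \<Longrightarrow> heq D s u"
  using heq_add [of D s t t u] unfolding heq_def by simp

text \<open>The neighbourhoods are left ideals without any shift of \<open>N\<close>, so the left
  factor may vary with \<open>n\<close>.\<close>

lemma heq_left: "heq D s t \<Longrightarrow> heq D (\<lambda>n. a n * s n) (\<lambda>n. a n * t n)"
  unfolding heq_def right_diff_distrib [symmetric] by (meson tri_left)

lemma heq_right_E:
  "heq D s t \<Longrightarrow> (\<And>n. a n \<in> wsupp E_words) \<Longrightarrow> heq D (\<lambda>n. s n * a n) (\<lambda>n. t n * a n)"
  unfolding heq_def left_diff_distrib [symmetric] by (meson tri_right_E)

lemma heq_right: "heq D s t \<Longrightarrow> heq D (\<lambda>n. s n * a) (\<lambda>n. t n * a)"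
proof -
  assume *: "heq D s t"
  show ?thesis unfolding heq_def
  proof
    fix N
    obtain k where k: "\<forall>N. \<forall>p\<in>mspan D (tri_words (N + k)). p * a \<in> mspan D (tri_words N)"
      using tri_right ..
    obtain n0 where "\<And>n. n0 \<le> n \<Longrightarrow> s n - t n \<in> mspan D (tri_words (N + k))" using * by (rule heqD [where N = "N + k"]) blast
    then have "\<forall>n\<ge>n0. (s n - t n) * a \<in> mspan D (tri_words N)" using k by blast
    then show "\<exists>n0. \<forall>n\<ge>n0. s n * a - t n * a \<in> mspan D (tri_words N)"
      unfolding left_diff_distrib ..
  qed
qed

definition E_long :: "nat \<Rightarrow> ('i, 'y) gen list set" where
  "E_long N = {gs \<in> E_words. N \<le> length gs}"

lemma E_long_tri: "E_long N \<subseteq> tri_words N"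
proof
  fix gs assume "gs \<in> (E_long N :: ('a, 'b) gen list set)"
  then have "[] @ [] @ gs \<in> tri_words N"
    unfolding tri_words_def E_long_def F_words_def torus_words_def by blast
  then show "gs \<in> tri_words N" by simp
qed

lemma heq_E_long: "(\<And>n. s n - t n \<in> wsupp (E_long n)) \<Longrightarrow> heq D s t"
proof -
  assume *: "\<And>n. s n - t n \<in> wsupp (E_long n)"
  have "s n - t n \<in> mspan D (tri_words N)" if "N \<le> n" for N n
  proof (rule wsupp_mspan)
    have "E_long n \<subseteq> tri_words N" using E_long_tri tri_words_mono [OF that] by blast
    then show "s n - t n \<in> wsupp (tri_words N)" using * wsupp_mono by blast
  qed
  then show ?thesis unfolding heq_def by blast
qed


subsection \<open>Families of elements of the positive part\<close>

lemma finite_ht: "finite {\<nu> :: 'i::finite \<Rightarrow> nat. ht \<nu> < n}"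
proof (rule finite_subset)
  show "{\<nu> :: 'i \<Rightarrow> nat. ht \<nu> < n} \<subseteq> PiE UNIV (\<lambda>_. {..<n})"
  proof
    fix \<nu> :: "'i \<Rightarrow> nat" assume "\<nu> \<in> {\<nu>. ht \<nu> < n}"
    moreover have "\<nu> i \<le> ht \<nu>" for i
      unfolding ht_def by (rule member_le_sum) auto
    ultimately have "\<nu> i < n" for i by (metis le_less_trans mem_Collect_eq)
    then show "\<nu> \<in> PiE UNIV (\<lambda>_. {..<n})" by (simp add: PiE_UNIV_domain)
  qed
qed (intro finite_PiE, auto)

definition trunc :: "nat \<Rightarrow> (('i::finite \<Rightarrow> nat) \<Rightarrow> ('i, 'y) free_alg) \<Rightarrow> ('i, 'y) free_alg" where
  "trunc n Y = (\<Sum>\<nu>\<in>{\<nu>. ht \<nu> < n}. Y \<nu>)"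

text \<open>The components are kept as elements of the free algebra supported on words of the exact
  weight, so that products and conjugates can be formed without choosing representatives
  again.\<close>

definition E_family :: "(('i::finite \<Rightarrow> nat) \<Rightarrow> ('i, 'y) free_alg) \<Rightarrow> bool" where
  "E_family Y \<longleftrightarrow> (\<forall>\<nu>. Y \<nu> \<in> wsupp (E_words_wt \<nu>))"

lemma hat_sum_trunc: "hat_sum D (\<lambda>\<nu>. U_class D (Y \<nu>)) n = U_class D (trunc n Y)"
  unfolding hat_sum_def trunc_def by (rule U_class_sum [OF finite_ht, symmetric])

lemma E_family_E_words: "E_family Y \<Longrightarrow> Y \<nu> \<in> wsupp E_words"
  using E_words_wt_subset wsupp_mono unfolding E_family_def by blast

lemma trunc_E_words: "E_family Y \<Longrightarrow> trunc n Y \<in> wsupp E_words"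
  unfolding trunc_def by (intro wsupp_sum E_family_E_words)

definition conv ::
  "(('i::finite \<Rightarrow> nat) \<Rightarrow> ('i, 'y) free_alg) \<Rightarrow> (('i \<Rightarrow> nat) \<Rightarrow> ('i, 'y) free_alg) \<Rightarrow>
    ('i \<Rightarrow> nat) \<Rightarrow> ('i, 'y) free_alg" where
  "conv Y Z \<nu> = (\<Sum>\<alpha>\<in>{\<alpha>. \<forall>i. \<alpha> i \<le> \<nu> i}. Y \<alpha> * Z (\<lambda>i. \<nu> i - \<alpha> i))"

lemma ht_add: "ht (\<lambda>i. \<alpha> i + \<beta> i) = ht \<alpha> + ht \<beta>"
  by (simp add: ht_def sum.distrib)

lemma E_words_wt_append:
  "xs \<in> E_words_wt \<alpha> \<Longrightarrow> ys \<in> E_words_wt \<beta> \<Longrightarrow> xs @ ys \<in> E_words_wt (\<lambda>i. \<alpha> i + \<beta> i)"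
proof -
  assume "xs \<in> E_words_wt \<alpha>" "ys \<in> E_words_wt \<beta>"
  then obtain js ks where "xs = map GenE js" "\<forall>i. count_list js i = \<alpha> i"
    "ys = map GenE ks" "\<forall>i. count_list ks i = \<beta> i" by (auto simp: E_words_wt_def)
  then have "xs @ ys = map GenE (js @ ks)" "\<forall>i. count_list (js @ ks) i = \<alpha> i + \<beta> i" by simp_all
  then show ?thesis unfolding E_words_wt_def by blast
qed

lemma E_family_mult: "E_family Y \<Longrightarrow> E_family Z \<Longrightarrow> Y \<alpha> * Z \<beta> \<in> wsupp (E_words_wt (\<lambda>i. \<alpha> i + \<beta> i))"
  unfolding E_family_def by (rule wsupp_mult) (auto intro: E_words_wt_append)

lemma E_family_conv: "E_family Y \<Longrightarrow> E_family Z \<Longrightarrow> E_family (conv Y Z)"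
  unfolding E_family_def [of "conv Y Z"] conv_def
proof (intro allI wsupp_sum)
  fix \<nu> \<alpha> :: "'a \<Rightarrow> nat" assume "E_family Y" "E_family Z" "\<alpha> \<in> {\<alpha>. \<forall>i. \<alpha> i \<le> \<nu> i}"
  then show "Y \<alpha> * Z (\<lambda>i. \<nu> i - \<alpha> i) \<in> wsupp (E_words_wt \<nu>)"
    using E_family_mult [of Y Z \<alpha> "\<lambda>i. \<nu> i - \<alpha> i"] by simp
qed

text \<open>The product of two truncations contains, besides the truncation of the product, only the
  pairs of components whose heights add up to at least \<open>n\<close>, and these consist of long
  \<open>E\<close> words.\<close>

lemma trunc_conv:
  assumes "E_family Y" "E_family Z"
  shows "trunc n Y * trunc n Z - trunc n (conv Y Z) \<in> wsupp (E_long n)"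
proof -
  let ?P = "{(\<alpha>, \<beta>). ht \<alpha> + ht \<beta> < n}" and ?Q = "{\<nu>. ht \<nu> < n} \<times> {\<nu>. ht \<nu> < n}"
  have sub: "?P \<subseteq> ?Q" by auto
  have fin: "finite ?Q" by (intro finite_cartesian_product finite_ht)
  have below: "finite {\<alpha>. \<forall>i. \<alpha> i \<le> \<nu> i}" if "ht \<nu> < n" for \<nu> :: "'a \<Rightarrow> nat"
  proof (rule finite_subset [OF _ finite_ht [of n]])
    show "{\<alpha>. \<forall>i. \<alpha> i \<le> \<nu> i} \<subseteq> {\<nu>. ht \<nu> < n}"
    proof
      fix \<alpha> assume "\<alpha> \<in> {\<alpha>. \<forall>i. \<alpha> i \<le> \<nu> i}"
      then have "ht \<alpha> \<le> ht \<nu>" unfolding ht_def by (intro sum_mono) auto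
      then show "\<alpha> \<in> {\<nu>. ht \<nu> < n}" using that by simp
    qed
  qed
  have "trunc n (conv Y Z) = (\<Sum>(\<nu>, \<alpha>)\<in>(SIGMA \<nu>:{\<nu>. ht \<nu> < n}. {\<alpha>. \<forall>i. \<alpha> i \<le> \<nu> i}). Y \<alpha> * Z (\<lambda>i. \<nu> i - \<alpha> i))"
    unfolding trunc_def conv_def using below by (intro sum.Sigma finite_ht) auto
  also have "\<dots> = (\<Sum>(\<alpha>, \<beta>)\<in>?P. Y \<alpha> * Z \<beta>)"
  proof (rule sum.reindex_bij_witness [where i = "\<lambda>(\<alpha>, \<beta>). (\<lambda>i. \<alpha> i + \<beta> i, \<alpha>)"
        and j = "\<lambda>(\<nu>, \<alpha>). (\<alpha>, \<lambda>i. \<nu> i - \<alpha> i)"]; clarsimp)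
    fix \<nu> \<alpha> :: "'a \<Rightarrow> nat" assume "ht \<nu> < n" "\<forall>i. \<alpha> i \<le> \<nu> i"
    then show "ht \<alpha> + ht (\<lambda>i. \<nu> i - \<alpha> i) < n" using ht_add [of \<alpha> "\<lambda>i. \<nu> i - \<alpha> i"] by simp
  qed (simp_all add: ht_add)
  finally have 1: "trunc n (conv Y Z) = (\<Sum>(\<alpha>, \<beta>)\<in>?P. Y \<alpha> * Z \<beta>)" .
  have "trunc n Y * trunc n Z = (\<Sum>(\<alpha>, \<beta>)\<in>?Q. Y \<alpha> * Z \<beta>)"
    unfolding trunc_def by (simp add: sum_product sum.cartesian_product)
  also have "\<dots> = (\<Sum>(\<alpha>, \<beta>)\<in>?Q - ?P. Y \<alpha> * Z \<beta>) + (\<Sum>(\<alpha>, \<beta>)\<in>?P. Y \<alpha> * Z \<beta>)"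
    by (rule sum.subset_diff [OF sub fin])
  finally have 2: "trunc n Y * trunc n Z - trunc n (conv Y Z) = (\<Sum>(\<alpha>, \<beta>)\<in>?Q - ?P. Y \<alpha> * Z \<beta>)"
    using 1 by simp
  have "Y \<alpha> * Z \<beta> \<in> wsupp (E_long n)" if "n \<le> ht \<alpha> + ht \<beta>" for \<alpha> \<beta>
  proof -
    have "E_words_wt (\<lambda>i. \<alpha> i + \<beta> i) \<subseteq> (E_long n :: ('a, 'b) gen list set)"
      unfolding E_long_def using that E_words_wt_subset E_words_wt_length by (fastforce simp: ht_add)
    then show ?thesis using E_family_mult [OF assms, of \<alpha> \<beta>] wsupp_mono by blast
  qed
  then show ?thesis unfolding 2 by (intro wsupp_sum) auto
qed

lemma root_of_add:
  fixes D :: "('i::finite, 'x::ab_group_add, 'y, 'z) root_datum_scheme"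
  shows "root_of D (\<lambda>i. \<alpha> i + \<beta> i) = root_of D \<alpha> + root_of D \<beta>"
proof -
  have eq: "int_mult (int n) x = (\<Sum>_<n. x)" for n and x :: 'x
    by (simp add: int_mult_def)
  have "(\<Sum>_<m + n. x) = (\<Sum>_<m. x) + (\<Sum>_<n. x)" for m n :: nat and x :: 'x
    by (induction n) (simp_all add: add.assoc)
  then show ?thesis unfolding root_of_def eq by (simp add: sum.distrib)
qed


subsection \<open>Involutions\<close>

text \<open>On words in the \<open>E\<close>'s, which \<open>\<psi>\<close> fixes letter by letter,
  this represents the action of \<open>\<psi>\<close> (\<open>psi_E_words\<close>).\<close>

definition bar_coeffs :: "('i, 'y) free_alg \<Rightarrow> ('i, 'y) free_alg" where
  "bar_coeffs p = Poly_Mapping.map qbar p"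

lemma lookup_bar_coeffs: "Poly_Mapping.lookup (bar_coeffs p) w = qbar (Poly_Mapping.lookup p w)"
  unfolding bar_coeffs_def by (cases "Poly_Mapping.lookup p w = 0") (simp_all add: Poly_Mapping.map.rep_eq when_def)

lemma bar_coeffs_add: "bar_coeffs (p + r) = bar_coeffs p + bar_coeffs r"
  by (rule poly_mapping_eqI) (simp add: lookup_bar_coeffs lookup_add qbar_add)

lemma bar_coeffs_0 [simp]: "bar_coeffs 0 = 0"
  by (rule poly_mapping_eqI) (simp add: lookup_bar_coeffs)

lemma bar_coeffs_sum: "bar_coeffs (sum f A) = (\<Sum>a\<in>A. bar_coeffs (f a))"
  by (induction A rule: infinite_finite_induct) (simp_all add: bar_coeffs_add)

lemma bar_coeffs_word: "bar_coeffs (fa_const c * mon gs) = fa_const (qbar c) * mon gs"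
  unfolding single_Word [symmetric]
  by (rule poly_mapping_eqI) (auto simp: lookup_bar_coeffs lookup_single when_def)

lemma bar_coeffs_1 [simp]: "bar_coeffs 1 = 1"
  using bar_coeffs_word [of 1 "[]"] by (simp add: fa_const_simps)

lemma bar_coeffs_wsupp: "p \<in> wsupp L \<Longrightarrow> bar_coeffs p \<in> wsupp L"
proof -
  have "Poly_Mapping.keys (bar_coeffs p) \<subseteq> Poly_Mapping.keys p"
    by (auto simp: in_keys_iff lookup_bar_coeffs)
  then show "p \<in> wsupp L \<Longrightarrow> bar_coeffs p \<in> wsupp L" unfolding wsupp_def by blast
qed

lemma E_family_bar: "E_family Y \<Longrightarrow> E_family (\<lambda>\<nu>. bar_coeffs (Y \<nu>))"
  by (simp add: E_family_def bar_coeffs_wsupp)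

lemma trunc_bar: "trunc n (\<lambda>\<nu>. bar_coeffs (Y \<nu>)) = bar_coeffs (trunc n Y)"
  by (simp add: trunc_def bar_coeffs_sum)

locale U_psi =
  fixes D :: "('i, 'x, 'y::ab_group_add, 'z) root_datum_scheme" and \<psi>
  assumes psi: "is_psi D \<psi>"
begin

lemma psi_hom: "\<psi> \<in> ring_hom (U D) (U D)"
  using psi by (simp add: is_psi_def)

lemma psi_class_mult: "\<psi> (U_class D (p * r)) = \<psi> (U_class D p) \<otimes>\<^bsub>U D\<^esub> \<psi> (U_class D r)"
  using ring_hom_mult [OF psi_hom] by (simp add: U_class_simps)

lemma psi_class_add: "\<psi> (U_class D (p + r)) = \<psi> (U_class D p) \<oplus>\<^bsub>U D\<^esub> \<psi> (U_class D r)"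
  using ring_hom_add [OF psi_hom] by (simp add: U_class_simps)

lemma psi_class_1: "\<psi> (U_class D 1) = U_class D 1"
  using ring_hom_one [OF psi_hom] by (simp add: U_class_simps)

lemma psi_const: "\<psi> (Uscal D c) = Uscal D (qbar c)"
proof -
  interpret ring "U D" by (rule ring_U)
  have "\<psi> (scale D (regular_module (U D)) c \<one>\<^bsub>U D\<^esub>) = scale D (regular_module (U D)) (qbar c) (\<psi> \<one>\<^bsub>U D\<^esub>)"
    using psi unfolding is_psi_def semilinear_def by simp
  then show ?thesis
    using psi_class_1 by (simp add: scale_def U_class_simps)
qed

lemma psi_class_0: "\<psi> (U_class D 0) = U_class D 0"
  using psi_const [of 0] by (simp add: fa_const_simps)

fun psi_gen :: "('i, 'y) gen \<Rightarrow> ('i, 'y) free_alg" where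
  "psi_gen (GenK \<mu>) = fa_gen (GenJ \<mu>) * fa_gen (GenK (- \<mu>))"
| "psi_gen g = fa_gen g"

definition psi_word :: "('i, 'y) gen list \<Rightarrow> ('i, 'y) free_alg" where
  "psi_word gs = foldr (\<lambda>g p. psi_gen g * p) gs 1"

lemma psi_gen: "\<psi> (U_class D (fa_gen g)) = U_class D (psi_gen g)"
  using psi by (cases g) (simp_all add: is_psi_def U_class_simps)

lemma psi_word: "\<psi> (U_class D (mon gs)) = U_class D (psi_word gs)"
  by (induction gs) (simp_all add: psi_word_def psi_class_1 mon_Cons psi_class_mult psi_gen flip: U_class_simps(3))

lemma psi_word_append: "psi_word (xs @ ys) = psi_word xs * psi_word ys"
  by (induction xs) (simp_all add: psi_word_def mult.assoc)

lemma psi_word_mon: "gs \<in> nil_words \<Longrightarrow> psi_word gs = mon gs"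
  by (induction gs) (auto simp: psi_word_def mon_Cons nil_words_def)

lemma psi_word_torus: "gs \<in> torus_words \<Longrightarrow> psi_word gs \<in> wsupp torus_words"
proof (induction gs)
  case (Cons g gs)
  then have "psi_gen g \<in> wsupp torus_words"
    by (cases g) (auto simp: torus_words_def intro!: wsupp_gen wsupp_mult [OF wsupp_gen [of _ torus_words] wsupp_gen [of _ torus_words]])
  moreover have "psi_word gs \<in> wsupp torus_words" using Cons by (simp add: torus_words_def)
  ultimately have "psi_gen g * psi_word gs \<in> wsupp torus_words"
    by (rule wsupp_mult) (simp add: torus_words_def)
  then show ?case by (simp add: psi_word_def)
next
  case Nil
  have "mon [] \<in> wsupp torus_words" by (rule wsupp_simps) (simp add: torus_words_def)
  then show ?case by (simp add: psi_word_def)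
qed

lemma psi_class_expand:
  assumes "finite A"
  shows "\<psi> (U_class D (\<Sum>gs\<in>A. fa_const (c gs) * mon gs)) = U_class D (\<Sum>gs\<in>A. fa_const (qbar (c gs)) * psi_word gs)"
  using assms
  by (induction A rule: finite_induct)
    (simp_all add: psi_class_0 psi_class_add psi_class_mult psi_const psi_word flip: U_class_simps(2,3))

lemma psi_E_words: "p \<in> wsupp E_words \<Longrightarrow> \<psi> (U_class D p) = U_class D (bar_coeffs p)"
proof -
  assume "p \<in> wsupp E_words"
  then obtain A c where A: "finite A" "A \<subseteq> E_words" "p = (\<Sum>gs\<in>A. fa_const (c gs) * mon gs)"
    by (rule wsupp_expand)
  have "psi_word gs = mon gs" if "gs \<in> A" for gs
    using A(2) that E_words_nil by (intro psi_word_mon) blast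
  then show ?thesis
    unfolding A(3) psi_class_expand [OF A(1)] bar_coeffs_sum bar_coeffs_word
    by (intro arg_cong [of _ _ "U_class D"] sum.cong) simp_all
qed

text \<open>\<open>\<psi>\<close> fixes the letters \<open>E\<close> and \<open>F\<close> and maps
  torus words to torus words, so sorted words stay sorted with the same number of
  \<open>E\<close>'s. Hence \<open>\<psi>\<close> is continuous.\<close>

lemma psi_tri:
  assumes "p \<in> mspan D (tri_words N)" "\<psi> (U_class D p) = U_class D r"
  shows "r \<in> mspan D (tri_words N)"
proof -
  obtain p' where p': "p' \<in> wsupp (tri_words N)" "U_class D p = U_class D p'"
    using assms(1) unfolding mspan_iff by blast
  obtain A c where A: "finite A" "A \<subseteq> tri_words N" "p' = (\<Sum>gs\<in>A. fa_const (c gs) * mon gs)"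
    using p'(1) by (rule wsupp_expand)
  have "psi_word gs \<in> mspan D (tri_words N)" if gs: "gs \<in> tri_words N" for gs
  proof -
    obtain fs zs es where eq: "gs = fs @ zs @ es" and fs: "fs \<in> F_words" and zs: "zs \<in> torus_words"
      and es: "es \<in> E_words" "N \<le> length es" using gs unfolding tri_words_def by blast
    have "psi_word zs * mon es \<in> mspan D {zs @ es | zs. zs \<in> torus_words}"
      by (rule wsupp_mspan, rule wsupp_mult [OF psi_word_torus [OF zs] wsupp_simps(5) [of es "{es}"]]) auto
    then have "mon fs * (psi_word zs * mon es) \<in> mspan D (tri_words N)"
    proof (rule mspan_mult_left)
      fix hs :: "('i, 'y) gen list" assume "hs \<in> {zs @ es | zs. zs \<in> torus_words}"
      then have "fs @ hs \<in> tri_words N" using fs es unfolding tri_words_def by blast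
      then show "mon fs * mon hs \<in> mspan D (tri_words N)"
        unfolding mon_append [symmetric] by (rule mspan_simps)
    qed
    then show ?thesis
      using psi_word_mon [OF F_words_nil [OF fs]] psi_word_mon [OF E_words_nil [OF es(1)]]
      by (simp add: eq psi_word_append)
  qed
  then have "(\<Sum>gs\<in>A. fa_const (qbar (c gs)) * psi_word gs) \<in> mspan D (tri_words N)"
    using A(2) by (intro mspan_sum mspan_simps) auto
  moreover have "U_class D (\<Sum>gs\<in>A. fa_const (qbar (c gs)) * psi_word gs) = U_class D r"
    using psi_class_expand [OF A(1), of c] assms(2) p'(2) unfolding A(3) by simp
  ultimately show ?thesis using mspan_cong by blast
qed

lemma heq_psi:
  assumes "heq D s t" "\<And>n. \<psi> (U_class D (s n)) = U_class D (s' n)" "\<And>n. \<psi> (U_class D (t n)) = U_class D (t' n)"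
  shows "heq D s' t'"
proof -
  have neg: "\<psi> (U_class D (- p)) = U_class D (- r)" if "\<psi> (U_class D p) = U_class D r" for p r
  proof -
    have eq: "- p = fa_const (- 1) * p" "- r = fa_const (- 1) * r" by (simp_all add: fa_const_simps)
    show ?thesis unfolding eq psi_class_mult that psi_const
      unfolding U_class_simps(3) qbar_uminus qbar_1 by (rule refl)
  qed
  have "\<psi> (U_class D (s n - t n)) = U_class D (s' n - t' n)" for n
    using psi_class_add [of "s n" "- t n"] neg [OF assms(3)] assms(2) U_class_simps(2) [of D "s' n" "- t' n"] by simp
  then show ?thesis
    using assms(1) psi_tri unfolding heq_def by blast
qed

end

subsection \<open>The quasi-K-matrix\<close>

lemma perfect_pairing_additive:
  assumes "perfect_pairing p"
  shows "p \<mu> (\<xi> + \<xi>') = p \<mu> \<xi> + p \<mu> \<xi>'" "p (\<mu> + \<mu>') \<xi> = p \<mu> \<xi> + p \<mu>' \<xi>"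
    "p \<mu> 0 = 0" "p 0 \<xi> = 0" "p \<mu> (- \<xi>) = - p \<mu> \<xi>" "p (- \<mu>) \<xi> = - p \<mu> \<xi>"
    "p \<mu> (\<Sum>i\<in>A. f i) = (\<Sum>i\<in>A. p \<mu> (f i))"
    "p \<mu> (int_mult (int n) \<xi>) = int n * p \<mu> \<xi>" "p (int_mult (int n) \<mu>) \<xi> = int n * p \<mu> \<xi>"
proof -
  have a: "additive (p \<mu>)" "additive (\<lambda>\<mu>. p \<mu> \<xi>)" for \<mu> \<xi>
    using assms by (auto simp: perfect_pairing_def)
  show "p \<mu> (\<xi> + \<xi>') = p \<mu> \<xi> + p \<mu> \<xi>'" "p (\<mu> + \<mu>') \<xi> = p \<mu> \<xi> + p \<mu>' \<xi>"
    "p \<mu> 0 = 0" "p 0 \<xi> = 0" "p \<mu> (- \<xi>) = - p \<mu> \<xi>" "p (- \<mu>) \<xi> = - p \<mu> \<xi>"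
    "p \<mu> (\<Sum>i\<in>A. f i) = (\<Sum>i\<in>A. p \<mu> (f i))"
    using additive.add [OF a(1)] additive.add [OF a(2)] additive.zero [OF a(1)] additive.zero [OF a(2)]
      additive.minus [OF a(1)] additive.minus [OF a(2)] additive.sum [OF a(1)] by simp_all
  show "p \<mu> (int_mult (int n) \<xi>) = int n * p \<mu> \<xi>" "p (int_mult (int n) \<mu>) \<xi> = int n * p \<mu> \<xi>"
    using additive.sum [OF a(1), of \<mu> "\<lambda>_. \<xi>" "{..<n}"] additive.sum [OF a(2), of "\<lambda>_. \<mu>" "{..<n}" \<xi>]
    by (simp_all add: int_mult_def)
qed

lemma torus_E_word:
  assumes "perfect_pairing (pairing D)" "gs \<in> E_words"
  shows "U_class D (fa_gen (GenK \<mu>) * mon gs) =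
      U_class D (fa_const (qq powi pairing D \<mu> (word_wt D gs)) * (mon gs * fa_gen (GenK \<mu>)))"
    "U_class D (fa_gen (GenJ \<mu>) * mon gs) =
      U_class D (fa_const (ppi powi pairing D \<mu> (word_wt D gs)) * (mon gs * fa_gen (GenJ \<mu>)))"
proof -
  have step: "U_class D (h * mon (g # gs)) = U_class D (fa_const (a * b) * (mon (g # gs) * h))"
    if "U_class D (h * fa_gen g) = U_class D (fa_const a * (fa_gen g * h))"
      "U_class D (h * mon gs) = U_class D (fa_const b * (mon gs * h))" for h g gs a b
  proof -
    have "U_class D (h * mon (g # gs)) = U_class D ((h * fa_gen g) * mon gs)"
      by (simp add: mon_Cons mult.assoc)
    also have "\<dots> = U_class D ((fa_const a * (fa_gen g * h)) * mon gs)"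
      by (rule U_class_mult_cong [OF that(1) refl])
    also have "(fa_const a * (fa_gen g * h)) * mon gs = (fa_const a * fa_gen g) * (h * mon gs)"
      by (simp add: mult.assoc)
    also have "U_class D \<dots> = U_class D ((fa_const a * fa_gen g) * (fa_const b * (mon gs * h)))"
      by (rule U_class_mult_cong [OF refl that(2)])
    also have "(fa_const a * fa_gen g) * (fa_const b * (mon gs * h)) = fa_const (a * b) * (mon (g # gs) * h)"
      by (simp add: mon_Cons mult.assoc fa_const_simps fa_const_left_commute [of "fa_gen g"])
    finally show ?thesis .
  qed
  show "U_class D (fa_gen (GenK \<mu>) * mon gs) =
      U_class D (fa_const (qq powi pairing D \<mu> (word_wt D gs)) * (mon gs * fa_gen (GenK \<mu>)))"
    using assms(2)
  proof (induction gs)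
    case (Cons g gs)
    then obtain i where "g = GenE i" by (auto simp: E_words_def)
    with Cons show ?case
      using step [OF U_rel_KJ(1) [of D \<mu> i] Cons.IH]
      by (simp add: E_words_def perfect_pairing_additive [OF assms(1)] qq_powi_add)
  qed (simp add: perfect_pairing_additive [OF assms(1)] fa_const_simps)
  show "U_class D (fa_gen (GenJ \<mu>) * mon gs) =
      U_class D (fa_const (ppi powi pairing D \<mu> (word_wt D gs)) * (mon gs * fa_gen (GenJ \<mu>)))"
    using assms(2)
  proof (induction gs)
    case (Cons g gs)
    then obtain i where "g = GenE i" by (auto simp: E_words_def)
    with Cons show ?case
      using step [OF U_rel_KJ(2) [of D \<mu> i] Cons.IH]
      by (simp add: E_words_def perfect_pairing_additive [OF assms(1)] ppi_powi_add)
  qed (simp add: perfect_pairing_additive [OF assms(1)] fa_const_simps)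
qed

lemma torus_commute_E:
  assumes "perfect_pairing (pairing D)" "p \<in> wsupp L" "L \<subseteq> E_words"
  shows "(\<And>gs. gs \<in> L \<Longrightarrow> pairing D \<mu> (word_wt D gs) = 0) \<Longrightarrow>
      U_class D (fa_gen (GenK \<mu>) * p) = U_class D (p * fa_gen (GenK \<mu>))"
    "(\<And>gs. gs \<in> L \<Longrightarrow> even (pairing D \<mu> (word_wt D gs))) \<Longrightarrow>
      U_class D (fa_gen (GenJ \<mu>) * p) = U_class D (p * fa_gen (GenJ \<mu>))"
proof -
  obtain A c where A: "finite A" "A \<subseteq> L" "p = (\<Sum>gs\<in>A. fa_const (c gs) * mon gs)"
    using assms(2) by (rule wsupp_expand)
  have *: "U_class D (h * p) = U_class D (p * h)"
    if word: "\<And>gs. gs \<in> L \<Longrightarrow> U_class D (h * mon gs) = U_class D (mon gs * h)" for h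
  proof -
    have "U_class D (h * (fa_const (c gs) * mon gs)) = U_class D (fa_const (c gs) * mon gs * h)" if "gs \<in> A" for gs
    proof -
      have "h * (fa_const (c gs) * mon gs) = fa_const (c gs) * (h * mon gs)"
        by (rule fa_const_left_commute)
      moreover have "U_class D (fa_const (c gs) * (h * mon gs)) = U_class D (fa_const (c gs) * (mon gs * h))"
        using A(2) that by (intro U_class_mult_cong [OF refl word]) auto
      ultimately show ?thesis by (simp add: mult.assoc)
    qed
    then have "h * (fa_const (c gs) * mon gs) - fa_const (c gs) * mon gs * h \<in> U_ideal D" if "gs \<in> A" for gs
      using that by (simp flip: U_class_eq_iff)
    then show ?thesis unfolding U_class_eq_iff A(3) sum_distrib_left sum_distrib_right sum_subtractf [symmetric]
      by (rule U_ideal_sum)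
  qed
  show "U_class D (fa_gen (GenK \<mu>) * p) = U_class D (p * fa_gen (GenK \<mu>))"
    if "\<And>gs. gs \<in> L \<Longrightarrow> pairing D \<mu> (word_wt D gs) = 0"
    by (rule *) (use torus_E_word(1) [OF assms(1)] assms(3) that in \<open>force simp: fa_const_simps\<close>)
  show "U_class D (fa_gen (GenJ \<mu>) * p) = U_class D (p * fa_gen (GenJ \<mu>))"
    if "\<And>gs. gs \<in> L \<Longrightarrow> even (pairing D \<mu> (word_wt D gs))"
    by (rule *) (use torus_E_word(2) [OF assms(1)] assms(3) that in \<open>force simp: fa_const_simps ppi_powi_parity\<close>)
qed

section \<open>The coideal subalgebra, its involution and the subgroup \<open>T\<close> of
  weights\<close>

locale iquantum = U_psi D \<psi>
  for D :: "('i::finite, 'x::ab_group_add, 'y::ab_group_add, 'z) iroot_datum_scheme" and \<psi> +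
  fixes \<psi>i
  assumes datum: "iquantum_datum D" and psi_i: "is_psi_i D \<psi>i"
begin

lemma pp: "perfect_pairing (pairing D)"
  using datum by (simp add: iquantum_datum_def super_root_datum_def)

lemmas pairing_simps = perfect_pairing_additive [OF pp]

text \<open>The subgroup whose cosets are the elements of \<open>Xi D\<close>; the pairing with
  \<open>Yi D\<close> vanishes on it (\<open>pairing_T\<close>).\<close>

definition T :: "'x set" where "T = {\<kappa> + tauX D \<kappa> | \<kappa>. True}"

lemma tauX_simps: "tauX D (\<xi> + \<xi>') = tauX D \<xi> + tauX D \<xi>'" "tauX D 0 = 0" "tauX D (- \<xi>) = - tauX D \<xi>"
  "tauX D (xroot D i) = xroot D (tau D i)"
proof -
  have "additive (tauX D)" using datum by (simp add: iquantum_datum_def)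
  then show "tauX D (\<xi> + \<xi>') = tauX D \<xi> + tauX D \<xi>'" "tauX D 0 = 0" "tauX D (- \<xi>) = - tauX D \<xi>"
    using additive.add additive.zero additive.minus by blast+
  show "tauX D (xroot D i) = xroot D (tau D i)" using datum by (simp add: iquantum_datum_def)
qed

lemma T_simps: "0 \<in> T" "\<xi> \<in> T \<Longrightarrow> \<xi>' \<in> T \<Longrightarrow> \<xi> + \<xi>' \<in> T" "\<xi> \<in> T \<Longrightarrow> - \<xi> \<in> T"
proof -
  show "0 \<in> T" unfolding T_def using tauX_simps(2) by (intro CollectI exI [of _ 0]) simp
  assume "\<xi> \<in> T"
  then obtain \<kappa> where \<kappa>: "\<xi> = \<kappa> + tauX D \<kappa>" by (auto simp: T_def)
  show "- \<xi> \<in> T" unfolding T_def using \<kappa> tauX_simps(3) [of \<kappa>] by (intro CollectI exI [of _ "- \<kappa>"]) simp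
  assume "\<xi>' \<in> T"
  then obtain \<kappa>' where \<kappa>': "\<xi>' = \<kappa>' + tauX D \<kappa>'" by (auto simp: T_def)
  show "\<xi> + \<xi>' \<in> T" unfolding T_def
    using \<kappa> \<kappa>' tauX_simps(1) [of \<kappa> \<kappa>'] by (intro CollectI exI [of _ "\<kappa> + \<kappa>'"]) (simp add: algebra_simps)
qed

lemma T_cancel: "\<xi>' \<in> T \<Longrightarrow> \<xi>' + \<xi> \<in> T \<longleftrightarrow> \<xi> \<in> T"
  using T_simps(2) [of "- \<xi>'" "\<xi>' + \<xi>"] T_simps(2) [of \<xi>' \<xi>] T_simps(3) [of \<xi>'] by auto

lemma pairing_T: "\<mu> \<in> Yi D \<Longrightarrow> \<xi> \<in> T \<Longrightarrow> pairing D \<mu> \<xi> = 0"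
proof -
  assume "\<mu> \<in> Yi D" "\<xi> \<in> T"
  then obtain \<kappa> where \<kappa>: "\<xi> = \<kappa> + tauX D \<kappa>" and \<mu>: "tauY D \<mu> = - \<mu>" by (auto simp: T_def Yi_def)
  have "pairing D (tauY D \<mu>) (tauX D \<kappa>) = pairing D \<mu> \<kappa>" using datum by (simp add: iquantum_datum_def)
  then show ?thesis by (simp add: \<kappa> \<mu> pairing_simps)
qed

text \<open>For odd \<open>i\<close> all entries \<open>cartan D i j\<close> are even; for even
  \<open>i\<close> the number \<open>dd D i\<close> is even by the parity condition. Consequently no
  factor \<open>\<pi>\<close> arises when a \<open>Jtilde\<close> is moved past words in the
  \<open>E\<close>'s.\<close>

lemma pairing_Jtilde_even: "even (pairing D (int_mult (int (dd D i)) (yroot D i)) (root_of D \<nu>))"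
proof -
  have *: "dd D i mod 2 = par D i" "i \<in> odd_nodes D \<Longrightarrow> even (cartan D i j)"
    "pairing D (yroot D i) (xroot D j) = cartan D i j" for j
    using datum by (simp_all add: iquantum_datum_def super_root_datum_def super_cartan_datum_def)
  show ?thesis
  proof (cases "i \<in> odd_nodes D")
    case True
    then show ?thesis
      unfolding root_of_def pairing_simps using *(2,3) by (intro dvd_mult dvd_sum) auto
  next
    case False
    then have "even (dd D i)" using *(1) by (simp add: par_def even_iff_mod_2_eq_zero)
    then show ?thesis unfolding pairing_simps by simp
  qed
qed

text \<open>A representative of \<open>UB D i\<close>; its companion \<open>bi'\<close> represents
  the image of \<open>UB D i\<close> under \<open>\<psi>\<close>.\<close>

definition bi :: "'i \<Rightarrow> ('i, 'y) free_alg" where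
  "bi i = fa_gen (GenF i) + fa_const (vs D i) * fa_gen (GenE (tau D i)) *
     fa_gen (GenK (- int_mult (int (dd D i)) (yroot D i)))"

definition bi' :: "'i \<Rightarrow> ('i, 'y) free_alg" where
  "bi' i = fa_gen (GenF i) + fa_const (qbar (vs D i)) * fa_gen (GenE (tau D i)) *
     (fa_gen (GenJ (- int_mult (int (dd D i)) (yroot D i))) * fa_gen (GenK (- (- int_mult (int (dd D i)) (yroot D i)))))"

lemma UB_bi: "UB D i = U_class D (bi i)"
  by (simp add: UB_def bi_def Ktilde_inv_def U_class_simps)

lemma psi_bi: "\<psi> (U_class D (bi i)) = U_class D (bi' i)"
  unfolding bi_def bi'_def psi_class_add psi_class_mult psi_const psi_gen psi_gen.simps
  unfolding U_class_simps ..

lemma psi_bi': "\<psi> (U_class D (bi' i)) = U_class D (bi i)"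
  using psi U_class_simps(1) unfolding psi_bi [symmetric] is_psi_def by blast

text \<open>The summands of \<open>B_i\<close> have the weights \<open>- i'\<close> and
  \<open>(\<tau> i)'\<close>, whose difference \<open>i' + (\<tau> i)'\<close> lies in
  \<open>T\<close>. So \<open>B_i\<close> is homogeneous modulo \<open>T\<close>, of class
  \<open>- i'\<close>.\<close>

definition Bi_words :: "'i \<Rightarrow> ('i, 'y) gen list set" where
  "Bi_words i = {gs. word_wt D gs + xroot D i \<in> T}"

lemma bi_wsupp: "bi i \<in> wsupp (Bi_words i)" "bi' i \<in> wsupp (Bi_words i)"
proof -
  have 1: "xroot D (tau D i) + xroot D i \<in> T"
    unfolding T_def using tauX_simps(4) [of i] by (intro CollectI exI [of _ "xroot D i"]) (simp add: add.commute)
  have "fa_gen (GenF i) \<in> wsupp (Bi_words i)"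
    by (rule wsupp_gen) (simp add: Bi_words_def T_simps)
  moreover have "mon [GenE (tau D i), GenK \<mu>] \<in> wsupp (Bi_words i)"
    "mon [GenE (tau D i), GenJ \<nu>, GenK \<mu>] \<in> wsupp (Bi_words i)" for \<mu> \<nu>
    using 1 by (auto intro!: wsupp_simps simp: Bi_words_def)
  ultimately have "fa_gen (GenF i) + fa_const c * mon [GenE (tau D i), GenK \<mu>] \<in> wsupp (Bi_words i)"
    "fa_gen (GenF i) + fa_const c * mon [GenE (tau D i), GenJ \<nu>, GenK \<mu>] \<in> wsupp (Bi_words i)" for c \<mu> \<nu>
    by (intro wsupp_simps(2) wsupp_simps(4); simp)+
  then show "bi i \<in> wsupp (Bi_words i)" "bi' i \<in> wsupp (Bi_words i)"
    unfolding bi_def bi'_def by (simp_all add: mon_Cons mult.assoc)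
qed

lemma Ui_sel [simp]: "(\<otimes>\<^bsub>Ui D\<^esub>) = (\<otimes>\<^bsub>U D\<^esub>)" "(\<oplus>\<^bsub>Ui D\<^esub>) = (\<oplus>\<^bsub>U D\<^esub>)" "\<one>\<^bsub>Ui D\<^esub> = \<one>\<^bsub>U D\<^esub>" "\<zero>\<^bsub>Ui D\<^esub> = \<zero>\<^bsub>U D\<^esub>"
  by (simp_all add: Ui_def)

definition Ui_gens :: "('i, 'y) Uelt set" where
  "Ui_gens = range (Uscal D) \<union> range (UB D) \<union> range (Jtilde D) \<union> UK D ` Yi D"

lemma carrier_Ui: "carrier (Ui D) = generate_ring (U D) Ui_gens"
  by (simp add: Ui_def Ui_gens_def)

lemma Ui_gens_carrier: "Ui_gens \<subseteq> carrier (U D)"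
  unfolding Ui_gens_def by (auto simp: UB_bi Jtilde_def U_class_simps)

lemma ring_Ui: "ring (Ui D)"
  using ring.generate_ring_is_ring [OF ring_U Ui_gens_carrier] by (simp add: Ui_def Ui_gens_def)

lemma Ui_carrier: "x \<in> carrier (Ui D) \<Longrightarrow> x \<in> carrier (U D)"
  using ring.generate_ring_in_carrier [OF ring_U Ui_gens_carrier] by (simp add: carrier_Ui)

lemma Ui_closed:
  "x \<in> carrier (Ui D) \<Longrightarrow> y \<in> carrier (Ui D) \<Longrightarrow> x \<oplus>\<^bsub>U D\<^esub> y \<in> carrier (Ui D)"
  "x \<in> carrier (Ui D) \<Longrightarrow> y \<in> carrier (Ui D) \<Longrightarrow> x \<otimes>\<^bsub>U D\<^esub> y \<in> carrier (Ui D)"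
  "x \<in> carrier (Ui D) \<Longrightarrow> \<ominus>\<^bsub>U D\<^esub> x \<in> carrier (Ui D)"
  "\<one>\<^bsub>U D\<^esub> \<in> carrier (Ui D)" "Uscal D c \<in> carrier (Ui D)" "UB D i \<in> carrier (Ui D)"
  "Jtilde D i \<in> carrier (Ui D)" "\<mu> \<in> Yi D \<Longrightarrow> UK D \<mu> \<in> carrier (Ui D)"
  unfolding carrier_Ui
  by (blast intro: generate_ring.intros, blast intro: generate_ring.intros, blast intro: generate_ring.intros,
      rule generate_ring.one) (rule generate_ring.incl; simp add: Ui_gens_def)+

lemma psi_i_hom: "\<psi>i \<in> ring_hom (Ui D) (Ui D)"
  using psi_i by (simp add: is_psi_i_def)

lemma psi_i_closed: "x \<in> carrier (Ui D) \<Longrightarrow> \<psi>i x \<in> carrier (Ui D)"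
  by (rule ring_hom_closed [OF psi_i_hom])

lemma psi_i_mult:
  "x \<in> carrier (Ui D) \<Longrightarrow> y \<in> carrier (Ui D) \<Longrightarrow> \<psi>i (x \<otimes>\<^bsub>U D\<^esub> y) = \<psi>i x \<otimes>\<^bsub>U D\<^esub> \<psi>i y"
  using ring_hom_mult [OF psi_i_hom] by simp

lemma psi_i_add:
  "x \<in> carrier (Ui D) \<Longrightarrow> y \<in> carrier (Ui D) \<Longrightarrow> \<psi>i (x \<oplus>\<^bsub>U D\<^esub> y) = \<psi>i x \<oplus>\<^bsub>U D\<^esub> \<psi>i y"
  using ring_hom_add [OF psi_i_hom] by simp

lemma psi_i_1: "\<psi>i \<one>\<^bsub>U D\<^esub> = \<one>\<^bsub>U D\<^esub>"
  using ring_hom_one [OF psi_i_hom] by simp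

lemma psi_i_const: "\<psi>i (Uscal D c) = Uscal D (qbar c)"
proof -
  interpret ring "U D" by (rule ring_U)
  have "\<psi>i (scale D (regular_module (Ui D)) c \<one>\<^bsub>U D\<^esub>) = scale D (regular_module (Ui D)) (qbar c) (\<psi>i \<one>\<^bsub>U D\<^esub>)"
    using psi_i Ui_closed(4) unfolding is_psi_i_def semilinear_def by simp
  then show ?thesis
    using psi_i_1 by (simp add: scale_def U_class_simps)
qed

lemma psi_i_uminus: "x \<in> carrier (Ui D) \<Longrightarrow> \<psi>i (\<ominus>\<^bsub>U D\<^esub> x) = \<ominus>\<^bsub>U D\<^esub> \<psi>i x"
proof -
  interpret ring "U D" by (rule ring_U)
  assume x: "x \<in> carrier (Ui D)"
  have m: "\<ominus>\<^bsub>U D\<^esub> y = Uscal D (- 1) \<otimes>\<^bsub>U D\<^esub> y" if "y \<in> carrier (U D)" for y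
    using that by (simp add: fa_const_simps U_class_simps l_minus)
  show ?thesis
    using m [OF Ui_carrier [OF x]] m [OF Ui_carrier [OF psi_i_closed [OF x]]] psi_i_mult [OF Ui_closed(5) x, of "- 1"]
    by (simp add: psi_i_const qbar_uminus)
qed

lemma psi_i_gens:
  "\<psi>i (UB D i) = UB D i" "\<psi>i (Jtilde D i) = Jtilde D i"
  "\<mu> \<in> Yi D \<Longrightarrow> \<psi>i (UK D \<mu>) = UJ D \<mu> \<otimes>\<^bsub>U D\<^esub> UK D (- \<mu>)"
  using psi_i by (simp_all add: is_psi_i_def)

text \<open>Series that yield intertwiners. Intertwining is stated for the \<open>UB D i\<close>;
  the condition on weights takes care of the torus generators (\<open>trunc_torus_commute\<close>),
  and later keeps the action within the classes of \<open>Xi D\<close>.\<close>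

definition good_family :: "(('i \<Rightarrow> nat) \<Rightarrow> ('i, 'y) free_alg) \<Rightarrow> bool" where
  "good_family Y \<longleftrightarrow> E_family Y \<and> Y (\<lambda>_. 0) = 1 \<and> (\<forall>\<nu>. Y \<nu> \<noteq> 0 \<longrightarrow> root_of D \<nu> \<in> T) \<and>
     (\<forall>i. heq D (\<lambda>n. bi i * trunc n Y) (\<lambda>n. trunc n Y * bi' i))"

text \<open>Passing a word of weight \<open>\<lambda>\<close> costs a power of \<open>q\<close> or
  of \<open>\<pi>\<close> with exponent the pairing with \<open>\<lambda>\<close>. For
  \<open>\<lambda>\<close> in \<open>T\<close> and \<open>\<mu>\<close> in \<open>Yi D\<close> this
  exponent is zero, and for a \<open>Jtilde\<close> it is even, so the scalar is
  \<open>1\<close>.\<close>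

lemma trunc_torus_commute:
  assumes "good_family Y"
  shows "\<mu> \<in> Yi D \<Longrightarrow> U_class D (fa_gen (GenK \<mu>) * trunc n Y) = U_class D (trunc n Y * fa_gen (GenK \<mu>))"
    "\<mu> \<in> Yi D \<Longrightarrow> U_class D (fa_gen (GenJ \<mu>) * trunc n Y) = U_class D (trunc n Y * fa_gen (GenJ \<mu>))"
    "\<mu> = int_mult (int (dd D i)) (yroot D i) \<Longrightarrow>
      U_class D (fa_gen (GenJ \<mu>) * trunc n Y) = U_class D (trunc n Y * fa_gen (GenJ \<mu>))"
proof -
  define L where "L = {gs. \<exists>\<nu>. gs \<in> (E_words_wt \<nu> :: ('i, 'y) gen list set) \<and> root_of D \<nu> \<in> T}"
  have L: "L \<subseteq> E_words" using E_words_wt_subset unfolding L_def by blast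
  have Y: "trunc n Y \<in> wsupp L"
    unfolding trunc_def
  proof (rule wsupp_sum)
    fix \<nu> :: "'i \<Rightarrow> nat"
    have Y: "Y \<nu> \<in> wsupp (E_words_wt \<nu>)" "Y \<nu> \<noteq> 0 \<longrightarrow> root_of D \<nu> \<in> T"
      using assms by (simp_all add: good_family_def E_family_def)
    show "Y \<nu> \<in> wsupp L"
    proof (cases "Y \<nu> = 0")
      case False
      then have "E_words_wt \<nu> \<subseteq> L" using Y(2) unfolding L_def by blast
      then show ?thesis using Y(1) wsupp_mono by blast
    qed (simp add: wsupp_simps)
  qed
  have wt: "\<exists>\<nu>. word_wt D gs = root_of D \<nu> \<and> root_of D \<nu> \<in> T" if "gs \<in> L" for gs
    using that word_wt_E_words_wt unfolding L_def by blast
  show "U_class D (fa_gen (GenK \<mu>) * trunc n Y) = U_class D (trunc n Y * fa_gen (GenK \<mu>))" if "\<mu> \<in> Yi D"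
    by (rule torus_commute_E(1) [OF pp Y L]) (use wt pairing_T [OF that] in fastforce)
  show "U_class D (fa_gen (GenJ \<mu>) * trunc n Y) = U_class D (trunc n Y * fa_gen (GenJ \<mu>))" if "\<mu> \<in> Yi D"
    by (rule torus_commute_E(2) [OF pp Y L]) (use wt pairing_T [OF that] in fastforce)
  show "U_class D (fa_gen (GenJ \<mu>) * trunc n Y) = U_class D (trunc n Y * fa_gen (GenJ \<mu>))"
    if "\<mu> = int_mult (int (dd D i)) (yroot D i)"
    by (rule torus_commute_E(2) [OF pp Y L]) (use wt pairing_Jtilde_even [of i] that in fastforce)
qed

text \<open>Intertwining spreads from the generators to the generated ring. For products both
  continuity properties enter: \<open>a * a'\<close> is moved past the series in two steps,
  multiplying one relation by \<open>a\<close> from the left and the other by \<open>b'\<close> from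
  the right.\<close>

lemma good_family_intertwines:
  assumes Y: "good_family Y" and u: "u \<in> carrier (Ui D)"
  shows "\<exists>a b. \<psi>i u = U_class D a \<and> \<psi> u = U_class D b \<and> heq D (\<lambda>n. a * trunc n Y) (\<lambda>n. trunc n Y * b)"
  using u unfolding carrier_Ui
proof (induction rule: generate_ring.induct)
  case one
  have "\<psi>i \<one>\<^bsub>U D\<^esub> = U_class D 1" "\<psi> \<one>\<^bsub>U D\<^esub> = U_class D 1"
    using psi_i_1 psi_class_1 by (simp_all add: U_class_simps)
  moreover have "heq D (\<lambda>n. 1 * trunc n Y) (\<lambda>n. trunc n Y * 1)"
    by (rule heq_refl_class) simp
  ultimately show ?case by blast
next
  case (incl h)
  then consider c where "h = Uscal D c" | i where "h = UB D i" | i where "h = Jtilde D i"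
    | \<mu> where "\<mu> \<in> Yi D" "h = UK D \<mu>" unfolding Ui_gens_def by blast
  then show ?case
  proof cases
    case (1 c)
    have "heq D (\<lambda>n. fa_const (qbar c) * trunc n Y) (\<lambda>n. trunc n Y * fa_const (qbar c))"
      by (rule heq_refl_class) (simp add: fa_const_commute)
    then show ?thesis unfolding 1 psi_i_const psi_const by blast
  next
    case (2 i)
    have "\<psi>i h = U_class D (bi i)" "\<psi> h = U_class D (bi' i)"
      unfolding 2 psi_i_gens by (simp_all add: UB_bi psi_bi)
    moreover have "heq D (\<lambda>n. bi i * trunc n Y) (\<lambda>n. trunc n Y * bi' i)"
      using Y by (simp add: good_family_def)
    ultimately show ?thesis by blast
  next
    case (3 i)
    let ?J = "fa_gen (GenJ (int_mult (int (dd D i)) (yroot D i)))"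
    have "\<psi>i h = U_class D ?J" "\<psi> h = U_class D ?J"
      unfolding 3 psi_i_gens unfolding Jtilde_def psi_gen by simp_all
    moreover have "heq D (\<lambda>n. ?J * trunc n Y) (\<lambda>n. trunc n Y * ?J)"
      by (rule heq_refl_class) (rule trunc_torus_commute(3) [OF Y refl])
    ultimately show ?thesis by blast
  next
    case (4 \<mu>)
    let ?JK = "fa_gen (GenJ \<mu>) * fa_gen (GenK (- \<mu>))"
    have \<mu>: "- \<mu> \<in> Yi D"
    proof -
      have "additive (tauY D)" using datum by (simp add: iquantum_datum_def)
      then show ?thesis using 4(1) by (simp add: Yi_def additive.minus)
    qed
    have "\<psi>i h = U_class D ?JK" "\<psi> h = U_class D ?JK"
      unfolding 4(2) psi_i_gens(3) [OF 4(1)] psi_gen psi_gen.simps U_class_simps by (rule refl)+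
    moreover have "heq D (\<lambda>n. ?JK * trunc n Y) (\<lambda>n. trunc n Y * ?JK)"
    proof (rule heq_refl_class)
      fix n
      have "U_class D (?JK * trunc n Y) = U_class D (fa_gen (GenJ \<mu>) * (fa_gen (GenK (- \<mu>)) * trunc n Y))"
        by (simp add: mult.assoc)
      also have "\<dots> = U_class D (fa_gen (GenJ \<mu>) * (trunc n Y * fa_gen (GenK (- \<mu>))))"
        by (rule U_class_mult_cong [OF refl trunc_torus_commute(1) [OF Y \<mu>]])
      also have "\<dots> = U_class D ((fa_gen (GenJ \<mu>) * trunc n Y) * fa_gen (GenK (- \<mu>)))"
        by (simp add: mult.assoc)
      also have "\<dots> = U_class D ((trunc n Y * fa_gen (GenJ \<mu>)) * fa_gen (GenK (- \<mu>)))"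
        by (rule U_class_mult_cong [OF trunc_torus_commute(2) [OF Y 4(1)] refl])
      finally show "U_class D (?JK * trunc n Y) = U_class D (trunc n Y * ?JK)" by (simp add: mult.assoc)
    qed
    ultimately show ?thesis by blast
  qed
next
  case (a_inv h)
  then obtain a b where ab: "\<psi>i h = U_class D a" "\<psi> h = U_class D b"
    and "heq D (\<lambda>n. a * trunc n Y) (\<lambda>n. trunc n Y * b)" by blast
  then have "heq D (\<lambda>n. - a * trunc n Y) (\<lambda>n. trunc n Y * - b)" using heq_uminus by fastforce
  moreover have h: "h \<in> carrier (Ui D)" using a_inv by (simp add: carrier_Ui)
  have "\<psi>i (\<ominus>\<^bsub>U D\<^esub> h) = U_class D (- a)" using psi_i_uminus [OF h] ab by (simp add: U_class_simps)
  moreover obtain p where p: "h = U_class D p" using Ui_carrier [OF h] unfolding carrier_U by blast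
  have "\<psi> (\<ominus>\<^bsub>U D\<^esub> h) = U_class D (- b)"
  proof -
    have eq: "- p = fa_const (- 1) * p" "- b = fa_const (- 1) * b" by (simp_all add: fa_const_simps)
    have "\<psi> (U_class D (- p)) = U_class D (- b)"
      unfolding eq psi_class_mult ab(2) [unfolded p] psi_const
      unfolding U_class_simps(3) qbar_uminus qbar_1 by (rule refl)
    then show ?thesis by (simp add: p U_class_simps)
  qed
  ultimately show ?case by blast
next
  case (eng_add h1 h2)
  then obtain a b a' b' where ab: "\<psi>i h1 = U_class D a" "\<psi> h1 = U_class D b" "\<psi>i h2 = U_class D a'" "\<psi> h2 = U_class D b'"
    and eq: "heq D (\<lambda>n. a * trunc n Y) (\<lambda>n. trunc n Y * b)" "heq D (\<lambda>n. a' * trunc n Y) (\<lambda>n. trunc n Y * b')" by blast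
  have h: "h1 \<in> carrier (Ui D)" "h2 \<in> carrier (Ui D)" using eng_add by (simp_all add: carrier_Ui)
  have "heq D (\<lambda>n. (a + a') * trunc n Y) (\<lambda>n. trunc n Y * (b + b'))"
    using heq_add [OF eq] by (simp add: algebra_simps)
  moreover have "\<psi>i (h1 \<oplus>\<^bsub>U D\<^esub> h2) = U_class D (a + a')"
    using psi_i_add [OF h] ab by (simp add: U_class_simps)
  moreover have "\<psi> (h1 \<oplus>\<^bsub>U D\<^esub> h2) = U_class D (b + b')"
    using ring_hom_add [OF psi_hom Ui_carrier [OF h(1)] Ui_carrier [OF h(2)]] ab by (simp add: U_class_simps)
  ultimately show ?case by blast
next
  case (eng_mult h1 h2)
  then obtain a b a' b' where ab: "\<psi>i h1 = U_class D a" "\<psi> h1 = U_class D b" "\<psi>i h2 = U_class D a'" "\<psi> h2 = U_class D b'"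
    and eq: "heq D (\<lambda>n. a * trunc n Y) (\<lambda>n. trunc n Y * b)" "heq D (\<lambda>n. a' * trunc n Y) (\<lambda>n. trunc n Y * b')" by blast
  have h: "h1 \<in> carrier (Ui D)" "h2 \<in> carrier (Ui D)" using eng_mult by (simp_all add: carrier_Ui)
  have "heq D (\<lambda>n. (a * a') * trunc n Y) (\<lambda>n. trunc n Y * (b * b'))"
    using heq_trans [OF heq_left [OF eq(2), of "\<lambda>_. a"]] heq_right [OF eq(1), of b'] by (simp add: mult.assoc)
  moreover have "\<psi>i (h1 \<otimes>\<^bsub>U D\<^esub> h2) = U_class D (a * a')"
    using psi_i_mult [OF h] ab by (simp add: U_class_simps)
  moreover have "\<psi> (h1 \<otimes>\<^bsub>U D\<^esub> h2) = U_class D (b * b')"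
    using ring_hom_mult [OF psi_hom Ui_carrier [OF h(1)] Ui_carrier [OF h(2)]] ab by (simp add: U_class_simps)
  ultimately show ?case by blast
qed

lemma good_family_intertwiner:
  assumes "good_family Y" shows "intertwiner D \<psi> \<psi>i (\<lambda>\<nu>. U_class D (Y \<nu>))"
  unfolding intertwiner_def
proof (intro conjI allI ballI)
  show "U_class D (Y \<nu>) \<in> U_plus_wt D \<nu>" for \<nu>
    using assms unfolding U_plus_wt_words good_family_def E_family_def by blast
  show "U_class D (Y (\<lambda>_. 0)) = \<one>\<^bsub>U D\<^esub>"
    using assms by (simp add: good_family_def U_class_simps)
  fix u assume "u \<in> carrier (Ui D)"
  then obtain a b where "\<psi>i u = U_class D a" "\<psi> u = U_class D b"
    "heq D (\<lambda>n. a * trunc n Y) (\<lambda>n. trunc n Y * b)"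
    using good_family_intertwines [OF assms] by blast
  then show "hat_eq D (\<lambda>n. \<psi>i u \<otimes>\<^bsub>U D\<^esub> hat_sum D (\<lambda>\<nu>. U_class D (Y \<nu>)) n)
      (\<lambda>n. hat_sum D (\<lambda>\<nu>. U_class D (Y \<nu>)) n \<otimes>\<^bsub>U D\<^esub> \<psi> u)"
    unfolding hat_sum_trunc by (simp only: hat_eq_iff_heq flip: U_class_simps(3))
qed

text \<open>Projecting to the weights in \<open>T\<close> preserves the intertwining property, so by uniqueness
  the components of the quasi-\<open>K\<close>-matrix outside of \<open>T\<close> may be ignored.\<close>

lemma quasi_K_good_family:
  assumes "is_quasi_K D \<psi> \<psi>i \<Upsilon>"
  obtains Y where "good_family Y" "hat_eq D (\<lambda>n. U_class D (trunc n Y)) (hat_sum D \<Upsilon>)"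
proof -
  have int: "intertwiner D \<psi> \<psi>i \<Upsilon>" using assms by (simp add: is_quasi_K_def)
  \<comment> \<open>The representative in weight zero is chosen to be \<open>1\<close> itself and
    not just congruent to \<open>1\<close>, as \<open>good_family\<close> demands an equation in the
    free algebra.\<close>
  have "\<exists>p. p \<in> wsupp (E_words_wt \<nu>) \<and> \<Upsilon> \<nu> = U_class D p \<and> (\<nu> = (\<lambda>_. 0) \<longrightarrow> p = 1)" for \<nu>
  proof (cases "\<nu> = (\<lambda>_. 0)")
    case True
    have "mon [] \<in> wsupp (E_words_wt \<nu>)" by (rule wsupp_simps) (simp add: True E_words_wt_def)
    then show ?thesis using int True by (intro exI [of _ 1]) (simp add: intertwiner_def U_class_simps)
  next
    case False
    then show ?thesis using int unfolding intertwiner_def U_plus_wt_words by blast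
  qed
  then obtain Z where Z: "\<And>\<nu>. Z \<nu> \<in> wsupp (E_words_wt \<nu>)" "\<And>\<nu>. \<Upsilon> \<nu> = U_class D (Z \<nu>)" "Z (\<lambda>_. 0) = 1"
    by metis
  have ZU: "\<Upsilon> = (\<lambda>\<nu>. U_class D (Z \<nu>))" using Z(2) by blast
  define Y where "Y \<nu> = (if root_of D \<nu> \<in> T then Z \<nu> else 0)" for \<nu>
  have EY: "E_family Y" using Z(1) by (simp add: E_family_def Y_def wsupp_simps)
  have trunc: "trunc n Y = wproj D T (trunc n Z)" for n
  proof -
    have "wproj D T (Z \<nu>) = Y \<nu>" for \<nu>
      using wproj_inside [OF Z(1), of \<nu> D T] wproj_outside [OF Z(1), of \<nu> D T] word_wt_E_words_wt [of _ \<nu> D]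
      by (auto simp: Y_def)
    then show ?thesis by (simp add: trunc_def wproj_sum)
  qed
  have "heq D (\<lambda>n. bi i * trunc n Y) (\<lambda>n. trunc n Y * bi' i)" for i
  proof -
    have "hat_eq D (\<lambda>n. \<psi>i (UB D i) \<otimes>\<^bsub>U D\<^esub> hat_sum D \<Upsilon> n) (\<lambda>n. hat_sum D \<Upsilon> n \<otimes>\<^bsub>U D\<^esub> \<psi> (UB D i))"
      using int Ui_closed(6) unfolding intertwiner_def by blast
    then have Z_eq: "heq D (\<lambda>n. bi i * trunc n Z) (\<lambda>n. trunc n Z * bi' i)"
      unfolding ZU hat_sum_trunc psi_i_gens unfolding UB_bi psi_bi by (simp only: hat_eq_iff_heq flip: U_class_simps(3))
    \<comment> \<open>The coset of \<open>T\<close> to which every word of \<open>bi i\<close> and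
      \<open>bi' i\<close> translates \<open>T\<close>. Projecting the relation for \<open>Z\<close>
      to \<open>?S\<close> therefore gives the relation for the truncated family.\<close>
    let ?S = "{\<xi>. \<xi> + xroot D i \<in> T}"
    have *: "word_wt D gs + \<xi> \<in> ?S \<longleftrightarrow> \<xi> \<in> T" "\<xi> + word_wt D gs \<in> ?S \<longleftrightarrow> \<xi> \<in> T" if "gs \<in> Bi_words i" for gs \<xi>
      using that T_cancel [of "word_wt D gs + xroot D i" \<xi>] by (simp_all add: Bi_words_def algebra_simps)
    have "wproj D ?S (bi i * trunc n Z - trunc n Z * bi' i) = bi i * trunc n Y - trunc n Y * bi' i" for n
      unfolding wproj_diff trunc
      using wproj_mult_left [OF bi_wsupp(1) *(1), of i "trunc n Z"] wproj_mult_right [OF bi_wsupp(2) *(2), of i "trunc n Z"]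
      by simp
    then show ?thesis using Z_eq wproj_mspan unfolding heq_def by metis
  qed
  moreover have "Y (\<lambda>_. 0) = 1" using Z(3) T_simps(1) by (simp add: Y_def root_of_def)
  moreover have "root_of D \<nu> \<in> T" if "Y \<nu> \<noteq> 0" for \<nu> using that by (auto simp: Y_def split: if_splits)
  ultimately have good: "good_family Y" using EY by (simp add: good_family_def)
  then have "hat_eq D (hat_sum D (\<lambda>\<nu>. U_class D (Y \<nu>))) (hat_sum D \<Upsilon>)"
    using good_family_intertwiner assms unfolding is_quasi_K_def by blast
  moreover have "hat_sum D (\<lambda>\<nu>. U_class D (Y \<nu>)) = (\<lambda>n. U_class D (trunc n Y))"
    by (rule ext) (rule hat_sum_trunc)
  ultimately show ?thesis using good that by simp
qed

text \<open>\<open>\<Upsilon> \<psi>(\<Upsilon>) \<Upsilon>\<close> has the intertwining property as well, hence equals \<open>\<Upsilon>\<close>.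
  This shows \<open>\<Upsilon> \<psi>(\<Upsilon>) = 1\<close> without having to invert \<open>\<Upsilon>\<close> in the completion.\<close>

definition triple :: "(('i \<Rightarrow> nat) \<Rightarrow> ('i, 'y) free_alg) \<Rightarrow> ('i \<Rightarrow> nat) \<Rightarrow> ('i, 'y) free_alg" where
  "triple Y = conv (conv Y (\<lambda>\<nu>. bar_coeffs (Y \<nu>))) Y"

lemma trunc_triple:
  assumes "E_family Y"
  shows "trunc n Y * bar_coeffs (trunc n Y) * trunc n Y - trunc n (triple Y) \<in> wsupp (E_long n)"
proof -
  let ?bY = "\<lambda>\<nu>. bar_coeffs (Y \<nu>)"
  note E = E_family_bar [OF assms] E_family_conv [OF assms E_family_bar [OF assms]]
  have "(trunc n Y * bar_coeffs (trunc n Y) - trunc n (conv Y ?bY)) * trunc n Y \<in> wsupp (E_long n)"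
    using trunc_conv [OF assms E(1), of n] trunc_E_words [OF assms, of n]
    unfolding trunc_bar by (rule wsupp_mult) (auto simp: E_long_def E_words_def)
  moreover have "trunc n (conv Y ?bY) * trunc n Y - trunc n (triple Y) \<in> wsupp (E_long n)"
    unfolding triple_def by (rule trunc_conv [OF E(2) assms])
  ultimately have "(trunc n Y * bar_coeffs (trunc n Y) - trunc n (conv Y ?bY)) * trunc n Y +
      (trunc n (conv Y ?bY) * trunc n Y - trunc n (triple Y)) \<in> wsupp (E_long n)"
    by (rule wsupp_simps)
  then show ?thesis by (simp add: algebra_simps)
qed

lemma conv_T:
  assumes "\<And>\<nu>. Y \<nu> \<noteq> 0 \<Longrightarrow> root_of D \<nu> \<in> T" "\<And>\<nu>. Z \<nu> \<noteq> 0 \<Longrightarrow> root_of D \<nu> \<in> T" "conv Y Z \<nu> \<noteq> 0"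
  shows "root_of D \<nu> \<in> T"
proof -
  obtain \<alpha> where \<alpha>: "\<forall>i. \<alpha> i \<le> \<nu> i" "Y \<alpha> * Z (\<lambda>i. \<nu> i - \<alpha> i) \<noteq> 0"
    using assms(3) sum.not_neutral_contains_not_neutral unfolding conv_def by (metis (mono_tags, lifting) mem_Collect_eq)
  then have "root_of D \<alpha> \<in> T" "root_of D (\<lambda>i. \<nu> i - \<alpha> i) \<in> T" using assms(1,2) by force+
  then have "root_of D (\<lambda>i. \<alpha> i + (\<nu> i - \<alpha> i)) \<in> T" unfolding root_of_add by (rule T_simps)
  then show ?thesis using \<alpha>(1) by simp
qed

lemma conv_0: "conv Y Z (\<lambda>_. 0) = Y (\<lambda>_. 0) * Z (\<lambda>_. 0)"
proof -
  have "conv Y Z (\<lambda>_. 0) = (\<Sum>\<alpha>\<in>{\<lambda>_. 0}. Y \<alpha> * Z (\<lambda>i. 0 - \<alpha> i))"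
    unfolding conv_def by (rule sum.cong) auto
  then show ?thesis by simp
qed

text \<open>The relation \<open>bi * s = s * bi'\<close> turns under \<open>\<psi>\<close> into the
  one with \<open>bi\<close> and \<open>bi'\<close> exchanged. So the three factors
  \<open>s\<close>, its conjugate and \<open>s\<close> take \<open>bi\<close> to \<open>bi'\<close>,
  back to \<open>bi\<close>, and to \<open>bi'\<close> again.\<close>

lemma good_family_triple:
  assumes "good_family Y" shows "good_family (triple Y)"
proof -
  have Y: "E_family Y" "Y (\<lambda>_. 0) = 1" "\<And>\<nu>. Y \<nu> \<noteq> 0 \<Longrightarrow> root_of D \<nu> \<in> T"
    "\<And>i. heq D (\<lambda>n. bi i * trunc n Y) (\<lambda>n. trunc n Y * bi' i)"
    using assms by (simp_all add: good_family_def)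
  let ?bY = "\<lambda>\<nu>. bar_coeffs (Y \<nu>)"
  have bY: "root_of D \<nu> \<in> T" if "?bY \<nu> \<noteq> 0" for \<nu>
    using that Y(3) by (cases "Y \<nu> = 0") auto
  have E: "trunc n Y \<in> wsupp E_words" "bar_coeffs (trunc n Y) \<in> wsupp E_words" for n
    using trunc_E_words [OF Y(1)] bar_coeffs_wsupp by blast+
  have E2: "bar_coeffs (trunc n Y) * trunc n Y \<in> wsupp E_words" for n
    by (rule wsupp_mult [OF E(2) E(1)]) (simp add: E_words_def)
  define s where "s n = trunc n Y" for n
  have psi_s: "\<psi> (U_class D (s n)) = U_class D (bar_coeffs (s n))" for n
    unfolding s_def by (rule psi_E_words [OF E(1)])
  have "heq D (\<lambda>n. bi i * trunc n (triple Y)) (\<lambda>n. trunc n (triple Y) * bi' i)" for i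
  proof -
    have H: "heq D (\<lambda>n. bi i * s n) (\<lambda>n. s n * bi' i)" unfolding s_def by (rule Y)
    then have H': "heq D (\<lambda>n. bi' i * bar_coeffs (s n)) (\<lambda>n. bar_coeffs (s n) * bi i)"
    proof (rule heq_psi)
      show "\<psi> (U_class D (bi i * s n)) = U_class D (bi' i * bar_coeffs (s n))" for n
        unfolding psi_class_mult psi_bi psi_s unfolding U_class_simps ..
      show "\<psi> (U_class D (s n * bi' i)) = U_class D (bar_coeffs (s n) * bi i)" for n
        unfolding psi_class_mult psi_bi' psi_s unfolding U_class_simps ..
    qed
    define z where "z n = s n * bar_coeffs (s n) * s n" for n
    \<comment> \<open>The element is moved past one factor at a time. All factors to its right are
      words in the \<open>E\<close>'s, so multiplication by them is uniformly continuous although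
      they vary with \<open>n\<close>.\<close>
    have "heq D (\<lambda>n. bi i * s n * (bar_coeffs (s n) * s n)) (\<lambda>n. s n * bi' i * (bar_coeffs (s n) * s n))"
      using H E2 by (intro heq_right_E) (simp_all add: s_def)
    moreover have "heq D (\<lambda>n. s n * (bi' i * bar_coeffs (s n)) * s n) (\<lambda>n. s n * (bar_coeffs (s n) * bi i) * s n)"
      using H' E(1) by (intro heq_right_E heq_left) (simp_all add: s_def)
    moreover have "heq D (\<lambda>n. s n * bar_coeffs (s n) * (bi i * s n)) (\<lambda>n. s n * bar_coeffs (s n) * (s n * bi' i))"
      using H by (rule heq_left)
    ultimately have z: "heq D (\<lambda>n. bi i * z n) (\<lambda>n. z n * bi' i)"
      unfolding z_def mult.assoc by (blast intro: heq_trans)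
    have zt: "heq D z (\<lambda>n. trunc n (triple Y))"
      by (rule heq_E_long) (simp add: z_def s_def trunc_triple [OF Y(1)])
    show ?thesis
      using heq_trans [OF heq_trans [OF heq_left [OF heq_sym [OF zt], of "\<lambda>_. bi i"] z] heq_right [OF zt, of "bi' i"]] .
  qed
  moreover have "root_of D \<nu> \<in> T" if "triple Y \<nu> \<noteq> 0" for \<nu>
  proof -
    have "root_of D \<nu> \<in> T" if "conv Y ?bY \<nu> \<noteq> 0" for \<nu>
      using conv_T [of Y ?bY \<nu>] Y(3) bY that by blast
    then show ?thesis using conv_T [of "conv Y ?bY" Y \<nu>] Y(3) that unfolding triple_def by blast
  qed
  moreover have "triple Y (\<lambda>_. 0) = 1" by (simp add: triple_def conv_0 Y(2))
  moreover have "E_family (triple Y)"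
    unfolding triple_def by (intro E_family_conv E_family_bar Y(1))
  ultimately show ?thesis by (simp add: good_family_def)
qed

end

section \<open>Weight modules\<close>

lemma (in U_module) minus_eq_zero_iff [simp]:
  assumes "x \<in> carrier M" "y \<in> carrier M" shows "x \<ominus> y = \<zero> \<longleftrightarrow> x = y"
proof
  assume "x \<ominus> y = \<zero>"
  then have "\<ominus> (\<ominus> y) = x" using assms by (intro M.minus_equality) (simp_all add: a_minus_def)
  then show "x = y" using assms by simp
qed (use assms in \<open>simp add: a_minus_def M.r_neg\<close>)

lemma torus_gen:
  assumes "perfect_pairing (pairing D)"
  shows "U_class D (fa_gen (GenK \<mu>) * fa_gen g) =
      U_class D (fa_const (qq powi pairing D \<mu> (gen_wt D g)) * (fa_gen g * fa_gen (GenK \<mu>)))"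
    "U_class D (fa_gen (GenJ \<mu>) * fa_gen g) =
      U_class D (fa_const (ppi powi pairing D \<mu> (gen_wt D g)) * (fa_gen g * fa_gen (GenJ \<mu>)))"
proof -
  note p = perfect_pairing_additive [OF assms]
  show "U_class D (fa_gen (GenK \<mu>) * fa_gen g) =
      U_class D (fa_const (qq powi pairing D \<mu> (gen_wt D g)) * (fa_gen g * fa_gen (GenK \<mu>)))"
  proof (cases g)
    case (GenK \<nu>)
    have "U_class D (fa_gen (GenK \<mu>) * fa_gen (GenK \<nu>)) = U_class D (fa_gen (GenK \<nu>) * fa_gen (GenK \<mu>))"
      unfolding U_rel_torus(2) [symmetric] by (simp add: add.commute)
    then show ?thesis by (simp add: GenK p fa_const_simps)
  next
    case (GenJ \<nu>)
    then show ?thesis using U_rel_torus(5) [of D \<nu> \<mu>] by (simp add: p fa_const_simps)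
  qed (simp_all add: p U_rel_KJ)
  show "U_class D (fa_gen (GenJ \<mu>) * fa_gen g) =
      U_class D (fa_const (ppi powi pairing D \<mu> (gen_wt D g)) * (fa_gen g * fa_gen (GenJ \<mu>)))"
  proof (cases g)
    case (GenJ \<nu>)
    have "U_class D (fa_gen (GenJ \<mu>) * fa_gen (GenJ \<nu>)) = U_class D (fa_gen (GenJ \<nu>) * fa_gen (GenJ \<mu>))"
      unfolding U_rel_torus(4) [symmetric] by (simp add: add.commute)
    then show ?thesis by (simp add: GenJ p fa_const_simps)
  next
    case (GenK \<nu>)
    then show ?thesis using U_rel_torus(5) [of D \<mu> \<nu>] by (simp add: p fa_const_simps)
  qed (simp_all add: p U_rel_KJ)
qed

locale U_weight = U_module D M
  for D :: "('i::finite, 'x::ab_group_add, 'y::ab_group_add, 'z) root_datum_scheme"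
    and M :: "(('i, 'y) Uelt, 'm) module" (structure) +
  assumes perfect: "perfect_pairing (pairing D)"
begin

abbreviation wt where "wt \<equiv> wt_space D M"

lemma wt_closed [simp]: "m \<in> wt \<xi> \<Longrightarrow> m \<in> carrier M"
  by (simp add: wt_space_def)

lemma wt_K: "m \<in> wt \<xi> \<Longrightarrow> act (fa_gen (GenK \<mu>)) m = scale D M (qq powi pairing D \<mu> \<xi>) m"
  and wt_J: "m \<in> wt \<xi> \<Longrightarrow> act (fa_gen (GenJ \<mu>)) m = scale D M (ppi powi pairing D \<mu> \<xi>) m"
  unfolding wt_space_def by blast+

lemma wt_add: "m \<in> wt \<xi> \<Longrightarrow> n \<in> wt \<xi> \<Longrightarrow> m \<oplus> n \<in> wt \<xi>"
  unfolding wt_space_def by (simp add: act_add_right scale_simps)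

lemma wt_0: "\<zero> \<in> wt \<xi>"
  unfolding wt_space_def by simp

lemma wt_scale: "m \<in> wt \<xi> \<Longrightarrow> scale D M c m \<in> wt \<xi>"
proof -
  assume m: "m \<in> wt \<xi>"
  then have "act p (scale D M c m) = scale D M c (act p m)" for p by (simp add: scale_act)
  then show ?thesis using m
    unfolding wt_space_def by (auto simp: scale_simps(3) [symmetric] mult.commute)
qed

lemma wt_uminus: "m \<in> wt \<xi> \<Longrightarrow> \<ominus> m \<in> wt \<xi>"
  using wt_scale [of m \<xi> "- 1"] by (simp add: scale_simps)

lemma wt_finsum: "f \<in> A \<rightarrow> wt \<xi> \<Longrightarrow> (\<Oplus>a\<in>A. f a) \<in> wt \<xi>"
proof (induction A rule: infinite_finite_induct)
  case (insert a A)
  then have "f \<in> A \<rightarrow> carrier M" "f a \<in> wt \<xi>" "f \<in> A \<rightarrow> wt \<xi>" using wt_closed by blast+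
  then show ?case using insert by (simp add: wt_add)
qed (simp_all add: wt_0)

lemma wt_act_gen:
  assumes "m \<in> wt \<xi>" shows "act (fa_gen g) m \<in> wt (gen_wt D g + \<xi>)"
proof -
  have m: "m \<in> carrier M" using assms by simp
  have *: "act h (act (fa_gen g) m) = scale D M (a * b) (act (fa_gen g) m)"
    if "U_class D (h * fa_gen g) = U_class D (fa_const a * (fa_gen g * h))" "act h m = scale D M b m" for h a b
  proof -
    have "act h (act (fa_gen g) m) = act (fa_const a * (fa_gen g * h)) m"
      using m by (simp add: that(1) flip: act_mult)
    also have "\<dots> = scale D M a (act (fa_gen g) (scale D M b m))"
      using m by (simp add: act_mult act_const that(2))
    also have "\<dots> = scale D M (a * b) (act (fa_gen g) m)"
      using m by (simp add: scale_simps scale_act)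
    finally show ?thesis .
  qed
  show ?thesis
    unfolding wt_space_def
    using m *[OF torus_gen(1) [OF perfect] wt_K [OF assms]] *[OF torus_gen(2) [OF perfect] wt_J [OF assms]]
    by (simp add: perfect_pairing_additive [OF perfect] qq_powi_add ppi_powi_add)
qed

lemma wt_act_word: "m \<in> wt \<xi> \<Longrightarrow> act (mon gs) m \<in> wt (word_wt D gs + \<xi>)"
proof (induction gs)
  case (Cons g gs)
  then have "act (fa_gen g) (act (mon gs) m) \<in> wt (gen_wt D g + (word_wt D gs + \<xi>))"
    by (intro wt_act_gen) simp
  then show ?case using Cons.prems by (simp add: mon_Cons act_mult add.assoc)
qed simp

lemma wt_act_wsupp:
  assumes "p \<in> wsupp L" "\<And>gs. gs \<in> L \<Longrightarrow> word_wt D gs = \<alpha>" "m \<in> wt \<xi>"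
  shows "act p m \<in> wt (\<alpha> + \<xi>)"
proof -
  obtain A c where A: "finite A" "A \<subseteq> L" "p = (\<Sum>gs\<in>A. fa_const (c gs) * mon gs)"
    using assms(1) by (rule wsupp_expand)
  have "act (fa_const (c gs) * mon gs) m \<in> wt (\<alpha> + \<xi>)" if "gs \<in> A" for gs
    using wt_act_word [OF assms(3), of gs] assms(2) [of gs] A(2) that assms(3)
    by (auto simp: act_mult act_const intro: wt_scale)
  then show ?thesis unfolding A(3) using A(1) assms(3) by (auto simp: act_sum intro: wt_finsum)
qed

lemma pairing_separates:
  assumes "\<xi> \<noteq> \<xi>'" obtains \<mu> where "pairing D \<mu> \<xi> \<noteq> pairing D \<mu> \<xi>'"
proof -
  have "additive (\<lambda>\<mu>. pairing D \<mu> \<xi>)" using perfect by (simp add: perfect_pairing_def)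
  then have "\<exists>!\<xi>'. (\<lambda>\<mu>. pairing D \<mu> \<xi>) = (\<lambda>\<mu>. pairing D \<mu> \<xi>')"
    using perfect unfolding perfect_pairing_def by blast
  then have "(\<lambda>\<mu>. pairing D \<mu> \<xi>) \<noteq> (\<lambda>\<mu>. pairing D \<mu> \<xi>')" using assms by metis
  then show ?thesis using that by auto
qed

text \<open>The operator \<open>K_\<mu>\<close> minus its eigenvalue at \<open>\<xi>0\<close> kills
  the component of weight \<open>\<xi>0\<close> and multiplies the one of weight
  \<open>\<xi>\<close> by a difference of two powers of \<open>q\<close>. With \<open>\<mu>\<close>
  chosen to separate the two weights this difference is a unit and can be cancelled.\<close>

lemma wt_independent:
  assumes "finite t" "\<And>\<xi>. \<xi> \<in> t \<Longrightarrow> f \<xi> \<in> wt \<xi>" "(\<Oplus>\<xi>\<in>t. f \<xi>) = \<zero>" "\<xi> \<in> t"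
  shows "f \<xi> = \<zero>"
  using assms
proof (induction t arbitrary: f \<xi> rule: finite_induct)
  case (insert \<xi>0 t)
  have f: "f \<in> insert \<xi>0 t \<rightarrow> carrier M" "f \<in> t \<rightarrow> carrier M" "f \<xi>0 \<in> carrier M"
    using insert.prems(1) wt_closed by blast+
  have t: "f \<xi> = \<zero>" if "\<xi> \<in> t" for \<xi>
  proof -
    have "\<xi> \<noteq> \<xi>0" using that insert by blast
    then obtain \<mu> where \<mu>: "pairing D \<mu> \<xi> \<noteq> pairing D \<mu> \<xi>0" by (rule pairing_separates)
    let ?op = "fa_gen (GenK \<mu>) - fa_const (qq powi pairing D \<mu> \<xi>0)"
    let ?g = "\<lambda>\<xi>. scale D M (qq powi pairing D \<mu> \<xi> - qq powi pairing D \<mu> \<xi>0) (f \<xi>)"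
    have g: "act ?op (f \<xi>) = ?g \<xi>" if "\<xi> \<in> insert \<xi>0 t" for \<xi>
      using wt_K [OF insert.prems(1) [OF that], of \<mu>] insert.prems(1) [OF that]
      by (simp add: act_diff act_const scale_simps)
    have "\<zero> = act ?op (\<Oplus>\<xi>\<in>insert \<xi>0 t. f \<xi>)" by (simp add: insert.prems(2))
    also have "\<dots> = (\<Oplus>\<xi>\<in>insert \<xi>0 t. act ?op (f \<xi>))" using f(1) by (rule act_finsum)
    also have "\<dots> = (\<Oplus>\<xi>\<in>insert \<xi>0 t. ?g \<xi>)"
      using f(1) g by (intro M.finsum_cong') (auto simp: Pi_iff)
    also have "\<dots> = ?g \<xi>0 \<oplus> (\<Oplus>\<xi>\<in>t. ?g \<xi>)"
      using insert.hyps f by (intro M.finsum_insert) (auto simp: Pi_iff)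
    also have "?g \<xi>0 = \<zero>" using f(3) by (simp add: scale_simps)
    finally have "(\<Oplus>\<xi>\<in>t. ?g \<xi>) = \<zero>"
      using f(2) by (metis (no_types, lifting) M.finsum_closed M.l_zero Pi_I Pi_mem scale_closed)
    then have "?g \<xi> = \<zero>"
      using insert.prems(1) that by (intro insert.IH [of ?g \<xi>]) (auto intro: wt_scale)
    then show "f \<xi> = \<zero>"
      using scale_cancel [OF qq_powi_diff_unit [OF \<mu>]] f(2) that by blast
  qed
  then have "(\<Oplus>\<xi>\<in>t. f \<xi>) = \<zero>" by (intro M.add.finprod_one_eqI)
  then have "f \<xi>0 = \<zero>" using insert.prems(2) insert.hyps f by simp
  then show ?case using t insert.prems(3) by blast
qed simp

lemma wt_unique: "m \<in> wt \<xi> \<Longrightarrow> m \<in> wt \<xi>' \<Longrightarrow> m \<noteq> \<zero> \<Longrightarrow> \<xi> = \<xi>'"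
proof (rule ccontr)
  assume m: "m \<in> wt \<xi>" "m \<in> wt \<xi>'" "m \<noteq> \<zero>" and ne: "\<xi> \<noteq> \<xi>'"
  let ?f = "\<lambda>\<kappa>. if \<kappa> = \<xi> then m else \<ominus> m"
  have "(\<Oplus>\<kappa>\<in>{\<xi>, \<xi>'}. ?f \<kappa>) = m \<oplus> \<ominus> m" using m ne by simp
  then have "(\<Oplus>\<kappa>\<in>{\<xi>, \<xi>'}. ?f \<kappa>) = \<zero>" using m by (simp add: M.r_neg)
  moreover have "?f \<kappa> \<in> wt \<kappa>" if "\<kappa> \<in> {\<xi>, \<xi>'}" for \<kappa> using that m wt_uminus by auto
  ultimately have "?f \<xi> = \<zero>" by (intro wt_independent [of "{\<xi>, \<xi>'}" ?f \<xi>]) simp_all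
  then show False using m(3) by simp
qed


subsection \<open>Coarser gradings\<close>

abbreviation iwt where "iwt \<equiv> iwt_space D M"

lemma iwtE:
  assumes "x \<in> iwt \<zeta>"
  obtains t f where "finite t" "t \<subseteq> \<zeta>" "\<forall>\<xi>\<in>t. f \<xi> \<in> wt \<xi>" "x = (\<Oplus>\<xi>\<in>t. f \<xi>)"
  using assms unfolding iwt_space_def by blast

lemma iwtI:
  "finite t \<Longrightarrow> t \<subseteq> \<zeta> \<Longrightarrow> (\<And>\<xi>. \<xi> \<in> t \<Longrightarrow> f \<xi> \<in> wt \<xi>) \<Longrightarrow> (\<Oplus>\<xi>\<in>t. f \<xi>) \<in> iwt \<zeta>"
  unfolding iwt_space_def by blast

lemma wt_iwt: "m \<in> wt \<xi> \<Longrightarrow> \<xi> \<in> \<zeta> \<Longrightarrow> m \<in> iwt \<zeta>"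
  using iwtI [of "{\<xi>}" \<zeta> "\<lambda>_. m"] by simp

lemma iwt_0: "\<zero> \<in> iwt \<zeta>"
  using iwtI [of "{}" \<zeta> "\<lambda>_. \<zero>"] by simp

lemma iwt_add: "x \<in> iwt \<zeta> \<Longrightarrow> y \<in> iwt \<zeta> \<Longrightarrow> x \<oplus> y \<in> iwt \<zeta>"
proof -
  assume "x \<in> iwt \<zeta>"
  then obtain t f where t: "finite t" "t \<subseteq> \<zeta>" "\<forall>\<xi>\<in>t. f \<xi> \<in> wt \<xi>" "x = (\<Oplus>\<xi>\<in>t. f \<xi>)"
    by (rule iwtE)
  assume "y \<in> iwt \<zeta>"
  then obtain t' f' where t': "finite t'" "t' \<subseteq> \<zeta>" "\<forall>\<xi>\<in>t'. f' \<xi> \<in> wt \<xi>" "y = (\<Oplus>\<xi>\<in>t'. f' \<xi>)"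
    by (rule iwtE)
  let ?f = "\<lambda>\<xi>. if \<xi> \<in> t then f \<xi> else \<zero>" and ?f' = "\<lambda>\<xi>. if \<xi> \<in> t' then f' \<xi> else \<zero>"
  have wt: "?f \<xi> \<in> wt \<xi>" "?f' \<xi> \<in> wt \<xi>" for \<xi> using t(3) t'(3) wt_0 by auto
  have 1: "x = (\<Oplus>\<xi>\<in>t \<union> t'. ?f \<xi>)" unfolding t(4)
    using t t' by (intro M.add.finprod_mono_neutral_cong_left) (auto simp: Pi_iff)
  have 2: "y = (\<Oplus>\<xi>\<in>t \<union> t'. ?f' \<xi>)" unfolding t'(4)
    using t t' by (intro M.add.finprod_mono_neutral_cong_left) (auto simp: Pi_iff)
  have "?f \<in> t \<union> t' \<rightarrow> carrier M" "?f' \<in> t \<union> t' \<rightarrow> carrier M"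
    using wt wt_closed by blast+
  then have "x \<oplus> y = (\<Oplus>\<xi>\<in>t \<union> t'. ?f \<xi> \<oplus> ?f' \<xi>)"
    unfolding 1 2 by (rule M.finsum_addf [symmetric])
  also have "\<dots> \<in> iwt \<zeta>" using t t' wt by (intro iwtI wt_add) auto
  finally show ?thesis .
qed

lemma iwt_least:
  assumes "x \<in> iwt \<zeta>" "\<zero> \<in> P" "\<And>\<xi> m x. \<xi> \<in> \<zeta> \<Longrightarrow> m \<in> wt \<xi> \<Longrightarrow> x \<in> P \<Longrightarrow> x \<in> carrier M \<Longrightarrow> m \<oplus> x \<in> P"
  shows "x \<in> P"
proof -
  obtain t f where t: "finite t" "t \<subseteq> \<zeta>" "\<forall>\<xi>\<in>t. f \<xi> \<in> wt \<xi>" "x = (\<Oplus>\<xi>\<in>t. f \<xi>)"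
    using assms(1) by (rule iwtE)
  from t(1-3) have "(\<Oplus>\<xi>\<in>t. f \<xi>) \<in> P \<inter> carrier M"
  proof (induction t rule: finite_induct)
    case (insert \<xi> t)
    have f: "f \<xi> \<in> wt \<xi>" using insert.prems by blast
    moreover have "f \<xi> \<in> carrier M" using f by simp
    moreover have "f \<in> t \<rightarrow> carrier M" using insert.prems wt_closed by blast
    moreover have "(\<Oplus>\<xi>\<in>t. f \<xi>) \<in> P \<inter> carrier M" using insert by blast
    moreover have "\<xi> \<in> \<zeta>" using insert.prems by blast
    ultimately show ?case using insert.hyps assms(3) [of \<xi> "f \<xi>"] by simp
  qed (simp add: assms(2))
  then show ?thesis using t(4) by simp
qed

lemma iwt_closed [simp]: "x \<in> iwt \<zeta> \<Longrightarrow> x \<in> carrier M"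
  by (erule iwt_least) auto

lemma iwt_scale: "x \<in> iwt \<zeta> \<Longrightarrow> scale D M c x \<in> iwt \<zeta>"
proof -
  assume "x \<in> iwt \<zeta>"
  then have "x \<in> {x \<in> carrier M. scale D M c x \<in> iwt \<zeta>}"
    by (rule iwt_least) (auto simp: scale_simps iwt_0 intro!: iwt_add [OF wt_iwt [OF wt_scale]])
  then show ?thesis by simp
qed

lemma iwt_uminus: "x \<in> iwt \<zeta> \<Longrightarrow> \<ominus> x \<in> iwt \<zeta>"
  using iwt_scale [of x \<zeta> "- 1"] by (simp add: scale_simps)

lemma iwt_finsum: "finite A \<Longrightarrow> f \<in> A \<rightarrow> iwt \<zeta> \<Longrightarrow> (\<Oplus>a\<in>A. f a) \<in> iwt \<zeta>"
proof (induction A rule: finite_induct)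
  case (insert a A)
  then have "f \<in> A \<rightarrow> carrier M" "f a \<in> iwt \<zeta>" "f \<in> A \<rightarrow> iwt \<zeta>" using iwt_closed by blast+
  then show ?case using insert by (simp add: iwt_add)
qed (simp_all add: iwt_0)

lemma iwt_independent:
  assumes "finite Z" "\<And>\<zeta>. \<zeta> \<in> Z \<Longrightarrow> f \<zeta> \<in> iwt \<zeta>" "(\<Oplus>\<zeta>\<in>Z. f \<zeta>) = \<zero>"
    "\<And>\<zeta> \<zeta>'. \<zeta> \<in> Z \<Longrightarrow> \<zeta>' \<in> Z \<Longrightarrow> \<zeta> \<noteq> \<zeta>' \<Longrightarrow> \<zeta> \<inter> \<zeta>' = {}" "\<zeta> \<in> Z"
  shows "f \<zeta> = \<zero>"
proof -
  have "\<exists>t g. finite t \<and> t \<subseteq> \<zeta> \<and> (\<forall>\<xi>\<in>t. g \<xi> \<in> wt \<xi>) \<and> f \<zeta> = (\<Oplus>\<xi>\<in>t. g \<xi>)" if "\<zeta> \<in> Z" for \<zeta>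
    using assms(2) [OF that] by (rule iwtE) blast
  then obtain t g where tg: "\<And>\<zeta>. \<zeta> \<in> Z \<Longrightarrow> finite (t \<zeta>) \<and> t \<zeta> \<subseteq> \<zeta> \<and> (\<forall>\<xi>\<in>t \<zeta>. g \<zeta> \<xi> \<in> wt \<xi>) \<and> f \<zeta> = (\<Oplus>\<xi>\<in>t \<zeta>. g \<zeta> \<xi>)"
    by metis
  \<comment> \<open>The sets in \<open>Z\<close> are disjoint, so each weight belongs to at most one
    of the chosen decompositions; \<open>h\<close> merges them into one family of weight vectors, to
    which independence of weights applies.\<close>
  define h where "h \<xi> = g (THE \<zeta>. \<zeta> \<in> Z \<and> \<xi> \<in> t \<zeta>) \<xi>" for \<xi>
  have h: "h \<xi> = g \<zeta> \<xi>" if "\<zeta> \<in> Z" "\<xi> \<in> t \<zeta>" for \<zeta> \<xi>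
  proof -
    have "(THE \<zeta>. \<zeta> \<in> Z \<and> \<xi> \<in> t \<zeta>) = \<zeta>"
      using that tg assms(4) by (intro the_equality) blast+
    then show ?thesis by (simp add: h_def)
  qed
  have hwt: "h \<xi> \<in> wt \<xi>" if "\<xi> \<in> \<Union> (t ` Z)" for \<xi> using that tg h by auto
  have f: "f \<zeta> = (\<Oplus>\<xi>\<in>t \<zeta>. h \<xi>)" if "\<zeta> \<in> Z" for \<zeta>
  proof -
    have "f \<zeta> = (\<Oplus>\<xi>\<in>t \<zeta>. g \<zeta> \<xi>)" using tg [OF that] by blast
    also have "\<dots> = (\<Oplus>\<xi>\<in>t \<zeta>. h \<xi>)"
      using tg [OF that] h [OF that] by (intro M.finsum_cong') auto
    finally show ?thesis .
  qed
  have "(\<Oplus>\<xi>\<in>\<Union> (t ` Z). h \<xi>) = (\<Oplus>\<zeta>\<in>Z. \<Oplus>\<xi>\<in>t \<zeta>. h \<xi>)"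
  proof (rule M.add.finprod_UN_disjoint)
    show "pairwise (\<lambda>i j. disjnt (t i) (t j)) Z"
      unfolding pairwise_def disjnt_def using tg assms(4) by blast
    show "h \<xi> \<in> carrier M" if "\<zeta> \<in> Z" "\<xi> \<in> t \<zeta>" for \<zeta> \<xi>
      using wt_closed [OF hwt [of \<xi>]] that by auto
  qed (use assms(1) tg in auto)
  also have "\<dots> = (\<Oplus>\<zeta>\<in>Z. f \<zeta>)"
  proof (rule M.finsum_cong')
    show "f \<in> Z \<rightarrow> carrier M" using iwt_closed [OF assms(2)] by blast
    show "(\<Oplus>\<xi>\<in>t \<zeta>. h \<xi>) = f \<zeta>" if "\<zeta> \<in> Z" for \<zeta> using f [OF that] by simp
  qed simp
  finally have "(\<Oplus>\<xi>\<in>\<Union> (t ` Z). h \<xi>) = \<zero>" using assms(3) by simp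
  then have "h \<xi> = \<zero>" if "\<xi> \<in> \<Union> (t ` Z)" for \<xi>
    using assms(1) tg hwt that by (intro wt_independent [of "\<Union> (t ` Z)" h \<xi>]) auto
  then show ?thesis unfolding f [OF assms(5)] using assms(5) by (intro M.add.finprod_one_eqI) auto
qed

lemma iwt_decomposes_unique:
  assumes "decomposes M Z iwt m f" "decomposes M Z iwt m g"
    "\<And>\<zeta> \<zeta>'. \<zeta> \<in> Z \<Longrightarrow> \<zeta>' \<in> Z \<Longrightarrow> \<zeta> \<noteq> \<zeta>' \<Longrightarrow> \<zeta> \<inter> \<zeta>' = {}"
  shows "f = g"
proof
  fix \<zeta>
  let ?S = "{k. f k \<noteq> \<zero>} \<union> {k. g k \<noteq> \<zero>}"
  have f: "\<And>k. k \<in> Z \<Longrightarrow> f k \<in> iwt k" "\<And>k. k \<notin> Z \<Longrightarrow> f k = \<zero>" "finite {k. f k \<noteq> \<zero>}" "m = (\<Oplus>k\<in>{k. f k \<noteq> \<zero>}. f k)"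
    and g: "\<And>k. k \<in> Z \<Longrightarrow> g k \<in> iwt k" "\<And>k. k \<notin> Z \<Longrightarrow> g k = \<zero>" "finite {k. g k \<noteq> \<zero>}" "m = (\<Oplus>k\<in>{k. g k \<noteq> \<zero>}. g k)"
    using assms(1,2) unfolding decomposes_def by blast+
  have closed: "f k \<in> carrier M" "g k \<in> carrier M" for k
    using f(1,2) [of k] g(1,2) [of k] by (cases "k \<in> Z"; simp)+
  have SZ: "?S \<subseteq> Z" using f(2) g(2) by blast
  have "(\<Oplus>k\<in>?S. f k \<oplus> scale D M (- 1) (g k)) = (\<Oplus>k\<in>?S. f k) \<oplus> (\<Oplus>k\<in>?S. scale D M (- 1) (g k))"
    using closed by (intro M.finsum_addf) auto
  also have "(\<Oplus>k\<in>?S. scale D M (- 1) (g k)) = scale D M (- 1) (\<Oplus>k\<in>?S. g k)"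
    using closed by (intro scale_finsum [symmetric]) auto
  also have "(\<Oplus>k\<in>?S. f k) = m" unfolding f(4)
    using f(3) g(3) closed by (intro M.add.finprod_mono_neutral_cong_right) auto
  also have "(\<Oplus>k\<in>?S. g k) = m" unfolding g(4)
    using f(3) g(3) closed by (intro M.add.finprod_mono_neutral_cong_right) auto
  also have "m \<oplus> scale D M (- 1) m = \<zero>"
    using closed unfolding f(4) by (simp add: scale_simps M.r_neg)
  finally have sum0: "(\<Oplus>k\<in>?S. f k \<oplus> scale D M (- 1) (g k)) = \<zero>" .
  have S: "f k \<oplus> scale D M (- 1) (g k) = \<zero>" if "k \<in> ?S" for k
  proof (rule iwt_independent [of ?S "\<lambda>k. f k \<oplus> scale D M (- 1) (g k)"])
    show "finite ?S" using f(3) g(3) by simp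
    show "f k \<oplus> scale D M (- 1) (g k) \<in> iwt k" if "k \<in> ?S" for k
      using f(1) g(1) SZ that by (blast intro: iwt_add iwt_scale)
    show "\<zeta> \<inter> \<zeta>' = {}" if "\<zeta> \<in> ?S" "\<zeta>' \<in> ?S" "\<zeta> \<noteq> \<zeta>'" for \<zeta> \<zeta>'
      using assms(3) [OF _ _ that(3)] SZ that(1,2) by blast
  qed (rule sum0, rule that)
  show "f \<zeta> = g \<zeta>"
  proof (cases "\<zeta> \<in> ?S")
    case True
    then have "f \<zeta> \<oplus> \<ominus> g \<zeta> = \<zero>" using S [OF True] closed by (simp add: scale_simps)
    then have "f \<zeta> \<ominus> g \<zeta> = \<zero>" by (simp add: a_minus_def)
    then show ?thesis using closed minus_eq_zero_iff by blast
  qed simp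
qed

lemma iwt_component:
  assumes "decomposes M Z iwt m f" "\<And>\<zeta> \<zeta>'. \<zeta> \<in> Z \<Longrightarrow> \<zeta>' \<in> Z \<Longrightarrow> \<zeta> \<noteq> \<zeta>' \<Longrightarrow> \<zeta> \<inter> \<zeta>' = {}"
  shows "component M Z iwt \<zeta> m = f \<zeta>"
proof -
  have "(THE f. decomposes M Z iwt m f) = f"
  proof (rule the_equality)
    show "decomposes M Z iwt m f" by (rule assms(1))
    fix g assume "decomposes M Z iwt m g"
    then show "g = f" using assms by (rule iwt_decomposes_unique)
  qed
  then show ?thesis by (simp add: component_def)
qed

lemma iwt_decomposes_single:
  assumes "m \<in> iwt \<zeta>" "\<zeta> \<in> Z"
  shows "decomposes M Z iwt m (\<lambda>\<zeta>'. if \<zeta>' = \<zeta> then m else \<zero>)"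
proof -
  have "(\<Oplus>k\<in>{k. (if k = \<zeta> then m else \<zero>) \<noteq> \<zero>}. if k = \<zeta> then m else \<zero>) = (\<Oplus>k\<in>{\<zeta>}. if k = \<zeta> then m else \<zero>)"
    using assms by (intro M.add.finprod_mono_neutral_cong_left) auto
  then show ?thesis
    using assms unfolding decomposes_def by (auto simp: iwt_0)
qed

end


subsection \<open>Left ideals\<close>

context ring
begin

lemma left_ideal_gen_least:
  assumes "x \<in> left_ideal_gen R S" "S \<subseteq> carrier R" "\<zero> \<in> P"
    "\<And>c s y. c \<in> carrier R \<Longrightarrow> s \<in> S \<Longrightarrow> y \<in> P \<Longrightarrow> y \<in> carrier R \<Longrightarrow> c \<otimes> s \<oplus> y \<in> P"
  shows "x \<in> P"
proof -
  obtain t c where t: "finite t" "t \<subseteq> S" "c \<in> t \<rightarrow> carrier R" "x = (\<Oplus>s\<in>t. c s \<otimes> s)"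
    using assms(1) unfolding left_ideal_gen_def by blast
  from t(1-3) have "(\<Oplus>s\<in>t. c s \<otimes> s) \<in> P \<inter> carrier R"
  proof (induction t rule: finite_induct)
    case (insert s t)
    then have *: "(\<lambda>s. c s \<otimes> s) \<in> t \<rightarrow> carrier R" "s \<in> carrier R" "c s \<in> carrier R" "s \<in> S"
      "(\<Oplus>s\<in>t. c s \<otimes> s) \<in> P \<inter> carrier R"
      using assms(2) by auto
    then show ?case using insert(1,2) assms(4) by simp
  qed (simp add: assms)
  then show ?thesis by (simp add: t(4))
qed

lemma left_ideal_gen_closed: "S \<subseteq> carrier R \<Longrightarrow> x \<in> left_ideal_gen R S \<Longrightarrow> x \<in> carrier R"
  by (erule left_ideal_gen_least) auto

lemma left_ideal_gen_0: "\<zero> \<in> left_ideal_gen R S"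
  unfolding left_ideal_gen_def by (rule CollectI, rule exI [of _ "{}"]) auto

lemma left_ideal_gen_base:
  "S \<subseteq> carrier R \<Longrightarrow> c \<in> carrier R \<Longrightarrow> s \<in> S \<Longrightarrow> c \<otimes> s \<in> left_ideal_gen R S"
  unfolding left_ideal_gen_def by (rule CollectI, rule exI [of _ "{s}"], rule exI [of _ "\<lambda>_. c"]) auto

lemma left_ideal_gen_add:
  assumes S: "S \<subseteq> carrier R" and "x \<in> left_ideal_gen R S" "y \<in> left_ideal_gen R S"
  shows "x \<oplus> y \<in> left_ideal_gen R S"
proof -
  obtain t c where t: "finite t" "t \<subseteq> S" "c \<in> t \<rightarrow> carrier R" "x = (\<Oplus>s\<in>t. c s \<otimes> s)"
    using assms(2) unfolding left_ideal_gen_def by blast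
  obtain t' c' where t': "finite t'" "t' \<subseteq> S" "c' \<in> t' \<rightarrow> carrier R" "y = (\<Oplus>s\<in>t'. c' s \<otimes> s)"
    using assms(3) unfolding left_ideal_gen_def by blast
  let ?c = "\<lambda>s. if s \<in> t then c s else \<zero>" and ?c' = "\<lambda>s. if s \<in> t' then c' s else \<zero>"
  have cc: "?c s \<in> carrier R" "?c' s \<in> carrier R" for s using t(3) t'(3) by auto
  have sub: "t \<union> t' \<subseteq> carrier R" using t t' S by auto
  have 1: "x = (\<Oplus>s\<in>t \<union> t'. ?c s \<otimes> s)" unfolding t(4)
    using t t' sub by (intro add.finprod_mono_neutral_cong_left) (auto simp: Pi_iff subset_iff)
  have 2: "y = (\<Oplus>s\<in>t \<union> t'. ?c' s \<otimes> s)" unfolding t'(4)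
    using t t' sub by (intro add.finprod_mono_neutral_cong_left) (auto simp: Pi_iff subset_iff)
  have "x \<oplus> y = (\<Oplus>s\<in>t \<union> t'. ?c s \<otimes> s \<oplus> ?c' s \<otimes> s)"
    unfolding 1 2 by (intro finsum_addf [symmetric] funcsetI m_closed cc subsetD [OF sub])
  also have "\<dots> = (\<Oplus>s\<in>t \<union> t'. (?c s \<oplus> ?c' s) \<otimes> s)"
  proof (rule finsum_cong')
    show "(\<lambda>s. (?c s \<oplus> ?c' s) \<otimes> s) \<in> t \<union> t' \<rightarrow> carrier R"
      by (intro funcsetI m_closed a_closed cc subsetD [OF sub])
    show "?c s \<otimes> s \<oplus> ?c' s \<otimes> s = (?c s \<oplus> ?c' s) \<otimes> s" if "s \<in> t \<union> t'" for s
      using l_distr [OF cc subsetD [OF sub that]] by simp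
  qed simp
  also have "\<dots> \<in> left_ideal_gen R S"
    unfolding left_ideal_gen_def
  proof (intro CollectI exI [of _ "t \<union> t'"] exI [of _ "\<lambda>s. ?c s \<oplus> ?c' s"] conjI)
    show "(\<lambda>s. ?c s \<oplus> ?c' s) \<in> t \<union> t' \<rightarrow> carrier R" by (intro funcsetI a_closed cc)
  qed (use t t' in auto)
  finally show ?thesis .
qed

lemma left_ideal_gen_mult:
  assumes S: "S \<subseteq> carrier R" and a: "a \<in> carrier R" and x: "x \<in> left_ideal_gen R S"
  shows "a \<otimes> x \<in> left_ideal_gen R S"
proof -
  have "x \<in> {x \<in> carrier R. a \<otimes> x \<in> left_ideal_gen R S}"
    using x S
  proof (rule left_ideal_gen_least)
    fix c s y assume "c \<in> carrier R" "s \<in> S" and y: "y \<in> {x \<in> carrier R. a \<otimes> x \<in> left_ideal_gen R S}"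
    then have "a \<otimes> (c \<otimes> s \<oplus> y) = (a \<otimes> c) \<otimes> s \<oplus> a \<otimes> y" "s \<in> carrier R"
      using S a by (auto simp: r_distr m_assoc subset_iff)
    then show "c \<otimes> s \<oplus> y \<in> {x \<in> carrier R. a \<otimes> x \<in> left_ideal_gen R S}"
      using y S a \<open>c \<in> carrier R\<close> \<open>s \<in> S\<close> by (auto intro: left_ideal_gen_add left_ideal_gen_base)
  qed (use a left_ideal_gen_0 in auto)
  then show ?thesis by simp
qed

lemma left_ideal_gen_subgroup:
  assumes S: "S \<subseteq> carrier R" shows "abelian_subgroup (left_ideal_gen R S) R"
proof (rule abelian_subgroupI3)
  show "additive_subgroup (left_ideal_gen R S) R"
  proof (rule additive_subgroup.intro, rule add.subgroupI)
    show "left_ideal_gen R S \<subseteq> carrier R" using left_ideal_gen_closed [OF S] by blast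
    show "left_ideal_gen R S \<noteq> {}" using left_ideal_gen_0 by blast
    fix x assume x: "x \<in> left_ideal_gen R S"
    have "(\<ominus> \<one>) \<otimes> x \<in> left_ideal_gen R S" using x by (intro left_ideal_gen_mult S) auto
    then show "\<ominus> x \<in> left_ideal_gen R S" using left_ideal_gen_closed [OF S x] by (simp add: l_minus)
    fix y assume "y \<in> left_ideal_gen R S"
    with x show "x \<oplus> y \<in> left_ideal_gen R S" by (rule left_ideal_gen_add [OF S])
  qed
qed (rule abelian_group_axioms)

end

section \<open>Coordinates with respect to a basis\<close>

locale U_basis = U_module D M
  for D :: "('i, 'x, 'y::ab_group_add, 'z) root_datum_scheme"
    and M :: "(('i, 'y) Uelt, 'm) module" (structure) +
  fixes B :: "'m set"
  assumes basis: "is_basis D M UNIV (carrier M) B"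
begin

lemma B_carrier: "B \<subseteq> carrier M"
  using basis by (simp add: is_basis_def is_basis_mod_def)

lemma B_closed [simp]: "b \<in> B \<Longrightarrow> b \<in> carrier M"
  using B_carrier by blast

lemma B_independent:
  "finite t \<Longrightarrow> t \<subseteq> B \<Longrightarrow> (\<Oplus>s\<in>t. scale D M (c s) s) = \<zero> \<Longrightarrow> s \<in> t \<Longrightarrow> c s = 0"
  using basis unfolding is_basis_def is_basis_mod_def by auto

lemma carrier_lspan: "x \<in> carrier M \<Longrightarrow> x \<in> lspan D M UNIV B"
proof -
  assume x: "x \<in> carrier M"
  then obtain y where y: "y \<in> lspan D M UNIV B" "x \<ominus> y = \<zero>"
    using basis unfolding is_basis_def is_basis_mod_def by auto
  then have "y \<in> carrier M" using lspan_closed [OF B_carrier] by blast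
  then show ?thesis using x y by simp
qed

definition coord :: "'m \<Rightarrow> 'm \<Rightarrow> scal" where
  "coord x = (SOME c. finite {b. c b \<noteq> 0} \<and> {b. c b \<noteq> 0} \<subseteq> B \<and> x = (\<Oplus>b\<in>{b. c b \<noteq> 0}. scale D M (c b) b))"

lemma coord_expand:
  assumes "x \<in> carrier M"
  shows "finite {b. coord x b \<noteq> 0}" "{b. coord x b \<noteq> 0} \<subseteq> B"
    "x = (\<Oplus>b\<in>{b. coord x b \<noteq> 0}. scale D M (coord x b) b)"
proof -
  obtain t c where t: "finite t" "t \<subseteq> B" "x = (\<Oplus>s\<in>t. scale D M (c s) s)"
    using carrier_lspan [OF assms] by (rule lspanE)
  let ?c = "\<lambda>b. if b \<in> t then c b else 0"
  have sub: "{b. ?c b \<noteq> 0} \<subseteq> t" by auto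
  have "x = (\<Oplus>b\<in>{b. ?c b \<noteq> 0}. scale D M (?c b) b)"
    unfolding t(3) using t(1,2) sub
    by (intro M.add.finprod_mono_neutral_cong_right) (auto simp: scale_simps)
  then have "\<exists>c. finite {b. c b \<noteq> 0} \<and> {b. c b \<noteq> 0} \<subseteq> B \<and> x = (\<Oplus>b\<in>{b. c b \<noteq> 0}. scale D M (c b) b)"
    using t(1,2) sub finite_subset [OF sub] by (intro exI [of _ ?c]) blast
  from someI_ex [OF this, folded coord_def]
  show "finite {b. coord x b \<noteq> 0}" "{b. coord x b \<noteq> 0} \<subseteq> B"
    "x = (\<Oplus>b\<in>{b. coord x b \<noteq> 0}. scale D M (coord x b) b)" by blast+
qed

lemma coord_outside: "x \<in> carrier M \<Longrightarrow> b \<notin> B \<Longrightarrow> coord x b = 0"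
  using coord_expand(2) by blast

lemma coord_expand_superset:
  assumes "x \<in> carrier M" "finite t" "{b. coord x b \<noteq> 0} \<subseteq> t" "t \<subseteq> B"
  shows "x = (\<Oplus>b\<in>t. scale D M (coord x b) b)"
proof -
  have "(\<Oplus>b\<in>{b. coord x b \<noteq> 0}. scale D M (coord x b) b) = (\<Oplus>b\<in>t. scale D M (coord x b) b)"
    using assms by (intro M.add.finprod_mono_neutral_cong_left) (auto simp: scale_simps)
  then show ?thesis using coord_expand(3) [OF assms(1)] by simp
qed

lemma coord_unique:
  assumes "finite t" "t \<subseteq> B" "x = (\<Oplus>s\<in>t. scale D M (c s) s)"
  shows "coord x b = (if b \<in> t then c b else 0)"
proof -
  have tc: "t \<subseteq> carrier M" using assms(2) by auto
  have x: "x \<in> carrier M" unfolding assms(3) using tc by (intro M.finsum_closed) auto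
  let ?t = "t \<union> {b. coord x b \<noteq> 0}"
  let ?c = "\<lambda>b. if b \<in> t then c b else 0"
  have fin: "finite ?t" "?t \<subseteq> B" using assms coord_expand [OF x] by auto
  then have tc': "?t \<subseteq> carrier M" by auto
  have "(\<Oplus>s\<in>t. scale D M (c s) s) = (\<Oplus>s\<in>?t. scale D M (?c s) s)"
    by (rule lspan_extend [OF fin(1) _ tc']) blast
  then have 1: "x = (\<Oplus>s\<in>?t. scale D M (?c s) s)" by (rule trans [OF assms(3)])
  have 2: "x = (\<Oplus>s\<in>?t. scale D M (coord x s) s)"
    using fin by (intro coord_expand_superset [OF x]) auto
  have "(\<Oplus>s\<in>?t. scale D M (?c s - coord x s) s) =
      (\<Oplus>s\<in>?t. scale D M (?c s) s \<oplus> scale D M (- 1) (scale D M (coord x s) s))"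
    using tc' by (intro M.finsum_cong') (auto simp: scale_simps a_minus_def)
  also have "\<dots> = (\<Oplus>s\<in>?t. scale D M (?c s) s) \<oplus> (\<Oplus>s\<in>?t. scale D M (- 1) (scale D M (coord x s) s))"
    using tc' by (intro M.finsum_addf) auto
  also have "(\<Oplus>s\<in>?t. scale D M (- 1) (scale D M (coord x s) s)) = scale D M (- 1) (\<Oplus>s\<in>?t. scale D M (coord x s) s)"
    using tc' by (intro scale_finsum [symmetric]) auto
  also have "(\<Oplus>s\<in>?t. scale D M (?c s) s) \<oplus> scale D M (- 1) (\<Oplus>s\<in>?t. scale D M (coord x s) s) = \<zero>"
    unfolding 1 [symmetric] 2 [symmetric] using x by (simp add: scale_simps M.r_neg)
  finally have "?c s - coord x s = 0" if "s \<in> ?t" for s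
    using B_independent [OF fin, of "\<lambda>s. ?c s - coord x s"] that by blast
  then show ?thesis by (cases "b \<in> ?t") auto
qed

lemma coord_eqI:
  assumes "x \<in> carrier M" "y \<in> carrier M" "\<And>b. b \<in> B \<Longrightarrow> coord x b = coord y b"
  shows "x = y"
proof -
  have "coord x = coord y"
  proof
    fix b show "coord x b = coord y b" using assms coord_outside by (cases "b \<in> B") auto
  qed
  then show ?thesis using coord_expand(3) [OF assms(1)] coord_expand(3) [OF assms(2)] by metis
qed

lemma coord_add:
  assumes "x \<in> carrier M" "y \<in> carrier M" shows "coord (x \<oplus> y) b = coord x b + coord y b"
proof -
  let ?t = "{b. coord x b \<noteq> 0} \<union> {b. coord y b \<noteq> 0}"
  have t: "finite ?t" "?t \<subseteq> B" using coord_expand [OF assms(1)] coord_expand [OF assms(2)] by auto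
  then have tc: "?t \<subseteq> carrier M" by auto
  have "x \<oplus> y = (\<Oplus>b\<in>?t. scale D M (coord x b) b) \<oplus> (\<Oplus>b\<in>?t. scale D M (coord y b) b)"
    using coord_expand_superset [OF assms(1) t(1) _ t(2)] coord_expand_superset [OF assms(2) t(1) _ t(2)] by auto
  also have "\<dots> = (\<Oplus>b\<in>?t. scale D M (coord x b) b \<oplus> scale D M (coord y b) b)"
    using tc by (intro M.finsum_addf [symmetric]) auto
  also have "\<dots> = (\<Oplus>b\<in>?t. scale D M (coord x b + coord y b) b)"
    using tc by (intro M.finsum_cong') (auto simp: scale_simps)
  finally have "coord (x \<oplus> y) b = (if b \<in> ?t then coord x b + coord y b else 0)"
    by (rule coord_unique [OF t])
  then show ?thesis by auto
qed

lemma coord_scale: assumes "x \<in> carrier M" shows "coord (scale D M c x) b = c * coord x b"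
proof -
  let ?t = "{b. coord x b \<noteq> 0}"
  have t: "finite ?t" "?t \<subseteq> B" using coord_expand [OF assms] by auto
  then have tc: "?t \<subseteq> carrier M" by auto
  have "scale D M c x = scale D M c (\<Oplus>b\<in>?t. scale D M (coord x b) b)"
    using coord_expand(3) [OF assms] by simp
  also have "\<dots> = (\<Oplus>b\<in>?t. scale D M c (scale D M (coord x b) b))"
    using tc by (intro scale_finsum) auto
  also have "\<dots> = (\<Oplus>b\<in>?t. scale D M (c * coord x b) b)"
    using tc by (intro M.finsum_cong') (auto simp: scale_simps)
  finally have "coord (scale D M c x) b = (if b \<in> ?t then c * coord x b else 0)"
    by (rule coord_unique [OF t])
  then show ?thesis by auto
qed

lemma coord_0 [simp]: "coord \<zero> b = 0"
  using coord_unique [of "{}" \<zero> "\<lambda>_. 0"] by simp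

lemma coord_uminus: "x \<in> carrier M \<Longrightarrow> coord (\<ominus> x) b = - coord x b"
  using coord_scale [of x "- 1"] by (simp add: scale_simps)

lemma coord_diff: "x \<in> carrier M \<Longrightarrow> y \<in> carrier M \<Longrightarrow> coord (x \<ominus> y) b = coord x b - coord y b"
  by (simp add: a_minus_def coord_add coord_uminus)

lemma coord_base: "b \<in> B \<Longrightarrow> coord b b' = (if b' = b then 1 else 0)"
  using coord_unique [of "{b}" b "\<lambda>_. 1" b'] by (simp add: scale_simps)

lemma coord_finsum:
  "finite A \<Longrightarrow> f \<in> A \<rightarrow> carrier M \<Longrightarrow> coord (\<Oplus>a\<in>A. f a) b = (\<Sum>a\<in>A. coord (f a) b)"
proof (induction A rule: finite_induct)
  case (insert a A)
  then have "f \<in> A \<rightarrow> carrier M" "f a \<in> carrier M" by auto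
  then show ?case using insert by (simp add: coord_add)
qed simp

lemma lspan_iff:
  assumes "S \<subseteq> B" "0 \<in> R"
  shows "x \<in> lspan D M R S \<longleftrightarrow> x \<in> carrier M \<and> (\<forall>b. coord x b \<in> R) \<and> (\<forall>b. b \<notin> S \<longrightarrow> coord x b = 0)"
proof
  assume "x \<in> lspan D M R S"
  then obtain t c where t: "finite t" "t \<subseteq> S" "c \<in> t \<rightarrow> R" "x = (\<Oplus>s\<in>t. scale D M (c s) s)"
    by (rule lspanE)
  have "x \<in> carrier M"
    using \<open>x \<in> lspan D M R S\<close> lspan_closed assms(1) B_carrier by (meson subset_trans)
  moreover have "coord x b = (if b \<in> t then c b else 0)" for b
    using t assms(1) by (intro coord_unique) auto
  ultimately show "x \<in> carrier M \<and> (\<forall>b. coord x b \<in> R) \<and> (\<forall>b. b \<notin> S \<longrightarrow> coord x b = 0)"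
    using t(2,3) assms(2) by auto
next
  assume x: "x \<in> carrier M \<and> (\<forall>b. coord x b \<in> R) \<and> (\<forall>b. b \<notin> S \<longrightarrow> coord x b = 0)"
  then have "{b. coord x b \<noteq> 0} \<subseteq> S" by blast
  then have "(\<Oplus>b\<in>{b. coord x b \<noteq> 0}. scale D M (coord x b) b) \<in> lspan D M R S"
    using x coord_expand(1) by (intro lspanI) auto
  then show "x \<in> lspan D M R S" using coord_expand(3) x by simp
qed

lemma coord_exists:
  assumes "finite {b. c b \<noteq> 0}" "{b. c b \<noteq> 0} \<subseteq> B"
  obtains x where "x \<in> carrier M" "coord x = c"
proof -
  let ?x = "\<Oplus>b\<in>{b. c b \<noteq> 0}. scale D M (c b) b"
  have "?x \<in> carrier M" using assms(2) by (intro M.finsum_closed) auto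
  moreover have "coord ?x b = (if b \<in> {b. c b \<noteq> 0} then c b else 0)" for b
    by (rule coord_unique [OF assms refl])
  then have "coord ?x = c" by auto
  ultimately show ?thesis using that by blast
qed

text \<open>Covers both the linear extension (\<open>\<sigma>\<close> the identity) and the
  semilinear extension (\<open>\<sigma> = qbar\<close>) of a map given on the basis.\<close>

definition basis_ext :: "(scal \<Rightarrow> scal) \<Rightarrow> ('m \<Rightarrow> 'm) \<Rightarrow> 'm \<Rightarrow> 'm" where
  "basis_ext \<sigma> g x = (\<Oplus>b\<in>{b. coord x b \<noteq> 0}. scale D M (\<sigma> (coord x b)) (g b))"

context
  fixes \<sigma> :: "scal \<Rightarrow> scal" and g :: "'m \<Rightarrow> 'm"
  assumes \<sigma>: "\<And>a b. \<sigma> (a + b) = \<sigma> a + \<sigma> b" "\<And>a b. \<sigma> (a * b) = \<sigma> a * \<sigma> b" "\<sigma> 0 = 0" "\<sigma> 1 = 1"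
    and g: "\<And>b. b \<in> B \<Longrightarrow> g b \<in> carrier M"
begin

lemma basis_ext_superset:
  assumes "x \<in> carrier M" "finite t" "{b. coord x b \<noteq> 0} \<subseteq> t" "t \<subseteq> B"
  shows "basis_ext \<sigma> g x = (\<Oplus>b\<in>t. scale D M (\<sigma> (coord x b)) (g b))"
  unfolding basis_ext_def using assms g \<sigma>(3)
  by (intro M.add.finprod_mono_neutral_cong_left) (auto simp: scale_simps)

lemma basis_ext_closed: "x \<in> carrier M \<Longrightarrow> basis_ext \<sigma> g x \<in> carrier M"
  unfolding basis_ext_def by (intro M.finsum_closed funcsetI scale_closed g subsetD [OF coord_expand(2)])

lemma basis_ext_add:
  assumes "x \<in> carrier M" "y \<in> carrier M"
  shows "basis_ext \<sigma> g (x \<oplus> y) = basis_ext \<sigma> g x \<oplus> basis_ext \<sigma> g y"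
proof -
  let ?t = "{b. coord x b \<noteq> 0} \<union> {b. coord y b \<noteq> 0}"
  have t: "finite ?t" "?t \<subseteq> B" using coord_expand [OF assms(1)] coord_expand [OF assms(2)] by auto
  then have gc: "g b \<in> carrier M" if "b \<in> ?t" for b using g that by blast
  have "{b. coord (x \<oplus> y) b \<noteq> 0} \<subseteq> ?t" using assms by (auto simp: coord_add)
  then have "basis_ext \<sigma> g (x \<oplus> y) = (\<Oplus>b\<in>?t. scale D M (\<sigma> (coord (x \<oplus> y) b)) (g b))"
    using assms t by (intro basis_ext_superset) auto
  also have "\<dots> = (\<Oplus>b\<in>?t. scale D M (\<sigma> (coord x b)) (g b) \<oplus> scale D M (\<sigma> (coord y b)) (g b))"
    using gc assms by (intro M.finsum_cong') (auto simp: scale_simps coord_add \<sigma>)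
  also have "\<dots> = (\<Oplus>b\<in>?t. scale D M (\<sigma> (coord x b)) (g b)) \<oplus> (\<Oplus>b\<in>?t. scale D M (\<sigma> (coord y b)) (g b))"
    using gc by (intro M.finsum_addf) auto
  also have "\<dots> = basis_ext \<sigma> g x \<oplus> basis_ext \<sigma> g y"
    using basis_ext_superset [OF assms(1) t(1) _ t(2)] basis_ext_superset [OF assms(2) t(1) _ t(2)] by auto
  finally show ?thesis .
qed

lemma basis_ext_scale:
  assumes "x \<in> carrier M"
  shows "basis_ext \<sigma> g (scale D M c x) = scale D M (\<sigma> c) (basis_ext \<sigma> g x)"
proof -
  let ?t = "{b. coord x b \<noteq> 0}"
  have t: "finite ?t" "?t \<subseteq> B" using coord_expand [OF assms] by auto
  then have gc: "g b \<in> carrier M" if "b \<in> ?t" for b using g that by blast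
  have "{b. coord (scale D M c x) b \<noteq> 0} \<subseteq> ?t" using assms by (auto simp: coord_scale)
  then have "basis_ext \<sigma> g (scale D M c x) = (\<Oplus>b\<in>?t. scale D M (\<sigma> (coord (scale D M c x) b)) (g b))"
    using assms t by (intro basis_ext_superset) auto
  also have "\<dots> = (\<Oplus>b\<in>?t. scale D M (\<sigma> c) (scale D M (\<sigma> (coord x b)) (g b)))"
    using gc assms by (intro M.finsum_cong') (auto simp: scale_simps coord_scale \<sigma>)
  also have "\<dots> = scale D M (\<sigma> c) (\<Oplus>b\<in>?t. scale D M (\<sigma> (coord x b)) (g b))"
    using gc by (intro scale_finsum [symmetric]) auto
  finally show ?thesis by (simp add: basis_ext_def)
qed

lemma basis_ext_base:
  assumes "b \<in> B" shows "basis_ext \<sigma> g b = g b"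
proof -
  have "basis_ext \<sigma> g b = (\<Oplus>b'\<in>{b}. scale D M (\<sigma> (coord b b')) (g b'))"
    using assms by (intro basis_ext_superset) (auto simp: coord_base)
  also have "\<dots> = g b" using assms g by (simp add: coord_base \<sigma> scale_simps)
  finally show ?thesis .
qed

end

lemma semilinear_0:
  assumes "semilinear D M f" shows "f \<zero> = \<zero>"
proof -
  have "f \<zero> \<in> carrier M" using assms unfolding semilinear_def by auto
  moreover have "\<forall>c. \<forall>x\<in>carrier M. f (scale D M c x) = scale D M (qbar c) (f x)"
    using assms unfolding semilinear_def by blast
  then have "f (scale D M 0 \<zero>) = scale D M (qbar 0) (f \<zero>)" by blast
  ultimately show ?thesis using scale_simps(5) [of "f \<zero>"] by simp
qed

lemma semilinear_eq:
  assumes "semilinear D M f" "semilinear D M h" "\<And>b. b \<in> B \<Longrightarrow> f b = h b" "x \<in> carrier M"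
  shows "f x = h x"
proof -
  have "x \<in> {x. f x = h x}"
    using carrier_lspan [OF assms(4)] B_carrier
  proof (rule lspan_least)
    fix c s x assume *: "s \<in> B" "x \<in> {x. f x = h x}" "x \<in> carrier M"
    have "f (scale D M c s \<oplus> x) = scale D M (qbar c) (f s) \<oplus> f x"
      using * assms(1) unfolding semilinear_def by simp
    also have "\<dots> = h (scale D M c s \<oplus> x)"
      using * assms(2,3) unfolding semilinear_def by simp
    finally show "scale D M c s \<oplus> x \<in> {x. f x = h x}" by simp
  qed (use semilinear_0 [OF assms(1)] semilinear_0 [OF assms(2)] in simp)
  then show ?thesis by simp
qed

lemma basis_involution_unique:
  assumes "semilinear D M f" "\<And>b. b \<in> B \<Longrightarrow> f b = b" "x \<in> carrier M"
  shows "basis_involution D M B x = f x"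
proof -
  \<comment> \<open>The description of \<open>basis_involution\<close> singles out an extensional
    map.\<close>
  let ?f = "restrict f (carrier M)"
  have sl: "semilinear D M ?f"
    using assms(1) unfolding semilinear_def by (simp add: Pi_iff)
  have "basis_involution D M B = ?f"
    unfolding basis_involution_def
  proof (rule the_equality)
    show "?f \<in> extensional (carrier M) \<and> semilinear D M ?f \<and> (\<forall>b\<in>B. ?f b = b)"
      using sl assms(2) by simp
    fix h assume h: "h \<in> extensional (carrier M) \<and> semilinear D M h \<and> (\<forall>b\<in>B. h b = b)"
    show "h = ?f"
    proof (rule extensionalityI [of _ "carrier M"])
      show "h x = ?f x" if "x \<in> carrier M" for x
        using semilinear_eq [of h ?f x] h sl assms(2) that by simp
    qed (use h in auto)
  qed
  then show ?thesis using assms(3) by simp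
qed

lemma basis_involution_semilinear: "semilinear D M (basis_involution D M B)"
  and basis_involution_base: "b \<in> B \<Longrightarrow> basis_involution D M B b = b"
proof -
  let ?f = "basis_ext qbar (\<lambda>b. b)"
  note q = qbar_add qbar_mult qbar_0 qbar_1
  have f: "semilinear D M ?f"
    unfolding semilinear_def
    using basis_ext_closed [OF q, of "\<lambda>b. b"] basis_ext_add [OF q, of "\<lambda>b. b"] basis_ext_scale [OF q, of "\<lambda>b. b"] by auto
  have base: "?f b = b" if "b \<in> B" for b
    using basis_ext_base [OF q, of "\<lambda>b. b"] that by auto
  have eq: "basis_involution D M B x = ?f x" if "x \<in> carrier M" for x
    using basis_involution_unique [OF f base that] .
  show "semilinear D M (basis_involution D M B)"
    using f eq unfolding semilinear_def by (auto simp: Pi_iff)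
  show "b \<in> B \<Longrightarrow> basis_involution D M B b = b"
    using eq base by simp
qed

lemma coord_basis_involution:
  assumes "x \<in> carrier M" shows "coord (basis_involution D M B x) b = qbar (coord x b)"
proof -
  let ?f = "basis_involution D M B"
  have f: "?f x \<in> carrier M" if "x \<in> carrier M" for x
    using basis_involution_semilinear that unfolding semilinear_def by auto
  have "x \<in> {x \<in> carrier M. \<forall>b. coord (?f x) b = qbar (coord x b)}"
    using carrier_lspan [OF assms] B_carrier
  proof (rule lspan_least)
    fix c s x assume s: "s \<in> B" and x: "x \<in> {x \<in> carrier M. \<forall>b. coord (?f x) b = qbar (coord x b)}"
    have "?f (scale D M c s \<oplus> x) = scale D M (qbar c) s \<oplus> ?f x"
      using basis_involution_semilinear basis_involution_base [OF s] s x unfolding semilinear_def by simp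
    then show "scale D M c s \<oplus> x \<in> {x \<in> carrier M. \<forall>b. coord (?f x) b = qbar (coord x b)}"
      using s x f by (auto simp: coord_add coord_scale coord_base qbar_add qbar_mult)
  qed (use semilinear_0 [OF basis_involution_semilinear] in simp)
  then show ?thesis by simp
qed


subsection \<open>Unipotent maps\<close>

text \<open>Along \<open>lt\<close> the rank drops strictly, so the terms that \<open>G\<close> adds
  to a basis element of rank at most \<open>n\<close> have rank below \<open>n\<close>: coordinates
  of rank \<open>n\<close> change only by \<open>\<sigma>\<close>. The upper set \<open>C\<close>
  makes the result available for the spans of parts of the basis as well.\<close>

lemma unipotent_coord:
  fixes rk :: "'m \<Rightarrow> nat"
  assumes G: "\<And>x. x \<in> carrier M \<Longrightarrow> G x \<in> carrier M"
      "\<And>x y. x \<in> carrier M \<Longrightarrow> y \<in> carrier M \<Longrightarrow> G (x \<oplus> y) = G x \<oplus> G y"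
      "\<And>c x. x \<in> carrier M \<Longrightarrow> G (scale D M c x) = scale D M (\<sigma> c) (G x)"
    and \<sigma>: "\<And>a b. \<sigma> (a + b) = \<sigma> a + \<sigma> b" "\<sigma> 0 = 0"
    and tri: "\<And>b. b \<in> B \<Longrightarrow> G b \<ominus> b \<in> lspan D M UNIV {b' \<in> B. lt b b'}"
    and C: "C \<subseteq> B" "\<And>b b'. b \<in> C \<Longrightarrow> b' \<in> B \<Longrightarrow> lt b b' \<Longrightarrow> b' \<in> C"
    and rk: "\<And>b b'. b \<in> B \<Longrightarrow> b' \<in> B \<Longrightarrow> lt b b' \<Longrightarrow> rk b' < rk b"
    and x: "x \<in> lspan D M UNIV {b \<in> C. rk b < Suc n}"
  shows "G x \<in> lspan D M UNIV {b \<in> C. rk b < Suc n} \<and> (\<forall>b. rk b = n \<longrightarrow> coord (G x) b = \<sigma> (coord x b))"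
proof -
  let ?S = "{b \<in> C. rk b < Suc n}"
  have S: "?S \<subseteq> B" using C(1) by auto
  have G0: "G \<zero> = \<zero>" using G(1) [of \<zero>] G(3) [of \<zero> 0] by (simp add: \<sigma> scale_simps)
  have "x \<in> {x \<in> carrier M. G x \<in> lspan D M UNIV ?S \<and> (\<forall>b. rk b = n \<longrightarrow> coord (G x) b = \<sigma> (coord x b))}"
    using x
  proof (rule lspan_least)
    show "?S \<subseteq> carrier M" using S by auto
    fix c s x assume s: "s \<in> ?S"
      and x: "x \<in> {x \<in> carrier M. G x \<in> lspan D M UNIV ?S \<and> (\<forall>b. rk b = n \<longrightarrow> coord (G x) b = \<sigma> (coord x b))}"
    have sB: "s \<in> B" using s S by blast
    define y where "y = G s \<ominus> s"
    have "y \<in> lspan D M UNIV {b' \<in> B. lt s b'}" unfolding y_def by (rule tri [OF sB])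
    then have y: "y \<in> carrier M" "\<And>b. coord y b \<noteq> 0 \<Longrightarrow> b \<in> B \<and> lt s b"
      using lspan_iff [of "{b' \<in> B. lt s b'}" UNIV y] by auto
    have Gs: "G s = s \<oplus> y"
      using sB G(1) [of s] M.a_lcomm [of s "G s" "\<ominus> s"] unfolding y_def by (simp add: a_minus_def M.r_neg)
    have yn: "b \<in> C \<and> rk b < n" if "coord y b \<noteq> 0" for b
    proof -
      have "b \<in> B" "lt s b" using y(2) [OF that] by blast+
      then have "b \<in> C" "rk b < rk s" using C(2) rk sB s by blast+
      then show ?thesis using s by simp
    qed
    have coord: "coord (G (scale D M c s \<oplus> x)) b = \<sigma> c * (coord s b + coord y b) + coord (G x) b" for b
      using sB x y G Gs by (simp add: coord_add coord_scale)
    have "G (scale D M c s \<oplus> x) \<in> lspan D M UNIV ?S"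
    proof (subst lspan_iff [OF S], simp, intro conjI allI impI)
      show "G (scale D M c s \<oplus> x) \<in> carrier M" using sB x by (intro G(1)) auto
      fix b assume b: "b \<notin> ?S"
      then have "b \<noteq> s" "\<not> (b \<in> C \<and> rk b < n)" using s by auto
      then have "coord s b = 0" "coord y b = 0" using yn [of b] sB by (auto simp: coord_base)
      moreover have "coord (G x) b = 0" using x b lspan_iff [OF S, of UNIV "G x"] by auto
      ultimately show "coord (G (scale D M c s \<oplus> x)) b = 0" by (simp add: coord)
    qed simp
    moreover have "coord (G (scale D M c s \<oplus> x)) b = \<sigma> (coord (scale D M c s \<oplus> x) b)" if "rk b = n" for b
    proof -
      have "coord y b = 0" using yn that by blast
      then show ?thesis using x sB that by (auto simp: coord coord_add coord_scale coord_base \<sigma>)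
    qed
    ultimately show "scale D M c s \<oplus> x \<in>
        {x \<in> carrier M. G x \<in> lspan D M UNIV ?S \<and> (\<forall>b. rk b = n \<longrightarrow> coord (G x) b = \<sigma> (coord x b))}"
      using sB x by simp
  qed (simp add: G0 lspan_0 \<sigma>)
  then show ?thesis by simp
qed

text \<open>A vector involves finitely many basis elements. Hence inductions over a bound of the
  rank reach every vector even if the rank is unbounded on \<open>B\<close>.\<close>

lemma finite_rank:
  fixes rk :: "'m \<Rightarrow> nat"
  assumes "C \<subseteq> B" "x \<in> lspan D M R C" "0 \<in> R"
  obtains n where "x \<in> lspan D M R {b \<in> C. rk b < n}"
proof -
  have x: "x \<in> carrier M" "\<forall>b. coord x b \<in> R" "\<forall>b. b \<notin> C \<longrightarrow> coord x b = 0"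
    using assms(2) lspan_iff [OF assms(1,3)] by blast+
  let ?n = "Suc (Max (insert 0 (rk ` {b. coord x b \<noteq> 0})))"
  have "rk b < ?n" if "coord x b \<noteq> 0" for b
    using that coord_expand(1) [OF x(1)] by (intro le_imp_less_Suc Max_ge) auto
  then have "x \<in> lspan D M R {b \<in> C. rk b < ?n}"
    using x assms(1,3) by (subst lspan_iff) auto
  then show ?thesis by (rule that)
qed

lemma lspan_rank_0: "x \<in> lspan D M R {b \<in> C. rk b < (0 :: nat)} \<Longrightarrow> x = \<zero>"
  by (erule lspanE) (auto simp: subset_empty)

text \<open>For surjectivity, \<open>x\<close> minus \<open>G x\<close> has smaller rank, and if it
  equals \<open>G z\<close> then \<open>G\<close> maps \<open>x \<oplus> z\<close> to
  \<open>x\<close>; all coefficients stay in \<open>R\<close>. For injectivity, the coordinates of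
  highest rank of a vector in the kernel vanish, so its rank can be lowered indefinitely.\<close>

lemma unipotent_bij:
  fixes rk :: "'m \<Rightarrow> nat"
  assumes G: "\<And>x. x \<in> carrier M \<Longrightarrow> G x \<in> carrier M"
      "\<And>x y. x \<in> carrier M \<Longrightarrow> y \<in> carrier M \<Longrightarrow> G (x \<oplus> y) = G x \<oplus> G y"
      "\<And>c x. x \<in> carrier M \<Longrightarrow> G (scale D M c x) = scale D M c (G x)"
    and tri: "\<And>b. b \<in> B \<Longrightarrow> G b \<ominus> b \<in> lspan D M UNIV {b' \<in> B. lt b b'}"
    and triR: "\<And>b. b \<in> C \<Longrightarrow> G b \<ominus> b \<in> lspan D M R {b' \<in> B. lt b b'}"
    and R: "0 \<in> R" "1 \<in> R" "\<And>a b. a \<in> R \<Longrightarrow> b \<in> R \<Longrightarrow> a + b \<in> R" "\<And>a. a \<in> R \<Longrightarrow> - a \<in> R"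
      "\<And>a b. a \<in> R \<Longrightarrow> b \<in> R \<Longrightarrow> a * b \<in> R"
    and C: "C \<subseteq> B" "\<And>b b'. b \<in> C \<Longrightarrow> b' \<in> B \<Longrightarrow> lt b b' \<Longrightarrow> b' \<in> C"
    and rk: "\<And>b b'. b \<in> B \<Longrightarrow> b' \<in> B \<Longrightarrow> lt b b' \<Longrightarrow> rk b' < rk b"
  shows "G ` lspan D M R C = lspan D M R C" "inj_on G (carrier M)"
proof -
  have Rd: "a - b \<in> R" if "a \<in> R" "b \<in> R" for a b using R(3) [OF that(1) R(4) [OF that(2)]] by simp
  have into': "x \<in> {x. G x \<in> lspan D M R C}" if "x \<in> lspan D M R C" for x
    using that
  proof (rule lspan_least)
    show "C \<subseteq> carrier M" using C by auto
    have G0: "G \<zero> = \<zero>" using G(1) [of \<zero>] G(3) [of \<zero> 0] by (simp add: scale_simps)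
    then have "G \<zero> \<in> lspan D M R C" by (simp add: lspan_0)
    then show "\<zero> \<in> {x. G x \<in> lspan D M R C}" by simp
    fix c s x assume c: "c \<in> R" and s: "s \<in> C" and x: "x \<in> {x. G x \<in> lspan D M R C}" "x \<in> carrier M"
    have sB: "s \<in> B" using s C by blast
    have "lspan D M R {b' \<in> B. lt s b'} \<subseteq> lspan D M R C" using C s by (intro lspan_mono) auto
    then have "G s \<ominus> s \<in> lspan D M R C" using triR [OF s] by blast
    moreover have "s \<in> lspan D M R C" using C s R by (intro lspan_base) auto
    ultimately have "G s \<ominus> s \<oplus> s \<in> lspan D M R C" using C R by (intro lspan_add) auto
    then have "G s \<in> lspan D M R C" using sB G(1) by (simp add: a_minus_def M.a_assoc M.l_neg)
    then have "scale D M c (G s) \<oplus> G x \<in> lspan D M R C"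
      using c x C R by (intro lspan_add lspan_scale) auto
    then show "scale D M c s \<oplus> x \<in> {x. G x \<in> lspan D M R C}" using sB x G by simp
  qed
  have into: "G x \<in> lspan D M R C" if "x \<in> lspan D M R C" for x
    using into' [OF that] by simp
  have onto: "\<exists>z\<in>lspan D M R C. G z = x" if "x \<in> lspan D M R {b \<in> C. rk b < n}" for x n
    using that
  proof (induction n arbitrary: x)
    case 0
    then have "x = \<zero>" by (rule lspan_rank_0)
    moreover have "G \<zero> = \<zero>" using G(1) [of \<zero>] G(3) [of \<zero> 0] by (simp add: scale_simps)
    ultimately show ?case using lspan_0 by blast
  next
    case (Suc n)
    have SB: "{b \<in> C. rk b < k} \<subseteq> B" for k using C by auto
    have xU: "x \<in> lspan D M R C" using Suc.prems lspan_mono [of R R "{b \<in> C. rk b < Suc n}" C] by blast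
    then have xc: "x \<in> carrier M" using lspan_iff [OF C(1) R(1)] by blast
    have xC: "x \<in> lspan D M UNIV {b \<in> C. rk b < Suc n}"
      using Suc.prems lspan_mono [of R UNIV "{b \<in> C. rk b < Suc n}" "{b \<in> C. rk b < Suc n}"] by blast
    have "G x \<in> lspan D M UNIV {b \<in> C. rk b < Suc n} \<and> (\<forall>b. rk b = n \<longrightarrow> coord (G x) b = coord x b)"
      by (rule unipotent_coord [where G = G and \<sigma> = "\<lambda>c. c" and lt = lt and rk = rk])
        (rule G tri C rk xC refl; assumption)+
    then have Gx: "G x \<in> lspan D M UNIV {b \<in> C. rk b < Suc n}" "\<And>b. rk b = n \<Longrightarrow> coord (G x) b = coord x b" by simp_all
    have "x \<ominus> G x \<in> lspan D M R {b \<in> C. rk b < n}"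
    proof (subst lspan_iff [OF SB R(1)], intro conjI allI impI)
      show "x \<ominus> G x \<in> carrier M" using xc G(1) by simp
      show "coord (x \<ominus> G x) b \<in> R" for b
        using xU into [OF xU] lspan_iff [OF C(1) R(1)] xc G(1) Rd by (auto simp: coord_diff)
      fix b assume b: "b \<notin> {b \<in> C. rk b < n}"
      show "coord (x \<ominus> G x) b = 0"
      proof (cases "rk b = n")
        case False
        then have "b \<notin> {b \<in> C. rk b < Suc n}" using b by auto
        then have "coord x b = 0" "coord (G x) b = 0"
          using Suc.prems Gx(1) lspan_iff [OF SB R(1)] lspan_iff [OF SB, of UNIV] by blast+
        then show ?thesis using xc G(1) by (simp add: coord_diff)
      qed (use xc G(1) Gx(2) in \<open>simp add: coord_diff\<close>)
    qed
    then obtain z where z: "z \<in> lspan D M R C" "G z = x \<ominus> G x" using Suc.IH by blast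
    then have zc: "z \<in> carrier M" using lspan_iff [OF C(1) R(1)] by blast
    have "G (x \<oplus> z) = x" using xc zc G z(2) by (simp add: a_minus_def M.a_ac M.r_neg2 M.r_neg1 M.r_neg)
    moreover have "x \<oplus> z \<in> lspan D M R C" using xU z C R by (intro lspan_add) auto
    ultimately show ?case by blast
  qed
  show "G ` lspan D M R C = lspan D M R C"
  proof
    show "lspan D M R C \<subseteq> G ` lspan D M R C"
    proof
      fix x assume "x \<in> lspan D M R C"
      then obtain n where "x \<in> lspan D M R {b \<in> C. rk b < n}" using finite_rank [OF C(1) _ R(1)] by blast
      then show "x \<in> G ` lspan D M R C" using onto by blast
    qed
  qed (use into in blast)
  have ker: "x = \<zero>" if "x \<in> lspan D M UNIV {b \<in> B. rk b < n}" "G x = \<zero>" for x n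
    using that
  proof (induction n)
    case 0
    show ?case by (rule lspan_rank_0 [OF 0(1)])
  next
    case (Suc n)
    have SB: "{b \<in> B. rk b < k} \<subseteq> B" for k by auto
    have "G x \<in> lspan D M UNIV {b \<in> B. rk b < Suc n} \<and> (\<forall>b. rk b = n \<longrightarrow> coord (G x) b = coord x b)"
      by (rule unipotent_coord [where G = G and \<sigma> = "\<lambda>c. c" and lt = lt and rk = rk])
        (rule G tri subset_refl rk Suc.prems(1) refl | assumption)+
    then have "coord x b = 0" if "rk b = n" for b using that Suc.prems(2) by simp
    moreover have "coord x b = 0" if "b \<notin> {b \<in> B. rk b < Suc n}" for b
      using Suc.prems(1) that lspan_iff [OF SB, of UNIV] by blast
    moreover have "x \<in> carrier M" using Suc.prems(1) lspan_iff [OF SB, of UNIV] by blast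
    ultimately have "x \<in> lspan D M UNIV {b \<in> B. rk b < n}"
      by (subst lspan_iff [OF SB]) (auto simp: less_Suc_eq)
    then show ?case using Suc.IH Suc.prems(2) by blast
  qed
  show "inj_on G (carrier M)"
  proof (rule inj_onI)
    fix x y assume xy: "x \<in> carrier M" "y \<in> carrier M" "G x = G y"
    have "G (x \<oplus> scale D M (- 1) y) = G x \<oplus> scale D M (- 1) (G y)" using xy G by simp
    also have "\<dots> = \<zero>" using xy G(1) by (simp add: scale_simps M.r_neg)
    finally have G0: "G (x \<ominus> y) = \<zero>" using xy by (simp add: scale_simps a_minus_def)
    have "x \<ominus> y \<in> lspan D M UNIV B" using xy by (intro carrier_lspan) simp
    then obtain n where "x \<ominus> y \<in> lspan D M UNIV {b \<in> B. rk b < n}" using finite_rank [of B _ UNIV] by blast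
    then have "x \<ominus> y = \<zero>" using ker G0 by blast
    then show "x = y" using xy by simp
  qed
qed


subsection \<open>Bar-invariant bases\<close>

context
  fixes \<Psi> :: "'m \<Rightarrow> 'm" and lt :: "'m \<Rightarrow> 'm \<Rightarrow> bool" and rk :: "'m \<Rightarrow> nat"
  assumes \<Psi>: "semilinear D M \<Psi>"
    and tri: "\<And>b. b \<in> B \<Longrightarrow> \<Psi> b \<ominus> b \<in> lspan D M UNIV {b' \<in> B. lt b b'}"
    and rk: "\<And>b b'. b \<in> B \<Longrightarrow> b' \<in> B \<Longrightarrow> lt b b' \<Longrightarrow> rk b' < rk b"
begin

lemma Psi_simps:
  "x \<in> carrier M \<Longrightarrow> \<Psi> x \<in> carrier M"
  "x \<in> carrier M \<Longrightarrow> y \<in> carrier M \<Longrightarrow> \<Psi> (x \<oplus> y) = \<Psi> x \<oplus> \<Psi> y"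
  "x \<in> carrier M \<Longrightarrow> \<Psi> (scale D M c x) = scale D M (qbar c) (\<Psi> x)"
  using \<Psi> unfolding semilinear_def by auto

lemma Psi_uminus: "x \<in> carrier M \<Longrightarrow> \<Psi> (\<ominus> x) = \<ominus> \<Psi> x"
  using Psi_simps(3) [of x "- 1"] Psi_simps(1) by (simp add: scale_simps qbar_uminus)

lemma Psi_diff: "x \<in> carrier M \<Longrightarrow> y \<in> carrier M \<Longrightarrow> \<Psi> (x \<ominus> y) = \<Psi> x \<ominus> \<Psi> y"
  by (simp add: a_minus_def Psi_simps Psi_uminus)

context
  fixes C assumes C: "C \<subseteq> B" "\<And>b b'. b \<in> C \<Longrightarrow> b' \<in> B \<Longrightarrow> lt b b' \<Longrightarrow> b' \<in> C"
begin

lemma Psi_top: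
  assumes "x \<in> lspan D M UNIV {b \<in> C. rk b < Suc n}"
  shows "\<Psi> x \<in> lspan D M UNIV {b \<in> C. rk b < Suc n}" "rk b = n \<Longrightarrow> coord (\<Psi> x) b = qbar (coord x b)"
proof -
  have "\<Psi> x \<in> lspan D M UNIV {b \<in> C. rk b < Suc n} \<and> (\<forall>b. rk b = n \<longrightarrow> coord (\<Psi> x) b = qbar (coord x b))"
    by (rule unipotent_coord [where G = \<Psi> and \<sigma> = qbar and lt = lt and rk = rk])
      (rule Psi_simps qbar_add qbar_0 tri C rk assms; assumption)+
  then show "\<Psi> x \<in> lspan D M UNIV {b \<in> C. rk b < Suc n}" "rk b = n \<Longrightarrow> coord (\<Psi> x) b = qbar (coord x b)"
    by blast+
qed

lemma rank_subset: "{b \<in> C. rk b < n} \<subseteq> B" using C by auto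

lemma rank_step:
  assumes "x \<in> lspan D M R {b \<in> C. rk b < Suc n}" "0 \<in> R" "\<And>b. rk b = n \<Longrightarrow> coord x b = 0"
  shows "x \<in> lspan D M R {b \<in> C. rk b < n}"
  using assms(1,3) unfolding lspan_iff [OF rank_subset assms(2)] by (auto simp: less_Suc_eq)

text \<open>The coordinates of highest rank are conjugation invariant and have only negative powers
  of \<open>q\<close>, so they vanish; the bound for the rank then decreases.\<close>

lemma bar_invariant_zero:
  assumes "x \<in> lspan D M qinv_Z_pi_qinv {b \<in> C. rk b < n}" "\<Psi> x = x"
  shows "x = \<zero>"
  using assms
proof (induction n)
  case 0
  show ?case by (rule lspan_rank_0 [OF 0(1)])
next
  case (Suc n)
  have q: "\<forall>b. coord x b \<in> qinv_Z_pi_qinv"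
    using Suc.prems(1) lspan_iff [OF rank_subset qinv_Z_pi_qinv_simps(1)] by blast
  have "x \<in> lspan D M UNIV {b \<in> C. rk b < Suc n}"
    using Suc.prems(1) lspan_mono [of qinv_Z_pi_qinv UNIV] by blast
  then have "qbar (coord x b) = coord x b" if "rk b = n" for b
    using Psi_top(2) [OF _ that] Suc.prems(2) by metis
  then have "coord x b = 0" if "rk b = n" for b
    using bar_invariant_qinv q that by blast
  then have "x \<in> lspan D M qinv_Z_pi_qinv {b \<in> C. rk b < n}"
    using rank_step [OF Suc.prems(1) qinv_Z_pi_qinv_simps(1)] by blast
  then show ?case using Suc.IH Suc.prems(2) by blast
qed

text \<open>The Kazhdan-Lusztig recursion. The coordinates of \<open>y\<close> of highest rank are
  anti-invariant scalars and can be split one by one; subtracting the resulting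
  \<open>x0 \<ominus> \<Psi> x0\<close> from \<open>y\<close> leaves an anti-invariant vector of
  smaller rank, still in the lattice by stability.\<close>

lemma bar_antiinvariant:
  assumes inv: "\<And>x. x \<in> carrier M \<Longrightarrow> \<Psi> (\<Psi> x) = x"
    and stab: "\<And>x. x \<in> lspan D M A_pi B \<Longrightarrow> \<Psi> x \<in> lspan D M A_pi B"
    and "y \<in> lspan D M A_pi {b \<in> C. rk b < n}" "\<Psi> y = \<ominus> y"
  shows "\<exists>x\<in>lspan D M qinv_Z_pi_qinv {b \<in> C. rk b < n}. x \<ominus> \<Psi> x = y"
  using assms(3,4)
proof (induction n arbitrary: y)
  case 0
  have "y = \<zero>" by (rule lspan_rank_0 [OF 0(1)])
  moreover have "\<Psi> \<zero> = \<zero>" by (rule semilinear_0 [OF \<Psi>])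
  ultimately have "\<zero> \<ominus> \<Psi> \<zero> = y" by (simp add: a_minus_def)
  then show ?case using lspan_0 by blast
next
  case (Suc n)
  let ?S = "\<lambda>n. {b \<in> C. rk b < n}"
  have y: "y \<in> carrier M" "\<forall>b. coord y b \<in> A_pi" "\<forall>b. b \<notin> ?S (Suc n) \<longrightarrow> coord y b = 0"
    using Suc.prems(1) lspan_iff [OF rank_subset subring_A_pi(1)] by blast+
  have yU: "y \<in> lspan D M UNIV (?S (Suc n))"
    using Suc.prems(1) lspan_mono [of A_pi UNIV] by blast
  have anti: "qbar (coord y b) = - coord y b" if "rk b = n" for b
    using Psi_top(2) [OF yU that] Suc.prems(2) y(1) by (simp add: coord_uminus)
  \<comment> \<open>The last clause forces finite support of \<open>t\<close>, so that its values
    are the coordinates of a vector.\<close>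
  have "\<exists>t\<in>qinv_Z_pi_qinv. t - qbar t = coord y b \<and> (coord y b = 0 \<longrightarrow> t = 0)" if "rk b = n" for b
    using bar_antiinvariant_split [OF _ anti [OF that]] y(2) qinv_Z_pi_qinv_simps(1)
    by (cases "coord y b = 0") auto
  then obtain t where t: "\<And>b. rk b = n \<Longrightarrow> t b \<in> qinv_Z_pi_qinv \<and> t b - qbar (t b) = coord y b \<and> (coord y b = 0 \<longrightarrow> t b = 0)"
    by metis
  let ?t = "\<lambda>b. if rk b = n then t b else 0"
  have t_sub: "{b. ?t b \<noteq> 0} \<subseteq> {b. coord y b \<noteq> 0}" using t by (auto split: if_splits)
  obtain x0 where x0: "x0 \<in> carrier M" "coord x0 = ?t"
    using coord_exists [of ?t] finite_subset [OF t_sub coord_expand(1) [OF y(1)]] t_sub coord_expand(2) [OF y(1)]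
    by (metis (no_types, lifting) subset_trans)
  have x0q: "x0 \<in> lspan D M qinv_Z_pi_qinv (?S (Suc n))"
    using x0 t y(3) qinv_Z_pi_qinv_simps(1) unfolding lspan_iff [OF rank_subset qinv_Z_pi_qinv_simps(1)] by auto
  have x0A: "x0 \<in> lspan D M A_pi B"
    using x0q lspan_mono [of qinv_Z_pi_qinv A_pi "?S (Suc n)" B] rank_subset qinv_Z_pi_qinv_subset by blast
  have x0U: "x0 \<in> lspan D M UNIV (?S (Suc n))"
    using x0q lspan_mono [of qinv_Z_pi_qinv UNIV] by blast
  define y' where "y' = y \<ominus> (x0 \<ominus> \<Psi> x0)"
  have Px0: "\<Psi> x0 \<in> carrier M" using x0 by (simp add: Psi_simps)
  have cy': "coord y' b = coord y b - (coord x0 b - coord (\<Psi> x0) b)" for b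
    unfolding y'_def using y(1) x0(1) Px0 by (simp add: coord_diff)
  have "\<Psi> y' = \<ominus> y'"
  proof -
    have "\<Psi> y' = \<ominus> y \<ominus> (\<Psi> x0 \<ominus> x0)"
      unfolding y'_def using y(1) x0(1) Px0 Suc.prems(2) inv by (simp add: Psi_diff)
    moreover have "coord (\<ominus> y \<ominus> (\<Psi> x0 \<ominus> x0)) b = coord (\<ominus> y') b" for b
      using y(1) x0(1) Px0 by (simp add: y'_def coord_diff coord_uminus)
    ultimately show ?thesis
      using y(1) x0(1) Px0 by (intro coord_eqI) (auto simp: y'_def)
  qed
  moreover have "y' \<in> lspan D M A_pi (?S n)"
  proof (subst lspan_iff [OF rank_subset subring_A_pi(1)], intro conjI allI impI)
    show "y' \<in> carrier M" using y(1) x0(1) Px0 by (simp add: y'_def)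
    have "coord x0 b \<in> A_pi" "coord (\<Psi> x0) b \<in> A_pi" for b
      using x0A stab [OF x0A] lspan_iff [OF subset_refl subring_A_pi(1)] by blast+
    then show "coord y' b \<in> A_pi" for b
      unfolding cy' diff_conv_add_uminus using y(2) by (intro subring_A_pi) auto
    fix b assume b: "b \<notin> ?S n"
    show "coord y' b = 0"
    proof (cases "rk b = n")
      case True
      then show ?thesis using Psi_top(2) [OF x0U True] t [OF True] by (simp add: cy' x0)
    next
      case False
      then have "b \<notin> ?S (Suc n)" using b by auto
      then have "coord y b = 0" "coord x0 b = 0" "coord (\<Psi> x0) b = 0"
        using y(3) x0U Psi_top(1) [OF x0U] lspan_iff [OF rank_subset, of UNIV] by blast+
      then show ?thesis by (simp add: cy')
    qed
  qed
  ultimately obtain x where x: "x \<in> lspan D M qinv_Z_pi_qinv (?S n)" "x \<ominus> \<Psi> x = y'"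
    using Suc.IH by blast
  have xq: "x \<in> lspan D M qinv_Z_pi_qinv (?S (Suc n))"
    by (rule subsetD [OF lspan_mono x(1)]) auto
  have xc: "x \<in> carrier M" using x(1) lspan_iff [OF rank_subset qinv_Z_pi_qinv_simps(1)] by blast
  have "x \<oplus> x0 \<in> lspan D M qinv_Z_pi_qinv (?S (Suc n))"
    using xq x0q qinv_Z_pi_qinv_simps C by (intro lspan_add) auto
  moreover have "(x \<oplus> x0) \<ominus> \<Psi> (x \<oplus> x0) = y"
  proof (rule coord_eqI)
    have "coord x b - coord (\<Psi> x) b = coord y' b" for b
      using xc Psi_simps(1) [OF xc] by (simp flip: x(2) add: coord_diff)
    then show "coord ((x \<oplus> x0) \<ominus> \<Psi> (x \<oplus> x0)) b = coord y b" for b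
      using xc x0(1) Px0 Psi_simps(1) [OF xc] cy' [of b]
      by (simp add: coord_diff coord_add Psi_simps algebra_simps)
  qed (use xc x0 Px0 y Psi_simps in simp_all)
  ultimately show ?case by blast
qed

end

end

end

section \<open>The action of the quasi-K-matrix\<close>

lemma int_mult_diff: "int_mult (int a - int b) x = int_mult (int a) x - int_mult (int b) x"
proof -
  have split: "(\<Sum>_<c + k. x) = (\<Sum>_<c. x) + (\<Sum>_<k. x)" for c k :: nat
    by (induction k) (simp_all add: add.assoc)
  show ?thesis
  proof (cases "b \<le> a")
    case True
    then show ?thesis using split [of b "a - b"] by (simp add: int_mult_def nat_diff_distrib')
  next
    case False
    then have "nat (int b - int a) = b - a" by simp
    then show ?thesis using False split [of a "b - a"] by (simp add: int_mult_def)
  qed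
qed

lemma root_of_inj:
  fixes D :: "('i::finite, 'x::ab_group_add, 'y, 'z) root_datum_scheme"
  assumes "int_linear_independent (xroot D)" "root_of D \<nu> = root_of D \<nu>'"
  shows "\<nu> = \<nu>'"
proof -
  have "(\<Sum>i\<in>UNIV. int_mult (int (\<nu> i) - int (\<nu>' i)) (xroot D i)) = 0"
    using assms(2) by (simp add: int_mult_diff sum_subtractf root_of_def)
  then have "int (\<nu> i) - int (\<nu>' i) = 0" for i
    using assms(1) [unfolded int_linear_independent_def, rule_format, of "\<lambda>i. int (\<nu> i) - int (\<nu>' i)"] by simp
  then show ?thesis by (intro ext) simp
qed

lemma root_of_0 [simp]: "root_of D (\<lambda>_. 0) = 0"
  by (simp add: root_of_def)

text \<open>The description is meaningful when \<open>\<xi>\<close> is below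
  \<open>\<kappa>\<close>; uniqueness of \<open>\<nu>\<close> is linear independence of the simple
  roots.\<close>

definition hgt ::
  "('i::finite, 'x::ab_group_add, 'y, 'z) root_datum_scheme \<Rightarrow> 'x \<Rightarrow> 'x \<Rightarrow> nat" where
  "hgt D \<xi> \<kappa> = ht (THE \<nu>. \<kappa> - \<xi> = root_of D \<nu>)"

lemma hgt_eq:
  assumes "int_linear_independent (xroot D)" "\<kappa> - \<xi> = root_of D \<nu>"
  shows "hgt D \<xi> \<kappa> = ht \<nu>"
proof -
  have "(THE \<nu>. \<kappa> - \<xi> = root_of D \<nu>) = \<nu>"
    using assms root_of_inj [OF assms(1)] by (intro the_equality) auto
  then show ?thesis by (simp add: hgt_def)
qed

lemma hgt_add:
  assumes "int_linear_independent (xroot D)" "wle D \<xi> \<xi>'" "wle D \<xi>' \<kappa>"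
  shows "wle D \<xi> \<kappa>" "hgt D \<xi> \<kappa> = hgt D \<xi> \<xi>' + hgt D \<xi>' \<kappa>"
proof -
  obtain \<alpha> \<beta> where a: "\<xi>' - \<xi> = root_of D \<alpha>" and b: "\<kappa> - \<xi>' = root_of D \<beta>"
    using assms(2,3) by (auto simp: wle_def)
  have c: "\<kappa> - \<xi> = root_of D (\<lambda>i. \<alpha> i + \<beta> i)" using a b by (simp add: root_of_add flip: a b)
  then show "wle D \<xi> \<kappa>" by (auto simp: wle_def)
  show "hgt D \<xi> \<kappa> = hgt D \<xi> \<xi>' + hgt D \<xi>' \<kappa>"
    using hgt_eq [OF assms(1)] a b c by (simp add: ht_add)
qed

lemma hgt_pos:
  assumes "int_linear_independent (xroot D)" "wle D \<xi> \<xi>'" "\<xi> \<noteq> \<xi>'"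
  shows "0 < hgt D \<xi> \<xi>'"
proof -
  obtain \<alpha> where a: "\<xi>' - \<xi> = root_of D \<alpha>" using assms(2) by (auto simp: wle_def)
  then have "\<alpha> \<noteq> (\<lambda>_. 0)" using assms(3) by auto
  then have "ht \<alpha> \<noteq> 0" by (auto simp: ht_def)
  then show ?thesis using hgt_eq [OF assms(1) a] by simp
qed

text \<open>A number that drops strictly when a weight is raised below some bound in
  \<open>S\<close>: each bound contributes according to the height of its distance, and a bound that
  is no longer above the weight contributes \<open>0\<close>.\<close>

definition wrank ::
  "('i::finite, 'x::ab_group_add, 'y, 'z) root_datum_scheme \<Rightarrow> 'x set \<Rightarrow> 'x \<Rightarrow> nat" where
  "wrank D S \<xi> = (\<Sum>\<kappa>\<in>S. if wle D \<xi> \<kappa> then Suc (hgt D \<xi> \<kappa>) else 0)"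

lemma wrank_less:
  assumes ind: "int_linear_independent (xroot D)" and "finite S" "wle D \<xi> \<xi>'" "\<xi> \<noteq> \<xi>'" "\<exists>\<kappa>\<in>S. wle D \<xi>' \<kappa>"
  shows "wrank D S \<xi>' < wrank D S \<xi>"
  unfolding wrank_def
proof (rule sum_strict_mono_ex1 [OF assms(2)])
  show "\<forall>\<kappa>\<in>S. (if wle D \<xi>' \<kappa> then Suc (hgt D \<xi>' \<kappa>) else 0) \<le> (if wle D \<xi> \<kappa> then Suc (hgt D \<xi> \<kappa>) else 0)"
    using hgt_add [OF ind assms(3)] by auto
  obtain \<kappa> where k: "\<kappa> \<in> S" "wle D \<xi>' \<kappa>" using assms(5) by blast
  then have "(if wle D \<xi>' \<kappa> then Suc (hgt D \<xi>' \<kappa>) else 0) < (if wle D \<xi> \<kappa> then Suc (hgt D \<xi> \<kappa>) else 0)"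
    using hgt_add [OF ind assms(3) k(2)] hgt_pos [OF ind assms(3,4)] by simp
  then show "\<exists>\<kappa>\<in>S. (if wle D \<xi>' \<kappa> then Suc (hgt D \<xi>' \<kappa>) else 0) < (if wle D \<xi> \<kappa> then Suc (hgt D \<xi> \<kappa>) else 0)"
    using k(1) by blast
qed

lemma is_basis_span: "is_basis D M R N B \<Longrightarrow> x \<in> N \<Longrightarrow> \<exists>y\<in>lspan D M R B. x \<ominus>\<^bsub>M\<^esub> y = \<zero>\<^bsub>M\<^esub>"
  by (simp add: is_basis_def is_basis_mod_def)

lemma direct_sum_decomposes: "direct_sum M K G \<Longrightarrow> m \<in> carrier M \<Longrightarrow> \<exists>f. decomposes M K G m f"
  unfolding direct_sum_def by (rule ex1_implies_ex) (erule conjE, erule bspec)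

lemma hat_sum_trunc':
  fixes D :: "('i::finite, 'x, 'y::ab_group_add, 'z) root_datum_scheme"
  shows "hat_sum D (\<lambda>\<nu>. U_class D (Y \<nu>)) = (\<lambda>n. U_class D (trunc n Y))"
  by (intro ext hat_sum_trunc)

locale bounded_based_module = iquantum D \<psi> \<psi>i + U_weight D M + U_basis D M B
  for D :: "('i::finite, 'x::ab_group_add, 'y::ab_group_add, 'z) iroot_datum_scheme" and \<psi> \<psi>i
    and M :: "(('i, 'y) Uelt, 'm) module" (structure) and B +
  fixes \<Upsilon>
  assumes quasi_K: "is_quasi_K D \<psi> \<psi>i \<Upsilon>" and based: "based_module D \<psi> M B"
    and bounded: "weights_bounded_above D M"
begin

lemma xroot_independent: "int_linear_independent (xroot D)"
  using datum by (simp add: iquantum_datum_def super_root_datum_def)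

lemma wt_lspan:
  assumes "x \<in> wt \<xi>" shows "x \<in> lspan D M UNIV (B \<inter> wt \<xi>)"
proof -
  have "is_basis D M UNIV (wt \<xi>) (B \<inter> wt \<xi>)" using based by (simp add: based_module_def)
  from is_basis_span [OF this assms]
  obtain y where y: "y \<in> lspan D M UNIV (B \<inter> wt \<xi>)" "x \<ominus> y = \<zero>" by (rule bexE)
  have "y \<in> carrier M" using y(1) B_carrier by (intro lspan_closed [of "B \<inter> wt \<xi>"]) auto
  moreover have "x \<in> carrier M" using assms by simp
  ultimately have "x = y" using y(2) by simp
  then show ?thesis using y(1) by simp
qed

text \<open>As \<open>b\<close> has coordinate \<open>1\<close> at itself, some weight component of
  \<open>b\<close> has a nonzero coordinate at \<open>b\<close>. That component lies in the span of
  the basis elements of its own weight, so \<open>b\<close> is one of these.\<close>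

lemma B_wt:
  assumes "b \<in> B" obtains \<xi> where "b \<in> wt \<xi>"
proof -
  have "direct_sum M UNIV wt" using based by (simp add: based_module_def weight_module_def)
  from direct_sum_decomposes [OF this B_closed [OF assms]] obtain f where f: "decomposes M UNIV wt b f" ..
  have wt: "f \<xi> \<in> wt \<xi>" for \<xi> using f by (simp add: decomposes_def)
  have fc: "f \<in> A \<rightarrow> carrier M" for A using wt by (auto simp: Pi_iff intro: wt_closed)
  have fin: "finite {k. f k \<noteq> \<zero>}" and b: "b = (\<Oplus>k\<in>{k. f k \<noteq> \<zero>}. f k)"
    using f by (simp_all add: decomposes_def)
  have "(\<Sum>k\<in>{k. f k \<noteq> \<zero>}. coord (f k) b) = coord b b"
    using coord_finsum [OF fin fc, of b] b by simp
  also have "\<dots> \<noteq> 0" using assms by (simp add: coord_base)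
  finally obtain k where "coord (f k) b \<noteq> 0" by (meson sum.neutral)
  moreover have "f k \<in> lspan D M UNIV (B \<inter> wt k)" by (rule wt_lspan [OF wt])
  ultimately have "b \<in> wt k" using lspan_iff [of "B \<inter> wt k" UNIV "f k"] by auto
  then show ?thesis by (rule that)
qed

lemma B_nonzero: "b \<in> B \<Longrightarrow> b \<noteq> \<zero>"
  using coord_base [of b b] by auto

lemma weight_bound:
  obtains S where "finite S" "\<And>m \<xi>. m \<in> wt \<xi> \<Longrightarrow> m \<noteq> \<zero> \<Longrightarrow> \<exists>\<kappa>\<in>S. wle D \<xi> \<kappa>"
proof -
  obtain S where S: "finite S" "\<forall>\<xi>. wt \<xi> \<noteq> {\<zero>} \<longrightarrow> (\<exists>\<kappa>\<in>S. wle D \<xi> \<kappa>)"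
    using bounded unfolding weights_bounded_above_def by blast
  show ?thesis by (rule that [OF S(1)]) (use S(2) in blast)
qed

text \<open>Turns arguments along the weight order on a possibly infinite basis into inductions over
  natural numbers. The weight of a basis element is unique since basis elements are nonzero.\<close>

lemma basis_rank:
  obtains rk :: "'m \<Rightarrow> nat"
  where "\<And>b b'. b \<in> B \<Longrightarrow> b' \<in> B \<Longrightarrow> wt_above D M b b' \<Longrightarrow> rk b' < rk b"
proof -
  obtain S where S: "finite S" "\<And>m \<xi>. m \<in> wt \<xi> \<Longrightarrow> m \<noteq> \<zero> \<Longrightarrow> \<exists>\<kappa>\<in>S. wle D \<xi> \<kappa>"
    by (rule weight_bound) blast
  define w where "w b = (SOME \<xi>. b \<in> wt \<xi>)" for b
  have w: "w b = \<xi>" if "b \<in> B" "b \<in> wt \<xi>" for b \<xi>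
    using someI [of "\<lambda>\<xi>. b \<in> wt \<xi>"] that wt_unique B_nonzero unfolding w_def by blast
  show ?thesis
  proof (rule that [of "\<lambda>b. wrank D S (w b)"])
    fix b b' assume b: "b \<in> B" "b' \<in> B" and "wt_above D M b b'"
    then obtain \<xi> \<xi>' where x: "b \<in> wt \<xi>" "b' \<in> wt \<xi>'" "wle D \<xi> \<xi>'" "\<xi> \<noteq> \<xi>'"
      unfolding wt_above_def by blast
    show "wrank D S (w b') < wrank D S (w b)"
      using wrank_less [OF xroot_independent S(1) x(3,4) S(2) [OF x(2) B_nonzero [OF b(2)]]] w b x by simp
  qed
qed

lemma act_wsupp_zero:
  assumes "p \<in> wsupp L" "m \<in> carrier M" "\<And>gs. gs \<in> L \<Longrightarrow> act (mon gs) m = \<zero>"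
  shows "act p m = \<zero>"
proof -
  obtain A c where A: "finite A" "A \<subseteq> L" "p = (\<Sum>gs\<in>A. fa_const (c gs) * mon gs)"
    using wsupp_expand [OF assms(1)] by blast
  have "act p m = (\<Oplus>gs\<in>A. act (fa_const (c gs) * mon gs) m)"
    unfolding A(3) by (rule act_sum [OF A(1) assms(2)])
  also have "\<dots> = (\<Oplus>gs\<in>A. \<zero>)"
  proof (rule M.finsum_cong')
    fix gs assume "gs \<in> A"
    then have "act (mon gs) m = \<zero>" using A(2) assms(3) by blast
    then show "act (fa_const (c gs) * mon gs) m = \<zero>" using assms(2) by (simp add: act_mult)
  qed auto
  finally show ?thesis by simp
qed

text \<open>A word of \<open>l\<close> letters \<open>E\<close> raises the weight by a sum of
  \<open>l\<close> simple roots. If it does not kill \<open>m\<close>, the new weight is still below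
  a bound, so \<open>l\<close> is at most the height of the distance from \<open>\<xi>\<close> to
  one of finitely many bounds.\<close>

lemma tri_words_wt_kill:
  assumes "m \<in> wt \<xi>"
  shows "\<exists>N. \<forall>p\<in>mspan D (tri_words N). act p m = \<zero>"
proof -
  obtain S where S: "finite S" "\<And>m \<xi>. m \<in> wt \<xi> \<Longrightarrow> m \<noteq> \<zero> \<Longrightarrow> \<exists>\<kappa>\<in>S. wle D \<xi> \<kappa>"
    by (rule weight_bound) blast
  have m: "m \<in> carrier M" using assms by simp
  define N where "N = Suc (Max (insert 0 (hgt D \<xi> ` S)))"
  have N: "hgt D \<xi> \<kappa> < N" if "\<kappa> \<in> S" for \<kappa>
    unfolding N_def using that S(1) by (intro le_imp_less_Suc Max_ge) auto
  have E: "act (mon es) m = \<zero>" if es: "es \<in> E_words" "N \<le> length es" for es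
  proof (rule ccontr)
    assume nz: "act (mon es) m \<noteq> \<zero>"
    obtain "is" where "is": "es = map GenE is" using es(1) by (auto simp: E_words_map)
    then have "es \<in> E_words_wt (count_list is)" by (auto simp: E_words_wt_def)
    then have wt: "word_wt D es = root_of D (count_list is)" by (rule word_wt_E_words_wt)
    obtain \<kappa> where k: "\<kappa> \<in> S" "wle D (word_wt D es + \<xi>) \<kappa>" using S(2) [OF wt_act_word [OF assms] nz] by blast
    have "word_wt D es + \<xi> - \<xi> = root_of D (count_list is)" using wt by simp
    then have "wle D \<xi> (word_wt D es + \<xi>)" "hgt D \<xi> (word_wt D es + \<xi>) = length es"
      using hgt_eq [OF xroot_independent] "is" by (auto simp: wle_def ht_count_list)
    then have "length es \<le> hgt D \<xi> \<kappa>" using hgt_add(2) [OF xroot_independent _ k(2)] by fastforce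
    then show False using N [OF k(1)] es(2) by simp
  qed
  have "act p m = \<zero>" if p: "p \<in> mspan D (tri_words N)" for p
  proof -
    obtain p' where p': "p' \<in> wsupp (tri_words N)" "U_class D p = U_class D p'"
      using p unfolding mspan_iff by blast
    have "act p' m = \<zero>"
    proof (rule act_wsupp_zero [OF p'(1) m])
      fix gs :: "('i, 'y) gen list" assume "gs \<in> tri_words N"
      then obtain fs zs es where gs: "gs = fs @ zs @ es" "es \<in> E_words" "N \<le> length es"
        by (auto simp: tri_words_def)
      show "act (mon gs) m = \<zero>" using E [OF gs(2,3)] m by (simp add: gs(1) mon_append act_mult)
    qed
    then show ?thesis by (simp add: p'(2))
  qed
  then show ?thesis by blast
qed

lemma tri_words_kill:
  assumes "m \<in> carrier M"
  obtains N where "\<And>p. p \<in> mspan D (tri_words N) \<Longrightarrow> act p m = \<zero>"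
proof -
  have "m \<in> {m \<in> carrier M. \<exists>N. \<forall>p\<in>mspan D (tri_words N). act p m = \<zero>}"
  proof (rule lspan_least [OF carrier_lspan [OF assms] B_carrier])
    fix c s x assume s: "s \<in> B" and "x \<in> {m \<in> carrier M. \<exists>N. \<forall>p\<in>mspan D (tri_words N). act p m = \<zero>}"
    then obtain N where x: "x \<in> carrier M" and N: "\<forall>p\<in>mspan D (tri_words N). act p x = \<zero>" by blast
    obtain \<xi> where "s \<in> wt \<xi>" by (rule B_wt [OF s])
    then obtain N' where N': "\<forall>p\<in>mspan D (tri_words N'). act p s = \<zero>" using tri_words_wt_kill by blast
    have "act p (scale D M c s \<oplus> x) = \<zero>" if "p \<in> mspan D (tri_words (max N N'))" for p
    proof -
      have "p \<in> mspan D (tri_words N)" "p \<in> mspan D (tri_words N')"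
        using that mspan_mono [OF tri_words_mono] by (meson max.cobounded1 max.cobounded2 subsetD)+
      then show ?thesis using N N' s x by (simp add: act_add_right flip: scale_act)
    qed
    then show "scale D M c s \<oplus> x \<in> {m \<in> carrier M. \<exists>N. \<forall>p\<in>mspan D (tri_words N). act p m = \<zero>}"
      using s x by auto
  qed (auto intro: exI)
  then show ?thesis using that by blast
qed

text \<open>The bridge from the completion to the module: the difference eventually lies in a
  neighbourhood that kills \<open>m\<close>. Identities for \<open>\<theta>\<close> are obtained by
  taking an index at which finitely many such equations hold together.\<close>

lemma heq_act:
  assumes "heq D s t" "m \<in> carrier M"
  shows "\<forall>\<^sub>F n in sequentially. act (s n) m = act (t n) m"
proof -
  obtain N where N: "\<And>p. p \<in> mspan D (tri_words N) \<Longrightarrow> act p m = \<zero>"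
    using tri_words_kill [OF assms(2)] by blast
  obtain n0 where n0: "\<And>n. n0 \<le> n \<Longrightarrow> s n - t n \<in> mspan D (tri_words N)"
    using heqD [OF assms(1), of N] by blast
  have "act (s n) m = act (t n) m" if "n0 \<le> n" for n
    using N [OF n0 [OF that]] assms(2) by (simp add: act_diff)
  then show ?thesis unfolding eventually_sequentially by blast
qed

text \<open>A representing family of the quasi-K-matrix with all weights in \<open>T\<close>, fixed
  once for the whole module.\<close>

definition \<Theta> :: "('i \<Rightarrow> nat) \<Rightarrow> ('i, 'y) free_alg" where
  "\<Theta> = (SOME Y. good_family Y \<and> hat_eq D (\<lambda>n. U_class D (trunc n Y)) (hat_sum D \<Upsilon>))"

lemma \<Theta>: "good_family \<Theta>" "hat_eq D (\<lambda>n. U_class D (trunc n \<Theta>)) (hat_sum D \<Upsilon>)"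
proof -
  have "\<exists>Y. good_family Y \<and> hat_eq D (\<lambda>n. U_class D (trunc n Y)) (hat_sum D \<Upsilon>)"
    using quasi_K_good_family [OF quasi_K] by metis
  from someI_ex [OF this] show "good_family \<Theta>" "hat_eq D (\<lambda>n. U_class D (trunc n \<Theta>)) (hat_sum D \<Upsilon>)"
    by (simp_all add: \<Theta>_def)
qed

section \<open>The unipotent operator given by the quasi-K-matrix\<close>

abbreviation \<theta> :: "'m \<Rightarrow> 'm" where "\<theta> \<equiv> quasi_K_act \<Upsilon> M"

text \<open>Components of large height kill \<open>m\<close>, so the finite sum in
  \<open>quasi_K_act\<close> agrees with a truncation of \<open>\<Upsilon>\<close>; equality in the
  completion then permits replacing \<open>\<Upsilon>\<close> by \<open>\<Theta>\<close>.\<close>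

lemma theta_eventually:
  assumes m: "m \<in> carrier M"
  shows "\<forall>\<^sub>F n in sequentially. \<theta> m = act (trunc n \<Theta>) m"
proof -
  have "\<forall>\<nu>. \<exists>p. p \<in> wsupp (E_words_wt \<nu>) \<and> \<Upsilon> \<nu> = U_class D p"
    using quasi_K unfolding is_quasi_K_def intertwiner_def U_plus_wt_words by blast
  then obtain Y where Y: "\<And>\<nu>. Y \<nu> \<in> wsupp (E_words_wt \<nu>)" "\<And>\<nu>. \<Upsilon> \<nu> = U_class D (Y \<nu>)" by metis
  obtain N where N: "\<And>p. p \<in> mspan D (tri_words N) \<Longrightarrow> act p m = \<zero>"
    using tri_words_kill [OF m] by blast
  have big: "act (Y \<nu>) m = \<zero>" if "N \<le> ht \<nu>" for \<nu>
  proof (intro N wsupp_mspan)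
    have "E_words_wt \<nu> \<subseteq> E_long N"
      using that E_words_wt_length E_words_wt_subset by (fastforce simp: E_long_def)
    then show "Y \<nu> \<in> wsupp (tri_words N)" using Y(1) wsupp_mono E_long_tri by blast
  qed
  have eq: "\<theta> m = act (trunc n Y) m" if "N \<le> n" for n
  proof -
    have "{\<nu>. \<Upsilon> \<nu> \<odot> m \<noteq> \<zero>} \<subseteq> {\<nu>. ht \<nu> < n}" using big that by (force simp: Y(2))
    moreover have "(\<Oplus>\<nu>\<in>{\<nu>. ht \<nu> < n}. act (Y \<nu>) m) = act (trunc n Y) m"
      unfolding trunc_def using act_sum [OF finite_ht m] by metis
    moreover have "(\<Oplus>\<nu>\<in>{\<nu>. ht \<nu> < n}. act (Y \<nu>) m) = (\<Oplus>\<nu>\<in>{\<nu>. \<Upsilon> \<nu> \<odot> m \<noteq> \<zero>}. act (Y \<nu>) m)"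
      using calculation(1) m Y(2) finite_ht by (intro M.add.finprod_mono_neutral_cong_left [symmetric]) auto
    ultimately show ?thesis by (simp add: quasi_K_act_def Y(2))
  qed
  have Ups: "\<Upsilon> = (\<lambda>\<nu>. U_class D (Y \<nu>))" using Y(2) by blast
  have "heq D (\<lambda>n. trunc n \<Theta>) (\<lambda>n. trunc n Y)"
    using \<Theta>(2) hat_sum_trunc' [of D Y] Ups by (simp flip: hat_eq_iff_heq)
  from heq_act [OF this m] show ?thesis
    using eventually_ge_at_top [of N] by eventually_elim (simp add: eq)
qed

lemma theta_closed [simp]: "m \<in> carrier M \<Longrightarrow> \<theta> m \<in> carrier M"
  using eventually_happens [OF theta_eventually [of m]] by auto

lemma theta_add:
  assumes m: "m \<in> carrier M" and n: "n \<in> carrier M"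
  shows "\<theta> (m \<oplus> n) = \<theta> m \<oplus> \<theta> n"
proof -
  from theta_eventually [OF M.a_closed [OF m n]] theta_eventually [OF m] theta_eventually [OF n]
  have "\<forall>\<^sub>F k in sequentially. \<theta> (m \<oplus> n) = \<theta> m \<oplus> \<theta> n"
    by eventually_elim (simp add: act_add_right m n)
  then show ?thesis by simp
qed

lemma theta_scale:
  assumes m: "m \<in> carrier M"
  shows "\<theta> (scale D M c m) = scale D M c (\<theta> m)"
proof -
  from theta_eventually [OF scale_closed [OF m, of c]] theta_eventually [OF m]
  have "\<forall>\<^sub>F k in sequentially. \<theta> (scale D M c m) = scale D M c (\<theta> m)"
    by eventually_elim (simp add: scale_act m)
  then show ?thesis by simp
qed

text \<open>A refinement of the strict weight order by the requirement that weights differ by an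
  element of \<open>T\<close>. Triangularity for this finer relation is what keeps all constructions
  inside one class of \<open>Xi D\<close>.\<close>

definition ltT :: "'m \<Rightarrow> 'm \<Rightarrow> bool" where
  "ltT b b' \<longleftrightarrow> (\<exists>\<xi> \<xi>'. b \<in> wt \<xi> \<and> b' \<in> wt \<xi>' \<and> wle D \<xi> \<xi>' \<and> \<xi> \<noteq> \<xi>' \<and> \<xi>' - \<xi> \<in> T)"

lemma ltT_wt_above: "ltT b b' \<Longrightarrow> wt_above D M b b'"
  unfolding ltT_def wt_above_def by blast

lemma lspan_finsum:
  assumes "finite A" "S \<subseteq> carrier M" "\<And>a. a \<in> A \<Longrightarrow> f a \<in> lspan D M UNIV S"
  shows "(\<Oplus>a\<in>A. f a) \<in> lspan D M UNIV S"
  using assms(1,3)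
proof (induction A rule: finite_induct)
  case (insert a A)
  have "f \<in> A \<rightarrow> carrier M" "f a \<in> carrier M"
    using insert.prems lspan_closed [OF assms(2)] by (auto simp: Pi_iff)
  then show ?case using insert by (simp add: lspan_add [OF assms(2)])
qed (simp add: lspan_0)

text \<open>The component of \<open>\<Theta>\<close> in weight zero acts as the identity, and every
  other one raises the weight by an element of \<open>T\<close>, which is nonzero because the simple
  roots are independent.\<close>

lemma theta_triangular:
  assumes b: "b \<in> B" shows "\<theta> b \<ominus> b \<in> lspan D M UNIV {b' \<in> B. ltT b b'}"
proof -
  have S: "{b' \<in> B. ltT b b'} \<subseteq> carrier M" using B_carrier by auto
  obtain \<xi> where xi: "b \<in> wt \<xi>" by (rule B_wt [OF b])
  have Ef: "E_family \<Theta>" and Y0: "\<Theta> (\<lambda>_. 0) = 1" and YT: "\<And>\<nu>. \<Theta> \<nu> \<noteq> 0 \<Longrightarrow> root_of D \<nu> \<in> T"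
    using \<Theta>(1) unfolding good_family_def by blast+
  have "\<forall>\<^sub>F n in sequentially. \<theta> b = act (trunc n \<Theta>) b \<and> 1 \<le> n"
    using theta_eventually [OF B_closed [OF b]] eventually_ge_at_top [of 1] by (rule eventually_conj)
  from eventually_happens [OF this] obtain n where n: "\<theta> b = act (trunc n \<Theta>) b" "1 \<le> n" by auto
  let ?A = "{\<nu> :: 'i \<Rightarrow> nat. ht \<nu> < n} - {\<lambda>_. 0}"
  have fin: "finite {\<nu> :: 'i \<Rightarrow> nat. ht \<nu> < n}" by (rule finite_ht)
  have "trunc n \<Theta> = 1 + (\<Sum>\<nu>\<in>?A. \<Theta> \<nu>)"
    unfolding trunc_def using n(2) by (subst sum.remove [OF fin, of "\<lambda>_. 0"]) (auto simp: Y0 ht_def)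
  then have "act (trunc n \<Theta>) b = b \<oplus> act (\<Sum>\<nu>\<in>?A. \<Theta> \<nu>) b" using b by (simp add: act_add)
  then have "\<theta> b \<ominus> b = act (\<Sum>\<nu>\<in>?A. \<Theta> \<nu>) b"
    using b n(1) by (simp add: a_minus_def M.a_ac M.r_neg2 M.r_neg1 M.r_neg)
  also have "\<dots> = (\<Oplus>\<nu>\<in>?A. act (\<Theta> \<nu>) b)" using fin b by (intro act_sum) auto
  also have "\<dots> \<in> lspan D M UNIV {b' \<in> B. ltT b b'}"
  proof (rule lspan_finsum [OF _ S])
    fix \<nu> assume nu: "\<nu> \<in> ?A"
    show "act (\<Theta> \<nu>) b \<in> lspan D M UNIV {b' \<in> B. ltT b b'}"
    proof (cases "\<Theta> \<nu> = 0")
      case False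
      have "root_of D \<nu> \<noteq> 0" using nu root_of_inj [OF xroot_independent, of \<nu> "\<lambda>_. 0"] by auto
      then have lt: "ltT b b'" if "b' \<in> wt (root_of D \<nu> + \<xi>)" for b'
        unfolding ltT_def using that xi YT [OF False]
        by (intro exI [of _ \<xi>] exI [of _ "root_of D \<nu> + \<xi>"]) (auto simp: wle_def)
      have "act (\<Theta> \<nu>) b \<in> wt (root_of D \<nu> + \<xi>)"
        using Ef xi word_wt_E_words_wt unfolding E_family_def by (intro wt_act_wsupp) auto
      from wt_lspan [OF this] show ?thesis
        by (rule subsetD [OF lspan_mono, rotated 2]) (use lt in auto)
    qed (use b in \<open>simp add: lspan_0\<close>)
  qed (use fin in auto)
  finally show ?thesis .
qed

section \<open>The involution \<open>\<Psi>\<close> of the module\<close>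

abbreviation \<psi>M :: "'m \<Rightarrow> 'm" where "\<psi>M \<equiv> basis_involution D M B"
abbreviation \<Psi> :: "'m \<Rightarrow> 'm" where "\<Psi> \<equiv> psi_iM D \<Upsilon> M B"

lemma psiM_closed [simp]: "m \<in> carrier M \<Longrightarrow> \<psi>M m \<in> carrier M"
  using basis_involution_semilinear unfolding semilinear_def by blast

lemma psiM_psiM: "m \<in> carrier M \<Longrightarrow> \<psi>M (\<psi>M m) = m"
  by (rule coord_eqI) (simp_all add: coord_basis_involution)

lemma psiM_smult: "u \<in> carrier (U D) \<Longrightarrow> m \<in> carrier M \<Longrightarrow> \<psi>M (u \<odot> m) = \<psi> u \<odot> \<psi>M m"
  using based unfolding based_module_def by blast

text \<open>The uniqueness of the quasi-K-matrix, read on the module: all good families define the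
  same element of the completion.\<close>

lemma good_family_act:
  assumes "good_family Y" "m \<in> carrier M"
  shows "\<forall>\<^sub>F n in sequentially. \<theta> m = act (trunc n Y) m"
proof -
  have "hat_eq D (hat_sum D (\<lambda>\<nu>. U_class D (Y \<nu>))) (hat_sum D \<Upsilon>)"
    using quasi_K good_family_intertwiner [OF assms(1)] unfolding is_quasi_K_def by blast
  moreover have "hat_eq D (hat_sum D (\<lambda>\<nu>. U_class D (\<Theta> \<nu>))) (hat_sum D \<Upsilon>)"
    using quasi_K good_family_intertwiner [OF \<Theta>(1)] unfolding is_quasi_K_def by blast
  moreover obtain P where "\<Upsilon> = (\<lambda>\<nu>. U_class D (P \<nu>))"
  proof -
    have "\<forall>\<nu>. \<exists>p. \<Upsilon> \<nu> = U_class D p"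
      using quasi_K unfolding is_quasi_K_def intertwiner_def U_plus_wt_words by blast
    then show ?thesis using that by metis
  qed
  ultimately have "heq D (\<lambda>n. trunc n Y) (\<lambda>n. trunc n P)" "heq D (\<lambda>n. trunc n \<Theta>) (\<lambda>n. trunc n P)"
    by (simp_all add: hat_sum_trunc' flip: hat_eq_iff_heq)
  then have "heq D (\<lambda>n. trunc n \<Theta>) (\<lambda>n. trunc n Y)" using heq_trans heq_sym by blast
  from heq_act [OF this assms(2)] theta_eventually [OF assms(2)] show ?thesis
    by eventually_elim simp
qed

lemma theta_surj: "\<theta> ` carrier M = carrier M"
proof -
  obtain rk :: "'m \<Rightarrow> nat" where rk: "\<And>b b'. b \<in> B \<Longrightarrow> b' \<in> B \<Longrightarrow> wt_above D M b b' \<Longrightarrow> rk b' < rk b"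
    by (rule basis_rank) blast
  have "\<theta> ` lspan D M UNIV B = lspan D M UNIV B"
    by (rule unipotent_bij(1) [where lt = ltT and rk = rk])
      (auto simp: theta_add theta_scale intro: theta_triangular rk ltT_wt_above)
  moreover have "lspan D M UNIV B = carrier M" using carrier_lspan lspan_closed [OF B_carrier] by blast
  ultimately show ?thesis by simp
qed

text \<open>Compatibility of \<open>\<psi>M\<close> with \<open>\<psi>\<close> turns conjugation by
  \<open>\<psi>M\<close> into the application of \<open>\<psi>\<close> to the series.\<close>

lemma psiM_theta_psiM:
  assumes m: "m \<in> carrier M"
  shows "\<forall>\<^sub>F n in sequentially. \<psi>M (\<theta> (\<psi>M m)) = act (bar_coeffs (trunc n \<Theta>)) m"
  using theta_eventually [OF psiM_closed [OF m]]
proof eventually_elim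
  case (elim n)
  have "E_family \<Theta>" using \<Theta>(1) unfolding good_family_def by blast
  then have "\<psi> (U_class D (trunc n \<Theta>)) = U_class D (bar_coeffs (trunc n \<Theta>))"
    by (intro psi_E_words trunc_E_words)
  then show ?case using m by (simp add: elim psiM_smult psiM_psiM U_class_simps)
qed

text \<open>On the left the product of \<open>\<Theta>\<close>, its conjugate and
  \<open>\<Theta>\<close> acts, which is the family \<open>triple \<Theta>\<close> up to long words.
  That family is good again, hence acts as \<open>\<theta>\<close>.\<close>

lemma theta_psiM: "m \<in> carrier M \<Longrightarrow> \<theta> (\<psi>M (\<theta> (\<psi>M (\<theta> m)))) = \<theta> m"
proof -
  assume m: "m \<in> carrier M"
  let ?m1 = "\<theta> m" and ?m2 = "\<psi>M (\<theta> (\<psi>M (\<theta> m)))"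
  have Ef: "E_family \<Theta>" using \<Theta>(1) unfolding good_family_def by blast
  have m12: "?m1 \<in> carrier M" "?m2 \<in> carrier M" using m by simp_all
  have "heq D (\<lambda>n. trunc n \<Theta> * bar_coeffs (trunc n \<Theta>) * trunc n \<Theta>) (\<lambda>n. trunc n (triple \<Theta>))"
    by (rule heq_E_long) (rule trunc_triple [OF Ef])
  from heq_act [OF this m] theta_eventually [OF m] psiM_theta_psiM [OF m12(1)] theta_eventually [OF m12(2)]
    good_family_act [OF good_family_triple [OF \<Theta>(1)] m]
  have "\<forall>\<^sub>F n in sequentially. \<theta> ?m2 = \<theta> m"
  proof eventually_elim
    case (elim n)
    have "\<theta> ?m2 = act (trunc n \<Theta>) (act (bar_coeffs (trunc n \<Theta>)) (act (trunc n \<Theta>) m))"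
      using elim(2,3,4) by metis
    also have "\<dots> = act (trunc n \<Theta> * bar_coeffs (trunc n \<Theta>) * trunc n \<Theta>) m" using m by (simp add: act_mult)
    finally show ?case using elim(1,5) by metis
  qed
  then show ?thesis by simp
qed

lemma Psi_semilinear: "semilinear D M \<Psi>"
  using basis_involution_semilinear unfolding semilinear_def psi_iM_def
  by (auto simp: theta_add theta_scale Pi_iff)

lemma Psi_closed [simp]: "m \<in> carrier M \<Longrightarrow> \<Psi> m \<in> carrier M"
  using Psi_semilinear unfolding semilinear_def by blast

text \<open>Every vector is of the form \<open>\<theta> m'\<close>, so the rightmost factor in
  \<open>theta_psiM\<close> can be cancelled.\<close>

lemma Psi_Psi: assumes "m \<in> carrier M" shows "\<Psi> (\<Psi> m) = m"
proof -
  obtain m' where "m' \<in> carrier M" "m = \<theta> m'" using theta_surj assms by blast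
  then show ?thesis using theta_psiM [of m'] by (simp add: psi_iM_def)
qed

text \<open>The intertwining relation of \<open>\<Theta>\<close> applied to the vector
  \<open>\<psi>M m\<close>, at an index where all truncations involved have become
  stationary.\<close>

lemma Psi_smult:
  assumes u: "u \<in> carrier (Ui D)" and m: "m \<in> carrier M"
  shows "\<Psi> (u \<odot> m) = \<psi>i u \<odot> \<Psi> m"
proof -
  obtain a b where ab: "\<psi>i u = U_class D a" "\<psi> u = U_class D b"
    and h: "heq D (\<lambda>n. a * trunc n \<Theta>) (\<lambda>n. trunc n \<Theta> * b)"
    using good_family_intertwines [OF \<Theta>(1) u] by blast
  let ?x = "\<psi>M m"
  have x: "?x \<in> carrier M" using m by simp
  from heq_act [OF h x] theta_eventually [OF x] theta_eventually [OF act_closed [OF x, of b]]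
  have "\<forall>\<^sub>F n in sequentially. \<theta> (act b ?x) = act a (\<theta> ?x)"
    by eventually_elim (simp add: act_mult x)
  then have "\<theta> (act b ?x) = act a (\<theta> ?x)" by simp
  then show ?thesis using m Ui_carrier [OF u] by (simp add: psi_iM_def psiM_smult ab)
qed

lemma Psi_triangular: "b \<in> B \<Longrightarrow> \<Psi> b \<ominus> b \<in> lspan D M UNIV {b' \<in> B. ltT b b'}"
  using theta_triangular by (simp add: psi_iM_def basis_involution_base)

end

section \<open>The canonical basis\<close>

subsection \<open>Transport of bases along linear maps\<close>

context U_module
begin

context
  fixes F :: "'m \<Rightarrow> 'm"
  assumes F: "\<And>x. x \<in> carrier M \<Longrightarrow> F x \<in> carrier M"
      "\<And>x y. x \<in> carrier M \<Longrightarrow> y \<in> carrier M \<Longrightarrow> F (x \<oplus> y) = F x \<oplus> F y"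
      "\<And>c x. x \<in> carrier M \<Longrightarrow> F (scale D M c x) = scale D M c (F x)"
    and inj: "inj_on F (carrier M)"
begin

lemma linear_0: "F \<zero> = \<zero>"
  using F(1) [of \<zero>] F(3) [of \<zero> 0] by (simp add: scale_simps)

lemma linear_uminus: "x \<in> carrier M \<Longrightarrow> F (\<ominus> x) = \<ominus> F x"
  using F(1) [of x] F(3) [of x "- 1"] by (simp add: scale_simps)

lemma linear_diff: "x \<in> carrier M \<Longrightarrow> y \<in> carrier M \<Longrightarrow> F (x \<ominus> y) = F x \<ominus> F y"
  by (simp add: a_minus_def F linear_uminus)

lemma linear_combination:
  assumes "finite t" "t \<subseteq> carrier M"
  shows "F (\<Oplus>s\<in>t. scale D M (c s) s) = (\<Oplus>s\<in>t. scale D M (c s) (F s))"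
  using assms
proof (induction t rule: finite_induct)
  case (insert s t)
  have "(\<lambda>s. scale D M (c s) s) \<in> t \<rightarrow> carrier M" "(\<lambda>s. scale D M (c s) (F s)) \<in> t \<rightarrow> carrier M"
    "scale D M (c s) s \<in> carrier M" "s \<in> carrier M" "F s \<in> carrier M"
    using insert.prems F(1) by auto
  then show ?case using insert F by simp
qed (simp add: linear_0)

lemma combination_image:
  assumes "finite t" "t \<subseteq> carrier M"
  shows "F (\<Oplus>s\<in>t. scale D M (c (F s)) s) = (\<Oplus>s\<in>F ` t. scale D M (c s) s)"
proof -
  have "inj_on F t" using inj assms(2) by (rule inj_on_subset)
  then have "(\<Oplus>s\<in>F ` t. scale D M (c s) s) = (\<Oplus>s\<in>t. scale D M (c (F s)) (F s))"
    using assms(2) F(1) by (intro M.add.finprod_reindex) (auto simp: Pi_iff)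
  then show ?thesis by (simp add: linear_combination [OF assms])
qed

lemma lspan_image:
  assumes S: "S \<subseteq> carrier M" shows "lspan D M R (F ` S) = F ` lspan D M R S"
proof
  show "lspan D M R (F ` S) \<subseteq> F ` lspan D M R S"
  proof
    fix x assume "x \<in> lspan D M R (F ` S)"
    then obtain t c where t: "finite t" "t \<subseteq> F ` S" "c \<in> t \<rightarrow> R" "x = (\<Oplus>s\<in>t. scale D M (c s) s)"
      by (rule lspanE)
    obtain t' where t': "t' \<subseteq> S" "finite t'" "t = F ` t'" using finite_subset_image [OF t(1,2)] by blast
    have "x = F (\<Oplus>s\<in>t'. scale D M (c (F s)) s)"
      using t(4) t' S by (simp add: combination_image)
    moreover have "(\<Oplus>s\<in>t'. scale D M (c (F s)) s) \<in> lspan D M R S"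
      using t' t(3) by (intro lspanI) auto
    ultimately show "x \<in> F ` lspan D M R S" by blast
  qed
  show "F ` lspan D M R S \<subseteq> lspan D M R (F ` S)"
  proof
    fix x assume "x \<in> F ` lspan D M R S"
    then obtain y where y: "y \<in> lspan D M R S" "x = F y" by blast
    from y(1) obtain t c where t: "finite t" "t \<subseteq> S" "c \<in> t \<rightarrow> R" "y = (\<Oplus>s\<in>t. scale D M (c s) s)"
      by (rule lspanE)
    let ?c = "\<lambda>s. c (inv_into t F s)"
    have it: "inj_on F t" using inj t(2) S by (meson inj_on_subset subset_trans)
    have eq: "(\<Oplus>s\<in>t. scale D M (c s) s) = (\<Oplus>s\<in>t. scale D M (?c (F s)) s)"
      using t(2) S it by (intro M.finsum_cong') (auto simp: inv_into_f_f)
    have "x = (\<Oplus>s\<in>F ` t. scale D M (?c s) s)"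
      unfolding y(2) t(4) eq using t S by (intro combination_image) auto
    moreover have "\<dots> \<in> lspan D M R (F ` S)"
      using t it by (intro lspanI) (auto simp: inv_into_f_f Pi_iff)
    ultimately show "x \<in> lspan D M R (F ` S)" by simp
  qed
qed

text \<open>Injectivity brings a relation modulo the image of \<open>P\<close> back to one modulo
  \<open>P\<close>. The submodule is carried along in order to treat the reduction at infinity in
  the same way as ordinary bases.\<close>

lemma is_basis_mod_image:
  assumes N: "N \<subseteq> carrier M" and P: "P \<subseteq> carrier M" and bas: "is_basis_mod D M R N P S"
  shows "is_basis_mod D M R (F ` N) (F ` P) (F ` S)"
proof -
  have b: "S \<subseteq> N" "lspan D M R S \<subseteq> N" "\<And>x. x \<in> N \<Longrightarrow> \<exists>y\<in>lspan D M R S. x \<ominus> y \<in> P"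
    "\<And>t c. finite t \<Longrightarrow> t \<subseteq> S \<Longrightarrow> c \<in> t \<rightarrow> R \<Longrightarrow> (\<Oplus>s\<in>t. scale D M (c s) s) \<in> P \<Longrightarrow> \<forall>s\<in>t. c s = 0"
    using bas by (simp_all add: is_basis_mod_def)
  have S: "S \<subseteq> carrier M" using b(1) N by blast
  show ?thesis
    unfolding is_basis_mod_def lspan_image [OF S]
  proof (intro conjI ballI allI impI)
    fix x assume "x \<in> F ` N"
    then obtain z where z: "z \<in> N" "x = F z" by blast
    obtain y where y: "y \<in> lspan D M R S" "z \<ominus> y \<in> P" using b(3) [OF z(1)] by blast
    have "z \<in> carrier M" "y \<in> carrier M" using z y b(2) N by blast+
    then have "x \<ominus> F y = F (z \<ominus> y)" by (simp add: z(2) linear_diff)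
    then show "\<exists>y\<in>F ` lspan D M R S. x \<ominus> y \<in> F ` P" using y by blast
  next
    fix t c s
    assume "finite t \<and> t \<subseteq> F ` S \<and> c \<in> t \<rightarrow> R \<and> (\<Oplus>s\<in>t. scale D M (c s) s) \<in> F ` P" and s: "s \<in> t"
    then have t: "finite t" "t \<subseteq> F ` S" "c \<in> t \<rightarrow> R" "(\<Oplus>s\<in>t. scale D M (c s) s) \<in> F ` P" by blast+
    obtain t' where t': "t' \<subseteq> S" "finite t'" "t = F ` t'" using finite_subset_image [OF t(1,2)] by blast
    have tc: "t' \<subseteq> carrier M" using t'(1) S by blast
    let ?y = "\<Oplus>s\<in>t'. scale D M (c (F s)) s"
    have "F ?y \<in> F ` P" using t(4) t' tc by (simp add: combination_image)
    moreover have "?y \<in> carrier M" using tc by (intro M.finsum_closed) auto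
    ultimately have "?y \<in> P" using inj P by (auto simp: inj_on_def subset_iff)
    then have "\<forall>s\<in>t'. c (F s) = 0" using t' t(3) by (intro b(4)) auto
    then show "c s = 0" using s t'(3) by auto
  qed (use b in blast)+
qed

lemma is_basis_image:
  assumes "N \<subseteq> carrier M" "is_basis D M R N S"
  shows "is_basis D M R (F ` N) (F ` S)"
  using is_basis_mod_image [OF assms(1) _ assms(2) [unfolded is_basis_def]] by (simp add: is_basis_def linear_0)

text \<open>A linear map commutes with scaling by \<open>inverse qq\<close>, so it takes the
  submodule for the one lattice to that for the other.\<close>

lemma basis_at_infinity_image:
  assumes S: "S \<subseteq> carrier M" and b: "basis_at_infinity D M S"
  shows "basis_at_infinity D M (F ` S)"
proof -
  let ?L = "lspan D M A_inf S"
  have L: "?L \<subseteq> carrier M" using lspan_closed [OF S] by blast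
  have "is_basis_mod D M Q_pi ?L (scale D M (inverse qq) ` ?L) S"
    using b by (simp add: basis_at_infinity_def Let_def)
  moreover have "scale D M (inverse qq) ` ?L \<subseteq> carrier M" using L scale_closed by blast
  ultimately have "is_basis_mod D M Q_pi (F ` ?L) (F ` scale D M (inverse qq) ` ?L) (F ` S)"
    by (intro is_basis_mod_image [OF L])
  moreover have "F ` scale D M (inverse qq) ` ?L = scale D M (inverse qq) ` F ` ?L"
    unfolding image_image by (intro image_cong refl F(3)) (use L in blast)
  ultimately show ?thesis by (simp add: basis_at_infinity_def Let_def lspan_image [OF S])
qed

end

end

context U_basis
begin

lemma is_basis_lspan:
  assumes S: "S \<subseteq> B" and R: "0 \<in> R" "1 \<in> R"
  shows "is_basis D M R (lspan D M R S) S"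
  unfolding is_basis_def is_basis_mod_def
proof (intro conjI ballI allI impI)
  have Sc: "S \<subseteq> carrier M" using S B_carrier by blast
  show "S \<subseteq> lspan D M R S" using lspan_base [OF Sc R(2)] by blast
  show "\<exists>y\<in>lspan D M R S. x \<ominus> y \<in> {\<zero>}" if "x \<in> lspan D M R S" for x
    using that lspan_closed [OF Sc that] by (intro bexI [of _ x]) simp_all
  fix t c s
  assume "finite t \<and> t \<subseteq> S \<and> c \<in> t \<rightarrow> R \<and> (\<Oplus>s\<in>t. scale D M (c s) s) \<in> {\<zero>}" "s \<in> t"
  then show "c s = 0" using B_independent [of t c s] S by auto
qed simp

end

subsection \<open>Existence and uniqueness\<close>

context iquantum
begin

lemma xcoset_T: "xcoset D \<xi> = {\<xi>'. \<xi>' - \<xi> \<in> T}"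
proof -
  have "\<xi>' - \<xi> = \<kappa> + tauX D \<kappa> \<longleftrightarrow> \<xi>' = \<xi> + (\<kappa> + tauX D \<kappa>)" for \<xi>' \<kappa> by (auto simp: algebra_simps)
  then show ?thesis by (auto simp: xcoset_def T_def)
qed

lemma xcoset_self: "\<xi> \<in> xcoset D \<xi>"
  by (simp add: xcoset_T T_simps)

lemma Xi_iff: assumes "\<zeta> \<in> Xi D" "\<xi> \<in> \<zeta>" shows "\<xi>' \<in> \<zeta> \<longleftrightarrow> \<xi>' - \<xi> \<in> T"
proof -
  obtain \<kappa> where k: "\<zeta> = xcoset D \<kappa>" using assms(1) by (auto simp: Xi_def)
  have "\<xi> - \<kappa> \<in> T" using assms(2) by (simp add: k xcoset_T)
  from T_cancel [OF this, of "\<xi>' - \<xi>"] show ?thesis by (simp add: k xcoset_T)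
qed

lemma Xi_eq_xcoset: "\<zeta> \<in> Xi D \<Longrightarrow> \<xi> \<in> \<zeta> \<Longrightarrow> \<zeta> = xcoset D \<xi>"
  using Xi_iff by (auto simp: xcoset_T)

lemma xcoset_Xi: "xcoset D \<xi> \<in> Xi D"
  by (simp add: Xi_def)

lemma Xi_disjoint: "\<zeta> \<in> Xi D \<Longrightarrow> \<zeta>' \<in> Xi D \<Longrightarrow> \<zeta> \<noteq> \<zeta>' \<Longrightarrow> \<zeta> \<inter> \<zeta>' = {}"
  using Xi_eq_xcoset by blast

lemma Xi_nonempty: assumes "\<zeta> \<in> Xi D" obtains \<xi> where "\<xi> \<in> \<zeta>" "\<zeta> = xcoset D \<xi>"
  using assms xcoset_self unfolding Xi_def by blast

end

text \<open>Otherwise \<open>\<zeta>\<close> and the singleton of \<open>\<xi>\<close> would be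
  disjoint, and \<open>m\<close> minus \<open>m\<close> would be a nontrivial relation between
  vectors of the two pieces.\<close>

lemma (in U_weight) wt_in_iwt:
  assumes "m \<in> wt \<xi>" "m \<in> iwt \<zeta>" "m \<noteq> \<zero>" shows "\<xi> \<in> \<zeta>"
proof (rule ccontr)
  assume x: "\<xi> \<notin> \<zeta>"
  then have ne: "\<zeta> \<noteq> {\<xi>}" by blast
  have m: "m \<in> carrier M" using assms(1) by simp
  have "m \<in> iwt {\<xi>}" using assms(1) by (rule wt_iwt) simp
  let ?f = "\<lambda>\<zeta>'. if \<zeta>' = \<zeta> then m else \<ominus> m"
  have "?f \<zeta> = \<zero>"
  proof (rule iwt_independent [of "{\<zeta>, {\<xi>}}" ?f \<zeta>])
    show "(\<Oplus>\<zeta>'\<in>{\<zeta>, {\<xi>}}. ?f \<zeta>') = \<zero>" using ne m by (simp add: M.r_neg)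
  qed (use x ne assms(2) \<open>m \<in> iwt {\<xi>}\<close> in \<open>auto intro: iwt_uminus\<close>)
  then show False using assms(3) by simp
qed

section \<open>The weight order and the classes of \<open>Xi D\<close>\<close>

context bounded_based_module
begin

lemma wle_trans: "wle D \<xi> \<xi>' \<Longrightarrow> wle D \<xi>' \<xi>'' \<Longrightarrow> wle D \<xi> \<xi>''"
  using hgt_add(1) [OF xroot_independent] .

text \<open>Heights add up along a chain and are positive for distinct comparable weights, so a
  chain cannot return to its start.\<close>

lemma wle_strict_trans:
  assumes "wle D \<xi> \<xi>'" "\<xi> \<noteq> \<xi>'" "wle D \<xi>' \<xi>''" shows "\<xi> \<noteq> \<xi>''"
proof
  assume "\<xi> = \<xi>''"
  have "\<xi> - \<xi> = root_of D (\<lambda>_. 0)" by simp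
  from hgt_eq [OF xroot_independent this] have "hgt D \<xi> \<xi> = 0" by (simp add: ht_def)
  then show False
    using hgt_add(2) [OF xroot_independent assms(1,3)] hgt_pos [OF xroot_independent assms(1,2)] \<open>\<xi> = \<xi>''\<close> by simp
qed

lemma ltT_trans:
  assumes "b' \<in> B" "ltT b b'" "ltT b' b''" shows "ltT b b''"
proof -
  obtain \<xi> \<xi>' where a: "b \<in> wt \<xi>" "b' \<in> wt \<xi>'" "wle D \<xi> \<xi>'" "\<xi> \<noteq> \<xi>'" "\<xi>' - \<xi> \<in> T"
    using assms(2) unfolding ltT_def by blast
  obtain \<kappa> \<xi>'' where b: "b' \<in> wt \<kappa>" "b'' \<in> wt \<xi>''" "wle D \<kappa> \<xi>''" "\<xi>'' - \<kappa> \<in> T"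
    using assms(3) unfolding ltT_def by blast
  have k: "\<kappa> = \<xi>'" using wt_unique [OF b(1) a(2)] B_nonzero [OF assms(1)] by blast
  have "\<xi>'' - \<xi> \<in> T" using T_simps(2) [OF a(5) b(4)] by (simp add: k)
  then show ?thesis
    unfolding ltT_def using a b wle_trans [OF a(3)] wle_strict_trans [OF a(3,4)] k by blast
qed

lemma wt_above_trans:
  assumes "b' \<in> B" "wt_above D M b b'" "wt_above D M b' b''" shows "wt_above D M b b''"
proof -
  obtain \<xi> \<xi>' where a: "b \<in> wt \<xi>" "b' \<in> wt \<xi>'" "wle D \<xi> \<xi>'" "\<xi> \<noteq> \<xi>'"
    using assms(2) unfolding wt_above_def by blast
  obtain \<kappa> \<xi>'' where b: "b' \<in> wt \<kappa>" "b'' \<in> wt \<xi>''" "wle D \<kappa> \<xi>''"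
    using assms(3) unfolding wt_above_def by blast
  have k: "\<kappa> = \<xi>'" using wt_unique [OF b(1) a(2)] B_nonzero [OF assms(1)] by blast
  then show ?thesis
    unfolding wt_above_def using a b wle_trans [OF a(3)] wle_strict_trans [OF a(3,4)] by blast
qed

lemma iwt_lspan: "iwt \<zeta> = lspan D M UNIV (B \<inter> iwt \<zeta>)"
proof
  have S: "B \<inter> iwt \<zeta> \<subseteq> carrier M" using B_carrier by blast
  show "iwt \<zeta> \<subseteq> lspan D M UNIV (B \<inter> iwt \<zeta>)"
  proof
    fix x assume "x \<in> iwt \<zeta>"
    then show "x \<in> lspan D M UNIV (B \<inter> iwt \<zeta>)"
    proof (rule iwt_least)
      fix \<xi> m x assume "\<xi> \<in> \<zeta>" "m \<in> wt \<xi>" and x: "x \<in> lspan D M UNIV (B \<inter> iwt \<zeta>)"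
      then have "B \<inter> wt \<xi> \<subseteq> B \<inter> iwt \<zeta>" using wt_iwt by blast
      then have "m \<in> lspan D M UNIV (B \<inter> iwt \<zeta>)"
        using wt_lspan [OF \<open>m \<in> wt \<xi>\<close>] lspan_mono [OF subset_refl] by blast
      then show "m \<oplus> x \<in> lspan D M UNIV (B \<inter> iwt \<zeta>)" using x by (intro lspan_add [OF S]) auto
    qed (rule lspan_0)
  qed
  show "lspan D M UNIV (B \<inter> iwt \<zeta>) \<subseteq> iwt \<zeta>"
  proof
    fix x assume "x \<in> lspan D M UNIV (B \<inter> iwt \<zeta>)"
    then show "x \<in> iwt \<zeta>"
      by (rule lspan_least [OF _ S]) (auto intro: iwt_0 iwt_add iwt_scale)
  qed
qed

lemma iwt_upward:
  assumes "\<zeta> \<in> Xi D" "b \<in> B \<inter> iwt \<zeta>" "b' \<in> B" "ltT b b'" shows "b' \<in> B \<inter> iwt \<zeta>"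
proof -
  obtain \<xi> \<xi>' where a: "b \<in> wt \<xi>" "b' \<in> wt \<xi>'" "\<xi>' - \<xi> \<in> T" using assms(4) unfolding ltT_def by blast
  have "\<xi> \<in> \<zeta>" using wt_in_iwt [OF a(1)] assms(2) B_nonzero by blast
  then have "\<xi>' \<in> \<zeta>" using Xi_iff [OF assms(1)] a(3) by blast
  then show ?thesis using wt_iwt [OF a(2)] assms(3) by blast
qed

lemma unitriangular_iwt:
  assumes z: "\<zeta> \<in> Xi D" and b: "b \<in> B \<inter> iwt \<zeta>" and x: "x \<in> lspan D M UNIV {b' \<in> B. ltT b b'}"
  shows "x \<in> iwt \<zeta>"
proof -
  have "{b' \<in> B. ltT b b'} \<subseteq> B \<inter> iwt \<zeta>" using iwt_upward [OF z b] by blast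
  from subsetD [OF lspan_mono [OF subset_refl this] x] show ?thesis using iwt_lspan by blast
qed

text \<open>By \<open>Psi_triangular\<close> a basis element changes only by terms whose weights
  differ from its own by elements of \<open>T\<close>.\<close>

lemma Psi_iwt:
  assumes z: "\<zeta> \<in> Xi D" and x: "x \<in> iwt \<zeta>" shows "\<Psi> x \<in> iwt \<zeta>"
proof -
  note lin = Psi_semilinear [unfolded semilinear_def]
  have "x \<in> {x \<in> carrier M. \<Psi> x \<in> iwt \<zeta>}"
  proof (rule lspan_least)
    show "x \<in> lspan D M UNIV (B \<inter> iwt \<zeta>)" using x iwt_lspan by simp
    show "\<zero> \<in> {x \<in> carrier M. \<Psi> x \<in> iwt \<zeta>}" using semilinear_0 [OF Psi_semilinear] iwt_0 by simp
    fix c s x assume s: "s \<in> B \<inter> iwt \<zeta>" and "x \<in> {x \<in> carrier M. \<Psi> x \<in> iwt \<zeta>}"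
    then have x: "x \<in> carrier M" "\<Psi> x \<in> iwt \<zeta>" and sc: "s \<in> carrier M" by auto
    have "\<Psi> s = s \<oplus> (\<Psi> s \<ominus> s)"
      using sc M.a_lcomm [of s "\<Psi> s" "\<ominus> s"] by (simp add: a_minus_def M.r_neg)
    moreover have "\<Psi> s \<ominus> s \<in> iwt \<zeta>" using s by (intro unitriangular_iwt [OF z s] Psi_triangular) blast
    ultimately have "\<Psi> s \<in> iwt \<zeta>" using s iwt_add by (metis IntD2)
    then show "scale D M c s \<oplus> x \<in> {x \<in> carrier M. \<Psi> x \<in> iwt \<zeta>}"
      using lin sc x by (auto intro: iwt_add iwt_scale)
  qed (use B_carrier in blast)
  then show ?thesis by blast
qed

end

locale stable_based_module = bounded_based_module D \<psi> \<psi>i M B \<Upsilon>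
  for D :: "('i::finite, 'x::ab_group_add, 'y::ab_group_add, 'z) iroot_datum_scheme" and \<psi> \<psi>i
    and M :: "(('i, 'y) Uelt, 'm) module" (structure) and B \<Upsilon> +
  assumes stable: "\<And>m. m \<in> lspan D M A_pi B \<Longrightarrow> \<Psi> m \<in> lspan D M A_pi B"
begin

text \<open>The defect \<open>y = \<Psi> b \<ominus> b\<close> is anti-invariant because
  \<open>\<Psi>\<close> is an involution, and it lies in the lattice by stability. A solution
  \<open>x\<close> of \<open>x \<ominus> \<Psi> x = y\<close> with coefficients in
  \<open>qinv_Z_pi_qinv\<close> is the required correction.\<close>

lemma icanonical_element:
  assumes b: "b \<in> B"
  shows "\<exists>x\<in>lspan D M qinv_Z_pi_qinv {b' \<in> B. ltT b b'}. \<Psi> (b \<oplus> x) = b \<oplus> x"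
proof -
  let ?C = "{b' \<in> B. ltT b b'}"
  obtain rk :: "'m \<Rightarrow> nat" where rk: "\<And>b b'. b \<in> B \<Longrightarrow> b' \<in> B \<Longrightarrow> wt_above D M b b' \<Longrightarrow> rk b' < rk b"
    by (rule basis_rank) blast
  have rkT: "\<And>b b'. b \<in> B \<Longrightarrow> b' \<in> B \<Longrightarrow> ltT b b' \<Longrightarrow> rk b' < rk b" by (intro rk ltT_wt_above)
  have C: "?C \<subseteq> B" by blast
  have up: "\<And>c c'. c \<in> ?C \<Longrightarrow> c' \<in> B \<Longrightarrow> ltT c c' \<Longrightarrow> c' \<in> ?C" using ltT_trans by blast
  define y where "y = \<Psi> b \<ominus> b"
  have bc: "b \<in> carrier M" "\<Psi> b \<in> carrier M" using b by simp_all
  have bA: "b \<in> lspan D M A_pi B" using lspan_base [OF B_carrier subring_A_pi(2) b] .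
  have PbA: "\<Psi> b \<in> lspan D M A_pi B" by (rule stable [OF bA])
  have yC: "y \<in> lspan D M UNIV ?C" unfolding y_def by (rule Psi_triangular [OF b])
  have yA: "y \<in> lspan D M A_pi ?C"
  proof (subst lspan_iff [OF C subring_A_pi(1)], intro conjI allI impI)
    show "y \<in> carrier M" using bc by (simp add: y_def)
    show "coord y b' = 0" if "b' \<notin> ?C" for b' using yC that lspan_iff [OF C, of UNIV] by blast
    have "coord (\<Psi> b) b' \<in> A_pi" "coord b b' \<in> A_pi" for b'
      using bA PbA lspan_iff [OF subset_refl subring_A_pi(1)] by blast+
    then show "coord y b' \<in> A_pi" for b'
      using bc by (simp add: y_def coord_diff diff_conv_add_uminus subring_A_pi del: add_uminus_conv_diff)
  qed
  obtain n where n: "y \<in> lspan D M A_pi {b \<in> ?C. rk b < n}"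
    by (rule finite_rank [OF C yA subring_A_pi(1), where rk = rk]) blast
  have add: "\<Psi> (x \<oplus> z) = \<Psi> x \<oplus> \<Psi> z" if "x \<in> carrier M" "z \<in> carrier M" for x z
    using Psi_semilinear that unfolding semilinear_def by blast
  have um: "\<Psi> (\<ominus> x) = \<ominus> \<Psi> x" if "x \<in> carrier M" for x
    by (rule Psi_uminus [OF Psi_semilinear Psi_triangular rkT that])
  have Py: "\<Psi> y = \<ominus> y"
    using bc by (simp add: y_def a_minus_def add um Psi_Psi M.minus_add M.a_comm)
  have "\<exists>x\<in>lspan D M qinv_Z_pi_qinv {b \<in> ?C. rk b < n}. x \<ominus> \<Psi> x = y"
    by (rule bar_antiinvariant [where lt = ltT and rk = rk and C = ?C])
      (rule Psi_semilinear Psi_triangular rkT C up Psi_Psi stable n Py; assumption?)+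
  then obtain x where x: "x \<in> lspan D M qinv_Z_pi_qinv {b \<in> ?C. rk b < n}" "x \<ominus> \<Psi> x = y" ..
  have xC: "x \<in> lspan D M qinv_Z_pi_qinv ?C" by (rule subsetD [OF lspan_mono x(1)]) auto
  have xc: "x \<in> carrier M" using lspan_closed [OF _ xC] B_carrier by blast
  have "\<Psi> (b \<oplus> x) = b \<oplus> x"
  proof -
    have "coord x b' - coord (\<Psi> x) b' = coord (\<Psi> b) b' - coord b b'" for b'
      using arg_cong [OF x(2), of "\<lambda>z. coord z b'"] xc bc by (simp add: y_def coord_diff)
    then have "coord x b' = (coord (\<Psi> b) b' - coord b b') + coord (\<Psi> x) b'" for b'
      unfolding diff_eq_eq .
    then have "coord (\<Psi> b) b' + coord (\<Psi> x) b' = coord b b' + coord x b'" for b' by simp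
    then show ?thesis using xc bc by (intro coord_eqI) (simp_all add: add coord_add)
  qed
  then show ?thesis using xC by blast
qed

text \<open>The difference of two corrections is invariant with coefficients in
  \<open>qinv_Z_pi_qinv\<close>, hence zero. The coarse relation \<open>wt_above\<close> is used
  here since uniqueness has to hold among all elements that \<open>icanonical\<close>
  admits.\<close>

lemma icanonical_element_unique:
  assumes b: "b \<in> B" and x: "x \<in> lspan D M qinv_Z_pi_qinv {b' \<in> B. wt_above D M b b'}"
    and y: "y \<in> lspan D M qinv_Z_pi_qinv {b' \<in> B. wt_above D M b b'}"
    and "\<Psi> (b \<oplus> x) = b \<oplus> x" "\<Psi> (b \<oplus> y) = b \<oplus> y"
  shows "x = y"
proof -
  let ?C = "{b' \<in> B. wt_above D M b b'}"
  obtain rk :: "'m \<Rightarrow> nat" where rk: "\<And>b b'. b \<in> B \<Longrightarrow> b' \<in> B \<Longrightarrow> wt_above D M b b' \<Longrightarrow> rk b' < rk b"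
    by (rule basis_rank) blast
  have tri: "\<Psi> b \<ominus> b \<in> lspan D M UNIV {b' \<in> B. wt_above D M b b'}" if "b \<in> B" for b
    by (rule subsetD [OF lspan_mono Psi_triangular [OF that]]) (use ltT_wt_above in auto)
  have C: "?C \<subseteq> B" by blast
  have up: "\<And>c c'. c \<in> ?C \<Longrightarrow> c' \<in> B \<Longrightarrow> wt_above D M c c' \<Longrightarrow> c' \<in> ?C" using wt_above_trans by blast
  have Cc: "?C \<subseteq> carrier M" using B_carrier by blast
  have c: "x \<in> carrier M" "y \<in> carrier M" "b \<in> carrier M" using lspan_closed [OF Cc] x y b by auto
  have add: "\<Psi> (x \<oplus> z) = \<Psi> x \<oplus> \<Psi> z" if "x \<in> carrier M" "z \<in> carrier M" for x z
    using Psi_semilinear that unfolding semilinear_def by blast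
  have qinv: "0 \<in> qinv_Z_pi_qinv" by (rule qinv_Z_pi_qinv_simps)
  have d: "x \<ominus> y \<in> lspan D M qinv_Z_pi_qinv ?C"
  proof (subst lspan_iff [OF C qinv], intro conjI allI impI)
    show "x \<ominus> y \<in> carrier M" using c by simp
    have "coord x b' \<in> qinv_Z_pi_qinv" "coord y b' \<in> qinv_Z_pi_qinv" "b' \<notin> ?C \<longrightarrow> coord x b' = 0 \<and> coord y b' = 0" for b'
      using x y lspan_iff [OF C qinv] by blast+
    then show "coord (x \<ominus> y) b' \<in> qinv_Z_pi_qinv" "b' \<notin> ?C \<Longrightarrow> coord (x \<ominus> y) b' = 0" for b'
      using c by (simp_all add: coord_diff diff_conv_add_uminus qinv_Z_pi_qinv_simps del: add_uminus_conv_diff)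
  qed
  obtain n where n: "x \<ominus> y \<in> lspan D M qinv_Z_pi_qinv {b \<in> ?C. rk b < n}"
    by (rule finite_rank [OF C d qinv, where rk = rk]) blast
  have "\<Psi> x \<ominus> \<Psi> y = x \<ominus> y"
  proof (rule coord_eqI)
    fix b' assume "b' \<in> B"
    have "coord (\<Psi> b) b' + coord (\<Psi> x) b' = coord b b' + coord x b'"
      "coord (\<Psi> b) b' + coord (\<Psi> y) b' = coord b b' + coord y b'"
      using arg_cong [OF assms(4), of "\<lambda>z. coord z b'"] arg_cong [OF assms(5), of "\<lambda>z. coord z b'"] c
      by (simp_all add: add coord_add)
    then show "coord (\<Psi> x \<ominus> \<Psi> y) b' = coord (x \<ominus> y) b'"
      using c by (simp add: coord_diff) (metis add_diff_cancel_left)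
  qed (use c in simp_all)
  moreover have "\<Psi> (x \<ominus> y) = \<Psi> x \<ominus> \<Psi> y"
    by (rule Psi_diff [where lt = "wt_above D M" and rk = rk]) (rule Psi_semilinear tri rk c; assumption?)+
  ultimately have fixed: "\<Psi> (x \<ominus> y) = x \<ominus> y" by simp
  have "x \<ominus> y = \<zero>"
    by (rule bar_invariant_zero [where lt = "wt_above D M" and rk = rk and C = ?C])
      (rule Psi_semilinear tri rk C up n fixed; assumption?)+
  then show ?thesis using c by simp
qed

lemma icanonical_exists_unique: "\<exists>!f. icanonical D \<Psi> M B f"
proof -
  have "\<forall>b\<in>B. \<exists>x. x \<in> lspan D M qinv_Z_pi_qinv {b' \<in> B. ltT b b'} \<and> \<Psi> (b \<oplus> x) = b \<oplus> x"
    using icanonical_element unfolding Bex_def by (intro ballI)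
  from bchoice [OF this] obtain g
    where g: "\<forall>b\<in>B. g b \<in> lspan D M qinv_Z_pi_qinv {b' \<in> B. ltT b b'} \<and> \<Psi> (b \<oplus> g b) = b \<oplus> g b" ..
  have sub: "lspan D M qinv_Z_pi_qinv {b' \<in> B. ltT b b'} \<subseteq> lspan D M qinv_Z_pi_qinv {b' \<in> B. wt_above D M b b'}" for b
    using ltT_wt_above by (intro lspan_mono) auto
  have ex: "icanonical D \<Psi> M B (\<lambda>b\<in>B. b \<oplus> g b)"
    unfolding icanonical_def
  proof (intro conjI ballI bexI)
    fix b assume b: "b \<in> B"
    show "\<Psi> ((\<lambda>b\<in>B. b \<oplus> g b) b) = (\<lambda>b\<in>B. b \<oplus> g b) b" "(\<lambda>b\<in>B. b \<oplus> g b) b = b \<oplus> g b"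
      using g b by simp_all
    show "g b \<in> lspan D M qinv_Z_pi_qinv {b' \<in> B. wt_above D M b b'}"
      using g b sub by blast
  qed simp
  have un: "f = f'" if f: "icanonical D \<Psi> M B f" "icanonical D \<Psi> M B f'" for f f'
  proof (rule extensionalityI [of f B])
    fix b assume b: "b \<in> B"
    obtain x where x: "x \<in> lspan D M qinv_Z_pi_qinv {b' \<in> B. wt_above D M b b'}" "f b = b \<oplus> x" "\<Psi> (f b) = f b"
      using f(1) b unfolding icanonical_def by blast
    obtain x' where x': "x' \<in> lspan D M qinv_Z_pi_qinv {b' \<in> B. wt_above D M b b'}" "f' b = b \<oplus> x'" "\<Psi> (f' b) = f' b"
      using f(2) b unfolding icanonical_def by blast
    show "f b = f' b" using icanonical_element_unique [OF b x(1) x'(1)] x x' by simp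
  qed (use f in \<open>simp_all add: icanonical_def\<close>)
  show ?thesis using ex un by blast
qed

text \<open>Uniqueness for \<open>wt_above\<close> identifies the correction term of
  \<open>f b\<close> with the one constructed for \<open>ltT\<close>. So the finer triangularity
  holds automatically, which yields the compatibility with \<open>Xi D\<close>.\<close>

lemma icanonical_triangular:
  assumes f: "icanonical D \<Psi> M B f" and b: "b \<in> B"
  shows "f b \<in> carrier M" "\<Psi> (f b) = f b" "f b \<ominus> b \<in> lspan D M qinv_Z_pi_qinv {b' \<in> B. ltT b b'}"
proof -
  obtain x where x: "x \<in> lspan D M qinv_Z_pi_qinv {b' \<in> B. wt_above D M b b'}" "f b = b \<oplus> x" "\<Psi> (f b) = f b"
    using f b unfolding icanonical_def by blast
  show "\<Psi> (f b) = f b" by (rule x)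
  obtain y where y: "y \<in> lspan D M qinv_Z_pi_qinv {b' \<in> B. ltT b b'}" "\<Psi> (b \<oplus> y) = b \<oplus> y"
    using icanonical_element [OF b] by blast
  have y': "y \<in> lspan D M qinv_Z_pi_qinv {b' \<in> B. wt_above D M b b'}"
    by (rule subsetD [OF lspan_mono y(1)]) (use ltT_wt_above in auto)
  have xy: "x = y" using icanonical_element_unique [OF b x(1) y'] x y by simp
  have "{b' \<in> B. ltT b b'} \<subseteq> carrier M" using B_carrier by blast
  then have yc: "y \<in> carrier M" using lspan_closed y(1) by blast
  then show "f b \<in> carrier M" using b by (simp add: x(2) xy)
  have "f b \<ominus> b = y" using b yc M.a_lcomm [of b y "\<ominus> b"] by (simp add: x(2) xy a_minus_def M.a_assoc M.r_neg)
  then show "f b \<ominus> b \<in> lspan D M qinv_Z_pi_qinv {b' \<in> B. ltT b b'}" using y(1) by simp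
qed

section \<open>Properties of the canonical basis by transport from \<open>B\<close>\<close>

context
  fixes f assumes f: "icanonical D \<Psi> M B f"
begin

definition F where "F = basis_ext (\<lambda>c. c) f"

lemma F_linear:
  "x \<in> carrier M \<Longrightarrow> F x \<in> carrier M"
  "x \<in> carrier M \<Longrightarrow> y \<in> carrier M \<Longrightarrow> F (x \<oplus> y) = F x \<oplus> F y"
  "x \<in> carrier M \<Longrightarrow> F (scale D M c x) = scale D M c (F x)"
  and F_base: "b \<in> B \<Longrightarrow> F b = f b"
  unfolding F_def using icanonical_triangular(1) [OF f]
  by (auto intro: basis_ext_closed basis_ext_add basis_ext_scale basis_ext_base)

text \<open>The corrections have coefficients in \<open>qinv_Z_pi_qinv\<close>, so \<open>F\<close>
  is unitriangular over every subring containing these. The generality in \<open>R\<close> and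
  \<open>C\<close> serves the whole module, the two lattices and the classes of \<open>Xi D\<close>
  at once.\<close>

lemma F_bij:
  shows "C \<subseteq> B \<Longrightarrow> (\<And>b b'. b \<in> C \<Longrightarrow> b' \<in> B \<Longrightarrow> ltT b b' \<Longrightarrow> b' \<in> C) \<Longrightarrow> qinv_Z_pi_qinv \<subseteq> R \<Longrightarrow> 1 \<in> R \<Longrightarrow>
      (\<And>a b. a \<in> R \<Longrightarrow> b \<in> R \<Longrightarrow> a + b \<in> R) \<Longrightarrow> (\<And>a. a \<in> R \<Longrightarrow> - a \<in> R) \<Longrightarrow>
      (\<And>a b. a \<in> R \<Longrightarrow> b \<in> R \<Longrightarrow> a * b \<in> R) \<Longrightarrow> F ` lspan D M R C = lspan D M R C"
    and "inj_on F (carrier M)"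
proof -
  obtain rk :: "'m \<Rightarrow> nat" where rk: "\<And>b b'. b \<in> B \<Longrightarrow> b' \<in> B \<Longrightarrow> wt_above D M b b' \<Longrightarrow> rk b' < rk b"
    by (rule basis_rank) blast
  have rkT: "\<And>b b'. b \<in> B \<Longrightarrow> b' \<in> B \<Longrightarrow> ltT b b' \<Longrightarrow> rk b' < rk b" using rk ltT_wt_above by blast
  have tri: "F b \<ominus> b \<in> lspan D M R {b' \<in> B. ltT b b'}" if "b \<in> B" "qinv_Z_pi_qinv \<subseteq> R" for b R
    using icanonical_triangular(3) [OF f that(1)] lspan_mono [OF that(2) subset_refl] F_base [OF that(1)] by auto
  show "F ` lspan D M R C = lspan D M R C"
    if C: "C \<subseteq> B" "\<And>b b'. b \<in> C \<Longrightarrow> b' \<in> B \<Longrightarrow> ltT b b' \<Longrightarrow> b' \<in> C" and R: "qinv_Z_pi_qinv \<subseteq> R" "1 \<in> R"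
      "\<And>a b. a \<in> R \<Longrightarrow> b \<in> R \<Longrightarrow> a + b \<in> R" "\<And>a. a \<in> R \<Longrightarrow> - a \<in> R" "\<And>a b. a \<in> R \<Longrightarrow> b \<in> R \<Longrightarrow> a * b \<in> R"
  proof (rule unipotent_bij(1) [of F ltT C R rk])
    show "0 \<in> R" using R(1) qinv_Z_pi_qinv_simps(1) by blast
    show "F b \<ominus> b \<in> lspan D M UNIV {b' \<in> B. ltT b b'}" if "b \<in> B" for b by (rule tri [OF that subset_UNIV])
    show "F b \<ominus> b \<in> lspan D M R {b' \<in> B. ltT b b'}" if "b \<in> C" for b using C(1) that by (intro tri R(1)) blast
  qed (rule C R F_linear rkT; (assumption)?)+
  show "inj_on F (carrier M)"
  proof (rule unipotent_bij(2) [of F ltT B UNIV rk])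
    show "F b \<ominus> b \<in> lspan D M UNIV {b' \<in> B. ltT b b'}" "F b \<ominus> b \<in> lspan D M UNIV {b' \<in> B. ltT b b'}"
      if "b \<in> B" for b by (rule tri [OF that subset_UNIV])+
  qed (auto simp: F_linear rkT)
qed

lemma F_carrier: "F ` carrier M = carrier M"
proof -
  have "lspan D M UNIV B = carrier M" using carrier_lspan lspan_closed [OF B_carrier] by blast
  moreover have "F ` lspan D M UNIV B = lspan D M UNIV B" by (rule F_bij(1)) auto
  ultimately show ?thesis by simp
qed

lemma F_image: "F ` B = f ` B"
  using F_base by (intro image_cong) auto

lemma F_lattice:
  "F ` lspan D M A_pi B = lspan D M A_pi B" "F ` lspan D M Z_pi_qinv B = lspan D M Z_pi_qinv B"
proof -
  have "qinv_Z_pi_qinv \<subseteq> A_pi" using qinv_Z_pi_qinv_subset by (rule subset_trans)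
  then show "F ` lspan D M A_pi B = lspan D M A_pi B" by (intro F_bij(1)) (simp_all add: subring_A_pi)
  show "F ` lspan D M Z_pi_qinv B = lspan D M Z_pi_qinv B"
    by (intro F_bij(1)) (simp_all add: subring_Z_pi_qinv qinv_Z_pi_qinv_subset)
qed

lemma F_iwt: "\<zeta> \<in> Xi D \<Longrightarrow> F ` iwt \<zeta> = iwt \<zeta>"
proof -
  assume z: "\<zeta> \<in> Xi D"
  have "F ` lspan D M UNIV (B \<inter> iwt \<zeta>) = lspan D M UNIV (B \<inter> iwt \<zeta>)"
    using iwt_upward [OF z] by (intro F_bij(1)) auto
  then show ?thesis using iwt_lspan by simp
qed

lemma icanonical_lspan: "lspan D M A_pi (f ` B) = lspan D M A_pi B"
proof -
  have "lspan D M A_pi (F ` B) = F ` lspan D M A_pi B"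
    by (rule lspan_image) (simp_all add: F_linear F_bij(2) B_carrier)
  then show ?thesis by (simp add: F_lattice F_image)
qed

lemma icanonical_basis:
  "is_basis D M UNIV (carrier M) (f ` B)"
  "is_basis D M A_pi (lspan D M A_pi B) (f ` B)"
  "is_basis D M Z_pi_qinv (lspan D M Z_pi_qinv B) (f ` B)"
  "\<zeta> \<in> Xi D \<Longrightarrow> is_basis D M UNIV (iwt \<zeta>) (f ` B \<inter> iwt \<zeta>)"
  "basis_at_infinity D M (f ` B)"
proof -
  have image: "is_basis D M R (F ` N) (F ` S)" if "N \<subseteq> carrier M" "is_basis D M R N S" for R N S
    by (rule is_basis_image) (simp_all add: F_linear F_bij(2) that)
  have sub: "lspan D M R B \<subseteq> carrier M" for R using lspan_closed [OF B_carrier] by blast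
  show "is_basis D M UNIV (carrier M) (f ` B)" using image [OF subset_refl basis] by (simp add: F_carrier F_image)
  show "is_basis D M A_pi (lspan D M A_pi B) (f ` B)"
    using image [OF sub is_basis_lspan [OF subset_refl subring_A_pi(1,2)]] by (simp add: F_lattice F_image)
  show "is_basis D M Z_pi_qinv (lspan D M Z_pi_qinv B) (f ` B)"
    using image [OF sub is_basis_lspan [OF subset_refl, of Z_pi_qinv]] subring_Z_pi_qinv by (simp add: F_lattice F_image)
  show "is_basis D M UNIV (iwt \<zeta>) (f ` B \<inter> iwt \<zeta>)" if z: "\<zeta> \<in> Xi D"
  proof -
    have "iwt \<zeta> \<subseteq> carrier M" using iwt_closed by blast
    moreover from this have "F ` (B \<inter> iwt \<zeta>) = f ` B \<inter> iwt \<zeta>"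
      using inj_on_image_Int [OF F_bij(2) B_carrier, of "iwt \<zeta>"] by (simp add: F_image F_iwt [OF z])
    moreover have "is_basis D M UNIV (iwt \<zeta>) (B \<inter> iwt \<zeta>)"
      using is_basis_lspan [of "B \<inter> iwt \<zeta>" UNIV] iwt_lspan by simp
    ultimately show ?thesis using image [of "iwt \<zeta>" UNIV "B \<inter> iwt \<zeta>"] by (simp add: F_iwt [OF z])
  qed
  show "basis_at_infinity D M (f ` B)"
  proof -
    have "basis_at_infinity D M (F ` B)"
      using based by (intro basis_at_infinity_image) (simp_all add: F_linear F_bij(2) B_carrier based_module_def)
    then show ?thesis by (simp add: F_image)
  qed
qed

text \<open>A semilinear map is determined by its values on a basis, and \<open>\<Psi>\<close> fixes
  the image of \<open>f\<close>.\<close>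

lemma icanonical_involution: "x \<in> carrier M \<Longrightarrow> basis_involution D M (f ` B) x = \<Psi> x"
proof -
  assume x: "x \<in> carrier M"
  interpret f: U_basis D M "f ` B" by unfold_locales (rule icanonical_basis(1))
  have fixed: "\<Psi> b = b" if b: "b \<in> f ` B" for b
  proof -
    obtain b0 where "b0 \<in> B" "b = f b0" using b by (rule imageE)
    then show ?thesis using icanonical_triangular(2) [OF f] by simp
  qed
  show ?thesis by (rule f.basis_involution_unique [OF Psi_semilinear fixed x])
qed

end

end

section \<open>The modified forms\<close>

subsection \<open>The involution and the elements J\<close>

text \<open>The subgroup generated by all doubles and the coroots \<open>d_i i\<close>: those
  \<open>\<mu>\<close> for which \<open>J_\<mu>\<close> is visibly a product of elements
  \<open>Jtilde\<close>. Negatives come for free, as \<open>- \<nu>\<close> differs from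
  \<open>\<nu>\<close> by a double.\<close>

inductive_set Jlattice ::
  "('i, 'x, 'y::ab_group_add, 'z) root_datum_scheme \<Rightarrow> 'y set" for D where
  double: "\<nu> + \<nu> \<in> Jlattice D"
| root: "\<nu> \<in> Jlattice D \<Longrightarrow> int_mult (int (dd D i)) (yroot D i) + \<nu> \<in> Jlattice D"

lemma Jlattice_0: "0 \<in> Jlattice D"
  using Jlattice.double [of 0 D] by simp

lemma Jlattice_add:
  assumes "\<mu> \<in> Jlattice D" "\<nu> \<in> Jlattice D" shows "\<mu> + \<nu> \<in> Jlattice D"
  using assms(2,1)
proof (induction arbitrary: \<mu>)
  case (double \<nu>)
  from double.prems show ?case
  proof induction
    case (double \<mu>)
    have eq: "\<mu> + \<mu> + (\<nu> + \<nu>) = (\<mu> + \<nu>) + (\<mu> + \<nu>)" by (simp add: algebra_simps)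
    show ?case unfolding eq by (rule Jlattice.double)
  next
    case (root \<mu> i)
    then show ?case using Jlattice.root [of "\<mu> + (\<nu> + \<nu>)"] by (simp add: add.assoc)
  qed
next
  case (root \<nu> i)
  then show ?case using Jlattice.root [of "\<mu> + \<nu>" D i] by (simp add: add.left_commute)
qed

lemma Jlattice_cancel:
  assumes "\<nu> \<in> Jlattice D" shows "\<nu> + \<mu> \<in> Jlattice D \<longleftrightarrow> \<mu> \<in> Jlattice D"
proof
  assume "\<nu> + \<mu> \<in> Jlattice D"
  \<comment> \<open>Subtracting \<open>\<nu>\<close> is adding \<open>\<nu>\<close> together with
    the double of \<open>- \<nu>\<close>.\<close>
  from Jlattice_add [OF Jlattice_add [OF this assms] Jlattice.double [of "- \<nu>"]]
  have "(\<nu> + \<mu>) + \<nu> + (- \<nu> + - \<nu>) \<in> Jlattice D" .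
  then show "\<mu> \<in> Jlattice D" by (simp add: algebra_simps)
qed (rule Jlattice_add [OF assms])

fun gen_alive :: "('i, 'y) gen \<Rightarrow> bool" where
  "gen_alive (GenK \<mu>) = True" | "gen_alive (GenJ \<mu>) = True" | "gen_alive _ = False"

fun gen_J :: "('i, 'y::ab_group_add) gen \<Rightarrow> 'y" where
  "gen_J (GenJ \<mu>) = \<mu>" | "gen_J _ = 0"

text \<open>The linear functionals that send \<open>E\<^sub>i, F\<^sub>i\<close> to \<open>0\<close>, all \<open>K\<^sub>\<mu>\<close> to \<open>1\<close>, and pick the coefficient
  of the class of \<open>\<nu>\<close> modulo the lattice among the remaining \<open>J\<close>'s; they vanish on the relations.\<close>

definition Jfun ::
  "('i, 'x, 'y::ab_group_add, 'z) root_datum_scheme \<Rightarrow> 'y \<Rightarrow> ('i, 'y) gen list \<Rightarrow> scal" where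
  "Jfun D \<nu> gs =
     (if (\<forall>g\<in>set gs. gen_alive g) \<and> sum_list (map gen_J gs) - \<nu> \<in> Jlattice D then 1 else 0)"

definition Jcoeff ::
  "('i, 'x, 'y::ab_group_add, 'z) root_datum_scheme \<Rightarrow> 'y \<Rightarrow> ('i, 'y) free_alg \<Rightarrow> scal" where
  "Jcoeff D \<nu> p = (\<Sum>w\<in>Poly_Mapping.keys p. Poly_Mapping.lookup p w * (case w of Word gs \<Rightarrow> Jfun D \<nu> gs))"

lemma Jcoeff_superset:
  "finite A \<Longrightarrow> Poly_Mapping.keys p \<subseteq> A \<Longrightarrow>
    Jcoeff D \<nu> p = (\<Sum>w\<in>A. Poly_Mapping.lookup p w * (case w of Word gs \<Rightarrow> Jfun D \<nu> gs))"
  unfolding Jcoeff_def by (rule sum.mono_neutral_left) (auto simp: in_keys_iff)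

lemma Jcoeff_add: "Jcoeff D \<nu> (p + r) = Jcoeff D \<nu> p + Jcoeff D \<nu> r"
proof -
  let ?A = "Poly_Mapping.keys p \<union> Poly_Mapping.keys r"
  have "Poly_Mapping.keys (p + r) \<subseteq> ?A" by (rule Poly_Mapping.keys_add)
  then show ?thesis
    by (simp add: Jcoeff_superset [of ?A] lookup_add distrib_right sum.distrib)
qed

lemma Jcoeff_0 [simp]: "Jcoeff D \<nu> 0 = 0"
  by (simp add: Jcoeff_def)

lemma Jcoeff_uminus: "Jcoeff D \<nu> (- p) = - Jcoeff D \<nu> p"
  using Jcoeff_add [of D \<nu> p "- p"] by (simp add: eq_neg_iff_add_eq_0 add.commute)

lemma Jcoeff_diff: "Jcoeff D \<nu> (p - r) = Jcoeff D \<nu> p - Jcoeff D \<nu> r"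
  using Jcoeff_add [of D \<nu> p "- r"] by (simp add: Jcoeff_uminus)

lemma Jcoeff_sum: "Jcoeff D \<nu> (sum f A) = (\<Sum>a\<in>A. Jcoeff D \<nu> (f a))"
  by (induction A rule: infinite_finite_induct) (simp_all add: Jcoeff_add)

lemma Jcoeff_word: "Jcoeff D \<nu> (fa_const c * mon gs) = c * Jfun D \<nu> gs"
proof -
  have "fa_const c * mon gs = Poly_Mapping.single (Word gs) c" by (simp add: fa_const_def mon_def mult_single)
  then show ?thesis by (simp add: Jcoeff_superset [of "{Word gs}"])
qed

lemma Jcoeff_const_mult: "Jcoeff D \<nu> (fa_const c * p) = c * Jcoeff D \<nu> p"
proof -
  obtain A d where A: "finite A" "p = (\<Sum>gs\<in>A. fa_const (d gs) * mon gs)"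
    using wsupp_expand [OF wsupp_UNIV [of p]] by blast
  have "fa_const c * p = (\<Sum>gs\<in>A. fa_const (c * d gs) * mon gs)"
    by (simp add: A(2) sum_distrib_left fa_const_simps mult.assoc)
  then show ?thesis by (simp add: Jcoeff_sum Jcoeff_word A(2) sum_distrib_left mult.assoc)
qed

lemma Jfun_append:
  "Jfun D \<nu> (gs @ hs) = (if \<forall>g\<in>set gs. gen_alive g then Jfun D (\<nu> - sum_list (map gen_J gs)) hs else 0)"
  "Jfun D \<nu> (hs @ gs) = (if \<forall>g\<in>set gs. gen_alive g then Jfun D (\<nu> - sum_list (map gen_J gs)) hs else 0)"
  by (auto simp: Jfun_def algebra_simps)

text \<open>A word acts on the functionals from either side by the same translation of the index.
  Therefore their common kernel is a two-sided ideal, and only the relations themselves have to be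
  tested.\<close>

lemma Jcoeff_mon:
  "Jcoeff D \<nu> (mon gs * p) = (if \<forall>g\<in>set gs. gen_alive g then Jcoeff D (\<nu> - sum_list (map gen_J gs)) p else 0)"
  "Jcoeff D \<nu> (p * mon gs) = (if \<forall>g\<in>set gs. gen_alive g then Jcoeff D (\<nu> - sum_list (map gen_J gs)) p else 0)"
proof -
  obtain A d where A: "finite A" "p = (\<Sum>gs\<in>A. fa_const (d gs) * mon gs)"
    using wsupp_expand [OF wsupp_UNIV [of p]] by blast
  have "mon gs * p = (\<Sum>hs\<in>A. fa_const (d hs) * mon (gs @ hs))"
    "p * mon gs = (\<Sum>hs\<in>A. fa_const (d hs) * mon (hs @ gs))"
    by (simp_all add: A(2) sum_distrib_left sum_distrib_right fa_const_left_commute mon_append mult.assoc)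
  then show
    "Jcoeff D \<nu> (mon gs * p) = (if \<forall>g\<in>set gs. gen_alive g then Jcoeff D (\<nu> - sum_list (map gen_J gs)) p else 0)"
    "Jcoeff D \<nu> (p * mon gs) = (if \<forall>g\<in>set gs. gen_alive g then Jcoeff D (\<nu> - sum_list (map gen_J gs)) p else 0)"
    by (simp_all add: Jcoeff_sum Jcoeff_word A(2) Jfun_append(1) [of D \<nu> gs] Jfun_append(2) [of D \<nu> _ gs])
      (auto intro!: sum.neutral)
qed

definition Jkernel ::
  "('i, 'x, 'y::ab_group_add, 'z) root_datum_scheme \<Rightarrow> ('i, 'y) free_alg set" where
  "Jkernel D = {p. \<forall>\<nu>. Jcoeff D \<nu> p = 0}"

lemma Jkernel_mult:
  assumes "p \<in> Jkernel D" shows "a * p \<in> Jkernel D" "p * a \<in> Jkernel D"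
proof -
  obtain A d where A: "finite A" "a = (\<Sum>gs\<in>A. fa_const (d gs) * mon gs)"
    using wsupp_expand [OF wsupp_UNIV [of a]] by blast
  have "a * p = (\<Sum>gs\<in>A. fa_const (d gs) * (mon gs * p))" "p * a = (\<Sum>gs\<in>A. fa_const (d gs) * (p * mon gs))"
    by (simp_all add: A(2) sum_distrib_left sum_distrib_right fa_const_left_commute mult.assoc)
  then show "a * p \<in> Jkernel D" "p * a \<in> Jkernel D"
    using assms by (auto simp: Jkernel_def Jcoeff_sum Jcoeff_const_mult Jcoeff_mon intro!: sum.neutral)
qed

lemma Jkernel_add: "p \<in> Jkernel D \<Longrightarrow> r \<in> Jkernel D \<Longrightarrow> p + r \<in> Jkernel D"
  "p \<in> Jkernel D \<Longrightarrow> r \<in> Jkernel D \<Longrightarrow> p - r \<in> Jkernel D" "0 \<in> Jkernel D" "p \<in> Jkernel D \<Longrightarrow> - p \<in> Jkernel D"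
  by (simp_all add: Jkernel_def Jcoeff_add Jcoeff_diff Jcoeff_uminus)

lemma Jkernel_sum: "(\<And>a. a \<in> A \<Longrightarrow> f a \<in> Jkernel D) \<Longrightarrow> sum f A \<in> Jkernel D"
  by (simp add: Jkernel_def Jcoeff_sum)

lemma Jcoeff_gen:
  "Jcoeff D \<nu> (fa_gen (GenK \<mu>) * p) = Jcoeff D \<nu> p" "Jcoeff D \<nu> (fa_gen (GenJ \<mu>) * p) = Jcoeff D (\<nu> - \<mu>) p"
  "Jcoeff D \<nu> (fa_gen (GenK \<mu>)) = Jcoeff D \<nu> 1" "Jcoeff D \<nu> (fa_gen (GenJ \<mu>)) = Jcoeff D (\<nu> - \<mu>) 1"
  using Jcoeff_mon(1) [of D \<nu> "[GenK \<mu>]"] Jcoeff_mon(1) [of D \<nu> "[GenJ \<mu>]"]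
    Jcoeff_mon(1) [of D \<nu> "[GenK \<mu>]" 1] Jcoeff_mon(1) [of D \<nu> "[GenJ \<mu>]" 1]
  by (simp_all add: mon_Cons)

lemma Jkernel_EF: "fa_gen (GenE i) \<in> Jkernel D" "fa_gen (GenF i) \<in> Jkernel D"
  using Jcoeff_mon(1) [of D _ "[GenE i]" 1] Jcoeff_mon(1) [of D _ "[GenF i]" 1]
  by (simp_all add: mon_Cons Jkernel_def)

lemma Jcoeff_1_cancel: "\<mu> \<in> Jlattice D \<Longrightarrow> Jcoeff D (\<nu> - \<mu>) 1 = Jcoeff D \<nu> 1"
  using Jcoeff_word [of D _ 1 "[]"] Jlattice_cancel [of \<mu> D "- \<nu>"] by (simp add: fa_const_simps Jfun_def)

text \<open>Terms with a letter \<open>E\<close> or \<open>F\<close> are sent to \<open>0\<close>.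
  The torus relations keep the \<open>J\<close> part up to doubles, and the torus part of the
  commutator of \<open>E_i\<close> and \<open>F_i\<close> keeps it up to \<open>d_i i\<close>; both
  are absorbed by the lattice.\<close>

lemma Jkernel_rels:
  fixes D :: "('i, 'x, 'y::ab_group_add, 'z) root_datum_scheme"
  assumes "r \<in> U_rels D" shows "r \<in> Jkernel D"
proof -
  have serre: "serre D x i j \<in> Jkernel D" if "fa_gen (x j) \<in> Jkernel D" for x i j
    unfolding serre_def Let_def by (intro Jkernel_sum Jkernel_mult(2) Jkernel_mult(1) that)
  have comm: "fa_gen a * fa_gen x - c * fa_gen x * fa_gen a \<in> Jkernel D" if "fa_gen x \<in> Jkernel D" for a c x
    by (intro Jkernel_add Jkernel_mult(1) Jkernel_mult(2) that)
  have dy: "int_mult (int (dd D i)) (yroot D i) \<in> Jlattice D" for i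
    using Jlattice.root [OF Jlattice_0, of D i] by simp
  have ef: "fa_gen (GenE i) * fa_gen (GenF j) - c * fa_gen (GenF j) * fa_gen (GenE i)
        - (if i = j then fa_const d
                * (fa_gen (GenJ (int_mult (int (dd D i)) (yroot D i))) * fa_gen (GenK (int_mult (int (dd D i)) (yroot D i)))
                   - fa_gen (GenK (- int_mult (int (dd D i)) (yroot D i))))
           else 0) \<in> Jkernel D" for i j c d
  proof (rule Jkernel_add(2))
    show "fa_gen (GenE i) * fa_gen (GenF j) - c * fa_gen (GenF j) * fa_gen (GenE i) \<in> Jkernel D"
      by (intro Jkernel_add(2) Jkernel_mult(1) Jkernel_EF)
    show "(if i = j then fa_const d
                * (fa_gen (GenJ (int_mult (int (dd D i)) (yroot D i))) * fa_gen (GenK (int_mult (int (dd D i)) (yroot D i)))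
                   - fa_gen (GenK (- int_mult (int (dd D i)) (yroot D i))))
           else 0) \<in> Jkernel D"
      by (simp add: Jkernel_def Jcoeff_const_mult Jcoeff_diff Jcoeff_gen Jcoeff_1_cancel [OF dy])
  qed
  have torus: "fa_gen (GenK 0) - 1 \<in> Jkernel D" "fa_gen (GenK (\<mu> + \<nu>)) - fa_gen (GenK \<mu>) * fa_gen (GenK \<nu>) \<in> Jkernel D"
    "fa_gen (GenJ (\<mu> + \<mu>)) - 1 \<in> Jkernel D" "fa_gen (GenJ (\<mu> + \<nu>)) - fa_gen (GenJ \<mu>) * fa_gen (GenJ \<nu>) \<in> Jkernel D"
    "fa_gen (GenJ \<mu>) * fa_gen (GenK \<nu>) - fa_gen (GenK \<nu>) * fa_gen (GenJ \<mu>) \<in> Jkernel D" for \<mu> \<nu>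
    by (simp_all add: Jkernel_def Jcoeff_diff Jcoeff_gen Jcoeff_1_cancel Jlattice.double diff_diff_eq)
  from assms show ?thesis
    unfolding U_rels_def Let_def
    by (elim UnE CollectE exE conjE insertE emptyE; simp only:)
      (rule torus comm ef serre Jkernel_EF)+
qed

lemma U_ideal_Jkernel:
  fixes D :: "('i, 'x, 'y::ab_group_add, 'z) root_datum_scheme"
  shows "U_ideal D \<subseteq> Jkernel D"
  by (rule U_ideal_least) (auto intro: Jkernel_rels Jkernel_add Jkernel_mult)

section \<open>The elements \<open>J\<close> of the coideal subalgebra and the ideals of its
  modified form\<close>

context iquantum
begin

text \<open>A set of words closed under concatenation whose span contains representatives of all
  generators of \<open>Ui D\<close>. For words with a letter \<open>E\<close> or \<open>F\<close>
  the condition is vacuous.\<close>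

definition J_words :: "('i, 'y) gen list set" where
  "J_words = {gs. (\<forall>g\<in>set gs. gen_alive g) \<longrightarrow> sum_list (map gen_J gs) \<in> Jlattice D}"

lemma Ui_J_words:
  assumes "u \<in> carrier (Ui D)" shows "\<exists>p\<in>wsupp J_words. u = U_class D p"
proof -
  have nil: "[] \<in> J_words" by (simp add: J_words_def Jlattice_0)
  have app: "xs @ ys \<in> J_words" if "xs \<in> J_words" "ys \<in> J_words" for xs ys
    using that Jlattice_add by (auto simp: J_words_def)
  have "u \<in> generate_ring (U D) Ui_gens" using assms by (simp add: carrier_Ui)
  then show ?thesis
  proof induction
    case one
    show ?case by (rule bexI [of _ 1]) (use wsupp_simps(5) [OF nil] in \<open>simp_all add: U_class_simps\<close>)
  next
    case (incl h)
    have bi: "bi i \<in> wsupp J_words" for i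
    proof -
      have "[GenF i] \<in> J_words" "[GenE (tau D i)] \<in> J_words" "[GenK \<mu>] \<in> J_words" for \<mu>
        by (simp_all add: J_words_def Jlattice_0)
      then show ?thesis
        unfolding bi_def
        by (intro wsupp_simps(2) wsupp_gen wsupp_mult [OF wsupp_mult [OF wsupp_const [OF nil] wsupp_gen app] wsupp_gen app])
    qed
    have J: "[GenJ (int_mult (int (dd D i)) (yroot D i))] \<in> J_words" and K: "[GenK \<mu>] \<in> J_words" for i \<mu>
      using Jlattice.root [OF Jlattice_0, of D i] by (simp_all add: J_words_def Jlattice_0)
    from incl consider c where "h = Uscal D c" | i where "h = UB D i" | i where "h = Jtilde D i" | \<mu> where "h = UK D \<mu>"
      unfolding Ui_gens_def by blast
    then show ?case
    proof cases
      case 1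
      then show ?thesis using wsupp_const [OF nil] by blast
    next
      case 2
      then show ?thesis using bi UB_bi by blast
    next
      case 3
      then show ?thesis using wsupp_gen [OF J] by (auto simp: Jtilde_def)
    next
      case 4
      then show ?thesis using wsupp_gen [OF K] by blast
    qed
  next
    case (a_inv h)
    then obtain p where "p \<in> wsupp J_words" "h = U_class D p" by blast
    then show ?case by (intro bexI [of _ "- p"]) (simp_all add: U_class_simps wsupp_simps(3))
  next
    case (eng_add h k)
    then obtain p r where "p \<in> wsupp J_words" "h = U_class D p" "r \<in> wsupp J_words" "k = U_class D r" by blast
    then show ?case by (intro bexI [of _ "p + r"]) (simp_all add: U_class_simps wsupp_simps(2))
  next
    case (eng_mult h k)
    then obtain p r where p: "p \<in> wsupp J_words" "h = U_class D p" "r \<in> wsupp J_words" "k = U_class D r" by blast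
    have "p * r \<in> wsupp J_words" by (rule wsupp_mult [OF p(1,3) app])
    then show ?case by (intro bexI [of _ "p * r"]) (simp_all add: U_class_simps p(2,4))
  qed
qed

text \<open>If \<open>\<mu>\<close> is outside of the lattice, the functional
  \<open>Jcoeff D \<mu>\<close> vanishes on all words in \<open>J_words\<close>, hence on
  \<open>Ui D\<close>, while its value at \<open>J_\<mu>\<close> is \<open>1\<close>. It is well
  defined on \<open>U\<close> because it kills the relations.\<close>

lemma UJ_in_Ui:
  assumes "UJ D \<mu> \<in> carrier (Ui D)" shows "\<mu> \<in> Jlattice D"
proof (rule ccontr)
  assume mu: "\<mu> \<notin> Jlattice D"
  obtain p where p: "p \<in> wsupp J_words" "UJ D \<mu> = U_class D p" using Ui_J_words [OF assms] by blast
  obtain A c where A: "finite A" "A \<subseteq> J_words" "p = (\<Sum>gs\<in>A. fa_const (c gs) * mon gs)"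
    using wsupp_expand [OF p(1)] by blast
  have "Jfun D \<mu> gs = 0" if "gs \<in> A" for gs
  proof -
    have "sum_list (map gen_J gs) - \<mu> \<notin> Jlattice D" if "sum_list (map gen_J gs) \<in> Jlattice D"
    proof
      assume "sum_list (map gen_J gs) - \<mu> \<in> Jlattice D"
      then have "- \<mu> \<in> Jlattice D" using Jlattice_cancel [OF that, of "- \<mu>"] by simp
      then have "- \<mu> + (\<mu> + \<mu>) \<in> Jlattice D" by (intro Jlattice_add Jlattice.double)
      then show False using mu by simp
    qed
    then show ?thesis using \<open>gs \<in> A\<close> A(2) by (auto simp: Jfun_def J_words_def)
  qed
  then have "Jcoeff D \<mu> p = 0" by (simp add: A(3) Jcoeff_sum Jcoeff_word)
  moreover have "fa_gen (GenJ \<mu>) - p \<in> Jkernel D" using p(2) U_ideal_Jkernel by (auto simp: U_class_eq_iff)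
  then have "Jcoeff D \<mu> (fa_gen (GenJ \<mu>)) = Jcoeff D \<mu> p" by (simp add: Jkernel_def Jcoeff_diff)
  moreover have "Jcoeff D \<mu> (fa_gen (GenJ \<mu>)) = 1"
    using Jcoeff_word [of D 0 1 "[]"] by (simp add: Jcoeff_gen fa_const_simps Jfun_def Jlattice_0)
  ultimately show False by simp
qed

lemma psi_i_UJ:
  assumes "UJ D \<mu> \<in> carrier (Ui D)" shows "\<psi>i (UJ D \<mu>) = UJ D \<mu>"
proof -
  from UJ_in_Ui [OF assms] have "UJ D \<mu> \<in> carrier (Ui D) \<and> \<psi>i (UJ D \<mu>) = UJ D \<mu>"
  proof induction
    case (double \<nu>)
    show ?case using Ui_closed(4) psi_i_1 by (simp only: U_rel_torus(3) U_class_simps)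
  next
    case (root \<nu> i)
    have "UJ D (int_mult (int (dd D i)) (yroot D i) + \<nu>) = Jtilde D i \<otimes>\<^bsub>U D\<^esub> UJ D \<nu>"
      by (simp only: U_rel_torus(4) U_class_simps Jtilde_def)
    then show ?case using root.IH by (simp add: psi_i_mult psi_i_gens Ui_closed)
  qed
  then show ?thesis ..
qed

lemma Yi_uminus: "\<mu> \<in> Yi D \<Longrightarrow> - \<mu> \<in> Yi D"
proof -
  assume "\<mu> \<in> Yi D"
  moreover have "additive (tauY D)" using datum by (simp add: iquantum_datum_def)
  ultimately show ?thesis by (simp add: Yi_def additive.minus)
qed

text \<open>\<open>\<psi>i\<close> sends \<open>K_\<mu>\<close> to the product of
  \<open>J_\<mu>\<close> and the inverse of \<open>K_\<mu>\<close>; multiplying the image by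
  \<open>K_\<mu>\<close> leaves \<open>J_\<mu>\<close>.\<close>

lemma UJ_Yi: assumes mu: "\<mu> \<in> Yi D" shows "UJ D \<mu> \<in> carrier (Ui D)"
proof -
  have "\<psi>i (UK D \<mu>) \<otimes>\<^bsub>U D\<^esub> UK D \<mu> \<in> carrier (Ui D)"
    by (intro Ui_closed psi_i_closed mu)
  moreover have "UJ D \<mu> \<otimes>\<^bsub>U D\<^esub> UK D (- \<mu>) \<otimes>\<^bsub>U D\<^esub> UK D \<mu> = UJ D \<mu>"
  proof -
    have "U_class D (fa_gen (GenK (- \<mu>)) * fa_gen (GenK \<mu>)) = U_class D 1"
      using U_rel_torus(2) [of D "- \<mu>" \<mu>] U_rel_torus(1) [of D] by simp
    from U_class_mult_cong [OF refl this, of "fa_gen (GenJ \<mu>)"] show ?thesis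
      by (simp add: U_class_simps(3) mult.assoc flip: U_class_simps(3))
  qed
  ultimately show ?thesis using psi_i_gens(3) [OF mu] by simp
qed

lemma ipairing_eq:
  assumes "\<mu> \<in> Yi D" "\<zeta> \<in> Xi D" "\<xi> \<in> \<zeta>" shows "ipairing D \<mu> \<zeta> = pairing D \<mu> \<xi>"
proof -
  have "(SOME \<xi>. \<xi> \<in> \<zeta>) \<in> \<zeta>" using assms(3) by (rule someI)
  then have "(SOME \<xi>. \<xi> \<in> \<zeta>) - \<xi> \<in> T" using Xi_iff [OF assms(2,3)] by blast
  from pairing_T [OF assms(1) this] show ?thesis
    unfolding diff_conv_add_uminus pairing_simps ipairing_def by simp
qed

definition idot_gens :: "'x set \<Rightarrow> ('i, 'y) Uelt set" where
  "idot_gens \<zeta> = {UK D \<mu> \<ominus>\<^bsub>U D\<^esub> Uscal D (qq powi ipairing D \<mu> \<zeta>) | \<mu>. \<mu> \<in> Yi D} \<union>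
      {UJ D \<mu> \<ominus>\<^bsub>U D\<^esub> Uscal D (ppi powi ipairing D \<mu> \<zeta>) | \<mu>. \<mu> \<in> Yi D \<and> UJ D \<mu> \<in> carrier (Ui D)}"

lemma idot_ideal: "idot_ideal D \<zeta> = left_ideal_gen (Ui D) (idot_gens \<zeta>)"
  by (simp add: idot_ideal_def idot_gens_def)

lemma Ui_diff: "x \<in> carrier (Ui D) \<Longrightarrow> y \<in> carrier (Ui D) \<Longrightarrow> x \<ominus>\<^bsub>U D\<^esub> y \<in> carrier (Ui D)"
  by (simp add: a_minus_def Ui_closed)

lemma idot_gens_carrier: "idot_gens \<zeta> \<subseteq> carrier (Ui D)"
  by (auto simp: idot_gens_def intro!: Ui_diff Ui_closed)

sublocale Ui: ring "Ui D" by (rule ring_Ui)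

text \<open>With \<open>n\<close> the pairing, the image of \<open>K_\<mu> - q^n\<close> is
  \<open>J_\<mu> K_{-\<mu>} - \<pi>^n q^{-n}\<close>. It splits as
  \<open>J_\<mu> (K_{-\<mu>} - q^{-n}) + q^{-n} (J_\<mu> - \<pi>^n)\<close>, which shows why the
  ideal has generators of the second kind.\<close>

lemma psi_i_idot_gens:
  assumes z: "\<zeta> \<in> Xi D" and s: "s \<in> idot_gens \<zeta>"
  shows "\<psi>i s \<in> idot_ideal D \<zeta>"
proof -
  obtain \<xi> where xi: "\<xi> \<in> \<zeta>" using Xi_nonempty [OF z] by blast
  have diff: "\<psi>i (x \<ominus>\<^bsub>U D\<^esub> y) = \<psi>i x \<ominus>\<^bsub>U D\<^esub> \<psi>i y" if "x \<in> carrier (Ui D)" "y \<in> carrier (Ui D)" for x y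
    using that by (simp add: a_minus_def psi_i_add psi_i_uminus Ui_closed)
  have base: "c \<otimes>\<^bsub>U D\<^esub> s \<in> idot_ideal D \<zeta>" if "c \<in> carrier (Ui D)" "s \<in> idot_gens \<zeta>" for c s
    using Ui.left_ideal_gen_base [OF idot_gens_carrier that] by (simp add: idot_ideal)
  have add: "x \<oplus>\<^bsub>U D\<^esub> y \<in> idot_ideal D \<zeta>" if "x \<in> idot_ideal D \<zeta>" "y \<in> idot_ideal D \<zeta>" for x y
    using Ui.left_ideal_gen_add [OF idot_gens_carrier] that by (simp add: idot_ideal)
  from s consider \<mu> where "\<mu> \<in> Yi D" "s = UK D \<mu> \<ominus>\<^bsub>U D\<^esub> Uscal D (qq powi ipairing D \<mu> \<zeta>)"
    | \<mu> where "\<mu> \<in> Yi D" "s = UJ D \<mu> \<ominus>\<^bsub>U D\<^esub> Uscal D (ppi powi ipairing D \<mu> \<zeta>)"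
    unfolding idot_gens_def by blast
  then show ?thesis
  proof cases
    case 1
    let ?n = "ipairing D \<mu> \<zeta>"
    have n: "ipairing D (- \<mu>) \<zeta> = - ?n"
      using ipairing_eq [OF Yi_uminus [OF 1(1)] z xi] ipairing_eq [OF 1(1) z xi] by (simp add: pairing_simps)
    have K: "UK D (- \<mu>) \<ominus>\<^bsub>U D\<^esub> Uscal D (qq powi - ?n) \<in> idot_gens \<zeta>"
      unfolding idot_gens_def using Yi_uminus [OF 1(1)] n by auto
    have J: "UJ D \<mu> \<ominus>\<^bsub>U D\<^esub> Uscal D (ppi powi ?n) \<in> idot_gens \<zeta>"
      unfolding idot_gens_def using 1(1) UJ_Yi by auto
    have "\<psi>i s = UJ D \<mu> \<otimes>\<^bsub>U D\<^esub> UK D (- \<mu>) \<ominus>\<^bsub>U D\<^esub> Uscal D (ppi powi ?n * qq powi - ?n)"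
      using 1 by (simp add: diff Ui_closed psi_i_gens psi_i_const qbar_qq_powi)
    also have "\<dots> = U_class D (fa_gen (GenJ \<mu>) * (fa_gen (GenK (- \<mu>)) - fa_const (qq powi - ?n)) +
        fa_const (qq powi - ?n) * (fa_gen (GenJ \<mu>) - fa_const (ppi powi ?n)))"
      unfolding U_class_simps(3,7) [symmetric]
      by (rule arg_cong [where f = "U_class D"])
        (simp add: algebra_simps fa_const_simps fa_const_commute [of _ "fa_gen (GenJ \<mu>)"] flip: fa_const_simps(4))
    also have "\<dots> = UJ D \<mu> \<otimes>\<^bsub>U D\<^esub> (UK D (- \<mu>) \<ominus>\<^bsub>U D\<^esub> Uscal D (qq powi - ?n)) \<oplus>\<^bsub>U D\<^esub>
        Uscal D (qq powi - ?n) \<otimes>\<^bsub>U D\<^esub> (UJ D \<mu> \<ominus>\<^bsub>U D\<^esub> Uscal D (ppi powi ?n))"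
      by (simp only: U_class_simps)
    also have "\<dots> \<in> idot_ideal D \<zeta>"
      by (intro add base K J UJ_Yi 1(1) Ui_closed)
    finally show ?thesis .
  next
    case 2
    have "qbar (ppi powi n) = ppi powi n" for n by (simp add: ppi_powi_parity)
    then have "\<psi>i s = s" using 2 UJ_Yi by (simp add: diff Ui_closed psi_i_const psi_i_UJ)
    moreover have "\<one>\<^bsub>U D\<^esub> \<otimes>\<^bsub>U D\<^esub> s = s" using Ui.l_one [of s] s idot_gens_carrier by auto
    ultimately show ?thesis using base [OF Ui_closed(4) s] by simp
  qed
qed

lemma psi_i_idot_ideal:
  assumes z: "\<zeta> \<in> Xi D" and x: "x \<in> idot_ideal D \<zeta>" shows "\<psi>i x \<in> idot_ideal D \<zeta>"
proof -
  note S = idot_gens_carrier [of \<zeta>]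
  have "x \<in> {x \<in> carrier (Ui D). \<psi>i x \<in> idot_ideal D \<zeta>}"
  proof (rule Ui.left_ideal_gen_least [OF _ S])
    show "x \<in> left_ideal_gen (Ui D) (idot_gens \<zeta>)" using x by (simp add: idot_ideal)
    have "\<psi>i \<zero>\<^bsub>U D\<^esub> = \<zero>\<^bsub>U D\<^esub>" using psi_i_const [of 0] by (simp add: fa_const_simps U_class_simps)
    then show "\<zero>\<^bsub>Ui D\<^esub> \<in> {x \<in> carrier (Ui D). \<psi>i x \<in> idot_ideal D \<zeta>}"
      using Ui.left_ideal_gen_0 [of "idot_gens \<zeta>"] Ui.zero_closed by (simp add: idot_ideal)
    fix c s y assume c: "c \<in> carrier (Ui D)" and s: "s \<in> idot_gens \<zeta>" and "y \<in> {x \<in> carrier (Ui D). \<psi>i x \<in> idot_ideal D \<zeta>}"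
    then have y: "y \<in> carrier (Ui D)" "\<psi>i y \<in> idot_ideal D \<zeta>" by blast+
    have sc: "s \<in> carrier (Ui D)" using s S by blast
    have "\<psi>i c \<otimes>\<^bsub>U D\<^esub> \<psi>i s \<in> idot_ideal D \<zeta>"
      using Ui.left_ideal_gen_mult [OF S psi_i_closed [OF c], of "\<psi>i s"] psi_i_idot_gens [OF z s] by (simp add: idot_ideal)
    then have "\<psi>i c \<otimes>\<^bsub>U D\<^esub> \<psi>i s \<oplus>\<^bsub>U D\<^esub> \<psi>i y \<in> idot_ideal D \<zeta>"
      using Ui.left_ideal_gen_add [OF S, of "\<psi>i c \<otimes>\<^bsub>U D\<^esub> \<psi>i s" "\<psi>i y"] y(2) by (simp add: idot_ideal)
    then show "c \<otimes>\<^bsub>Ui D\<^esub> s \<oplus>\<^bsub>Ui D\<^esub> y \<in> {x \<in> carrier (Ui D). \<psi>i x \<in> idot_ideal D \<zeta>}"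
      using c sc y by (simp add: psi_i_add psi_i_mult Ui_closed)
  qed
  then show ?thesis by blast
qed

end

subsection \<open>The modified form as a module\<close>

lemma (in abelian_subgroup) rcos_eq_iff:
  assumes "x \<in> carrier G" "y \<in> carrier G"
  shows "H +> x = H +> y \<longleftrightarrow> x \<ominus> y \<in> H"
proof
  assume "H +> x = H +> y"
  then have "x \<in> H +> y" using a_rcos_self [OF assms(1)] by simp
  then show "x \<ominus> y \<in> H" using a_rcos_module [OF assms(2,1)] by (simp add: a_minus_def)
next
  assume "x \<ominus> y \<in> H"
  then have "x \<in> H +> y" using a_rcos_module [OF assms(2,1)] by (simp add: a_minus_def)
  from a_repr_independence' [OF this assms(2)] show "H +> x = H +> y" by simp
qed

lemma Udot_sel [simp]:
  "carrier (Udot D) = {f. (\<forall>\<xi>. f \<xi> \<in> a_rcosets\<^bsub>U D\<^esub> (dot_ideal D \<xi>)) \<and> finite {\<xi>. f \<xi> \<noteq> dot_ideal D \<xi>}}"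
  "\<zero>\<^bsub>Udot D\<^esub> = dot_ideal D" "f \<oplus>\<^bsub>Udot D\<^esub> g = (\<lambda>\<xi>. f \<xi> <+>\<^bsub>U D\<^esub> g \<xi>)"
  "u \<odot>\<^bsub>Udot D\<^esub> f = (\<lambda>\<xi>. \<Union>x\<in>f \<xi>. dot_ideal D \<xi> +>\<^bsub>U D\<^esub> (u \<otimes>\<^bsub>U D\<^esub> x))"
  by (simp_all add: Udot_def)

text \<open>Elements of \<open>Udot D\<close> presented by families of representatives, on which all
  module operations become componentwise operations in \<open>U\<close>.\<close>

definition Ucls ::
  "('i, 'x, 'y::ab_group_add, 'z) root_datum_scheme \<Rightarrow> ('x \<Rightarrow> ('i, 'y) Uelt) \<Rightarrow> 'x \<Rightarrow> ('i, 'y) Uelt set" where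
  "Ucls D r = (\<lambda>\<xi>. dot_ideal D \<xi> +>\<^bsub>U D\<^esub> r \<xi>)"

locale Udot_module =
  fixes D :: "('i::finite, 'x::ab_group_add, 'y::ab_group_add, 'z) root_datum_scheme"
begin

sublocale U: ring "U D" by (rule ring_U)

definition dot_gens :: "'x \<Rightarrow> ('i, 'y) Uelt set" where
  "dot_gens \<xi> = {UK D \<mu> \<ominus>\<^bsub>U D\<^esub> Uscal D (qq powi pairing D \<mu> \<xi>) | \<mu>. True} \<union>
      {UJ D \<mu> \<ominus>\<^bsub>U D\<^esub> Uscal D (ppi powi pairing D \<mu> \<xi>) | \<mu>. True}"

lemma dot_ideal: "dot_ideal D \<xi> = left_ideal_gen (U D) (dot_gens \<xi>)"
  by (simp add: dot_ideal_def dot_gens_def)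

lemma dot_gens_carrier: "dot_gens \<xi> \<subseteq> carrier (U D)"
  by (auto simp: dot_gens_def U_class_simps simp flip: U_class_simps(7))

lemma dot_ideal_subgroup: "abelian_subgroup (dot_ideal D \<xi>) (U D)"
  unfolding dot_ideal by (rule U.left_ideal_gen_subgroup [OF dot_gens_carrier])

lemma dot_ideal_mult: "u \<in> carrier (U D) \<Longrightarrow> x \<in> dot_ideal D \<xi> \<Longrightarrow> u \<otimes>\<^bsub>U D\<^esub> x \<in> dot_ideal D \<xi>"
  unfolding dot_ideal by (rule U.left_ideal_gen_mult [OF dot_gens_carrier])

lemma dot_ideal_carrier: "dot_ideal D \<xi> \<subseteq> carrier (U D)"
  unfolding dot_ideal using U.left_ideal_gen_closed [OF dot_gens_carrier] by blast

lemma dot_coset_0: "dot_ideal D \<xi> +>\<^bsub>U D\<^esub> \<zero>\<^bsub>U D\<^esub> = dot_ideal D \<xi>"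
  by (rule U.a_coset_add_zero [OF dot_ideal_carrier])

lemma dot_coset_eq:
  "x \<in> carrier (U D) \<Longrightarrow> y \<in> carrier (U D) \<Longrightarrow>
    dot_ideal D \<xi> +>\<^bsub>U D\<^esub> x = dot_ideal D \<xi> +>\<^bsub>U D\<^esub> y \<longleftrightarrow> x \<ominus>\<^bsub>U D\<^esub> y \<in> dot_ideal D \<xi>"
  by (rule abelian_subgroup.rcos_eq_iff [OF dot_ideal_subgroup])

lemma dot_coset_trivial:
  "x \<in> carrier (U D) \<Longrightarrow> dot_ideal D \<xi> +>\<^bsub>U D\<^esub> x = dot_ideal D \<xi> \<longleftrightarrow> x \<in> dot_ideal D \<xi>"
  using dot_coset_eq [of x "\<zero>\<^bsub>U D\<^esub>" \<xi>] by (simp add: dot_coset_0 a_minus_def)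

lemma Ucls_add:
  assumes "\<And>\<xi>. r \<xi> \<in> carrier (U D)" "\<And>\<xi>. s \<xi> \<in> carrier (U D)"
  shows "Ucls D r \<oplus>\<^bsub>Udot D\<^esub> Ucls D s = Ucls D (\<lambda>\<xi>. r \<xi> \<oplus>\<^bsub>U D\<^esub> s \<xi>)"
  using assms by (simp add: Ucls_def abelian_subgroup.a_rcos_sum [OF dot_ideal_subgroup])

text \<open>The union over all representatives in the scalar action collapses to one coset, since
  \<open>dot_ideal\<close> is a left ideal.\<close>

lemma dot_coset_smult:
  assumes u: "u \<in> carrier (U D)" and r: "r \<in> carrier (U D)"
  shows "(\<Union>x\<in>dot_ideal D \<xi> +>\<^bsub>U D\<^esub> r. dot_ideal D \<xi> +>\<^bsub>U D\<^esub> (u \<otimes>\<^bsub>U D\<^esub> x)) = dot_ideal D \<xi> +>\<^bsub>U D\<^esub> (u \<otimes>\<^bsub>U D\<^esub> r)"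
proof -
  interpret I: abelian_subgroup "dot_ideal D \<xi>" "U D" by (rule dot_ideal_subgroup)
  have "dot_ideal D \<xi> +>\<^bsub>U D\<^esub> (u \<otimes>\<^bsub>U D\<^esub> x) = dot_ideal D \<xi> +>\<^bsub>U D\<^esub> (u \<otimes>\<^bsub>U D\<^esub> r)"
    if "x \<in> dot_ideal D \<xi> +>\<^bsub>U D\<^esub> r" for x
  proof -
    have x: "x \<in> carrier (U D)" using that U.a_r_coset_subset_G [OF dot_ideal_carrier r] by blast
    then have "x \<ominus>\<^bsub>U D\<^esub> r \<in> dot_ideal D \<xi>" using that I.a_rcos_module [OF r x] by (simp add: a_minus_def)
    from dot_ideal_mult [OF u this] have "u \<otimes>\<^bsub>U D\<^esub> x \<ominus>\<^bsub>U D\<^esub> u \<otimes>\<^bsub>U D\<^esub> r \<in> dot_ideal D \<xi>"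
      using u x r by (simp add: a_minus_def U.r_distr U.r_minus)
    then show ?thesis using u x r by (simp add: dot_coset_eq)
  qed
  moreover have "r \<in> dot_ideal D \<xi> +>\<^bsub>U D\<^esub> r" by (rule I.a_rcos_self [OF r])
  ultimately show ?thesis by blast
qed

lemma Ucls_smult:
  assumes "u \<in> carrier (U D)" "\<And>\<xi>. r \<xi> \<in> carrier (U D)"
  shows "u \<odot>\<^bsub>Udot D\<^esub> Ucls D r = Ucls D (\<lambda>\<xi>. u \<otimes>\<^bsub>U D\<^esub> r \<xi>)"
  using assms by (simp add: Ucls_def dot_coset_smult)

lemma Ucls_zero: "Ucls D (\<lambda>_. \<zero>\<^bsub>U D\<^esub>) = \<zero>\<^bsub>Udot D\<^esub>"
  by (simp add: Ucls_def dot_coset_0)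

lemma Ucls_carrier:
  assumes "\<And>\<xi>. r \<xi> \<in> carrier (U D)"
  shows "Ucls D r \<in> carrier (Udot D) \<longleftrightarrow> finite {\<xi>. r \<xi> \<notin> dot_ideal D \<xi>}"
  using assms U.a_rcosetsI [OF dot_ideal_carrier] by (simp add: Ucls_def dot_coset_trivial)

lemma Udot_cases:
  assumes "f \<in> carrier (Udot D)"
  obtains r where "\<And>\<xi>. r \<xi> \<in> carrier (U D)" "finite {\<xi>. r \<xi> \<notin> dot_ideal D \<xi>}" "f = Ucls D r"
proof -
  have "\<forall>\<xi>. \<exists>x. x \<in> carrier (U D) \<and> f \<xi> = dot_ideal D \<xi> +>\<^bsub>U D\<^esub> x"
    using assms by (intro allI) (simp add: A_RCOSETS_def' a_r_coset_def' Bex_def)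
  from choice [OF this] obtain r where r: "\<forall>\<xi>. r \<xi> \<in> carrier (U D) \<and> f \<xi> = dot_ideal D \<xi> +>\<^bsub>U D\<^esub> r \<xi>" ..
  then have f: "f = Ucls D r" by (auto simp: Ucls_def)
  have rc: "r \<xi> \<in> carrier (U D)" for \<xi> using r by blast
  show ?thesis
    by (rule that [OF rc _ f]) (use assms Ucls_carrier [of r] rc f in blast)
qed

lemma Udot_abelian_group: "abelian_group (Udot D)"
proof (rule abelian_groupI)
  note I = abelian_subgroup.axioms(1) [OF dot_ideal_subgroup]
  have Iadd: "x \<oplus>\<^bsub>U D\<^esub> y \<in> dot_ideal D \<xi>" if "x \<in> dot_ideal D \<xi>" "y \<in> dot_ideal D \<xi>" for x y \<xi>
    by (rule additive_subgroup.a_closed [OF I that])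
  have Iinv: "\<ominus>\<^bsub>U D\<^esub> x \<in> dot_ideal D \<xi>" if "x \<in> dot_ideal D \<xi>" for x \<xi>
    by (rule additive_subgroup.a_inv_closed [OF I that])
  have zero: "\<zero>\<^bsub>U D\<^esub> \<in> dot_ideal D \<xi>" for \<xi> by (rule additive_subgroup.zero_closed [OF I])
  show "\<zero>\<^bsub>Udot D\<^esub> \<in> carrier (Udot D)"
    unfolding Ucls_zero [symmetric] by (subst Ucls_carrier) (use zero in auto)
  fix f g assume f: "f \<in> carrier (Udot D)" and g: "g \<in> carrier (Udot D)"
  obtain r where r: "\<And>\<xi>. r \<xi> \<in> carrier (U D)" "finite {\<xi>. r \<xi> \<notin> dot_ideal D \<xi>}" "f = Ucls D r"
    by (rule Udot_cases [OF f]) blast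
  obtain s where s: "\<And>\<xi>. s \<xi> \<in> carrier (U D)" "finite {\<xi>. s \<xi> \<notin> dot_ideal D \<xi>}" "g = Ucls D s"
    by (rule Udot_cases [OF g]) blast
  have "{\<xi>. r \<xi> \<oplus>\<^bsub>U D\<^esub> s \<xi> \<notin> dot_ideal D \<xi>} \<subseteq> {\<xi>. r \<xi> \<notin> dot_ideal D \<xi>} \<union> {\<xi>. s \<xi> \<notin> dot_ideal D \<xi>}"
    using Iadd by blast
  then have "finite {\<xi>. r \<xi> \<oplus>\<^bsub>U D\<^esub> s \<xi> \<notin> dot_ideal D \<xi>}" using r(2) s(2) finite_subset by blast
  then show "f \<oplus>\<^bsub>Udot D\<^esub> g \<in> carrier (Udot D)"
    unfolding r(3) s(3) Ucls_add [OF r(1) s(1)] by (subst Ucls_carrier) (use r(1) s(1) in auto)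
  show "f \<oplus>\<^bsub>Udot D\<^esub> g = g \<oplus>\<^bsub>Udot D\<^esub> f"
    unfolding r(3) s(3) Ucls_add [OF r(1) s(1)] Ucls_add [OF s(1) r(1)] using r(1) s(1) by (simp add: U.a_comm)
  have "\<zero>\<^bsub>Udot D\<^esub> \<oplus>\<^bsub>Udot D\<^esub> f = Ucls D (\<lambda>\<xi>. \<zero>\<^bsub>U D\<^esub> \<oplus>\<^bsub>U D\<^esub> r \<xi>)"
    unfolding Ucls_zero [symmetric] r(3) by (rule Ucls_add) (simp_all add: r(1))
  then show "\<zero>\<^bsub>Udot D\<^esub> \<oplus>\<^bsub>Udot D\<^esub> f = f" unfolding r(3) using r(1) by simp
  have "finite {\<xi>. \<ominus>\<^bsub>U D\<^esub> r \<xi> \<notin> dot_ideal D \<xi>}" by (rule finite_subset [OF _ r(2)]) (use Iinv in auto)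
  then have "Ucls D (\<lambda>\<xi>. \<ominus>\<^bsub>U D\<^esub> r \<xi>) \<in> carrier (Udot D)"
    by (subst Ucls_carrier) (use r(1) in auto)
  moreover have "Ucls D (\<lambda>\<xi>. \<ominus>\<^bsub>U D\<^esub> r \<xi>) \<oplus>\<^bsub>Udot D\<^esub> f = Ucls D (\<lambda>\<xi>. \<ominus>\<^bsub>U D\<^esub> r \<xi> \<oplus>\<^bsub>U D\<^esub> r \<xi>)"
    unfolding r(3) by (rule Ucls_add) (simp_all add: r(1))
  moreover have "\<dots> = \<zero>\<^bsub>Udot D\<^esub>" using r(1) by (simp only: U.l_neg Ucls_zero)
  ultimately show "\<exists>h\<in>carrier (Udot D). h \<oplus>\<^bsub>Udot D\<^esub> f = \<zero>\<^bsub>Udot D\<^esub>" by (intro bexI) simp_all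
  fix h assume h: "h \<in> carrier (Udot D)"
  obtain t where t: "\<And>\<xi>. t \<xi> \<in> carrier (U D)" "h = Ucls D t"
    by (rule Udot_cases [OF h]) blast
  have "f \<oplus>\<^bsub>Udot D\<^esub> g \<oplus>\<^bsub>Udot D\<^esub> h = Ucls D (\<lambda>\<xi>. r \<xi> \<oplus>\<^bsub>U D\<^esub> s \<xi> \<oplus>\<^bsub>U D\<^esub> t \<xi>)"
    unfolding r(3) s(3) t(2) Ucls_add [OF r(1) s(1)] by (rule Ucls_add) (simp_all add: r(1) s(1) t(1))
  moreover have "f \<oplus>\<^bsub>Udot D\<^esub> (g \<oplus>\<^bsub>Udot D\<^esub> h) = Ucls D (\<lambda>\<xi>. r \<xi> \<oplus>\<^bsub>U D\<^esub> (s \<xi> \<oplus>\<^bsub>U D\<^esub> t \<xi>))"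
    unfolding r(3) s(3) t(2) Ucls_add [OF s(1) t(1)] by (rule Ucls_add) (simp_all add: r(1) s(1) t(1))
  ultimately show "f \<oplus>\<^bsub>Udot D\<^esub> g \<oplus>\<^bsub>Udot D\<^esub> h = f \<oplus>\<^bsub>Udot D\<^esub> (g \<oplus>\<^bsub>Udot D\<^esub> h)"
    using r(1) s(1) t(1) by (simp only: U.a_assoc)
qed

lemma Udot_left_module: "left_module (U D) (Udot D)"
  unfolding left_module_def
proof (intro conjI ring_U Udot_abelian_group left_module_axioms.intro)
  fix a f assume a: "a \<in> carrier (U D)" and f: "f \<in> carrier (Udot D)"
  obtain r where r: "\<And>\<xi>. r \<xi> \<in> carrier (U D)" "finite {\<xi>. r \<xi> \<notin> dot_ideal D \<xi>}" "f = Ucls D r"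
    by (rule Udot_cases [OF f]) blast
  have "finite {\<xi>. a \<otimes>\<^bsub>U D\<^esub> r \<xi> \<notin> dot_ideal D \<xi>}"
    by (rule finite_subset [OF _ r(2)]) (use dot_ideal_mult [OF a] in auto)
  then show "a \<odot>\<^bsub>Udot D\<^esub> f \<in> carrier (Udot D)"
    unfolding r(3) Ucls_smult [OF a r(1)] by (subst Ucls_carrier) (use r(1) a in auto)
  { fix b assume b: "b \<in> carrier (U D)"
    show "(a \<oplus>\<^bsub>U D\<^esub> b) \<odot>\<^bsub>Udot D\<^esub> f = a \<odot>\<^bsub>Udot D\<^esub> f \<oplus>\<^bsub>Udot D\<^esub> b \<odot>\<^bsub>Udot D\<^esub> f"
      unfolding r(3) Ucls_smult [OF a r(1)] Ucls_smult [OF b r(1)] Ucls_smult [OF U.a_closed [OF a b] r(1)]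
      by (subst Ucls_add) (use a b r(1) in \<open>simp_all add: U.l_distr\<close>)
    have "b \<otimes>\<^bsub>U D\<^esub> r \<xi> \<in> carrier (U D)" for \<xi> using b r(1) by simp
    from Ucls_smult [OF a this]
    show "(a \<otimes>\<^bsub>U D\<^esub> b) \<odot>\<^bsub>Udot D\<^esub> f = a \<odot>\<^bsub>Udot D\<^esub> (b \<odot>\<^bsub>Udot D\<^esub> f)"
      unfolding r(3) Ucls_smult [OF b r(1)] Ucls_smult [OF U.m_closed [OF a b] r(1)]
      using a b r(1) by (simp only: U.m_assoc)
  }
  fix g assume g: "g \<in> carrier (Udot D)"
  obtain s where s: "\<And>\<xi>. s \<xi> \<in> carrier (U D)" "g = Ucls D s"
    by (rule Udot_cases [OF g]) blast
  have rs: "r \<xi> \<oplus>\<^bsub>U D\<^esub> s \<xi> \<in> carrier (U D)" "a \<otimes>\<^bsub>U D\<^esub> r \<xi> \<in> carrier (U D)" "a \<otimes>\<^bsub>U D\<^esub> s \<xi> \<in> carrier (U D)" for \<xi>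
    using a r(1) s(1) by simp_all
  show "a \<odot>\<^bsub>Udot D\<^esub> (f \<oplus>\<^bsub>Udot D\<^esub> g) = a \<odot>\<^bsub>Udot D\<^esub> f \<oplus>\<^bsub>Udot D\<^esub> a \<odot>\<^bsub>Udot D\<^esub> g"
    unfolding r(3) s(2) Ucls_add [OF r(1) s(1)] Ucls_smult [OF a r(1)] Ucls_smult [OF a s(1)]
      Ucls_smult [OF a rs(1)] Ucls_add [OF rs(2,3)] using a r(1) s(1) by (simp only: U.r_distr)
next
  fix f assume f: "f \<in> carrier (Udot D)"
  obtain r where r: "\<And>\<xi>. r \<xi> \<in> carrier (U D)" "f = Ucls D r"
    by (rule Udot_cases [OF f]) blast
  show "\<one>\<^bsub>U D\<^esub> \<odot>\<^bsub>Udot D\<^esub> f = f"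
    unfolding r(2) Ucls_smult [OF U.one_closed r(1)] using r(1) by simp
qed

lemma dot_idem_Ucls: "dot_idem D \<xi> = Ucls D (\<lambda>\<kappa>. if \<kappa> = \<xi> then \<one>\<^bsub>U D\<^esub> else \<zero>\<^bsub>U D\<^esub>)"
  by (simp add: dot_idem_def Ucls_def)

lemma smult_dot_idem:
  assumes "u \<in> carrier (U D)"
  shows "u \<odot>\<^bsub>Udot D\<^esub> dot_idem D \<xi> = Ucls D (\<lambda>\<kappa>. if \<kappa> = \<xi> then u else \<zero>\<^bsub>U D\<^esub>)"
proof -
  have "u \<odot>\<^bsub>Udot D\<^esub> dot_idem D \<xi> = Ucls D (\<lambda>\<kappa>. u \<otimes>\<^bsub>U D\<^esub> (if \<kappa> = \<xi> then \<one>\<^bsub>U D\<^esub> else \<zero>\<^bsub>U D\<^esub>))"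
    unfolding dot_idem_Ucls by (rule Ucls_smult [OF assms]) simp
  also have "(\<lambda>\<kappa>. u \<otimes>\<^bsub>U D\<^esub> (if \<kappa> = \<xi> then \<one>\<^bsub>U D\<^esub> else \<zero>\<^bsub>U D\<^esub>)) = (\<lambda>\<kappa>. if \<kappa> = \<xi> then u else \<zero>\<^bsub>U D\<^esub>)"
    using assms by (intro ext) simp
  finally show ?thesis .
qed

lemma dot_idem_carrier: "dot_idem D \<xi> \<in> carrier (Udot D)"
proof -
  have z: "\<zero>\<^bsub>U D\<^esub> \<in> dot_ideal D \<kappa>" for \<kappa> using U.left_ideal_gen_0 by (simp add: dot_ideal)
  have "finite {\<kappa>. (if \<kappa> = \<xi> then \<one>\<^bsub>U D\<^esub> else \<zero>\<^bsub>U D\<^esub>) \<notin> dot_ideal D \<kappa>}"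
    by (rule finite_subset [of _ "{\<xi>}"]) (use z in auto)
  then show ?thesis unfolding dot_idem_Ucls by (subst Ucls_carrier) auto
qed

lemma dot_idem_wt: "dot_idem D \<xi> \<in> wt_space D (Udot D) \<xi>"
proof -
  have eq: "Ucls D (\<lambda>\<kappa>. if \<kappa> = \<xi> then x else \<zero>\<^bsub>U D\<^esub>) = Ucls D (\<lambda>\<kappa>. if \<kappa> = \<xi> then y else \<zero>\<^bsub>U D\<^esub>)"
    if "x \<in> carrier (U D)" "y \<in> carrier (U D)" "x \<ominus>\<^bsub>U D\<^esub> y \<in> dot_gens \<xi>" for x y
  proof -
    have "\<one>\<^bsub>U D\<^esub> \<otimes>\<^bsub>U D\<^esub> (x \<ominus>\<^bsub>U D\<^esub> y) \<in> dot_ideal D \<xi>"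
      unfolding dot_ideal by (rule U.left_ideal_gen_base [OF dot_gens_carrier U.one_closed that(3)])
    then have "x \<ominus>\<^bsub>U D\<^esub> y \<in> dot_ideal D \<xi>" using that by simp
    then show ?thesis using that unfolding Ucls_def by (intro ext) (simp add: dot_coset_eq [of x y])
  qed
  have K: "UK D \<mu> \<ominus>\<^bsub>U D\<^esub> Uscal D (qq powi pairing D \<mu> \<xi>) \<in> dot_gens \<xi>"
    and J: "UJ D \<mu> \<ominus>\<^bsub>U D\<^esub> Uscal D (ppi powi pairing D \<mu> \<xi>) \<in> dot_gens \<xi>" for \<mu>
    by (auto simp: dot_gens_def)
  show ?thesis
    unfolding wt_space_def scale_def
    using dot_idem_carrier eq [OF U_class_simps(1) U_class_simps(1) K] eq [OF U_class_simps(1) U_class_simps(1) J]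
    by (simp add: smult_dot_idem [OF U_class_simps(1)] del: Udot_sel)
qed

text \<open>The idempotent is the divided power of exponent \<open>0\<close> of an arbitrary
  \<open>E_i\<close>.\<close>

lemma dot_idem_A_Udot: "dot_idem D \<xi> \<in> A_Udot D"
proof -
  fix i :: 'i
  have "qfact D i 0 = 1" by (simp add: qfact_def)
  moreover have "1 / (1 :: scal) = 1" by (simp add: divide_piext_def inverse_piext_def one_piext_def times_piext_def)
  ultimately have q: "1 / qfact D i 0 = 1" by simp
  have p: "UE D i [^]\<^bsub>U D\<^esub> (0 :: nat) = \<one>\<^bsub>U D\<^esub>" by (rule U.nat_pow_0)
  have "\<one>\<^bsub>U D\<^esub> \<odot>\<^bsub>Udot D\<^esub> dot_idem D \<xi> = dot_idem D \<xi>"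
    by (rule left_module.smult_one [OF Udot_left_module dot_idem_carrier])
  with A_Udot.divE [of D i 0 \<xi>] show ?thesis
    by (simp only: p q U_module.scale_simps(4) [OF U_module.intro [OF Udot_left_module] dot_idem_carrier])
qed

end

context U_weight
begin

sublocale Udot_module D .

lemma dot_ideal_kills:
  assumes x: "x \<in> dot_ideal D \<xi>" and m: "m \<in> wt \<xi>"
  shows "x \<odot> m = \<zero>"
proof -
  have mc: "m \<in> carrier M" using m by simp
  have "x \<in> {x \<in> carrier (U D). x \<odot> m = \<zero>}"
  proof (rule U.left_ideal_gen_least [OF _ dot_gens_carrier])
    show "x \<in> left_ideal_gen (U D) (dot_gens \<xi>)" using x by (simp add: dot_ideal)
    show "\<zero>\<^bsub>U D\<^esub> \<in> {x \<in> carrier (U D). x \<odot> m = \<zero>}"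
      using act_0 [OF mc] U.zero_closed unfolding U_class_simps(4) by simp
    fix c s y assume c: "c \<in> carrier (U D)" and s: "s \<in> dot_gens \<xi>" and y: "y \<in> {x \<in> carrier (U D). x \<odot> m = \<zero>}"
    obtain p where p: "c = U_class D p" using c carrier_U by blast
    obtain r where r: "y = U_class D r" using y carrier_U by blast
    obtain t where t: "s = U_class D t" using s dot_gens_carrier carrier_U by blast
    have "s \<odot> m = \<zero>"
      using s wt_K [OF m] wt_J [OF m] mc
      by (auto simp: dot_gens_def act_diff act_const simp flip: U_class_simps(7))
    then have "act t m = \<zero>" by (simp add: t)
    then have "act (p * t + r) m = \<zero>" using mc y r by (simp add: act_add act_mult)
    then show "c \<otimes>\<^bsub>U D\<^esub> s \<oplus>\<^bsub>U D\<^esub> y \<in> {x \<in> carrier (U D). x \<odot> m = \<zero>}"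
      using c s y dot_gens_carrier by (simp add: p r t U_class_simps)
  qed
  then show ?thesis by blast
qed

text \<open>Two representatives of the same coset differ by an element of
  \<open>dot_ideal D \<xi>\<close>, which kills vectors of weight \<open>\<xi>\<close>; so the
  choice made in \<open>dot_act\<close> has no influence. If \<open>u\<close> itself lies in the
  ideal, the support is empty and both sides are zero.\<close>

lemma dot_act_idem:
  assumes M: "direct_sum M UNIV wt" and u: "u \<in> carrier (U D)" and m: "m \<in> wt \<xi>"
  shows "dot_act D M (u \<odot>\<^bsub>Udot D\<^esub> dot_idem D \<xi>) m = u \<odot> m"
proof -
  have mc: "m \<in> carrier M" using m by simp
  have "decomposes M UNIV wt m (\<lambda>\<kappa>. if \<kappa> = \<xi> then m else \<zero>)"
  proof -
    have eq: "{k. (if k = \<xi> then m else \<zero>) \<noteq> \<zero>} = (if m = \<zero> then {} else {\<xi>})" by auto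
    show ?thesis unfolding decomposes_def eq using m mc wt_0 by auto
  qed
  moreover have "\<exists>!f. decomposes M UNIV wt m f" using M mc by (simp add: direct_sum_def)
  ultimately have "(THE f. decomposes M UNIV wt m f) = (\<lambda>\<kappa>. if \<kappa> = \<xi> then m else \<zero>)" by (intro the1_equality)
  then have comp: "component M UNIV wt \<xi> m = m" by (simp add: component_def)
  let ?f = "u \<odot>\<^bsub>Udot D\<^esub> dot_idem D \<xi>"
  have f: "?f \<kappa> = (if \<kappa> = \<xi> then dot_ideal D \<xi> +>\<^bsub>U D\<^esub> u else dot_ideal D \<kappa>)" for \<kappa>
    unfolding smult_dot_idem [OF u] by (simp add: Ucls_def dot_coset_0)
  interpret I: abelian_subgroup "dot_ideal D \<xi>" "U D" by (rule dot_ideal_subgroup)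
  show ?thesis
  proof (cases "u \<in> dot_ideal D \<xi>")
    case True
    then have "{\<kappa>. ?f \<kappa> \<noteq> dot_ideal D \<kappa>} = {}" by (auto simp: f dot_coset_trivial u simp del: Udot_sel)
    then show ?thesis using dot_ideal_kills [OF True m] unfolding dot_act_def by (simp del: Udot_sel)
  next
    case False
    then have supp: "{\<kappa>. ?f \<kappa> \<noteq> dot_ideal D \<kappa>} = {\<xi>}" by (auto simp: f dot_coset_trivial u simp del: Udot_sel)
    define v where "v = (SOME v. v \<in> ?f \<xi>)"
    have "v \<in> ?f \<xi>" unfolding v_def by (rule someI [of _ u]) (simp add: f I.a_rcos_self u del: Udot_sel)
    then have v: "v \<in> dot_ideal D \<xi> +>\<^bsub>U D\<^esub> u" by (simp add: f del: Udot_sel)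
    then have vc: "v \<in> carrier (U D)" using U.a_r_coset_subset_G [OF dot_ideal_carrier u] by blast
    then have "v \<ominus>\<^bsub>U D\<^esub> u \<in> dot_ideal D \<xi>" using v I.a_rcos_module [OF u vc] by (simp add: a_minus_def)
    from dot_ideal_kills [OF this m] have vu: "(v \<ominus>\<^bsub>U D\<^esub> u) \<odot> m = \<zero>" .
    obtain p where p: "v = U_class D p" using vc unfolding carrier_U by (rule rangeE)
    obtain r where r: "u = U_class D r" using u unfolding carrier_U by (rule rangeE)
    have "act p m \<ominus> act r m = \<zero>" using vu unfolding p r by (simp only: act_diff [OF mc] flip: U_class_simps(7))
    then have eq: "v \<odot> m = u \<odot> m" unfolding p r using mc by simp
    have vm: "v \<odot> m \<in> carrier M" unfolding p using mc by simp
    have "(\<Oplus>\<kappa>\<in>{\<xi>}. (SOME v. v \<in> ?f \<kappa>) \<odot> component M UNIV wt \<kappa> m) = v \<odot> m"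
      using vm unfolding v_def by (subst M.finsum_insert) (simp_all add: comp del: Udot_sel)
    then show ?thesis unfolding dot_act_def supp eq .
  qed
qed

lemma Udot_weight: "U_weight D (Udot D)"
  by (intro U_weight.intro U_module.intro U_weight_axioms.intro Udot_left_module perfect)

end

subsection \<open>The action of the modified coideal subalgebra\<close>

context U_weight
begin

lemma decomposes_closed: "decomposes M Z iwt m f \<Longrightarrow> f k \<in> carrier M"
  unfolding decomposes_def using iwt_closed M.zero_closed by metis

lemma decomposes_superset:
  assumes d: "decomposes M Z iwt m f" and A: "finite A" "{k. f k \<noteq> \<zero>} \<subseteq> A"
  shows "m = (\<Oplus>k\<in>A. f k)"
proof -
  have "(\<Oplus>k\<in>{k. f k \<noteq> \<zero>}. f k) = (\<Oplus>k\<in>A. f k)"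
    using A decomposes_closed [OF d] by (intro M.add.finprod_mono_neutral_cong_left) auto
  then show ?thesis using d by (simp add: decomposes_def)
qed

lemma decomposesI:
  assumes "finite A" "\<And>k. k \<in> Z \<Longrightarrow> f k \<in> iwt k" "\<And>k. k \<notin> Z \<Longrightarrow> f k = \<zero>" "{k. f k \<noteq> \<zero>} \<subseteq> A" "m = (\<Oplus>k\<in>A. f k)"
  shows "decomposes M Z iwt m f"
proof -
  have c: "f k \<in> carrier M" for k using assms(2,3) [of k] iwt_closed [of "f k" k] by (cases "k \<in> Z") auto
  have "(\<Oplus>k\<in>{k. f k \<noteq> \<zero>}. f k) = (\<Oplus>k\<in>A. f k)"
    using assms(1,4) c by (intro M.add.finprod_mono_neutral_cong_left) auto
  moreover have "finite {k. f k \<noteq> \<zero>}" using assms(1,4) by (rule finite_subset [rotated])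
  ultimately show ?thesis using assms(2,3,5) by (simp add: decomposes_def)
qed

lemma decomposes_add:
  assumes f: "decomposes M Z iwt m f" and g: "decomposes M Z iwt n g"
  shows "decomposes M Z iwt (m \<oplus> n) (\<lambda>k. f k \<oplus> g k)"
proof -
  let ?A = "{k. f k \<noteq> \<zero>} \<union> {k. g k \<noteq> \<zero>}"
  have A: "finite ?A" using f g by (simp add: decomposes_def)
  have sums: "m = (\<Oplus>k\<in>?A. f k)" "n = (\<Oplus>k\<in>?A. g k)"
    by (rule decomposes_superset [OF f A]; blast) (rule decomposes_superset [OF g A]; blast)
  have "m \<oplus> n = (\<Oplus>k\<in>?A. f k \<oplus> g k)"
    using decomposes_closed [OF f] decomposes_closed [OF g] by (simp add: M.finsum_addf Pi_iff flip: sums)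
  then show ?thesis
  proof (rule decomposesI [OF A, rotated 3])
    show "f k \<oplus> g k \<in> iwt k" if "k \<in> Z" for k using f g that by (intro iwt_add) (simp_all add: decomposes_def)
    show "f k \<oplus> g k = \<zero>" if "k \<notin> Z" for k using f g that by (simp add: decomposes_def)
    show "{k. f k \<oplus> g k \<noteq> \<zero>} \<subseteq> ?A" by auto
  qed
qed

lemma finsum_map:
  assumes h: "\<And>x. x \<in> carrier M \<Longrightarrow> h x \<in> carrier M"
      "\<And>x y. x \<in> carrier M \<Longrightarrow> y \<in> carrier M \<Longrightarrow> h (x \<oplus> y) = h x \<oplus> h y" "h \<zero> = \<zero>"
    and "finite A" "f \<in> A \<rightarrow> carrier M"
  shows "h (\<Oplus>a\<in>A. f a) = (\<Oplus>a\<in>A. h (f a))"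
  using assms(4,5)
proof (induction A rule: finite_induct)
  case (insert a A)
  then have "f \<in> A \<rightarrow> carrier M" "f a \<in> carrier M" "(\<lambda>a. h (f a)) \<in> A \<rightarrow> carrier M" using h(1) by auto
  then show ?case using insert h by simp
qed (simp add: h)

lemma decomposes_map:
  assumes h: "\<And>x. x \<in> carrier M \<Longrightarrow> h x \<in> carrier M"
      "\<And>x y. x \<in> carrier M \<Longrightarrow> y \<in> carrier M \<Longrightarrow> h (x \<oplus> y) = h x \<oplus> h y" "h \<zero> = \<zero>"
    and hi: "\<And>k x. k \<in> Z \<Longrightarrow> x \<in> iwt k \<Longrightarrow> h x \<in> iwt k" and f: "decomposes M Z iwt m f"
  shows "decomposes M Z iwt (h m) (\<lambda>k. h (f k))"
proof (rule decomposesI [of "{k. f k \<noteq> \<zero>}"])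
  show "finite {k. f k \<noteq> \<zero>}" "\<And>k. k \<in> Z \<Longrightarrow> h (f k) \<in> iwt k" "\<And>k. k \<notin> Z \<Longrightarrow> h (f k) = \<zero>"
    using f hi h(3) by (simp_all add: decomposes_def)
  show "{k. h (f k) \<noteq> \<zero>} \<subseteq> {k. f k \<noteq> \<zero>}" using h(3) by auto
  have "m = (\<Oplus>k\<in>{k. f k \<noteq> \<zero>}. f k)" using f by (simp add: decomposes_def)
  moreover have "h (\<Oplus>k\<in>{k. f k \<noteq> \<zero>}. f k) = (\<Oplus>k\<in>{k. f k \<noteq> \<zero>}. h (f k))"
    using f decomposes_closed [OF f] by (intro finsum_map h) (auto simp: decomposes_def)
  ultimately show "h m = (\<Oplus>k\<in>{k. f k \<noteq> \<zero>}. h (f k))" by metis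
qed

lemma iwt_subgroup: "subgroup (iwt \<zeta>) (add_monoid M)"
  by (rule subgroup.intro) (auto simp: iwt_0 iwt_add simp flip: a_inv_def intro: iwt_uminus iwt_closed)

lemma act_wsupp_iwt:
  assumes "p \<in> wsupp L" "m \<in> wt \<xi>" "\<And>gs. gs \<in> L \<Longrightarrow> word_wt D gs + \<xi> \<in> \<zeta>"
  shows "act p m \<in> iwt \<zeta>"
proof -
  have m: "m \<in> carrier M" using assms(2) by simp
  obtain A c where A: "finite A" "A \<subseteq> L" "p = (\<Sum>gs\<in>A. fa_const (c gs) * mon gs)"
    using wsupp_expand [OF assms(1)] by blast
  have w: "act (fa_const (c gs) * mon gs) m \<in> iwt \<zeta>" if "gs \<in> A" for gs
    using wt_iwt [OF wt_act_word [OF assms(2)] assms(3)] that A(2) m by (auto simp: act_mult act_const intro: iwt_scale)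
  have "act p m = (\<Oplus>gs\<in>A. act (fa_const (c gs) * mon gs) m)"
    unfolding A(3) by (rule act_sum [OF A(1) m])
  also have "\<dots> \<in> iwt \<zeta>" using w by (intro iwt_finsum A(1)) auto
  finally show ?thesis .
qed

lemma act_iwt:
  assumes "x \<in> iwt \<zeta>" "\<And>\<xi> m. \<xi> \<in> \<zeta> \<Longrightarrow> m \<in> wt \<xi> \<Longrightarrow> act p m \<in> iwt \<zeta>'"
  shows "act p x \<in> iwt \<zeta>'"
proof -
  have "x \<in> {x \<in> carrier M. act p x \<in> iwt \<zeta>'}"
    by (rule iwt_least [OF assms(1)]) (use assms(2) in \<open>auto simp: iwt_0 iwt_add act_add_right\<close>)
  then show ?thesis by blast
qed

end

locale iweight_module = iquantum D \<psi> \<psi>i + U_weight D M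
  for D :: "('i::finite, 'x::ab_group_add, 'y::ab_group_add, 'z) iroot_datum_scheme" and \<psi> \<psi>i
    and M :: "(('i, 'y) Uelt, 'm) module" (structure)
begin

lemma iwt_eigen:
  assumes "\<zeta> \<in> Xi D" "m \<in> iwt \<zeta>" "\<mu> \<in> Yi D"
  shows "act (fa_gen (GenK \<mu>)) m = scale D M (qq powi ipairing D \<mu> \<zeta>) m"
    "act (fa_gen (GenJ \<mu>)) m = scale D M (ppi powi ipairing D \<mu> \<zeta>) m"
proof -
  have "m \<in> {x \<in> carrier M. act (fa_gen (GenK \<mu>)) x = scale D M (qq powi ipairing D \<mu> \<zeta>) x \<and>
      act (fa_gen (GenJ \<mu>)) x = scale D M (ppi powi ipairing D \<mu> \<zeta>) x}"
  proof (rule iwt_least [OF assms(2)])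
    fix \<xi> m x assume xi: "\<xi> \<in> \<zeta>" and m: "m \<in> wt \<xi>"
      and "x \<in> {x \<in> carrier M. act (fa_gen (GenK \<mu>)) x = scale D M (qq powi ipairing D \<mu> \<zeta>) x \<and>
          act (fa_gen (GenJ \<mu>)) x = scale D M (ppi powi ipairing D \<mu> \<zeta>) x}"
    then show "m \<oplus> x \<in> {x \<in> carrier M. act (fa_gen (GenK \<mu>)) x = scale D M (qq powi ipairing D \<mu> \<zeta>) x \<and>
        act (fa_gen (GenJ \<mu>)) x = scale D M (ppi powi ipairing D \<mu> \<zeta>) x}"
      using wt_K [OF m] wt_J [OF m] ipairing_eq [OF assms(3,1) xi] wt_closed [OF m]
      by (simp add: act_add_right scale_simps(2))
  qed simp
  then show "act (fa_gen (GenK \<mu>)) m = scale D M (qq powi ipairing D \<mu> \<zeta>) m"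
    "act (fa_gen (GenJ \<mu>)) m = scale D M (ppi powi ipairing D \<mu> \<zeta>) m" by blast+
qed

lemma Ui_class: assumes "u \<in> carrier (Ui D)" obtains p where "u = U_class D p"
  using Ui_carrier [OF assms] unfolding carrier_U by (rule rangeE)

lemma Ui_smult_closed: "u \<in> carrier (Ui D) \<Longrightarrow> m \<in> carrier M \<Longrightarrow> u \<odot> m \<in> carrier M"
  by (erule Ui_class) simp

lemma left_module_Ui: "left_module (Ui D) M"
proof -
  interpret L: left_module "U D" M by (rule left_module_axioms)
  show ?thesis
    unfolding left_module_def
    by (intro conjI ring_Ui M.abelian_group_axioms left_module_axioms.intro)
      (simp_all add: Ui_carrier L.smult_closed L.smult_l_distr L.smult_r_distr L.smult_assoc L.smult_one)
qed

lemma idot_ideal_kills: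
  assumes z: "\<zeta> \<in> Xi D" and x: "x \<in> idot_ideal D \<zeta>" and m: "m \<in> iwt \<zeta>"
  shows "x \<odot> m = \<zero>"
proof -
  have mc: "m \<in> carrier M" using m by simp
  have "x \<in> {x \<in> carrier (Ui D). x \<odot> m = \<zero>}"
  proof (rule Ui.left_ideal_gen_least [OF _ idot_gens_carrier])
    show "x \<in> left_ideal_gen (Ui D) (idot_gens \<zeta>)" using x by (simp add: idot_ideal)
    show "\<zero>\<^bsub>Ui D\<^esub> \<in> {x \<in> carrier (Ui D). x \<odot> m = \<zero>}"
      using act_0 [OF mc] Ui.zero_closed unfolding U_class_simps(4) by simp
    fix c s y assume c: "c \<in> carrier (Ui D)" and s: "s \<in> idot_gens \<zeta>" and "y \<in> {x \<in> carrier (Ui D). x \<odot> m = \<zero>}"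
    then have y: "y \<in> carrier (Ui D)" "y \<odot> m = \<zero>" by blast+
    have sc: "s \<in> carrier (Ui D)" using s idot_gens_carrier by blast
    obtain p where p: "c = U_class D p" by (rule Ui_class [OF c])
    obtain r where r: "y = U_class D r" by (rule Ui_class [OF y(1)])
    obtain t where t: "s = U_class D t" by (rule Ui_class [OF sc])
    have "s \<odot> m = \<zero>"
      using s iwt_eigen [OF z m] mc
      by (auto simp: idot_gens_def act_diff act_const simp flip: U_class_simps(7))
    then have "act (p * t + r) m = \<zero>" using mc y(2) r t by (simp add: act_add act_mult)
    then have "(c \<otimes>\<^bsub>U D\<^esub> s \<oplus>\<^bsub>U D\<^esub> y) \<odot> m = \<zero>" by (simp only: p r t U_class_simps)
    then show "c \<otimes>\<^bsub>Ui D\<^esub> s \<oplus>\<^bsub>Ui D\<^esub> y \<in> {x \<in> carrier (Ui D). x \<odot> m = \<zero>}"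
      using c sc y(1) by (simp add: Ui_closed)
  qed
  then show ?thesis by blast
qed

definition rep :: "('x set \<Rightarrow> ('i, 'y) Uelt set) \<Rightarrow> 'x set \<Rightarrow> ('i, 'y) Uelt" where
  "rep g \<zeta> = (SOME x. x \<in> g \<zeta>)"

lemma idot_ideal_subgroup: "abelian_subgroup (idot_ideal D \<zeta>) (Ui D)"
  unfolding idot_ideal by (rule Ui.left_ideal_gen_subgroup [OF idot_gens_carrier])

lemma idot_ideal_carrier: "idot_ideal D \<zeta> \<subseteq> carrier (Ui D)"
  unfolding idot_ideal using Ui.left_ideal_gen_closed [OF idot_gens_carrier] by blast

lemma rep_in:
  assumes "g \<in> Uidot D" "\<zeta> \<in> Xi D"
  shows "rep g \<zeta> \<in> g \<zeta>" "rep g \<zeta> \<in> carrier (Ui D)"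
proof -
  interpret I: abelian_subgroup "idot_ideal D \<zeta>" "Ui D" by (rule idot_ideal_subgroup)
  have "g \<zeta> \<in> a_rcosets\<^bsub>Ui D\<^esub> (idot_ideal D \<zeta>)" using assms by (simp add: Uidot_def)
  then obtain a where a: "a \<in> carrier (Ui D)" "g \<zeta> = idot_ideal D \<zeta> +>\<^bsub>Ui D\<^esub> a"
    unfolding A_RCOSETS_def RCOSETS_def a_r_coset_def by auto
  have "a \<in> g \<zeta>" unfolding a(2) by (rule I.a_rcos_self [OF a(1)])
  then show r: "rep g \<zeta> \<in> g \<zeta>" unfolding rep_def by (rule someI)
  have "g \<zeta> \<subseteq> carrier (Ui D)" unfolding a(2) by (rule Ui.a_r_coset_subset_G [OF idot_ideal_carrier a(1)])
  then show "rep g \<zeta> \<in> carrier (Ui D)" using r by blast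
qed

lemma rep_kills:
  assumes "g \<in> Uidot D" "\<zeta> \<in> Xi D" "g \<zeta> = idot_ideal D \<zeta>" "m \<in> iwt \<zeta>"
  shows "rep g \<zeta> \<odot> m = \<zero>"
  using idot_ideal_kills [OF assms(2) _ assms(4)] rep_in(1) [OF assms(1,2)] assms(3) by simp

text \<open>The index set may be enlarged because, at a class where \<open>g\<close> is trivial, its
  representative lies in \<open>idot_ideal\<close> and kills the component. This permits evaluating
  \<open>g\<close> and its image under \<open>\<psi>i\<close> over a common index set.\<close>

lemma idot_act_eq:
  assumes g: "g \<in> Uidot D" and f: "decomposes M (Xi D) iwt m f"
    and A: "finite A" "A \<subseteq> Xi D" "{\<zeta> \<in> Xi D. g \<zeta> \<noteq> idot_ideal D \<zeta>} \<subseteq> A"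
  shows "idot_act D M iwt g m = (\<Oplus>\<zeta>\<in>A. rep g \<zeta> \<odot> f \<zeta>)"
proof -
  have comp: "component M (Xi D) iwt \<zeta> m = f \<zeta>" for \<zeta>
    using Xi_disjoint by (rule iwt_component [OF f])
  have "idot_act D M iwt g m = (\<Oplus>\<zeta>\<in>{\<zeta> \<in> Xi D. g \<zeta> \<noteq> idot_ideal D \<zeta>}. rep g \<zeta> \<odot> f \<zeta>)"
    unfolding idot_act_def comp rep_def ..
  also have "\<dots> = (\<Oplus>\<zeta>\<in>A. rep g \<zeta> \<odot> f \<zeta>)"
  proof -
    have kill: "rep g \<zeta> \<odot> f \<zeta> = \<zero>" if "\<zeta> \<in> A" "g \<zeta> = idot_ideal D \<zeta>" for \<zeta>
      using rep_kills [OF g _ that(2)] f A(2) that(1) by (auto simp: decomposes_def)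
    have "rep g \<zeta> \<odot> f \<zeta> \<in> carrier M" if "\<zeta> \<in> A" for \<zeta>
      using rep_in(2) [OF g] A(2) that decomposes_closed [OF f] by (intro Ui_smult_closed) auto
    then show ?thesis using A kill by (intro M.add.finprod_mono_neutral_cong_left) auto
  qed
  finally show ?thesis .
qed

lemma Uidot_support: "g \<in> Uidot D \<Longrightarrow> finite {\<zeta> \<in> Xi D. g \<zeta> \<noteq> idot_ideal D \<zeta>}"
  by (simp add: Uidot_def)

lemma idot_act_single:
  assumes g: "g \<in> Uidot D" and z: "\<zeta> \<in> Xi D" and m: "m \<in> iwt \<zeta>"
  shows "idot_act D M iwt g m = rep g \<zeta> \<odot> m"
proof -
  \<comment> \<open>The class \<open>\<zeta>\<close> is added since \<open>g\<close> may be trivial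
    there.\<close>
  let ?A = "insert \<zeta> {\<zeta> \<in> Xi D. g \<zeta> \<noteq> idot_ideal D \<zeta>}"
  have A: "finite ?A" "?A \<subseteq> Xi D" using Uidot_support [OF g] z by auto
  have mc: "m \<in> carrier M" using m by simp
  have rm: "rep g \<zeta> \<odot> m \<in> carrier M" by (rule Ui_smult_closed [OF rep_in(2) [OF g z] mc])
  have "idot_act D M iwt g m = (\<Oplus>\<zeta>'\<in>?A. rep g \<zeta>' \<odot> (if \<zeta>' = \<zeta> then m else \<zero>))"
    by (rule idot_act_eq [OF g iwt_decomposes_single [OF m z] A]) blast
  also have "\<dots> = (\<Oplus>\<zeta>'\<in>?A. if \<zeta> = \<zeta>' then rep g \<zeta> \<odot> m else \<zero>)"
  proof (rule M.finsum_cong')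
    fix \<zeta>' assume "\<zeta>' \<in> ?A"
    then have "rep g \<zeta>' \<in> carrier (Ui D)" using A(2) rep_in(2) [OF g] by blast
    then obtain p where "rep g \<zeta>' = U_class D p" by (rule Ui_class)
    then show "rep g \<zeta>' \<odot> (if \<zeta>' = \<zeta> then m else \<zero>) = (if \<zeta> = \<zeta>' then rep g \<zeta> \<odot> m else \<zero>)" by auto
  qed (use rm in \<open>simp_all add: Pi_iff\<close>)
  also have "\<dots> = rep g \<zeta> \<odot> m"
    using A(1) rm by (intro M.finsum_singleton [of \<zeta> ?A "\<lambda>_. rep g \<zeta> \<odot> m"]) auto
  finally show ?thesis .
qed

text \<open>Each weight occurring in \<open>B_i\<close> is congruent to \<open>- i'\<close> modulo
  \<open>T\<close>, so \<open>B_i\<close> moves one class as a whole.\<close>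

lemma UB_iwt:
  assumes z: "\<zeta> \<in> Xi D" and x: "x \<in> iwt \<zeta>"
  shows "UB D i \<odot> x \<in> iwt ((\<lambda>\<xi>. \<xi> - xroot D i) ` \<zeta>)"
  unfolding UB_bi
proof (rule act_iwt [OF x])
  fix \<xi> m assume xi: "\<xi> \<in> \<zeta>" and m: "m \<in> wt \<xi>"
  show "act (bi i) m \<in> iwt ((\<lambda>\<xi>. \<xi> - xroot D i) ` \<zeta>)"
  proof (rule act_wsupp_iwt [OF bi_wsupp(1) m])
    fix gs assume "gs \<in> Bi_words i"
    then have "\<xi> + (word_wt D gs + xroot D i) \<in> \<zeta>" using Xi_iff [OF z xi] by (simp add: Bi_words_def)
    moreover have "word_wt D gs + \<xi> = \<xi> + (word_wt D gs + xroot D i) - xroot D i" by (simp add: algebra_simps)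
    ultimately show "word_wt D gs + \<xi> \<in> (\<lambda>\<xi>. \<xi> - xroot D i) ` \<zeta>" by blast
  qed
qed

lemma Jtilde_iwt: "x \<in> iwt \<zeta> \<Longrightarrow> Jtilde D i \<odot> x \<in> iwt \<zeta>"
  unfolding Jtilde_def by (erule act_iwt) (auto simp: wt_J intro: wt_iwt wt_scale)

lemma weight_imodule_iwt:
  assumes "direct_sum M (Xi D) iwt" shows "weight_imodule D M iwt"
  unfolding weight_imodule_def
  using left_module_Ui assms iwt_eigen UB_iwt Jtilde_iwt by simp

text \<open>By definition of the integral form, applying \<open>g\<close> to the idempotent of
  weight \<open>\<xi>\<close> inside \<open>Udot D\<close> gives an element of
  \<open>A_Udot D\<close>. That element and \<open>g\<close> both act on \<open>m\<close> through
  the same representative of \<open>g\<close> at the class of \<open>\<xi>\<close>.\<close>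

lemma idot_act_dot_act:
  assumes M: "direct_sum M UNIV wt" and g: "g \<in> A_Uidot D" and m: "m \<in> wt \<xi>"
  shows "\<exists>u\<in>A_Udot D. idot_act D M iwt g m = dot_act D M u m"
proof -
  interpret V: iweight_module D \<psi> \<psi>i "Udot D"
    by (intro iweight_module.intro iquantum_axioms Udot_weight)
  have gU: "g \<in> Uidot D" using g by (simp add: A_Uidot_def)
  have z: "xcoset D \<xi> \<in> Xi D" by (rule xcoset_Xi)
  let ?r = "rep g (xcoset D \<xi>)" and ?e = "dot_idem D \<xi>"
  have "idot_act D (Udot D) V.iwt g ?e = V.rep g (xcoset D \<xi>) \<odot>\<^bsub>Udot D\<^esub> ?e"
    by (rule V.idot_act_single [OF gU z V.wt_iwt [OF dot_idem_wt xcoset_self]])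
  then have e: "idot_act D (Udot D) V.iwt g ?e = ?r \<odot>\<^bsub>Udot D\<^esub> ?e" by (simp only: V.rep_def rep_def)
  have A: "idot_act D (Udot D) V.iwt g ?e \<in> A_Udot D"
    using g dot_idem_A_Udot unfolding A_Uidot_def by blast
  have "idot_act D M iwt g m = ?r \<odot> m"
    by (rule idot_act_single [OF gU z wt_iwt [OF m xcoset_self]])
  also have "\<dots> = dot_act D M (?r \<odot>\<^bsub>Udot D\<^esub> ?e) m"
    by (rule dot_act_idem [OF M Ui_carrier [OF rep_in(2) [OF gU z]] m, symmetric])
  finally show ?thesis using A unfolding e by blast
qed

lemma Uidot_psi_closed:
  assumes g: "g \<in> Uidot D" shows "Uidot_psi D \<psi>i g \<in> Uidot D"
    "{\<zeta> \<in> Xi D. Uidot_psi D \<psi>i g \<zeta> \<noteq> idot_ideal D \<zeta>} \<subseteq> {\<zeta> \<in> Xi D. g \<zeta> \<noteq> idot_ideal D \<zeta>}"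
    "\<zeta> \<in> Xi D \<Longrightarrow> rep (Uidot_psi D \<psi>i g) \<zeta> \<ominus>\<^bsub>Ui D\<^esub> \<psi>i (rep g \<zeta>) \<in> idot_ideal D \<zeta>"
proof -
  have eq: "Uidot_psi D \<psi>i g \<zeta> = idot_ideal D \<zeta> +>\<^bsub>Ui D\<^esub> \<psi>i (rep g \<zeta>)" if "\<zeta> \<in> Xi D" for \<zeta>
    using that by (simp add: Uidot_psi_def rep_def)
  have pc: "\<psi>i (rep g \<zeta>) \<in> carrier (Ui D)" if "\<zeta> \<in> Xi D" for \<zeta> by (rule psi_i_closed [OF rep_in(2) [OF g that]])
  show sub: "{\<zeta> \<in> Xi D. Uidot_psi D \<psi>i g \<zeta> \<noteq> idot_ideal D \<zeta>} \<subseteq> {\<zeta> \<in> Xi D. g \<zeta> \<noteq> idot_ideal D \<zeta>}"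
  proof clarify
    fix \<zeta> assume z: "\<zeta> \<in> Xi D" and ne: "Uidot_psi D \<psi>i g \<zeta> \<noteq> idot_ideal D \<zeta>" and "g \<zeta> = idot_ideal D \<zeta>"
    then have "rep g \<zeta> \<in> idot_ideal D \<zeta>" using rep_in(1) [OF g z] by simp
    then have p: "\<psi>i (rep g \<zeta>) \<in> idot_ideal D \<zeta>" by (rule psi_i_idot_ideal [OF z])
    interpret I: abelian_subgroup "idot_ideal D \<zeta>" "Ui D" by (rule idot_ideal_subgroup)
    have "idot_ideal D \<zeta> +>\<^bsub>Ui D\<^esub> \<psi>i (rep g \<zeta>) = idot_ideal D \<zeta> +>\<^bsub>Ui D\<^esub> \<zero>\<^bsub>Ui D\<^esub>"
      using p pc [OF z] by (subst I.rcos_eq_iff) (simp_all add: a_minus_def del: Ui_sel)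
    also have "\<dots> = idot_ideal D \<zeta>" by (rule Ui.a_coset_add_zero [OF idot_ideal_carrier])
    finally show False using ne eq [OF z] by simp
  qed
  have "Uidot_psi D \<psi>i g \<in> extensional (Xi D)" by (simp add: Uidot_psi_def)
  moreover have "Uidot_psi D \<psi>i g \<zeta> \<in> a_rcosets\<^bsub>Ui D\<^esub> (idot_ideal D \<zeta>)" if "\<zeta> \<in> Xi D" for \<zeta>
    unfolding eq [OF that] by (rule Ui.a_rcosetsI [OF idot_ideal_carrier pc [OF that]])
  ultimately show u: "Uidot_psi D \<psi>i g \<in> Uidot D"
    using finite_subset [OF sub Uidot_support [OF g]] by (simp add: Uidot_def)
  show "rep (Uidot_psi D \<psi>i g) \<zeta> \<ominus>\<^bsub>Ui D\<^esub> \<psi>i (rep g \<zeta>) \<in> idot_ideal D \<zeta>" if z: "\<zeta> \<in> Xi D"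
  proof -
    interpret I: abelian_subgroup "idot_ideal D \<zeta>" "Ui D" by (rule idot_ideal_subgroup)
    show ?thesis
      using rep_in [OF u z] I.a_rcos_module [OF pc [OF z], of "rep (Uidot_psi D \<psi>i g) \<zeta>"] eq [OF z]
      by (simp add: a_minus_def del: Ui_sel)
  qed
qed

text \<open>The chosen representative of the image and the image of the chosen representative differ
  by an element of \<open>idot_ideal\<close>, which kills \<open>m\<close>.\<close>

lemma Uidot_psi_act:
  assumes g: "g \<in> Uidot D" and z: "\<zeta> \<in> Xi D" and m: "m \<in> iwt \<zeta>"
  shows "rep (Uidot_psi D \<psi>i g) \<zeta> \<odot> m = \<psi>i (rep g \<zeta>) \<odot> m"
proof -
  have mc: "m \<in> carrier M" using m by simp
  let ?a = "rep (Uidot_psi D \<psi>i g) \<zeta>" and ?b = "\<psi>i (rep g \<zeta>)"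
  have c: "?a \<in> carrier (Ui D)" "?b \<in> carrier (Ui D)"
    using rep_in(2) [OF Uidot_psi_closed(1) [OF g] z] psi_i_closed [OF rep_in(2) [OF g z]] .
  obtain p where p: "?a = U_class D p" by (rule Ui_class [OF c(1)])
  obtain r where r: "?b = U_class D r" by (rule Ui_class [OF c(2)])
  have "?b \<oplus>\<^bsub>U D\<^esub> (?a \<ominus>\<^bsub>Ui D\<^esub> ?b) = ?a"
    using c Ui.a_lcomm [of ?b ?a "\<ominus>\<^bsub>Ui D\<^esub> ?b"] Ui.r_neg [OF c(2)] Ui.r_zero [OF c(1)] Ui.a_inv_closed [OF c(2)]
    by (simp add: a_minus_def)
  moreover obtain t where t: "?a \<ominus>\<^bsub>Ui D\<^esub> ?b = U_class D t"
    by (rule Ui_class [OF Ui.minus_closed [OF c]])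
  ultimately have "U_class D p = U_class D (r + t)" by (simp add: p r U_class_simps(2))
  moreover have "act t m = \<zero>"
    unfolding t [symmetric] by (rule idot_ideal_kills [OF z Uidot_psi_closed(3) [OF g z] m])
  ultimately show ?thesis using mc unfolding p r by (simp add: act_add)
qed

end

sublocale bounded_based_module \<subseteq> iweight_module D \<psi> \<psi>i M
  by (intro iweight_module.intro iquantum_axioms U_weight_axioms)

section \<open>The modified form acting on a based module\<close>

context bounded_based_module
begin

lemma wt_direct_sum: "direct_sum M UNIV wt"
  using based by (simp add: based_module_def weight_module_def)

lemma iwt_decomposes:
  assumes "m \<in> carrier M" shows "\<exists>f. decomposes M (Xi D) iwt m f"
proof -
  have "m \<in> {m \<in> carrier M. \<exists>f. decomposes M (Xi D) iwt m f}"
  proof (rule lspan_least [OF carrier_lspan [OF assms] B_carrier])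
    show "\<zero> \<in> {m \<in> carrier M. \<exists>f. decomposes M (Xi D) iwt m f}"
      using iwt_decomposes_single [OF iwt_0 xcoset_Xi] by blast
    fix c s x assume s: "s \<in> B" and "x \<in> {m \<in> carrier M. \<exists>f. decomposes M (Xi D) iwt m f}"
    then obtain f where x: "x \<in> carrier M" and f: "decomposes M (Xi D) iwt x f" by blast
    obtain \<xi> where "s \<in> wt \<xi>" by (rule B_wt [OF s])
    then have "scale D M c s \<in> iwt (xcoset D \<xi>)" by (intro iwt_scale wt_iwt [OF _ xcoset_self])
    from decomposes_add [OF iwt_decomposes_single [OF this xcoset_Xi] f]
    show "scale D M c s \<oplus> x \<in> {m \<in> carrier M. \<exists>f. decomposes M (Xi D) iwt m f}" using s x by auto
  qed
  then show ?thesis by blast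
qed

lemma iwt_direct_sum: "direct_sum M (Xi D) iwt"
  unfolding direct_sum_def
proof (intro conjI ballI iwt_subgroup)
  fix m assume "m \<in> carrier M"
  then obtain f where f: "decomposes M (Xi D) iwt m f" using iwt_decomposes by blast
  show "\<exists>!f. decomposes M (Xi D) iwt m f"
  proof (rule ex1I [of _ f])
    show "decomposes M (Xi D) iwt m f" by (rule f)
    fix h assume h: "decomposes M (Xi D) iwt m h"
    show "h = f" using Xi_disjoint by (rule iwt_decomposes_unique [OF h f])
  qed
qed

lemma idot_act_linear:
  assumes g: "g \<in> Uidot D"
  shows "m \<in> carrier M \<Longrightarrow> idot_act D M iwt g m \<in> carrier M"
    "m \<in> carrier M \<Longrightarrow> n \<in> carrier M \<Longrightarrow>
      idot_act D M iwt g (m \<oplus> n) = idot_act D M iwt g m \<oplus> idot_act D M iwt g n"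
    "m \<in> carrier M \<Longrightarrow> idot_act D M iwt g (scale D M c m) = scale D M c (idot_act D M iwt g m)"
    "idot_act D M iwt g \<zero> = \<zero>"
proof -
  let ?A = "{\<zeta> \<in> Xi D. g \<zeta> \<noteq> idot_ideal D \<zeta>}"
  have A: "finite ?A" "?A \<subseteq> Xi D" using Uidot_support [OF g] by auto
  have act: "idot_act D M iwt g m = (\<Oplus>\<zeta>\<in>?A. rep g \<zeta> \<odot> f \<zeta>)" if "decomposes M (Xi D) iwt m f" for m f
    by (rule idot_act_eq [OF g that A subset_refl])
  have "\<exists>p. rep g \<zeta> = U_class D p" if "\<zeta> \<in> ?A" for \<zeta>
    using Ui_class [OF rep_in(2) [OF g]] that by blast
  then have "\<forall>\<zeta>\<in>?A. \<exists>p. rep g \<zeta> = U_class D p" by blast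
  from bchoice [OF this] obtain p where p: "\<forall>\<zeta>\<in>?A. rep g \<zeta> = U_class D (p \<zeta>)" ..
  have act': "idot_act D M iwt g m = (\<Oplus>\<zeta>\<in>?A. act (p \<zeta>) (f \<zeta>))" if f: "decomposes M (Xi D) iwt m f" for m f
    unfolding act [OF f] using p decomposes_closed [OF f] by (intro M.finsum_cong') auto
  fix m assume m: "m \<in> carrier M"
  obtain f where f: "decomposes M (Xi D) iwt m f" using iwt_decomposes [OF m] by blast
  note fc = decomposes_closed [OF f]
  show "idot_act D M iwt g m \<in> carrier M"
    unfolding act' [OF f] using fc by (intro M.finsum_closed) auto
  have "decomposes M (Xi D) iwt (scale D M c m) (\<lambda>\<zeta>. scale D M c (f \<zeta>))"
    by (rule decomposes_map [OF _ _ _ _ f]) (simp_all add: scale_simps iwt_scale)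
  from act' [OF this] show "idot_act D M iwt g (scale D M c m) = scale D M c (idot_act D M iwt g m)"
    unfolding act' [OF f] using fc by (simp add: scale_finsum scale_act Pi_iff)
  fix n assume n: "n \<in> carrier M"
  obtain h where h: "decomposes M (Xi D) iwt n h" using iwt_decomposes [OF n] by blast
  note hc = decomposes_closed [OF h]
  from act' [OF decomposes_add [OF f h]]
  show "idot_act D M iwt g (m \<oplus> n) = idot_act D M iwt g m \<oplus> idot_act D M iwt g n"
    unfolding act' [OF f] act' [OF h] using fc hc by (simp add: act_add_right M.finsum_addf Pi_iff)
next
  \<comment> \<open>Any class serves to evaluate the action on zero, as zero lies in every graded
    piece.\<close>
  obtain \<xi> :: 'x where True by simp
  have "idot_act D M iwt g \<zero> = rep g (xcoset D \<xi>) \<odot> \<zero>" by (rule idot_act_single [OF g xcoset_Xi iwt_0])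
  also obtain p where "rep g (xcoset D \<xi>) = U_class D p" by (rule Ui_class [OF rep_in(2) [OF g xcoset_Xi]])
  finally show "idot_act D M iwt g \<zero> = \<zero>" by simp
qed

text \<open>Basis elements are weight vectors, on which \<open>g\<close> acts like an element of
  \<open>A_Udot D\<close>; the lattice of a based module is stable under the latter.\<close>

lemma idot_act_lattice:
  assumes g: "g \<in> A_Uidot D" and m: "m \<in> lspan D M A_pi B"
  shows "idot_act D M iwt g m \<in> lspan D M A_pi B"
proof -
  have gU: "g \<in> Uidot D" using g by (simp add: A_Uidot_def)
  note lin = idot_act_linear [OF gU]
  have stab: "dot_act D M u x \<in> lspan D M A_pi B" if "u \<in> A_Udot D" "x \<in> lspan D M A_pi B" for u x
    using based that by (simp add: based_module_def)
  have "m \<in> {m \<in> carrier M. idot_act D M iwt g m \<in> lspan D M A_pi B}"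
  proof (rule lspan_least [OF m B_carrier])
    show "\<zero> \<in> {m \<in> carrier M. idot_act D M iwt g m \<in> lspan D M A_pi B}" using lin(4) lspan_0 by simp
    fix c s x assume c: "c \<in> A_pi" and s: "s \<in> B" and x: "x \<in> {m \<in> carrier M. idot_act D M iwt g m \<in> lspan D M A_pi B}"
    obtain \<xi> where xi: "s \<in> wt \<xi>" by (rule B_wt [OF s])
    obtain u where u: "u \<in> A_Udot D" "idot_act D M iwt g s = dot_act D M u s"
      using idot_act_dot_act [OF wt_direct_sum g xi] by blast
    have "idot_act D M iwt g s \<in> lspan D M A_pi B"
      unfolding u(2) by (rule stab [OF u(1) lspan_base [OF B_carrier subring_A_pi(2) s]])
    then have "scale D M c (idot_act D M iwt g s) \<oplus> idot_act D M iwt g x \<in> lspan D M A_pi B"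
      using x c by (intro lspan_add lspan_scale B_carrier subring_A_pi) auto
    then show "scale D M c s \<oplus> x \<in> {m \<in> carrier M. idot_act D M iwt g m \<in> lspan D M A_pi B}"
      using s x by (simp add: lin(2,3))
  qed
  then show ?thesis by blast
qed

text \<open>Class by class this is \<open>Psi_smult\<close>. Since \<open>\<Psi>\<close> preserves
  every class, the components of \<open>\<Psi> m\<close> are the images of the components of
  \<open>m\<close>.\<close>

lemma Psi_idot_act:
  assumes g: "g \<in> Uidot D" and m: "m \<in> carrier M"
  shows "\<Psi> (idot_act D M iwt g m) = idot_act D M iwt (Uidot_psi D \<psi>i g) (\<Psi> m)"
proof -
  let ?A = "{\<zeta> \<in> Xi D. g \<zeta> \<noteq> idot_ideal D \<zeta>}"
  have A: "finite ?A" "?A \<subseteq> Xi D" using Uidot_support [OF g] by auto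
  obtain f where f: "decomposes M (Xi D) iwt m f" using iwt_decomposes [OF m] by blast
  have fi: "f \<zeta> \<in> iwt \<zeta>" if "\<zeta> \<in> Xi D" for \<zeta> using f that by (simp add: decomposes_def)
  have Padd: "\<Psi> (x \<oplus> y) = \<Psi> x \<oplus> \<Psi> y" if "x \<in> carrier M" "y \<in> carrier M" for x y
    using Psi_semilinear that unfolding semilinear_def by blast
  have P0: "\<Psi> \<zero> = \<zero>" by (rule semilinear_0 [OF Psi_semilinear])
  have rc: "rep g \<zeta> \<odot> f \<zeta> \<in> carrier M" if "\<zeta> \<in> ?A" for \<zeta>
    using that rep_in(2) [OF g] decomposes_closed [OF f] by (intro Ui_smult_closed) auto
  have "\<Psi> (idot_act D M iwt g m) = \<Psi> (\<Oplus>\<zeta>\<in>?A. rep g \<zeta> \<odot> f \<zeta>)"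
    using idot_act_eq [OF g f A subset_refl] by simp
  also have "\<dots> = (\<Oplus>\<zeta>\<in>?A. \<Psi> (rep g \<zeta> \<odot> f \<zeta>))"
    by (rule finsum_map) (use Padd P0 A(1) rc in auto)
  also have "\<dots> = (\<Oplus>\<zeta>\<in>?A. rep (Uidot_psi D \<psi>i g) \<zeta> \<odot> \<Psi> (f \<zeta>))"
  proof (rule M.finsum_cong')
    fix \<zeta> assume "\<zeta> \<in> ?A"
    then have z: "\<zeta> \<in> Xi D" by blast
    have "\<Psi> (rep g \<zeta> \<odot> f \<zeta>) = \<psi>i (rep g \<zeta>) \<odot> \<Psi> (f \<zeta>)"
      by (rule Psi_smult [OF rep_in(2) [OF g z] decomposes_closed [OF f]])
    also have "\<dots> = rep (Uidot_psi D \<psi>i g) \<zeta> \<odot> \<Psi> (f \<zeta>)"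
      by (rule Uidot_psi_act [OF g z Psi_iwt [OF z fi [OF z]], symmetric])
    finally show "\<Psi> (rep g \<zeta> \<odot> f \<zeta>) = rep (Uidot_psi D \<psi>i g) \<zeta> \<odot> \<Psi> (f \<zeta>)" .
  next
    show "(\<lambda>\<zeta>. rep (Uidot_psi D \<psi>i g) \<zeta> \<odot> \<Psi> (f \<zeta>)) \<in> ?A \<rightarrow> carrier M"
      using rep_in(2) [OF Uidot_psi_closed(1) [OF g]] decomposes_closed [OF f]
      by (auto intro!: Ui_smult_closed)
  qed simp
  also have "\<dots> = idot_act D M iwt (Uidot_psi D \<psi>i g) (\<Psi> m)"
    by (rule idot_act_eq [OF Uidot_psi_closed(1) [OF g] decomposes_map [OF _ Padd P0 Psi_iwt f] A
          Uidot_psi_closed(2) [OF g], symmetric]) simp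
  finally show ?thesis .
qed

end

lemma (in stable_based_module) icanonical_based_imodule:
  assumes f: "icanonical D \<Psi> M B f"
  shows "based_imodule D \<psi>i M iwt (f ` B)"
  unfolding based_imodule_def
proof (intro conjI ballI)
  show "weight_imodule D M iwt" by (rule weight_imodule_iwt [OF iwt_direct_sum])
  show "is_basis D M UNIV (carrier M) (f ` B)" "basis_at_infinity D M (f ` B)"
    by (rule icanonical_basis [OF f])+
  show "is_basis D M UNIV (iwt \<zeta>) (f ` B \<inter> iwt \<zeta>)" if "\<zeta> \<in> Xi D" for \<zeta>
    by (rule icanonical_basis(4) [OF f that])
  show "idot_act D M iwt g m \<in> lspan D M A_pi (f ` B)" if "g \<in> A_Uidot D" "m \<in> lspan D M A_pi (f ` B)" for g m
    using idot_act_lattice that by (simp add: icanonical_lspan [OF f])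
  show "basis_involution D M (f ` B) (idot_act D M iwt g m) =
      idot_act D M iwt (Uidot_psi D \<psi>i g) (basis_involution D M (f ` B) m)"
    if "g \<in> Uidot D" "m \<in> carrier M" for g m
    using Psi_idot_act [OF that] icanonical_involution [OF f] that idot_act_linear(1) [OF that(1,2)] by simp
qed

text \<open>\<open>f\<close> assigns to each \<open>b\<close> its canonical basis element, so
  uniqueness concerns the indexed family and not merely its image. The \<open>\<pi>\<close>-basis
  consists of the image of \<open>f\<close> together with its multiples by
  \<open>\<pi>\<close>.\<close>

theorem theorem6p2:
  fixes D :: "('i::finite, 'x::ab_group_add, 'y::ab_group_add) iroot_datum"
    and \<psi> \<psi>i :: "('i, 'y) Uelt \<Rightarrow> ('i, 'y) Uelt"
    and \<Upsilon> :: "('i \<Rightarrow> nat) \<Rightarrow> ('i, 'y) Uelt"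
    and M :: "(('i, 'y) Uelt, 'm) module"
    and B :: "'m set"
  assumes "iquantum_datum D"
    and "is_psi D \<psi>"
    and "is_psi_i D \<psi>i"
    and "is_quasi_K D \<psi> \<psi>i \<Upsilon>"
    and "based_module D \<psi> M B"
    and "weights_bounded_above D M"
    and "\<forall>m\<in>lspan D M A_pi B. psi_iM D \<Upsilon> M B m \<in> lspan D M A_pi B"
  shows "(\<exists>!f. icanonical D (psi_iM D \<Upsilon> M B) M B f) \<and>
         (\<forall>f. icanonical D (psi_iM D \<Upsilon> M B) M B f \<longrightarrow>
            is_pi_basis D M (f ` B \<union> scale D M ppi ` f ` B) \<and>
            is_basis D M A_pi (lspan D M A_pi B) (f ` B) \<and>
            is_basis D M Z_pi_qinv (lspan D M Z_pi_qinv B) (f ` B) \<and>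
            based_imodule D \<psi>i M (iwt_space D M) (f ` B))"
proof -
  have perfect: "perfect_pairing (pairing D)"
    using assms(1) by (simp add: iquantum_datum_def super_root_datum_def)
  have mod: "left_module (U D) M" and bas: "is_basis D M UNIV (carrier M) B"
    using assms(5) by (simp_all add: based_module_def weight_module_def)
  have mod': "U_module D M" by (rule U_module.intro [OF mod])
  interpret stable_based_module D \<psi> \<psi>i M B \<Upsilon>
  proof (intro stable_based_module.intro bounded_based_module.intro)
    show "iquantum D \<psi> \<psi>i"
      by (intro iquantum.intro U_psi.intro iquantum_axioms.intro assms(1,2,3))
    show "U_weight D M" by (intro U_weight.intro mod' U_weight_axioms.intro perfect)
    show "U_basis D M B" by (intro U_basis.intro mod' U_basis_axioms.intro bas)
    show "bounded_based_module_axioms D \<psi> \<psi>i M B \<Upsilon>"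
      by (intro bounded_based_module_axioms.intro assms(4,5,6))
    show "stable_based_module_axioms D M B \<Upsilon>"
      using assms(7) by (intro stable_based_module_axioms.intro) blast
  qed
  show ?thesis
  proof (intro conjI allI impI icanonical_exists_unique)
    fix f assume f: "icanonical D \<Psi> M B f"
    show "is_pi_basis D M (f ` B \<union> scale D M ppi ` f ` B)"
      unfolding is_pi_basis_def using icanonical_basis(1) [OF f] by blast
    show "is_basis D M A_pi (lspan D M A_pi B) (f ` B)"
      "is_basis D M Z_pi_qinv (lspan D M Z_pi_qinv B) (f ` B)"
      by (rule icanonical_basis [OF f])+
    show "based_imodule D \<psi>i M iwt (f ` B)" by (rule icanonical_based_imodule [OF f])
  qed
qed

end
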